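(* Let $s>0$, $1\le r\le\infty$ and $p,p_1,p_2\in[1,\infty]$ with $\frac1p=\frac1{p_1}+\frac1{p_2}$. There exists a constant $C>0$ depending only on $p,p_1,p_2,s,r,d$ such that for all $f,g$ on $\mathbb{R}^d$ for which the right-hand side is finite there is a sequence $(c_q)_{q\ge-1}$ with $\|(c_q)\|_{l^r}\le1$ such that for all $q\ge-1$ $$2^{qs}\|[f,\Delta_q]\mathcal{A}g\|_{L^p}\le Cc_q\,\|\nabla f\|_{L^{p_1}\cap B^{s-1}_{p_2,r}\cap B^0_{p_1,r}}\big(\|g\|_{B^s_{p_2,r}}+\|\nabla g\|_{L^{p_1}}\big),$$ where the operator $\mathcal{A}$ is $\mathrm{div}$ or $\nabla$. As a direct consequence, when $1\le p\le p_2\le p_1\le\infty$, if $$s>1+d\Big(\frac1{p_2}-\frac1{p_1}\Big)\quad\text{or}\quad s=1+d\Big(\frac1{p_2}-\frac1{p_1}\Big)\ \text{ and }\ r=1,$$ then (for some sequence $(c_q)_{q\ge-1}$ with $\|(c_q)\|_{l^r}\le1$ and all $q\ge-1$) $$2^{qs}\|[f,\Delta_q]\mathcal{A}g\|_{L^p}\le Cc_q\,\|\nabla f\|_{B^{s-1}_{p_2,r}}\|g\|_{B^s_{p_2,r}}.$$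
   Context: The commutator is $[f,\Delta_q]h=f\,\Delta_qh-\Delta_q(fh)$. Here $f$ is a scalar function, and $g$ is a vector field if $\mathcal{A}=\mathrm{div}$, a scalar (or componentwise vector) function if $\mathcal{A}=\nabla$. The norm of an intersection of spaces is the sum of the norms. Littlewood-Paley blocks: let $\varphi,\chi$ be smooth functions with values in $[0,1]$, $\varphi$ supported in $\{\xi\in\mathbb{R}^d: 3/4\le|\xi|\le 8/3\}$, $\chi$ supported in $\{|\xi|\le 4/3\}$, with $\chi(\xi)+\sum_{q\ge0}\varphi(2^{-q}\xi)=1$ for all $\xi$. For a tempered distribution $u$ set $\Delta_{-1}u=\chi(D)u$ and $\Delta_qu=\varphi(2^{-q}D)u$ for $q\ge0$. Nonhomogeneous Besov norm: $\|u\|_{B^s_{p,r}}=\big(\sum_{q\ge-1}(2^{qs}\|\Delta_qu\|_{L^p})^r\big)^{1/r}$ (supremum if $r=\infty$). All spaces are over $\mathbb{R}^d$, where throughout $d\ge2$. *)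

theory Defs
  imports "HOL-Analysis.Analysis" "HOL-Probability.Essential_Supremum"
begin

section \<open>Test functions\<close>

definition pd :: "'n \<Rightarrow> (real^'n \<Rightarrow> 'a) \<Rightarrow> real^'n \<Rightarrow> 'a::real_normed_vector"
  where "pd j \<psi> x = frechet_derivative \<psi> (at x) (axis j 1)"

fun iter_pd :: "'n list \<Rightarrow> (real^'n \<Rightarrow> 'a) \<Rightarrow> real^'n \<Rightarrow> 'a::real_normed_vector"
  where
    "iter_pd [] \<psi> = \<psi>"
  | "iter_pd (j # js) \<psi> = pd j (iter_pd js \<psi>)"

definition smooth :: "(real^'n \<Rightarrow> 'a::real_normed_vector) \<Rightarrow> bool"
  where "smooth \<psi> \<longleftrightarrow> (\<forall>js x. iter_pd js \<psi> differentiable (at x))"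

definition schwartz :: "(real^'n \<Rightarrow> complex) \<Rightarrow> bool"
  where "schwartz \<psi> \<longleftrightarrow>
    smooth \<psi> \<and> (\<forall>js (k::nat). bounded (range (\<lambda>x. norm x ^ k * norm (iter_pd js \<psi> x))))"

definition fourier :: "(real^'n \<Rightarrow> complex) \<Rightarrow> real^'n \<Rightarrow> complex"
  where "fourier \<psi> \<xi> = (LINT x|lborel. exp (- (\<i> * of_real (x \<bullet> \<xi>))) * \<psi> x)"

definition inv_fourier :: "(real^'n \<Rightarrow> complex) \<Rightarrow> real^'n \<Rightarrow> complex"
  where "inv_fourier \<psi> x =
    (LINT \<xi>|lborel. exp (\<i> * of_real (x \<bullet> \<xi>)) * \<psi> \<xi>) / of_real ((2 * pi) ^ CARD('n))"


section \<open>Tempered distributions\<close>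

text \<open>
  A distribution is a functional on all functions, of which only the values on Schwartz
  functions carry meaning. Vector- and matrix-valued objects are families of scalar ones
  over a finite index set \<open>I\<close>.
\<close>

type_synonym 'n tdist = "(real^'n \<Rightarrow> complex) \<Rightarrow> complex"

text \<open>
  Functions of polynomial growth on average; multiplied by a Schwartz function they are
  integrable, so that \<open>dist_of F\<close> is a tempered distribution. All of \<open>L\<^sup>p\<close>, \<open>1 \<le> p \<le> \<infinity>\<close>,
  is included.
\<close>

definition tempered_fun :: "(real^'n \<Rightarrow> complex) \<Rightarrow> bool"
  where "tempered_fun F \<longleftrightarrow> (\<exists>N::nat. integrable lborel (\<lambda>x. F x / of_real ((1 + norm x) ^ N)))"

definition dist_of :: "(real^'n \<Rightarrow> complex) \<Rightarrow> 'n tdist"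
  where "dist_of F = (\<lambda>\<psi>. LINT x|lborel. F x * \<psi> x)"

definition represents :: "(real^'n \<Rightarrow> complex) \<Rightarrow> 'n tdist \<Rightarrow> bool"
  where "represents F u \<longleftrightarrow> tempered_fun F \<and> (\<forall>\<psi>. schwartz \<psi> \<longrightarrow> u \<psi> = dist_of F \<psi>)"

definition dpartial :: "'n::finite \<Rightarrow> 'n tdist \<Rightarrow> 'n tdist"
  where "dpartial j u = (\<lambda>\<psi>. - u (pd j \<psi>))"

definition grad :: "'n::finite tdist \<Rightarrow> 'n \<Rightarrow> 'n tdist"
  where "grad u = (\<lambda>j. dpartial j u)"

definition grad_vec :: "('i \<Rightarrow> 'n::finite tdist) \<Rightarrow> 'i \<times> 'n \<Rightarrow> 'n tdist"
  where "grad_vec u = (\<lambda>(i, j). dpartial j (u i))"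

definition divergence :: "('n::finite \<Rightarrow> 'n tdist) \<Rightarrow> 'n tdist"
  where "divergence u = (\<lambda>\<psi>. \<Sum>j\<in>UNIV. dpartial j (u j) \<psi>)"

definition dist_fourier :: "'n::finite tdist \<Rightarrow> 'n tdist"
  where "dist_fourier u = (\<lambda>\<psi>. u (fourier \<psi>))"

definition dist_inv_fourier :: "'n::finite tdist \<Rightarrow> 'n tdist"
  where "dist_inv_fourier u = (\<lambda>\<psi>. u (inv_fourier \<psi>))"

definition dist_times :: "(real^'n \<Rightarrow> real) \<Rightarrow> 'n tdist \<Rightarrow> 'n tdist"
  where "dist_times m u = (\<lambda>\<psi>. u (\<lambda>\<xi>. of_real (m \<xi>) * \<psi> \<xi>))"

text \<open>The operator \<open>m(D)\<close>.\<close>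

definition fourier_multiplier :: "(real^'n \<Rightarrow> real) \<Rightarrow> 'n tdist \<Rightarrow> 'n tdist"
  where "fourier_multiplier m u = dist_inv_fourier (dist_times m (dist_fourier u))"


section \<open>Littlewood--Paley blocks\<close>

definition littlewood_paley :: "(real^'n \<Rightarrow> real) \<Rightarrow> (real^'n \<Rightarrow> real) \<Rightarrow> bool"
  where "littlewood_paley phi chi \<longleftrightarrow>
    smooth phi \<and> smooth chi \<and>
    range phi \<subseteq> {0..1} \<and> range chi \<subseteq> {0..1} \<and>
    closure {\<xi>. phi \<xi> \<noteq> 0} \<subseteq> {\<xi>. 3/4 \<le> norm \<xi> \<and> norm \<xi> \<le> 8/3} \<and>
    closure {\<xi>. chi \<xi> \<noteq> 0} \<subseteq> {\<xi>. norm \<xi> \<le> 4/3} \<and>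
    (\<forall>\<xi>. (\<lambda>q::nat. phi ((1 / 2 ^ q) *\<^sub>R \<xi>)) sums (1 - chi \<xi>))"

text \<open>Only the indices \<open>q \<ge> -1\<close> are used.\<close>

definition lp_block ::
    "(real^'n \<Rightarrow> real) \<Rightarrow> (real^'n \<Rightarrow> real) \<Rightarrow> int \<Rightarrow> 'n tdist \<Rightarrow> 'n tdist"
  where "lp_block phi chi q u =
    (if q = -1 then fourier_multiplier chi u
     else fourier_multiplier (\<lambda>\<xi>. phi ((2 powr (- of_int q)) *\<^sub>R \<xi>)) u)"


section \<open>Norms\<close>

text \<open>Intended for exponents \<open>a > 0\<close>.\<close>

definition epowr :: "ennreal \<Rightarrow> real \<Rightarrow> ennreal"
  where "epowr x a = (if x = \<infinity> then \<infinity> else ennreal (enn2real x powr a))"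

definition Lp_norm_fun :: "ennreal \<Rightarrow> (real^'n \<Rightarrow> real) \<Rightarrow> ennreal"
  where "Lp_norm_fun p h =
    (if p = \<infinity> then esssup lborel (\<lambda>x. ennreal \<bar>h x\<bar>)
     else epowr (\<integral>\<^sup>+x. ennreal (\<bar>h x\<bar> powr enn2real p) \<partial>lborel) (1 / enn2real p))"

text \<open>
  The norm is infinite when the distribution is not a function; otherwise all representing
  functions agree almost everywhere, so that the infimum is the norm of any of them. The norm
  of a family is that of its pointwise Euclidean length.
\<close>

definition Lp_norm :: "ennreal \<Rightarrow> 'i set \<Rightarrow> ('i \<Rightarrow> 'n::finite tdist) \<Rightarrow> ennreal"
  where "Lp_norm p I u =
    (INF F \<in> {F. \<forall>i\<in>I. represents (F i) (u i)}. Lp_norm_fun p (\<lambda>x. L2_set (\<lambda>i. norm (F i x)) I))"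

text \<open>Sequences are indexed by \<open>q \<ge> -1\<close>.\<close>

definition lr_norm :: "ennreal \<Rightarrow> (int \<Rightarrow> ennreal) \<Rightarrow> ennreal"
  where "lr_norm r a =
    (if r = \<infinity> then (SUP q\<in>{-1..}. a q)
     else epowr (\<integral>\<^sup>+q. epowr (a q) (enn2real r) \<partial>count_space {-1..}) (1 / enn2real r))"

definition besov_norm ::
    "(real^'n \<Rightarrow> real) \<Rightarrow> (real^'n \<Rightarrow> real) \<Rightarrow> real \<Rightarrow> ennreal \<Rightarrow> ennreal
      \<Rightarrow> 'i set \<Rightarrow> ('i \<Rightarrow> 'n tdist) \<Rightarrow> ennreal"
  where "besov_norm phi chi s p r I u =
    lr_norm r (\<lambda>q. ennreal (2 powr (of_int q * s)) * Lp_norm p I (\<lambda>i. lp_block phi chi q (u i)))"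


section \<open>Commutators\<close>

text \<open>
  The product of a function \<open>f\<close> and a distribution \<open>u\<close> is formed when \<open>u\<close> is a function and the
  pointwise product is again a tempered function; otherwise \<open>dist_prod f u\<close> is meaningless.
  The choice of the representing function is irrelevant.
\<close>

definition prod_defined :: "(real^'n \<Rightarrow> complex) \<Rightarrow> 'n tdist \<Rightarrow> bool"
  where "prod_defined f u \<longleftrightarrow> (\<exists>H. represents H u \<and> tempered_fun (\<lambda>x. f x * H x))"

definition dist_prod :: "(real^'n \<Rightarrow> complex) \<Rightarrow> 'n tdist \<Rightarrow> 'n tdist"
  where "dist_prod f u = dist_of (\<lambda>x. f x * (SOME H. represents H u) x)"

definition commutator ::
    "(real^'n \<Rightarrow> real) \<Rightarrow> (real^'n \<Rightarrow> real) \<Rightarrow> (real^'n \<Rightarrow> complex) \<Rightarrow> int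
      \<Rightarrow> 'n tdist \<Rightarrow> 'n tdist"
  where "commutator phi chi f q h =
    (\<lambda>\<psi>. dist_prod f (lp_block phi chi q h) \<psi> - lp_block phi chi q (dist_prod f h) \<psi>)"

text \<open>
  Existence of a sequence \<open>c\<close> in the unit ball of \<open>l\<^sup>r\<close> with
  \<open>2 powr (q s) * \<parallel>[f, \<Delta>\<^sub>q] h\<parallel>\<^bsub>L^p\<^esub> \<le> c\<^sub>q * M\<close> for all \<open>q \<ge> -1\<close>; that the products in the
  commutator make sense is part of the claim. The commutator acts componentwise on the
  family \<open>h\<close>.
\<close>

definition commutator_estimate ::
    "(real^'n \<Rightarrow> real) \<Rightarrow> (real^'n \<Rightarrow> real) \<Rightarrow> real \<Rightarrow> ennreal \<Rightarrow> ennreal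
      \<Rightarrow> (real^'n \<Rightarrow> complex) \<Rightarrow> 'i set \<Rightarrow> ('i \<Rightarrow> 'n tdist) \<Rightarrow> ennreal \<Rightarrow> bool"
  where "commutator_estimate phi chi s r p f I h M \<longleftrightarrow>
    (\<exists>c::int \<Rightarrow> real. (\<forall>q\<ge>-1. 0 \<le> c q) \<and> lr_norm r (\<lambda>q. ennreal (c q)) \<le> 1 \<and>
      (\<forall>q\<ge>-1.
        (\<forall>i\<in>I. prod_defined f (h i) \<and> prod_defined f (lp_block phi chi q (h i))) \<and>
        ennreal (2 powr (of_int q * s)) * Lp_norm p I (\<lambda>i. commutator phi chi f q (h i))
          \<le> ennreal (c q) * M))"

end

theory Submission
  imports Defs "HOL-Probability.Sinc_Integral" "HOL-Probability.Characteristic_Functions"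
begin

text \<open>
  Write \<open>S\<^sub>N\<close> for the low-frequency cut-off at \<open>2\<^sup>N\<close>. For a fixed \<open>q\<close> put
  \<open>N = max (q - 2) 0\<close> and split \<open>f = S\<^sub>N f + b\<close>. The part
  \<open>b \<cdot> \<Delta>\<^sub>q h - \<Delta>\<^sub>q (b h)\<close> needs no cancellation: by Hoelder's
  inequality it is bounded by the \<open>L\<^sup>p\<^sup>2\<close> norm of \<open>b\<close> times the \<open>L\<^sup>p\<^sup>1\<close>
  norm of \<open>h\<close>. Since \<open>b\<close> is the sum of the blocks \<open>\<Delta>\<^sub>k f\<close> with \<open>k \<ge> N\<close>, and
  each of these is bounded by \<open>2\<^sup>-\<^sup>k\<close> times its gradient (\<open>reverse_Bernstein\<close>),
  multiplying by \<open>2\<^sup>q\<^sup>s\<close> leaves the convolution of the sequence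
  \<open>2\<^bsup>k(s-1)\<^esup>\<parallel>\<nabla>\<Delta>\<^sub>k f\<parallel>\<close> with the weights
  \<open>2\<^sup>l\<^sup>s\<close>, \<open>l = q - k \<le> 2\<close>, and these are summable exactly because \<open>s > 0\<close>.

  The part \<open>[S\<^sub>N f, \<Delta>\<^sub>q] h\<close> does use the commutator structure. By the
  supports of the symbols only the blocks \<open>\<Delta>\<^sub>k h\<close> with \<open>\<bar>k - q\<bar> \<le> 2\<close>
  contribute (\<open>block_localization\<close>), and each contribution is the integral of
  \<open>K\<^sub>q(y) (S\<^sub>N f(x) - S\<^sub>N f(x - y)) \<Delta>\<^sub>k h(x - y)\<close>. The
  difference is an integral of the gradient over a segment of length \<open>\<bar>y\<bar>\<close>, and the
  first moment of the kernel \<open>K\<^sub>q\<close> of \<open>\<Delta>\<^sub>q\<close> is of order \<open>2\<^sup>-\<^sup>q\<close>;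
  so Minkowski's and Hoelder's inequalities gain a factor \<open>2\<^sup>-\<^sup>q\<close>
  (\<open>Lpn_commutator\<close>). Young's inequality for sequences turns both bounds into one for the
  \<open>l\<^sup>r\<close> norm (\<open>commutator_sequence_bound\<close>), and the sequence \<open>c\<close> is the left-hand side
  divided by its bound. For \<open>h\<close> a divergence or a gradient of \<open>g\<close>, a block of \<open>h\<close> costs one
  derivative, that is a factor \<open>2\<^sup>q\<close>, compared with the block of \<open>g\<close>
  (\<open>derivative_block_bound\<close>).

  For the second inequality, the \<open>L\<^sup>p\<^sup>1\<close> norms of \<open>\<nabla>f\<close> and \<open>\<nabla>g\<close> are
  bounded by their norms in \<open>B\<^bsup>s-1\<^esup>\<close> over \<open>L\<^sup>p\<^sup>2\<close>: passing from
  \<open>L\<^sup>p\<^sup>2\<close> to \<open>L\<^sup>p\<^sup>1\<close> costs \<open>2\<^bsup>qd(1/p2-1/p1)\<^esup>\<close> on a block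
  (\<open>Lpe_Bernstein\<close>), and the sum over the blocks converges for \<open>s\<close> as assumed there
  (\<open>derivative_embedding\<close>).

  All operators are convolutions with inverse Fourier transforms of smooth, compactly supported
  symbols, acting on functions of tempered growth. Fourier inversion for such symbols
  (\<open>fourier_inv_fourier\<close>) and Fubini's theorem give everything that is usually read off from
  Fourier transforms of distributions: dyadic sums converge when tested against decaying
  functions (\<open>conv_approximate_identity\<close>), a distribution determines its representing function
  (\<open>represents_unique\<close>), so that norms of distributions are norms of functions, symbols
  multiply under composition (\<open>conv_conv\<close>), and a block of a product vanishes when the supports
  do not add up (\<open>conv_spectral_localization\<close>).
\<close>

section \<open>Partial derivatives\<close>

lemma frechet_derivative_eq_sum_pd:
  fixes f :: "real^'n \<Rightarrow> 'a::real_normed_vector"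
  assumes "f differentiable (at x)"
  shows "(f has_derivative (\<lambda>h. \<Sum>j\<in>UNIV. (h $ j) *\<^sub>R pd j f x)) (at x)"
proof -
  let ?D = "frechet_derivative f (at x)"
  have D: "(f has_derivative ?D) (at x)"
    using assms by (simp add: frechet_derivative_works)
  then have lin: "linear ?D" using has_derivative_linear by blast
  have "?D = (\<lambda>h. \<Sum>j\<in>UNIV. (h $ j) *\<^sub>R pd j f x)"
  proof
    fix h :: "real^'n"
    have "h = (\<Sum>j\<in>UNIV. (h $ j) *\<^sub>R axis j 1)"
      by (simp add: vec_eq_iff sum_component axis_def if_distrib[where f="\<lambda>x. _ * x"] cong: if_cong)
    then have "?D h = ?D (\<Sum>j\<in>UNIV. (h $ j) *\<^sub>R axis j 1)" by simp
    also have "\<dots> = (\<Sum>j\<in>UNIV. (h $ j) *\<^sub>R ?D (axis j 1))"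
      by (simp add: linear_sum[OF lin] linear_scale[OF lin])
    finally show "?D h = (\<Sum>j\<in>UNIV. (h $ j) *\<^sub>R pd j f x)" by (simp add: pd_def)
  qed
  with D show ?thesis by simp
qed

lemma frechet_derivative_worksI:
  "f differentiable (at x) \<Longrightarrow> (f has_derivative frechet_derivative f (at x)) (at x)"
  by (simp add: frechet_derivative_works)

lemma pd_eqI:
  assumes "(f has_derivative D) (at x)"
  shows "pd j f x = D (axis j 1)"
  using frechet_derivative_at[OF assms] by (simp add: pd_def)

section \<open>Smooth functions and Schwartz functions\<close>

text \<open>
  Replaces inductions over lists of directions: it suffices to exhibit a class that is closed
  under single partial derivatives.
\<close>

lemma smooth_coinduct:
  assumes "P f"
    and "\<And>g x. P g \<Longrightarrow> g differentiable (at x)"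
    and "\<And>g j. P g \<Longrightarrow> P (pd j g)"
  shows "smooth f"
proof -
  have "P (iter_pd js f)" for js
    by (induction js) (use assms in auto)
  then show ?thesis using assms(2) by (auto simp: smooth_def)
qed

lemma iter_pd_snoc: "iter_pd (js @ [j]) f = iter_pd js (pd j f)"
  by (induction js) auto

lemma smooth_differentiable: "smooth f \<Longrightarrow> f differentiable (at x)"
  unfolding smooth_def by (metis iter_pd.simps(1))

lemma smooth_pd: "smooth f \<Longrightarrow> smooth (pd j f)"
  unfolding smooth_def by (metis iter_pd_snoc)

lemma smooth_continuous: "smooth f \<Longrightarrow> continuous_on A f"
  by (meson continuous_at_imp_continuous_on differentiable_imp_continuous_within smooth_differentiable)

lemma smooth_measurable [measurable_dest]:
  fixes f :: "real^'n \<Rightarrow> 'a::{real_normed_vector, second_countable_topology}"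
  shows "smooth f \<Longrightarrow> f \<in> borel_measurable borel"
  by (intro borel_measurable_continuous_onI smooth_continuous)

lemma pd_add:
  assumes "f differentiable (at x)" "g differentiable (at x)"
  shows "pd j (\<lambda>x. f x + g x) x = pd j f x + pd j g x"
  using has_derivative_add[OF frechet_derivative_worksI[OF assms(1)] frechet_derivative_worksI[OF assms(2)]]
  by (subst pd_eqI) (auto simp: pd_def)

lemma pd_scaleR:
  assumes "f differentiable (at x)"
  shows "pd j (\<lambda>x. c *\<^sub>R f x) x = c *\<^sub>R pd j f x"
  using has_derivative_scaleR_right[OF frechet_derivative_worksI[OF assms(1)]]
  by (subst pd_eqI) (auto simp: pd_def)

lemma pd_cmult:
  fixes f :: "real^'n \<Rightarrow> complex"
  assumes "f differentiable (at x)"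
  shows "pd j (\<lambda>x. c * f x) x = c * pd j f x"
  using has_derivative_mult_right[OF frechet_derivative_worksI[OF assms(1)]]
  by (subst pd_eqI) (auto simp: pd_def)

lemma smooth_add:
  assumes "smooth f" "smooth g"
  shows "smooth (\<lambda>x. f x + g x)"
proof (rule smooth_coinduct[where P="\<lambda>h. \<exists>f g. smooth f \<and> smooth g \<and> h = (\<lambda>x. f x + g x)"])
  show "\<exists>f' g'. smooth f' \<and> smooth g' \<and> (\<lambda>x. f x + g x) = (\<lambda>x. f' x + g' x)"
    using assms by blast
next
  fix h x assume "\<exists>f g. smooth f \<and> smooth g \<and> h = (\<lambda>x. f x + g x)"
  then show "h differentiable (at x)" by (elim exE conjE, simp only:) (intro differentiable_add smooth_differentiable)
next
  fix h j assume "\<exists>f g. smooth f \<and> smooth g \<and> h = (\<lambda>x. f x + g x)"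
  then obtain f g where fg: "smooth f" "smooth g" "h = (\<lambda>x. f x + g x)" by auto
  then have "pd j h = (\<lambda>x. pd j f x + pd j g x)"
    by (auto simp: pd_add smooth_differentiable)
  then show "\<exists>f g. smooth f \<and> smooth g \<and> pd j h = (\<lambda>x. f x + g x)"
    using fg smooth_pd by blast
qed

lemma smooth_cmult:
  fixes f :: "real^'n \<Rightarrow> complex"
  assumes "smooth f"
  shows "smooth (\<lambda>x. c * f x)"
proof (rule smooth_coinduct[where P="\<lambda>h. \<exists>f. smooth f \<and> h = (\<lambda>x. c * f x)"])
  show "\<exists>f'. smooth f' \<and> (\<lambda>x. c * f x) = (\<lambda>x. c * f' x)"
    using assms by blast
next
  fix h x assume "\<exists>f. smooth f \<and> h = (\<lambda>x. c * f x)"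
  then show "h differentiable (at x)" by (elim exE conjE, simp only:) (intro differentiable_mult differentiable_const smooth_differentiable)
next
  fix h j assume "\<exists>f. smooth f \<and> h = (\<lambda>x. c * f x)"
  then show "\<exists>f. smooth f \<and> pd j h = (\<lambda>x. c * f x)"
    using smooth_pd[where j=j] by (metis (no_types, lifting) ext pd_cmult smooth_differentiable)
qed

lemma pd_of_real:
  fixes f :: "real^'n \<Rightarrow> real"
  assumes "f differentiable (at x)"
  shows "pd j (\<lambda>x. complex_of_real (f x)) x = complex_of_real (pd j f x)"
  using has_derivative_of_real[OF frechet_derivative_worksI[OF assms(1)]]
  by (subst pd_eqI) (auto simp: pd_def)

lemma differentiable_of_real:
  fixes f :: "real^'n \<Rightarrow> real"
  assumes "f differentiable F"
  shows "(\<lambda>x. complex_of_real (f x)) differentiable F"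
  using assms has_derivative_of_real unfolding differentiable_def by blast

lemma smooth_of_real:
  fixes f :: "real^'n \<Rightarrow> real"
  assumes "smooth f"
  shows "smooth (\<lambda>x. complex_of_real (f x))"
proof (rule smooth_coinduct[where P="\<lambda>h. \<exists>f. smooth f \<and> h = (\<lambda>x. complex_of_real (f x))"])
  show "\<exists>f'. smooth f' \<and> (\<lambda>x. complex_of_real (f x)) = (\<lambda>x. complex_of_real (f' x))"
    using assms by blast
next
  fix h x assume "\<exists>f. smooth f \<and> h = (\<lambda>x. complex_of_real (f x))"
  then show "h differentiable (at x)" by (elim exE conjE, simp only:) (intro differentiable_of_real smooth_differentiable)
next
  fix h j assume "\<exists>f. smooth f \<and> h = (\<lambda>x. complex_of_real (f x))"
  then show "\<exists>f. smooth f \<and> pd j h = (\<lambda>x. complex_of_real (f x))"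
    using smooth_pd[where j=j] by (metis (no_types, lifting) ext pd_of_real smooth_differentiable)
qed

lemma has_derivative_affine:
  assumes "f differentiable (at (c *\<^sub>R x + v))"
  shows "((\<lambda>x. f (c *\<^sub>R x + v)) has_derivative
    (\<lambda>h. frechet_derivative f (at (c *\<^sub>R x + v)) (c *\<^sub>R h))) (at x)"
proof -
  have "((\<lambda>x. c *\<^sub>R x + v) has_derivative (\<lambda>h. c *\<^sub>R h)) (at x)"
    by (auto intro!: derivative_eq_intros)
  from diff_chain_at[OF this frechet_derivative_worksI[OF assms]]
  show ?thesis by (simp add: o_def)
qed

lemma pd_affine:
  assumes "f differentiable (at (c *\<^sub>R x + v))"
  shows "pd j (\<lambda>x. f (c *\<^sub>R x + v)) x = c *\<^sub>R pd j f (c *\<^sub>R x + v)"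
proof -
  have "linear (frechet_derivative f (at (c *\<^sub>R x + v)))"
    using assms by (rule linear_frechet_derivative)
  then show ?thesis
    by (subst pd_eqI[OF has_derivative_affine[OF assms]]) (simp add: pd_def linear_scale)
qed

lemma differentiable_affine:
  assumes "\<And>x. f differentiable (at x)"
  shows "(\<lambda>x. f (c *\<^sub>R x + v)) differentiable (at x)"
  using has_derivative_affine[OF assms] by (auto simp: differentiable_def)

lemma smooth_affine:
  assumes "smooth f"
  shows "smooth (\<lambda>x. f (c *\<^sub>R x + v))"
proof (rule smooth_coinduct[where P="\<lambda>h. \<exists>f k. smooth f \<and> h = (\<lambda>x. k *\<^sub>R f (c *\<^sub>R x + v))"])
  show "\<exists>f' k. smooth f' \<and> (\<lambda>x. f (c *\<^sub>R x + v)) = (\<lambda>x. k *\<^sub>R f' (c *\<^sub>R x + v))"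
    using assms by (intro exI[of _ f] exI[of _ 1]) auto
next
  fix h x assume "\<exists>f k. smooth f \<and> h = (\<lambda>x. k *\<^sub>R f (c *\<^sub>R x + v))"
  then show "h differentiable (at x)"
    by (elim exE conjE, simp only:) (intro differentiable_scaleR differentiable_const differentiable_affine smooth_differentiable)
next
  fix h j assume "\<exists>f k. smooth f \<and> h = (\<lambda>x. k *\<^sub>R f (c *\<^sub>R x + v))"
  then obtain f k where f: "smooth f" "h = (\<lambda>x. k *\<^sub>R f (c *\<^sub>R x + v))" by auto
  then have "pd j h = (\<lambda>x. (k * c) *\<^sub>R pd j f (c *\<^sub>R x + v))"
    by (auto simp: pd_scaleR[OF differentiable_affine] pd_affine smooth_differentiable)
  then show "\<exists>f k. smooth f \<and> pd j h = (\<lambda>x. k *\<^sub>R f (c *\<^sub>R x + v))"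
    using f smooth_pd by blast
qed

lemma pd_coord_times:
  fixes f :: "real^'n \<Rightarrow> complex"
  assumes "f differentiable (at x)"
  shows "pd j (\<lambda>x. of_real (x $ i) * f x) x = of_real (x $ i) * pd j f x + (if i = j then 1 else 0) * f x"
    and "(\<lambda>x. of_real (x $ i) * f x) differentiable (at x)"
proof -
  have 1: "((\<lambda>x. complex_of_real (x $ i)) has_derivative (\<lambda>h. complex_of_real (h $ i))) (at x)"
    by (intro has_derivative_of_real bounded_linear_imp_has_derivative bounded_linear_vec_nth)
  note D = has_derivative_mult[OF 1 frechet_derivative_worksI[OF assms]]
  show "pd j (\<lambda>x. of_real (x $ i) * f x) x = of_real (x $ i) * pd j f x + (if i = j then 1 else 0) * f x"
    by (subst pd_eqI[OF D]) (auto simp: pd_def axis_def)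
  show "(\<lambda>x. of_real (x $ i) * f x) differentiable (at x)"
    using D by (auto simp: differentiable_def)
qed

lemma smooth_coord_times:
  fixes f :: "real^'n \<Rightarrow> complex"
  assumes "smooth f"
  shows "smooth (\<lambda>x. of_real (x $ i) * f x)"
proof (rule smooth_coinduct[where P="\<lambda>h. \<exists>a b. smooth a \<and> smooth b \<and> h = (\<lambda>x. of_real (x $ i) * a x + b x)"])
  show "\<exists>a b. smooth a \<and> smooth b \<and> (\<lambda>x. of_real (x $ i) * f x) = (\<lambda>x. of_real (x $ i) * a x + b x)"
    using assms smooth_cmult[OF assms, of 0] by (intro exI[of _ f] exI[of _ "\<lambda>x. 0 * f x"]) auto
next
  fix h :: "real^'n \<Rightarrow> complex" and x assume "\<exists>a b. smooth a \<and> smooth b \<and> h = (\<lambda>x. of_real (x $ i) * a x + b x)"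
  then show "h differentiable (at x)"
    by (elim exE conjE)
      (simp only:, rule differentiable_add[OF pd_coord_times(2)[OF smooth_differentiable] smooth_differentiable])
next
  fix h :: "real^'n \<Rightarrow> complex" and j assume "\<exists>a b. smooth a \<and> smooth b \<and> h = (\<lambda>x. of_real (x $ i) * a x + b x)"
  then obtain a b where ab: "smooth a" "smooth b" "h = (\<lambda>x. of_real (x $ i) * a x + b x)" by auto
  then have "pd j h = (\<lambda>x. of_real (x $ i) * pd j a x + ((if i = j then 1 else 0) * a x + pd j b x))"
    by (auto simp: pd_add pd_coord_times smooth_differentiable)
  then show "\<exists>a b. smooth a \<and> smooth b \<and> pd j h = (\<lambda>x. of_real (x $ i) * a x + b x)"
    using ab by (intro exI[of _ "pd j a"] exI[of _ "\<lambda>x. (if i = j then 1 else 0) * a x + pd j b x"])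
      (auto intro!: smooth_pd smooth_add smooth_cmult)
qed

text \<open>
  Decay has to be shown for the functions of the class only, since their derivatives belong to
  the class as well.
\<close>

lemma schwartz_coinduct:
  assumes "P f"
    and "\<And>g x. P g \<Longrightarrow> g differentiable (at x)"
    and "\<And>g j. P g \<Longrightarrow> P (pd j g)"
    and "\<And>g k. P g \<Longrightarrow> bounded (range (\<lambda>x. norm x ^ k * norm (g x)))"
  shows "schwartz f"
proof -
  have "P (iter_pd js f)" for js
    by (induction js) (use assms in auto)
  then show ?thesis using assms(4) smooth_coinduct[of P, OF assms(1-3)] by (auto simp: schwartz_def)
qed

lemma schwartz_smooth: "schwartz f \<Longrightarrow> smooth f"
  by (simp add: schwartz_def)

lemma schwartz_pd: "schwartz f \<Longrightarrow> schwartz (pd j f)"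
  unfolding schwartz_def using smooth_pd by (metis iter_pd_snoc)

lemma pd_zero_on_open:
  fixes f :: "real^'n \<Rightarrow> 'a::real_normed_vector"
  assumes "open S" "x \<in> S" "\<And>y. y \<in> S \<Longrightarrow> f y = 0"
  shows "pd j f x = 0"
proof -
  have "((\<lambda>x. 0) has_derivative (\<lambda>h. 0)) (at x)" by simp
  then have "(f has_derivative (\<lambda>h. 0)) (at x)"
    by (rule has_derivative_transform_within_open[OF _ assms(1,2)]) (use assms in auto)
  then show ?thesis by (rule pd_eqI)
qed

section \<open>Smooth functions of bounded support\<close>

definition test_symbol :: "(real^'n \<Rightarrow> complex) \<Rightarrow> bool"
  where "test_symbol m \<longleftrightarrow> smooth m \<and> (\<exists>R. \<forall>\<xi>. norm \<xi> > R \<longrightarrow> m \<xi> = 0)"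

lemma test_symbol_pd: "test_symbol m \<Longrightarrow> test_symbol (pd j m)"
proof -
  assume "test_symbol m"
  then obtain R where R: "smooth m" "\<And>\<xi>. norm \<xi> > R \<Longrightarrow> m \<xi> = 0" by (auto simp: test_symbol_def)
  have "pd j m \<xi> = 0" if "norm \<xi> > R" for \<xi>
  proof (rule pd_zero_on_open)
    show "open {\<xi>::real^'a. norm \<xi> > R}" by (intro open_Collect_less continuous_intros)
  qed (use R that in auto)
  then show ?thesis using R smooth_pd by (auto simp: test_symbol_def)
qed

lemma test_symbol_coord_times: "test_symbol m \<Longrightarrow> test_symbol (\<lambda>x. of_real (x $ i) * m x)"
  by (auto simp: test_symbol_def intro!: smooth_coord_times)

lemma test_symbol_cmult: "test_symbol m \<Longrightarrow> test_symbol (\<lambda>x. c * m x)"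
  by (auto simp: test_symbol_def intro!: smooth_cmult)

lemma test_symbol_add: 
  assumes "test_symbol m" "test_symbol n"
  shows "test_symbol (\<lambda>x. m x + n x)"
proof -
  obtain R S where "\<forall>\<xi>. norm \<xi> > R \<longrightarrow> m \<xi> = 0" "\<forall>\<xi>. norm \<xi> > S \<longrightarrow> n \<xi> = 0"
    using assms by (auto simp: test_symbol_def)
  then have "\<forall>\<xi>. norm \<xi> > max R S \<longrightarrow> m \<xi> + n \<xi> = 0" by auto
  then show ?thesis using assms smooth_add by (auto simp: test_symbol_def simp del: max_less_iff_conj)
qed

lemma test_symbol_diff: 
  assumes "test_symbol m" "test_symbol n"
  shows "test_symbol (\<lambda>x. m x - n x)"
  using test_symbol_add[OF assms(1) test_symbol_cmult[OF assms(2), of "-1"]] by simp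

lemma test_symbol_scale:
  assumes "test_symbol m" "c \<noteq> 0"
  shows "test_symbol (\<lambda>x. m (c *\<^sub>R x))"
proof -
  obtain R where R: "\<forall>\<xi>. norm \<xi> > R \<longrightarrow> m \<xi> = 0"
    using assms by (auto simp: test_symbol_def)
  have "m (c *\<^sub>R \<xi>) = 0" if "norm \<xi> > R / \<bar>c\<bar>" for \<xi>
    using R that assms(2) by (auto simp: field_simps)
  then show ?thesis using assms smooth_affine[of m c 0] by (auto simp: test_symbol_def)
qed

lemma continuous_bounded_support_integrable:
  fixes u :: "real^'n \<Rightarrow> 'a::{banach, second_countable_topology}"
  assumes "continuous_on UNIV u" "\<And>x. norm x > R \<Longrightarrow> u x = 0"
  shows "integrable lborel u"
proof -
  have "integrable lborel (\<lambda>x. indicator (cball 0 R) x *\<^sub>R u x)"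
    by (intro borel_integrable_compact continuous_on_subset[OF assms(1)]) auto
  moreover have "(\<lambda>x. indicator (cball 0 R) x *\<^sub>R u x) = u"
    using assms(2) by (auto simp: indicator_def fun_eq_iff not_le)
  ultimately show ?thesis by simp
qed

lemma test_symbol_continuous: "test_symbol m \<Longrightarrow> continuous_on A m"
  by (auto simp: test_symbol_def smooth_continuous)

lemma test_symbol_measurable [measurable_dest]: "test_symbol m \<Longrightarrow> m \<in> borel_measurable borel"
  by (auto simp: test_symbol_def smooth_measurable)

lemma test_symbol_integrable: "test_symbol m \<Longrightarrow> integrable lborel m"
  using continuous_bounded_support_integrable test_symbol_continuous
  unfolding test_symbol_def by metis

lemma test_symbol_bounded: "test_symbol m \<Longrightarrow> \<exists>B. \<forall>x. norm (m x) \<le> B"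
proof -
  assume m: "test_symbol m"
  then obtain R where R: "\<And>\<xi>. norm \<xi> > R \<Longrightarrow> m \<xi> = 0" by (auto simp: test_symbol_def)
  have "compact (m ` cball 0 R)"
    by (intro compact_continuous_image test_symbol_continuous[OF m]) auto
  then obtain B where "\<forall>x\<in>m ` cball 0 R. norm x \<le> B" using compact_imp_bounded bounded_iff by metis
  then have "norm (m x) \<le> max B 0" for x
    using R[of x] by (cases "norm x > R") (auto simp: not_less le_max_iff_disj)
  then show ?thesis by blast
qed

section \<open>Differentiation under the integral sign\<close>

text \<open>
  The derivative of the integrand is controlled on a ball around \<open>x0\<close> by one integrable
  function; on this ball the mean value theorem dominates the difference quotients, and
  dominated convergence applies.
\<close>

lemma pd_integral:
  fixes u :: "real^'n \<Rightarrow> 'b \<Rightarrow> complex" and x0 :: "real^'n"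
  assumes diff: "\<And>x y. (\<lambda>x. u x y) differentiable (at x)"
    and int: "\<And>x. integrable M (u x)"
    and meas: "\<And>j. (\<lambda>y. pd j (\<lambda>x. u x y) x0) \<in> borel_measurable M"
    and g: "integrable M g"
    and bound: "\<And>x y j. dist x0 x < 1 \<Longrightarrow> norm (pd j (\<lambda>x. u x y) x) \<le> g y"
  shows "(\<lambda>x. LINT y|M. u x y) differentiable (at x0)"
    and "pd j (\<lambda>x. LINT y|M. u x y) x0 = (LINT y|M. pd j (\<lambda>x. u x y) x0)"
proof -
  define D where "D = (\<lambda>x y h. \<Sum>j\<in>UNIV. (h $ j) *\<^sub>R pd j (\<lambda>x. u x y) x)"
  have D: "((\<lambda>x. u x y) has_derivative D x y) (at x)" for x y
    unfolding D_def by (rule frechet_derivative_eq_sum_pd[OF diff])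
  have pd_int: "integrable M (\<lambda>y. pd j (\<lambda>x. u x y) x0)" for j
    by (rule Bochner_Integration.integrable_bound[OF g meas]) (use bound[of x0 j] in \<open>auto intro!: AE_I2 order_trans[OF _ abs_ge_self]\<close>)
  have intD: "integrable M (\<lambda>y. D x0 y h)" for h
    unfolding D_def by (intro Bochner_Integration.integrable_sum integrable_scaleR_right pd_int)
  define N where "N = real CARD('n)"
  have Dbound: "norm (D x y h) \<le> N * g y * norm h" if "dist x0 x < 1" for x y h
  proof -
    have "norm (D x y h) \<le> (\<Sum>j\<in>UNIV. \<bar>h $ j\<bar> * norm (pd j (\<lambda>x. u x y) x))"
      unfolding D_def by (rule order_trans[OF norm_sum]) auto
    also have "\<dots> \<le> (\<Sum>j\<in>(UNIV::'n set). norm h * g y)"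
      by (intro sum_mono mult_mono bound that component_le_norm_cart) auto
    finally show ?thesis by (simp add: N_def mult.commute mult.left_commute)
  qed
  have gpos: "g y \<ge> 0" for y using order_trans[OF norm_ge_zero bound[of x0 undefined y]] by simp
  have "((\<lambda>x. LINT y|M. u x y) has_derivative (\<lambda>h. LINT y|M. D x0 y h)) (at x0)"
    unfolding has_derivative_at
  proof (intro conjI)
    have eq: "(LINT y|M. D x0 y h) = (\<Sum>j\<in>UNIV. (h $ j) *\<^sub>R (LINT y|M. pd j (\<lambda>x. u x y) x0))" for h
      unfolding D_def by (subst Bochner_Integration.integral_sum) (auto intro!: pd_int)
    show "bounded_linear (\<lambda>h. LINT y|M. D x0 y h)"
      unfolding eq by (intro bounded_linear_sum bounded_linear_scaleR_const bounded_linear_vec_nth)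
    show "((\<lambda>h. norm ((LINT y|M. u (x0 + h) y) - (LINT y|M. u x0 y) - (LINT y|M. D x0 y h)) / norm h) \<longlongrightarrow> 0) (at 0)"
      unfolding tendsto_at_iff_sequentially
    proof (intro allI impI, goal_cases)
      case (1 X)
      then have X: "X \<longlonglongrightarrow> 0" and X0: "\<And>i. X i \<noteq> 0" by auto
      obtain K where K: "\<And>n. n \<ge> K \<Longrightarrow> norm (X n) < 1"
        using LIMSEQ_D[OF X, of 1] by auto
      define Y where "Y = (\<lambda>n. X (n + K))"
      have Y: "Y \<longlonglongrightarrow> 0" using X unfolding Y_def by (rule LIMSEQ_ignore_initial_segment)
      have Y0: "Y i \<noteq> 0" and Y1: "norm (Y i) < 1" for i by (auto simp: Y_def X0 K)
      let ?q = "\<lambda>n y. (u (x0 + Y n) y - u x0 y - D x0 y (Y n)) /\<^sub>R norm (Y n)"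
      have "(\<lambda>n. LINT y|M. ?q n y) \<longlonglongrightarrow> (LINT y|M. 0)"
      proof (rule integral_dominated_convergence)
        show "integrable M (\<lambda>y. 2 * N * g y)" using g by simp
        show "?q n \<in> borel_measurable M" for n
          using int intD by (intro borel_measurable_scaleR borel_measurable_diff borel_measurable_const borel_measurable_integrable)
        show "AE y in M. (\<lambda>n. ?q n y) \<longlonglongrightarrow> 0"
        proof (rule AE_I2)
          fix y
          have "((\<lambda>h. norm (u (x0 + h) y - u x0 y - D x0 y h) / norm h) \<longlongrightarrow> 0) (at 0)"
            using D[where x=x0 and y=y] unfolding has_derivative_at by blast
          then have "(\<lambda>n. norm (u (x0 + Y n) y - u x0 y - D x0 y (Y n)) / norm (Y n)) \<longlonglongrightarrow> 0"
            unfolding tendsto_at_iff_sequentially using Y Y0 by (auto simp: o_def)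
          then show "(\<lambda>n. ?q n y) \<longlonglongrightarrow> 0"
            by (subst tendsto_norm_zero_iff[symmetric]) (simp add: divide_inverse mult.commute)
        qed
        show "AE y in M. norm (?q n y) \<le> 2 * N * g y" for n
        proof (rule AE_I2)
          fix y
          have "norm (u (x0 + Y n) y - u x0 y) \<le> N * g y * norm (x0 + Y n - x0)"
          proof (rule differentiable_bound[where S="ball x0 1" and f'="\<lambda>x. D x y"])
            show "convex (ball x0 1)" by simp
            show "((\<lambda>x. u x y) has_derivative D x y) (at x within ball x0 1)" for x
              using D has_derivative_at_withinI by blast
            show "onorm (D x y) \<le> N * g y" if "x \<in> ball x0 1" for x
              using Dbound that by (intro onorm_bound) (auto simp: N_def gpos)
            show "x0 + Y n \<in> ball x0 1" "x0 \<in> ball x0 1" using Y1 by (auto simp: dist_norm)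
          qed
          then have "norm (u (x0 + Y n) y - u x0 y - D x0 y (Y n)) \<le> N * g y * norm (Y n) + N * g y * norm (Y n)"
            using Dbound[of x0 y "Y n"] by (intro order_trans[OF norm_triangle_ineq4[of "u (x0 + Y n) y - u x0 y"]] add_mono) auto
          then show "norm (?q n y) \<le> 2 * N * g y"
            using Y0[of n] by (simp add: divide_simps mult_ac)
        qed
      qed auto
      moreover have "(LINT y|M. ?q n y) = ((LINT y|M. u (x0 + Y n) y) - (LINT y|M. u x0 y) - (LINT y|M. D x0 y (Y n))) /\<^sub>R norm (Y n)" for n
        using int intD by (simp del: scaleR_right_diff_distrib)
      ultimately have "(\<lambda>n. ((LINT y|M. u (x0 + Y n) y) - (LINT y|M. u x0 y) - (LINT y|M. D x0 y (Y n))) /\<^sub>R norm (Y n)) \<longlonglongrightarrow> 0"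
        by (simp only: Bochner_Integration.integral_zero)
      then have "(\<lambda>n. norm ((LINT y|M. u (x0 + Y n) y) - (LINT y|M. u x0 y) - (LINT y|M. D x0 y (Y n))) / norm (Y n)) \<longlonglongrightarrow> 0"
        by (subst (asm) tendsto_norm_zero_iff[symmetric]) (simp add: divide_inverse mult.commute)
      then have "(\<lambda>n. norm ((LINT y|M. u (x0 + X (n+K)) y) - (LINT y|M. u x0 y) - (LINT y|M. D x0 y (X (n+K)))) / norm (X (n+K))) \<longlonglongrightarrow> 0"
        by (simp add: Y_def)
      from LIMSEQ_offset[OF this] show ?case by (simp add: o_def)
    qed
  qed
  note * = this
  from * show "(\<lambda>x. LINT y|M. u x y) differentiable (at x0)" by (auto simp: differentiable_def)
  have "D x0 y (axis j 1) = pd j (\<lambda>x. u x y) x0" for y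
    by (simp add: D_def axis_def if_distrib[where f="\<lambda>x. x *\<^sub>R _"] cong: if_cong)
  then show "pd j (\<lambda>x. LINT y|M. u x y) x0 = (LINT y|M. pd j (\<lambda>x. u x y) x0)"
    by (subst pd_eqI[OF *]) simp
qed

section \<open>Integration on Euclidean space\<close>

lemma nn_integral_lborel_affine:
  fixes f :: "'a::euclidean_space \<Rightarrow> ennreal"
  assumes [measurable]: "f \<in> borel_measurable borel" and c: "c \<noteq> 0"
  shows "(\<integral>\<^sup>+x. f x \<partial>lborel) = ennreal (\<bar>c\<bar> ^ DIM('a)) * (\<integral>\<^sup>+x. f (t + c *\<^sub>R x) \<partial>lborel)"
  by (subst lborel_affine[OF c, of t])
     (simp add: nn_integral_density nn_integral_distr nn_integral_cmult)

lemma integrable_lborel_affine: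
  fixes f :: "'a::euclidean_space \<Rightarrow> 'b::{banach, second_countable_topology}"
  assumes f: "integrable lborel f" and c: "c \<noteq> 0"
  shows "integrable lborel (\<lambda>x. f (t + c *\<^sub>R x))"
  using f f[THEN borel_measurable_integrable] c unfolding integrable_iff_bounded
  by (subst (asm) nn_integral_lborel_affine[where c=c and t=t]) (auto simp: ennreal_mult_less_top)

lemma integrable_lborel_affine_iff:
  fixes f :: "'a::euclidean_space \<Rightarrow> 'b::{banach, second_countable_topology}"
  assumes c: "c \<noteq> 0"
  shows "integrable lborel (\<lambda>x. f (t + c *\<^sub>R x)) \<longleftrightarrow> integrable lborel f"
  using
    integrable_lborel_affine[of f c t]
    integrable_lborel_affine[of "\<lambda>x. f (t + c *\<^sub>R x)" "1/c" "(-1/c) *\<^sub>R t"] c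
  by (auto simp: scaleR_diff_right)

lemma integral_lborel_affine:
  fixes f :: "'a::euclidean_space \<Rightarrow> 'b::{banach, second_countable_topology}"
  assumes c: "c \<noteq> 0"
  shows "(LINT x|lborel. f x) = (\<bar>c\<bar> ^ DIM('a)) *\<^sub>R (LINT x|lborel. f (t + c *\<^sub>R x))"
proof cases
  assume f[measurable]: "integrable lborel f" then show ?thesis
    using c f f[THEN borel_measurable_integrable] f[THEN integrable_lborel_affine, of c t]
    by (subst lborel_affine[OF c, of t])
       (simp add: integral_density integral_distr)
next
  assume "\<not> integrable lborel f" with c show ?thesis
    by (simp add: integrable_lborel_affine_iff not_integrable_integral_eq)
qed

lemma
  fixes f :: "'a::euclidean_space \<Rightarrow> 'b::{banach, second_countable_topology}"
  shows integral_lborel_reflect: "(LINT y|lborel. f (x - y)) = (LINT y|lborel. f y)"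
    and integral_lborel_shift: "(LINT y|lborel. f (x + y)) = (LINT y|lborel. f y)"
    and integrable_lborel_reflect_iff: "integrable lborel (\<lambda>y. f (x - y)) \<longleftrightarrow> integrable lborel f"
    and integrable_lborel_shift_iff: "integrable lborel (\<lambda>y. f (x + y)) \<longleftrightarrow> integrable lborel f"
  using integral_lborel_affine[of "-1" f x] integral_lborel_affine[of 1 f x]
    integrable_lborel_affine_iff[of "-1" f x] integrable_lborel_affine_iff[of 1 f x]
  by simp_all

lemma
  fixes f :: "'a::euclidean_space \<Rightarrow> ennreal"
  assumes "f \<in> borel_measurable borel"
  shows nn_integral_lborel_reflect: "(\<integral>\<^sup>+y. f (x - y) \<partial>lborel) = (\<integral>\<^sup>+y. f y \<partial>lborel)"
    and nn_integral_lborel_shift: "(\<integral>\<^sup>+y. f (x + y) \<partial>lborel) = (\<integral>\<^sup>+y. f y \<partial>lborel)"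
  using nn_integral_lborel_affine[OF assms, of "-1" x] nn_integral_lborel_affine[OF assms, of 1 x]
  by (simp_all)

lemma AE_lborel_affine:
  fixes P :: "'a::euclidean_space \<Rightarrow> bool"
  assumes c: "c \<noteq> 0" and P: "AE x in lborel. P x"
  shows "AE x in lborel. P (t + c *\<^sub>R x)"
proof -
  have "AE x in density (distr lborel borel (\<lambda>x. t + c *\<^sub>R x)) (\<lambda>_. ennreal (\<bar>c\<bar> ^ DIM('a))). P x"
    using P lborel_affine[OF c, of t] by metis
  then have "AE x in distr lborel borel (\<lambda>x. t + c *\<^sub>R x). P x"
    using c by (subst (asm) AE_density) auto
  then show ?thesis by (rule AE_distrD[rotated]) simp
qed

lemma
  fixes f :: "'a::euclidean_space \<Rightarrow> real \<Rightarrow> 'b::{real_normed_field, banach, second_countable_topology}"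
  assumes f: "\<And>b. b \<in> Basis \<Longrightarrow> integrable lborel (f b)"
  shows integral_lborel_Basis_prod:
      "(LINT x|lborel. (\<Prod>b\<in>Basis. f b (x \<bullet> b))) = (\<Prod>b\<in>Basis. (LINT t|lborel. f b t))"
    and integrable_lborel_Basis_prod:
      "integrable lborel (\<lambda>x. (\<Prod>b\<in>Basis. f b (x \<bullet> b)))"
proof -
  interpret product_sigma_finite "\<lambda>_::'a. lborel :: real measure" ..
  have [measurable]: "\<And>b. b \<in> Basis \<Longrightarrow> f b \<in> borel_measurable borel" using f by auto
  show "(LINT x|lborel. (\<Prod>b\<in>Basis. f b (x \<bullet> b))) = (\<Prod>b\<in>Basis. (LINT t|lborel. f b t))"
    by (subst lborel_eq) (simp add: integral_distr product_integral_prod[OF finite_Basis f])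
  show "integrable lborel (\<lambda>x. (\<Prod>b\<in>Basis. f b (x \<bullet> b)))"
    by (subst lborel_eq) (simp add: integrable_distr_eq product_integrable_prod[OF finite_Basis f])
qed

text \<open>
  The weight lies below the product over the coordinates of
  \<open>(1 + \<bar>t\<bar>)\<^sup>-\<^sup>2\<close>, which is integrable coordinate by coordinate; hence
  the exponent \<open>2d\<close>.
\<close>

lemma integrable_inverse_weight:
  assumes "2 * CARD('n) \<le> M"
  shows "integrable lborel (\<lambda>x::real^'n. 1 / (1 + norm x) ^ M)"
proof -
  let ?f = "\<lambda>t::real. 1 / (1 + \<bar>t\<bar>) ^ 2"
  have 1: "integrable lborel ?f"
  proof -
    have "integrable lborel (\<lambda>t::real. 2 * inverse (1 + t^2))"
      using integrable_inverse_1_plus_square by (simp add: set_integrable_def)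
    then show ?thesis
      by (rule Bochner_Integration.integrable_bound)
        (auto simp: field_simps power2_eq_square add_pos_nonneg intro!: AE_I2 frac_le)
  qed
  have "integrable lborel (\<lambda>x::real^'n. \<Prod>b\<in>Basis. ?f (x \<bullet> b))"
    by (rule integrable_lborel_Basis_prod) (rule 1)
  then show ?thesis
  proof (rule Bochner_Integration.integrable_bound)
    show "AE x in lborel. norm (1 / (1 + norm (x::real^'n)) ^ M) \<le> norm (\<Prod>b\<in>Basis. ?f (x \<bullet> b))"
    proof (rule AE_I2)
      fix x :: "real^'n"
      have "(\<Prod>b\<in>(Basis :: (real^'n) set). (1 + \<bar>x \<bullet> b\<bar>) ^ 2) \<le> (\<Prod>b\<in>(Basis :: (real^'n) set). (1 + norm x) ^ 2)"
        by (intro prod_mono) (auto intro!: power_mono Basis_le_norm)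
      also have "\<dots> = (1 + norm x) ^ (2 * CARD('n))" by (simp add: power_mult)
      also have "\<dots> \<le> (1 + norm x) ^ M" using assms by (intro power_increasing) auto
      finally have *: "(\<Prod>b\<in>(Basis :: (real^'n) set). (1 + \<bar>x \<bullet> b\<bar>) ^ 2) \<le> (1 + norm x) ^ M" .
      have "0 < (\<Prod>b\<in>(Basis :: (real^'n) set). (1 + \<bar>x \<bullet> b\<bar>) ^ 2)" by (intro prod_pos) (auto intro!: zero_less_power add_pos_nonneg)
      then have "1 / (1 + norm x) ^ M \<le> 1 / (\<Prod>b\<in>(Basis :: (real^'n) set). (1 + \<bar>x \<bullet> b\<bar>) ^ 2)"
        using * by (intro divide_left_mono mult_pos_pos zero_less_power add_pos_nonneg) auto
      also have "\<dots> = (\<Prod>b\<in>Basis. ?f (x \<bullet> b))" by (simp add: prod_dividef)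
      finally show "norm (1 / (1 + norm x) ^ M) \<le> norm (\<Prod>b\<in>Basis. ?f (x \<bullet> b))" by simp
    qed
  qed measurable
qed

lemma integrable_pair_mult:
  fixes f :: "'a \<Rightarrow> 'b::{real_normed_field, banach, second_countable_topology}"
  assumes "sigma_finite_measure M" "sigma_finite_measure N"
    and f: "integrable M f" and g: "integrable N g"
  shows "integrable (M \<Otimes>\<^sub>M N) (\<lambda>(x, y). f x * g y)"
proof -
  interpret pair_sigma_finite M N using assms by (simp add: pair_sigma_finite_def)
  have [measurable]: "f \<in> borel_measurable M" "g \<in> borel_measurable N" using f g by auto
  show ?thesis
    by (rule Fubini_integrable) (use f g in \<open>auto simp: norm_mult\<close>)
qed

lemmas integrable_pair_lborel_mult = integrable_pair_mult[OF lborel.sigma_finite_measure_axioms lborel.sigma_finite_measure_axioms]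

section \<open>Rapidly decreasing functions\<close>

text \<open>
  Decay without any condition on derivatives: all that is needed of a convolution kernel, or of
  a function to be paired with one of tempered growth.
\<close>

definition rapid :: "(real^'n \<Rightarrow> complex) \<Rightarrow> bool"
  where "rapid k \<longleftrightarrow> k \<in> borel_measurable borel \<and> (\<forall>M. \<exists>C. \<forall>x. norm (k x) \<le> C / (1 + norm x) ^ M)"

lemma rapid_measurable [measurable_dest]: "rapid k \<Longrightarrow> k \<in> borel_measurable borel"
  by (simp add: rapid_def)

lemma rapid_bound:
  assumes "rapid k"
  shows "\<exists>C. \<forall>x. norm (k x) \<le> C / (1 + norm x) ^ M"
  using assms unfolding rapid_def by blast

lemma rapid_bound_nonneg:
  assumes "\<forall>x::'a::real_normed_vector. norm (k x) \<le> C / (1 + norm x) ^ M"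
  shows "C \<ge> (0::real)"
  using order_trans[OF norm_ge_zero assms[rule_format, of 0]] by simp

lemma rapid_weighted_integrable:
  fixes k :: "real^'n \<Rightarrow> complex"
  assumes "rapid k"
  shows "integrable lborel (\<lambda>x. (1 + norm x) ^ N * norm (k x))"
proof -
  have [measurable]: "k \<in> borel_measurable borel" using assms by (rule rapid_measurable)
  obtain C where C: "\<forall>x. norm (k x) \<le> C / (1 + norm x) ^ (2 * CARD('n) + N)"
    using rapid_bound[OF assms] by blast
  then have C0: "C \<ge> 0" by (rule rapid_bound_nonneg)
  have "integrable lborel (\<lambda>x::real^'n. C * (1 / (1 + norm x) ^ (2 * CARD('n))))"
    by (intro integrable_mult_right integrable_inverse_weight) simp
  then show ?thesis
  proof (rule Bochner_Integration.integrable_bound)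
    show "AE x in lborel. norm ((1 + norm x) ^ N * norm (k x)) \<le> norm (C * (1 / (1 + norm x) ^ (2 * CARD('n))))"
    proof (rule AE_I2)
      fix x :: "real^'n"
      have "1 + norm x > 0" by (simp add: add_pos_nonneg)
      then have "(1 + norm x) ^ N * norm (k x) \<le> (1 + norm x) ^ N * (C / (1 + norm x) ^ (2 * CARD('n) + N))"
        by (intro mult_left_mono C[rule_format]) auto
      also have "\<dots> = C * (1 / (1 + norm x) ^ (2 * CARD('n)))"
        using \<open>1 + norm x > 0\<close> by (simp add: power_add)
      finally show "norm ((1 + norm x) ^ N * norm (k x)) \<le> norm (C * (1 / (1 + norm x) ^ (2 * CARD('n))))"
        using C0 by simp
    qed
  qed measurable
qed

lemma rapid_integrable: "rapid k \<Longrightarrow> integrable lborel k"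
  using rapid_weighted_integrable[of k 0] integrable_norm_iff[of k lborel]
  by (auto dest: rapid_measurable)

lemma one_plus_power_le:
  fixes t :: real assumes "t \<ge> 0"
  shows "(1 + t) ^ M \<le> 2 ^ M * (1 + t ^ M)"
proof (cases "t \<le> 1")
  case True
  then have "(1 + t) ^ M \<le> 2 ^ M" using assms by (intro power_mono) auto
  also have "\<dots> \<le> 2 ^ M * (1 + t ^ M)" using assms by simp
  finally show ?thesis .
next
  case False
  then have "(1 + t) ^ M \<le> (2 * t) ^ M" using assms by (intro power_mono) auto
  also have "\<dots> \<le> 2 ^ M * (1 + t ^ M)" by (simp add: power_mult_distrib)
  finally show ?thesis .
qed

lemma rapidI:
  fixes k :: "real^'n \<Rightarrow> complex"
  assumes "k \<in> borel_measurable borel"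
    and "\<And>M. bounded (range (\<lambda>x. norm x ^ M * norm (k x)))"
  shows "rapid k"
  unfolding rapid_def
proof (intro conjI allI)
  fix M
  obtain A where A: "\<And>x. norm x ^ 0 * norm (k x) \<le> A" using assms(2)[of 0] unfolding bounded_iff by auto
  obtain B where B: "\<And>x. norm x ^ M * norm (k x) \<le> B" using assms(2)[of M] unfolding bounded_iff by auto
  have "norm (k x) \<le> (2 ^ M * (A + B)) / (1 + norm x) ^ M" for x
  proof -
    have "(1 + norm x) ^ M * norm (k x) \<le> 2 ^ M * (1 + norm x ^ M) * norm (k x)"
      by (intro mult_right_mono one_plus_power_le) auto
    also have "\<dots> = 2 ^ M * (norm x ^ 0 * norm (k x) + norm x ^ M * norm (k x))" by (simp add: algebra_simps)
    also have "\<dots> \<le> 2 ^ M * (A + B)" by (intro mult_left_mono add_mono A B) auto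
    finally have le: "(1 + norm x) ^ M * norm (k x) \<le> 2 ^ M * (A + B)" .
    have "0 < (1 + norm x) ^ M" by (intro zero_less_power add_pos_nonneg) auto
    from le show ?thesis unfolding pos_le_divide_eq[OF \<open>0 < (1 + norm x) ^ M\<close>] by (simp add: mult.commute)
  qed
  then show "\<exists>C. \<forall>x. norm (k x) \<le> C / (1 + norm x) ^ M" by blast
qed (rule assms)

lemma schwartz_rapid: "schwartz \<psi> \<Longrightarrow> rapid \<psi>"
proof (rule rapidI)
  assume s: "schwartz \<psi>"
  then show "\<psi> \<in> borel_measurable borel" using schwartz_smooth smooth_measurable by blast
  show "bounded (range (\<lambda>x. norm x ^ M * norm (\<psi> x)))" for M
  proof -
    have "bounded (range (\<lambda>x. norm x ^ M * norm (iter_pd [] \<psi> x)))"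
      using s unfolding schwartz_def by blast
    then show ?thesis by simp
  qed
qed

section \<open>Inverse Fourier transforms of test symbols\<close>

text \<open>
  Translation invariance makes \<open>\<integral>u(x + y) dy\<close> constant in \<open>x\<close>; differentiate under
  the integral sign.
\<close>

lemma integral_pd_eq_0:
  fixes u :: "real^'n \<Rightarrow> complex"
  assumes diff: "\<And>x. u differentiable (at x)"
    and cont: "\<And>j. continuous_on UNIV (pd j u)"
    and supp: "\<And>x. norm x > R \<Longrightarrow> u x = 0"
  shows "(LINT x|lborel. pd j u x) = 0"
proof -
  have cu: "continuous_on UNIV u"
    using diff by (meson continuous_at_imp_continuous_on differentiable_imp_continuous_within)
  have iu: "integrable lborel u" by (rule continuous_bounded_support_integrable[OF cu supp])
  have supp': "pd j u \<xi> = 0" if "norm \<xi> > R" for \<xi> j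
  proof (rule pd_zero_on_open)
    show "open {\<xi>::real^'n. norm \<xi> > R}" by (intro open_Collect_less continuous_intros)
  qed (use supp that in auto)
  have "\<exists>B. \<forall>x. norm (pd j u x) \<le> B" for j
  proof -
    have "compact (pd j u ` cball 0 R)"
      by (intro compact_continuous_image continuous_on_subset[OF cont]) auto
    then obtain B where "\<forall>x\<in>pd j u ` cball 0 R. norm x \<le> B" using compact_imp_bounded bounded_iff by metis
    then have "norm (pd j u x) \<le> max B 0" for x
      using supp'[of x] by (cases "norm x > R") (auto simp: not_less le_max_iff_disj)
    then show ?thesis by blast
  qed
  then obtain B where B: "\<And>j x. norm (pd j u x) \<le> B j" by metis
  have pdu: "pd j (\<lambda>x. u (x + y)) x = pd j u (x + y)" for j x y
    using pd_affine[of u 1 x y] diff by simp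
  define S where "S = (\<Sum>j\<in>UNIV. B j)"
  have B0: "B j \<ge> 0" for j using order_trans[OF norm_ge_zero B] .
  have BS: "norm (pd j u x) \<le> S" for j x
    using B[of j x] member_le_sum[of j UNIV B] B0 by (auto simp: S_def)
  have "pd j (\<lambda>x. LINT y|lborel. u (x + y)) 0 = (LINT y|lborel. pd j (\<lambda>x. u (x + y)) 0)"
  proof (rule pd_integral(2))
    show "(\<lambda>x. u (x + y)) differentiable (at x)" for x y
      using differentiable_affine[OF diff, of 1 y] by simp
    show "integrable lborel (\<lambda>y. u (x + y))" for x using iu by (simp add: integrable_lborel_shift_iff)
    show "(\<lambda>y. pd j (\<lambda>x. u (x + y)) 0) \<in> borel_measurable lborel" for j
      unfolding pdu using cont[THEN borel_measurable_continuous_onI] by simp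
    show "integrable lborel (\<lambda>y::real^'n. S * indicator (cball 0 (R + 1)) y)"
      using emeasure_bounded_finite[of "cball (0::real^'n) (R + 1)"]
      by (intro integrable_mult_right integrable_real_indicator) (auto simp: infinity_ennreal_def less_top)
    show "norm (pd j (\<lambda>x. u (x + y)) x) \<le> S * indicator (cball 0 (R + 1)) y" if "dist 0 x < 1" for x y j
    proof (cases "norm y \<le> R + 1")
      case True then show ?thesis using BS by (simp add: pdu indicator_def)
    next
      case False
      have "norm (x + y) \<ge> norm y - norm x" by (metis add.commute norm_diff_ineq)
      then show ?thesis using False that by (simp add: pdu indicator_def supp')
    qed
  qed
  moreover have "pd j (\<lambda>x. LINT y|lborel. u (x + y)) 0 = 0"
    unfolding integral_lborel_shift using pd_eqI[OF has_derivative_const[of "LINT x|lborel. u x"]] by metis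
  ultimately show ?thesis by (simp add: pdu)
qed

abbreviation ee :: "real \<Rightarrow> complex" where "ee t \<equiv> exp (\<i> * complex_of_real t)"

lemma ee_mult: "ee (s + t) = ee s * ee t"
  by (simp add: ring_distribs exp_add)

lemma norm_ee [simp]: "norm (ee t) = 1"
  by simp

lemma has_derivative_ee_inner:
  "((\<lambda>x. ee (x \<bullet> \<xi>)) has_derivative (\<lambda>h. \<i> * of_real (h \<bullet> \<xi>) * ee (x \<bullet> \<xi>))) (at x)"
proof -
  have 1: "((\<lambda>x. \<i> * complex_of_real (x \<bullet> \<xi>)) has_derivative (\<lambda>h. \<i> * of_real (h \<bullet> \<xi>))) (at x)"
    by (intro has_derivative_mult_right has_derivative_of_real has_derivative_inner_left has_derivative_ident)
  have "(exp has_derivative (\<lambda>h. exp z * h)) (at z)" for z :: complex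
    using DERIV_exp[of z] by (simp add: has_field_derivative_def)
  from diff_chain_at[OF 1 this] show ?thesis by (simp add: o_def mult_ac)
qed

lemma
  shows pd_ee_inner: "pd j (\<lambda>x. ee (x \<bullet> \<xi>)) x = \<i> * of_real (\<xi> $ j) * ee (x \<bullet> \<xi>)"
    and differentiable_ee_inner: "(\<lambda>x. ee (x \<bullet> \<xi>)) differentiable (at x)"
  using has_derivative_ee_inner[of \<xi> x] pd_eqI[OF has_derivative_ee_inner, of j \<xi> x]
  by (auto simp: differentiable_def inner_axis')

lemma pd_mult_const:
  fixes f :: "real^'n \<Rightarrow> complex"
  assumes "f differentiable (at x)"
  shows "pd j (\<lambda>x. f x * c) x = pd j f x * c"
  using has_derivative_mult_left[OF frechet_derivative_worksI[OF assms]]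
  by (subst pd_eqI) (auto simp: pd_def)

text \<open>
  On a bounded symbol support, multiplication by a coordinate keeps the integral absolutely
  convergent, so that the exponential can be differentiated under the integral sign.
\<close>

lemma
  assumes m: "test_symbol m"
  shows inv_fourier_differentiable: "inv_fourier m differentiable (at x)"
    and pd_inv_fourier: "pd j (inv_fourier m) x = inv_fourier (\<lambda>\<xi>. \<i> * (of_real (\<xi> $ j) * m \<xi>)) x"
proof -
  have [measurable]: "m \<in> borel_measurable borel" using m by (rule test_symbol_measurable)
  define u where "u = (\<lambda>x \<xi>. ee (x \<bullet> \<xi>) * m \<xi>)"
  have pdu: "pd j (\<lambda>x. u x \<xi>) x = \<i> * of_real (\<xi> $ j) * ee (x \<bullet> \<xi>) * m \<xi>" for x \<xi> j
    unfolding u_def by (simp add: pd_mult_const differentiable_ee_inner pd_ee_inner)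
  have mj: "integrable lborel (\<lambda>\<xi>. of_real (\<xi> $ j) * m \<xi>)" for j
    by (intro test_symbol_integrable test_symbol_coord_times m)
  note D = pd_integral[of u lborel x "\<lambda>\<xi>. \<Sum>j\<in>UNIV. norm (of_real (\<xi> $ j) * m \<xi>)"]
  have 1: "(\<lambda>x. u x \<xi>) differentiable (at x)" for x \<xi>
    unfolding u_def by (intro differentiable_mult differentiable_ee_inner differentiable_const)
  have 2: "integrable lborel (u x)" for x
    unfolding u_def by (rule Bochner_Integration.integrable_bound[OF test_symbol_integrable[OF m]])
      (auto simp: norm_mult)
  have 3: "(\<lambda>\<xi>. pd j (\<lambda>x. u x \<xi>) x) \<in> borel_measurable lborel" for j unfolding pdu by simp
  have 4: "integrable lborel (\<lambda>\<xi>. \<Sum>j\<in>UNIV. norm (of_real (\<xi> $ j) * m \<xi>))"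
    using mj by (intro Bochner_Integration.integrable_sum integrable_norm)
  have 5: "norm (pd j (\<lambda>x. u x \<xi>) y) \<le> (\<Sum>j\<in>UNIV. norm (of_real (\<xi> $ j) * m \<xi>))" for j y \<xi>
    unfolding pdu by (rule order_trans[OF _ member_le_sum[of j]]) (auto simp: norm_mult)
  have eq: "inv_fourier m = (\<lambda>x. (LINT \<xi>|lborel. u x \<xi>) * (1 / of_real ((2 * pi) ^ CARD('a))))"
    by (simp add: inv_fourier_def u_def fun_eq_iff)
  show "inv_fourier m differentiable (at x)"
    unfolding eq by (intro differentiable_mult differentiable_const D(1) 1 2 3 4 5)
  have "pd j (inv_fourier m) x = pd j (\<lambda>x. LINT \<xi>|lborel. u x \<xi>) x * (1 / of_real ((2 * pi) ^ CARD('a)))"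
    unfolding eq by (intro pd_mult_const D(1) 1 2 3 4 5)
  also have "pd j (\<lambda>x. LINT \<xi>|lborel. u x \<xi>) x = (LINT \<xi>|lborel. pd j (\<lambda>x. u x \<xi>) x)"
    by (intro D(2) 1 2 3 4 5)
  finally show "pd j (inv_fourier m) x = inv_fourier (\<lambda>\<xi>. \<i> * (of_real (\<xi> $ j) * m \<xi>)) x"
    unfolding inv_fourier_def pdu by (simp add: mult_ac)
qed

text \<open>
  Integration by parts: the integral of the derivative of \<open>ee (\<xi> \<bullet> x) * m \<xi>\<close>
  vanishes.
\<close>

lemma coord_times_inv_fourier:
  assumes m: "test_symbol m"
  shows "of_real (x $ j) * inv_fourier m x = \<i> * inv_fourier (pd j m) x"
proof -
  obtain R where R: "\<And>\<xi>. norm \<xi> > R \<Longrightarrow> m \<xi> = 0" using m by (auto simp: test_symbol_def)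
  have md: "m differentiable (at \<xi>)" for \<xi> using m by (auto simp: test_symbol_def smooth_differentiable)
  define u where "u = (\<lambda>\<xi>. ee (\<xi> \<bullet> x) * m \<xi>)"
  have D: "(u has_derivative (\<lambda>h. ee (\<xi> \<bullet> x) * frechet_derivative m (at \<xi>) h + (\<i> * of_real (h \<bullet> x) * ee (\<xi> \<bullet> x)) * m \<xi>)) (at \<xi>)" for \<xi>
    unfolding u_def by (rule has_derivative_mult[OF has_derivative_ee_inner frechet_derivative_worksI[OF md]])
  have pdu: "pd j u \<xi> = ee (\<xi> \<bullet> x) * pd j m \<xi> + \<i> * of_real (x $ j) * (ee (\<xi> \<bullet> x) * m \<xi>)" for j \<xi>
    by (subst pd_eqI[OF D]) (simp add: pd_def inner_axis')
  have "(LINT \<xi>|lborel. pd j u \<xi>) = 0"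
  proof (rule integral_pd_eq_0)
    show "u differentiable (at \<xi>)" for \<xi> using D by (auto simp: differentiable_def)
    show "continuous_on UNIV (pd j u)" for j
      unfolding pdu by (intro continuous_intros test_symbol_continuous test_symbol_pd m)
    show "u \<xi> = 0" if "norm \<xi> > R" for \<xi> using R[OF that] by (simp add: u_def)
  qed
  moreover have i: "integrable lborel (\<lambda>\<xi>. ee (\<xi> \<bullet> x) * n \<xi>)" if n: "test_symbol n" for n
    using test_symbol_measurable[OF n]
    by (intro Bochner_Integration.integrable_bound[OF test_symbol_integrable[OF n]]) (auto simp: norm_mult)
  ultimately have "(LINT \<xi>|lborel. ee (\<xi> \<bullet> x) * pd j m \<xi>) + \<i> * of_real (x $ j) * (LINT \<xi>|lborel. ee (\<xi> \<bullet> x) * m \<xi>) = 0"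
    unfolding pdu using i[OF m] i[OF test_symbol_pd[OF m, of j]] by simp
  then have *: "\<i> * (LINT \<xi>|lborel. ee (\<xi> \<bullet> x) * pd j m \<xi>) = of_real (x $ j) * (LINT \<xi>|lborel. ee (\<xi> \<bullet> x) * m \<xi>)"
    by (simp add: eq_neg_iff_add_eq_0[symmetric] algebra_simps)
  have "\<i> * inv_fourier (pd j m) x = (\<i> * (LINT \<xi>|lborel. ee (\<xi> \<bullet> x) * pd j m \<xi>)) / of_real ((2 * pi) ^ CARD('a))"
    by (simp add: inv_fourier_def inner_commute)
  then show ?thesis unfolding * by (simp add: inv_fourier_def inner_commute)
qed

lemma inv_fourier_bounded:
  assumes m: "test_symbol m"
  shows "\<exists>B. \<forall>x. norm (inv_fourier m x) \<le> B"
proof -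
  have [measurable]: "m \<in> borel_measurable borel" using m by (rule test_symbol_measurable)
  have "norm (inv_fourier m x) \<le> (LINT \<xi>|lborel. norm (m \<xi>)) / (2 * pi) ^ CARD('a)" for x
    unfolding inv_fourier_def norm_divide
    by (intro divide_mono order_trans[OF integral_norm_bound])
      (auto simp: norm_mult norm_power)
  then show ?thesis by blast
qed

lemma test_symbol_iter_pd: "test_symbol m \<Longrightarrow> test_symbol (iter_pd js m)"
  by (induction js) (auto intro: test_symbol_pd)

lemma coord_power_times_inv_fourier:
  assumes m: "test_symbol m"
  shows "of_real (x $ j) ^ k * inv_fourier m x = \<i> ^ k * inv_fourier (iter_pd (replicate k j) m) x"
proof (induction k)
  case (Suc k)
  have "of_real (x $ j) ^ Suc k * inv_fourier m x = of_real (x $ j) * (of_real (x $ j) ^ k * inv_fourier m x)"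
    by simp
  also have "\<dots> = \<i> ^ k * (of_real (x $ j) * inv_fourier (iter_pd (replicate k j) m) x)"
    unfolding Suc by (simp add: mult_ac)
  finally show ?case using coord_times_inv_fourier[OF test_symbol_iter_pd[OF m]] by (simp add: mult_ac)
qed simp

text \<open>
  The class of all inverse transforms of test symbols is closed under derivatives, and powers
  of a coordinate become derivatives of the symbol, so that its members decay. The Euclidean
  norm is bounded by \<open>d\<close> times the largest coordinate, which reduces decay to powers of one
  coordinate.
\<close>

lemma schwartz_inv_fourier:
  fixes m :: "real^'n \<Rightarrow> complex"
  assumes "test_symbol m"
  shows "schwartz (inv_fourier m)"
proof (rule schwartz_coinduct[where P="\<lambda>g. \<exists>m. test_symbol m \<and> g = inv_fourier m"])
  show "\<exists>m'. test_symbol m' \<and> inv_fourier m = inv_fourier m'" using assms by blast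
next
  fix g x assume "\<exists>m. test_symbol m \<and> g = (inv_fourier m :: real^'n \<Rightarrow> complex)"
  then show "g differentiable (at x)" using inv_fourier_differentiable by auto
next
  fix g j assume "\<exists>m. test_symbol m \<and> g = (inv_fourier m :: real^'n \<Rightarrow> complex)"
  then obtain m where m: "test_symbol m" "g = inv_fourier m" by auto
  then have "pd j g = inv_fourier (\<lambda>\<xi>. \<i> * (of_real (\<xi> $ j) * m \<xi>))" using pd_inv_fourier by auto
  moreover have "test_symbol (\<lambda>\<xi>. \<i> * (of_real (\<xi> $ j) * m \<xi>))"
    by (intro test_symbol_cmult test_symbol_coord_times m)
  ultimately show "\<exists>m. test_symbol m \<and> pd j g = inv_fourier m" by blast
next
  fix g k assume "\<exists>m. test_symbol m \<and> g = (inv_fourier m :: real^'n \<Rightarrow> complex)"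
  then obtain m where m: "test_symbol m" "g = inv_fourier m" by auto
  have "\<forall>j. \<exists>B. \<forall>x. norm (inv_fourier (iter_pd (replicate k j) m) x) \<le> B"
    using inv_fourier_bounded[OF test_symbol_iter_pd[OF m(1)]] by blast
  then obtain B where B: "\<And>j x. norm (inv_fourier (iter_pd (replicate k j) m) x) \<le> B j" by metis
  have B0: "B j \<ge> 0" for j using order_trans[OF norm_ge_zero B] .
  have *: "\<bar>x $ j\<bar> ^ k * norm (g x) \<le> (\<Sum>j\<in>UNIV. B j)" for x j
  proof -
    have "norm (of_real (x $ j) ^ k * inv_fourier m x) \<le> B j"
      unfolding coord_power_times_inv_fourier[OF m(1)] using B by (simp add: norm_mult norm_power)
    also have "\<dots> \<le> (\<Sum>j\<in>UNIV. B j)" by (rule member_le_sum) (auto simp: B0)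
    finally show ?thesis using m by (simp add: norm_mult norm_power)
  qed
  have "norm x ^ k * norm (g x) \<le> real CARD('n) ^ k * (\<Sum>j\<in>UNIV. B j)" for x :: "real^'n"
  proof -
    define M where "M = Max (range (\<lambda>j. \<bar>x $ j\<bar>))"
    have "M \<in> range (\<lambda>j. \<bar>x $ j\<bar>)" unfolding M_def by (rule Max_in) auto
    then obtain j where j: "M = \<bar>x $ j\<bar>" by auto
    have "norm x \<le> (\<Sum>i\<in>UNIV. \<bar>x $ i\<bar>)" by (rule norm_le_l1_cart)
    also have "\<dots> \<le> (\<Sum>i\<in>(UNIV::'n set). M)" unfolding M_def by (intro sum_mono Max_ge) auto
    finally have "norm x \<le> real CARD('n) * \<bar>x $ j\<bar>" by (simp add: j)
    then have "norm x ^ k * norm (g x) \<le> (real CARD('n) * \<bar>x $ j\<bar>) ^ k * norm (g x)"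
      by (intro mult_right_mono power_mono) auto
    also have "\<dots> = real CARD('n) ^ k * (\<bar>x $ j\<bar> ^ k * norm (g x))" by (simp add: power_mult_distrib)
    also have "\<dots> \<le> real CARD('n) ^ k * (\<Sum>j\<in>UNIV. B j)" by (intro mult_left_mono *) auto
    finally show ?thesis .
  qed
  then show "bounded (range (\<lambda>x. norm x ^ k * norm (g x)))" unfolding bounded_iff by auto
qed

lemma lborel_Fubini:
  fixes u :: "real^'n \<Rightarrow> real^'n \<Rightarrow> complex"
  assumes [measurable]: "(\<lambda>(x, y). u x y) \<in> borel_measurable (borel \<Otimes>\<^sub>M borel)"
    and f: "integrable lborel f" and g: "integrable lborel g"
    and bound: "\<And>x y. norm (u x y) \<le> f x * g y"
  shows "(LINT x|lborel. LINT y|lborel. u x y) = (LINT y|lborel. LINT x|lborel. u x y)"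
proof -
  have "integrable (lborel \<Otimes>\<^sub>M lborel) (\<lambda>(x, y). u x y)"
    by (rule Bochner_Integration.integrable_bound[OF integrable_pair_lborel_mult[OF f g]])
      (auto intro!: AE_I2 order_trans[OF bound abs_ge_self])
  then show ?thesis by (rule lborel_pair.Fubini_integral[symmetric])
qed

section \<open>Fourier inversion\<close>

text \<open>
  The standard normal density of \<open>\<real>\<^sup>d\<close>. Up to the factor \<open>gauss 0\<close> it is its own
  Fourier transform, and its square at the origin is the constant \<open>(2\<pi>)\<^sup>-\<^sup>d\<close> of
  the inversion formula.
\<close>

definition gauss :: "real^'n \<Rightarrow> real"
  where "gauss x = (\<Prod>b\<in>Basis. std_normal_density (x \<bullet> b))"

lemma gauss_pos: "gauss x > 0"
  unfolding gauss_def by (intro prod_pos) (auto intro!: normal_density_pos)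

lemma gauss_measurable [measurable]: "gauss \<in> borel_measurable borel"
  unfolding gauss_def by measurable

lemma gauss_le: "gauss x \<le> gauss (0::real^'a)" for x :: "real^'a"
  unfolding gauss_def
proof (rule prod_mono)
  fix b :: "real^'a"
  show "0 \<le> std_normal_density (x \<bullet> b) \<and> std_normal_density (x \<bullet> b) \<le> std_normal_density (0 \<bullet> b)"
    by (simp add: std_normal_density_def divide_right_mono)
qed

lemma isCont_gauss: "isCont gauss x"
  unfolding gauss_def std_normal_density_def by (intro continuous_intros) auto

lemma integrable_gauss: "integrable lborel gauss"
  and integral_gauss: "(LINT x|lborel. gauss x) = 1"
proof -
  have 1: "integrable lborel std_normal_density" by simp
  show "integrable lborel (gauss :: real^'n \<Rightarrow> real)"
    using integrable_lborel_Basis_prod[of "\<lambda>_. std_normal_density", OF 1]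
    unfolding gauss_def by simp
  show "(LINT x|lborel. (gauss :: real^'n \<Rightarrow> real) x) = 1"
    using integral_lborel_Basis_prod[of "\<lambda>_. std_normal_density", OF 1] integral_normal_density[of 1 0]
    unfolding gauss_def by simp
qed

lemma gauss_0: "gauss (0::real^'n) * gauss (0::real^'n) = 1 / (2 * pi) ^ CARD('n)"
proof -
  have 1: "1 / sqrt (2 * pi) * (1 / sqrt (2 * pi)) = 1 / (2 * pi)" by simp
  have "gauss (0::real^'n) = (1 / sqrt (2 * pi)) ^ CARD('n)"
    unfolding gauss_def by (simp add: std_normal_density_def)
  then show ?thesis by (metis power_mult_distrib 1 power_one_over)
qed

lemma fourier_std_normal:
  "(LINT t|lborel. ee (- (t * z)) * of_real (std_normal_density t)) = of_real (exp (- z\<^sup>2 / 2))"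
proof -
  have "char std_normal_distribution (- z) = (LINT t|lborel. std_normal_density t *\<^sub>R ee (- z * t))"
    unfolding char_def by (subst integral_density) (auto simp: normal_density_nonneg)
  then show ?thesis
    by (simp add: char_std_normal_distribution scaleR_conv_of_real mult_ac)
qed

lemma fourier_gauss:
  fixes \<zeta> :: "real^'n"
  shows "(LINT x|lborel. ee (- (x \<bullet> \<zeta>)) * of_real (gauss x)) = of_real (gauss \<zeta> / gauss (0::real^'n))"
proof -
  have 1: "ee (- (x \<bullet> \<zeta>)) * of_real (gauss x) =
      (\<Prod>b\<in>Basis. ee (- ((x \<bullet> b) * (\<zeta> \<bullet> b))) * of_real (std_normal_density (x \<bullet> b)))" for x :: "real^'n"
  proof -
    have "ee (- (x \<bullet> \<zeta>)) = exp (\<Sum>b\<in>Basis. \<i> * of_real (- ((x \<bullet> b) * (\<zeta> \<bullet> b))))"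
      unfolding euclidean_inner[of x \<zeta>] sum_distrib_left[symmetric] of_real_sum[symmetric] sum_negf ..
    also have "\<dots> = (\<Prod>b\<in>Basis. ee (- ((x \<bullet> b) * (\<zeta> \<bullet> b))))"
      by (rule exp_sum) simp
    finally show ?thesis by (simp only: gauss_def prod.distrib of_real_prod)
  qed
  have i: "integrable lborel (\<lambda>t. ee (- (t * z)) * of_real (std_normal_density t))" for z
    by (rule Bochner_Integration.integrable_bound[of _ std_normal_density]) (auto simp: norm_mult)
  have "(LINT x|lborel. ee (- (x \<bullet> \<zeta>)) * of_real (gauss x)) =
      (\<Prod>b\<in>Basis. (LINT t|lborel. ee (- (t * (\<zeta> \<bullet> b))) * of_real (std_normal_density t)))"
    unfolding 1 by (rule integral_lborel_Basis_prod) (rule i)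
  also have "\<dots> = (\<Prod>b\<in>Basis. of_real (exp (- (\<zeta> \<bullet> b)\<^sup>2 / 2)))"
    unfolding fourier_std_normal ..
  also have "\<dots> = of_real (gauss \<zeta> / gauss (0::real^'n))"
  proof -
    have "gauss \<zeta> / gauss (0::real^'n) = (\<Prod>b\<in>Basis. exp (- (\<zeta> \<bullet> b)\<^sup>2 / 2))"
      unfolding gauss_def prod_dividef[symmetric] by (simp add: std_normal_density_def)
    then show ?thesis by simp
  qed
  finally show ?thesis .
qed

text \<open>
  The double integral does not converge absolutely, so a factor \<open>gauss (c x)\<close> is inserted
  before the order of integration is exchanged. This turns the integral into an average of \<open>m\<close>
  against a Gaussian of width \<open>c\<close> around \<open>\<xi>\<close>, and both sides pass to the limit
  \<open>c \<rightarrow> 0\<close> by dominated convergence. One factor \<open>gauss 0\<close> arises from the inserted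
  Gaussian and another from its transform; their product cancels the constant of \<open>inv_fourier\<close>.
\<close>

theorem fourier_inv_fourier:
  fixes m :: "real^'n \<Rightarrow> complex"
  assumes m: "test_symbol m"
  shows "fourier (inv_fourier m) \<xi> = m \<xi>"
proof -
  define P where "P = complex_of_real ((2 * pi) ^ CARD('n))"
  have P: "P \<noteq> 0" by (simp add: P_def)
  have [measurable]: "m \<in> borel_measurable borel" using m by (rule test_symbol_measurable)
  define K where "K = inv_fourier m"
  have rK: "rapid K" unfolding K_def by (intro schwartz_rapid schwartz_inv_fourier m)
  then have [measurable]: "K \<in> borel_measurable borel" by (rule rapid_measurable)
  have iK: "integrable lborel K" using rK by (rule rapid_integrable)
  define c where "c = (\<lambda>n::nat. 1 / real (Suc n))"
  have c0: "c n > 0" for n by (simp add: c_def)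
  have c: "c \<longlonglongrightarrow> 0" unfolding c_def using LIMSEQ_Suc[OF lim_1_over_n] by simp
  \<comment> \<open>The first limit removes the inserted Gaussian.\<close>
  let ?A = "\<lambda>n. LINT x|lborel. ee (- (x \<bullet> \<xi>)) * K x * of_real (gauss (c n *\<^sub>R x))"
  have "?A \<longlonglongrightarrow> (LINT x|lborel. ee (- (x \<bullet> \<xi>)) * K x * of_real (gauss (0::real^'n)))"
  proof (rule integral_dominated_convergence[where w="\<lambda>x. norm (K x) * gauss (0::real^'n)"])
    show "integrable lborel (\<lambda>x. norm (K x) * gauss (0::real^'n))" using iK by simp
    show "AE x in lborel. (\<lambda>n. ee (- (x \<bullet> \<xi>)) * K x * of_real (gauss (c n *\<^sub>R x))) \<longlonglongrightarrow> ee (- (x \<bullet> \<xi>)) * K x * of_real (gauss (0::real^'n))"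
    proof (intro AE_I2 tendsto_mult tendsto_const tendsto_of_real)
      fix x :: "real^'n"
      have "(\<lambda>n. c n *\<^sub>R x) \<longlonglongrightarrow> 0 *\<^sub>R x" by (intro tendsto_intros c)
      then show "(\<lambda>n. gauss (c n *\<^sub>R x)) \<longlonglongrightarrow> gauss (0::real^'n)"
        by (intro isCont_tendsto_compose[OF isCont_gauss]) simp
    qed
    show "AE x in lborel. norm (ee (- (x \<bullet> \<xi>)) * K x * of_real (gauss (c n *\<^sub>R x))) \<le> norm (K x) * gauss (0::real^'n)" for n
    proof (rule AE_I2)
      fix x :: "real^'n"
      have "\<bar>gauss (c n *\<^sub>R x)\<bar> \<le> gauss (0::real^'n)"
        using gauss_le[of "c n *\<^sub>R x"] gauss_pos[of "c n *\<^sub>R x"] by simp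
      then show "norm (ee (- (x \<bullet> \<xi>)) * K x * of_real (gauss (c n *\<^sub>R x))) \<le> norm (K x) * gauss (0::real^'n)"
        by (simp add: norm_mult mult_left_mono)
    qed
    show "(\<lambda>x. ee (- (x \<bullet> \<xi>)) * K x * of_real (gauss (c n *\<^sub>R x))) \<in> borel_measurable lborel" for n
      by measurable
    show "(\<lambda>x. ee (- (x \<bullet> \<xi>)) * K x * of_real (gauss (0::real^'n))) \<in> borel_measurable lborel"
      by measurable
  qed
  moreover have "(LINT x|lborel. ee (- (x \<bullet> \<xi>)) * K x * of_real (gauss (0::real^'n))) = fourier K \<xi> * of_real (gauss (0::real^'n))"
    unfolding fourier_def of_real_minus mult_minus_right by (rule integral_mult_left_zero)
  ultimately have L1: "?A \<longlonglongrightarrow> fourier K \<xi> * of_real (gauss (0::real^'n))" by (simp only:)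
  \<comment> \<open>Fubini and the self-duality of the Gaussian turn the regularized integral into an average of
    \<open>m\<close> near \<open>\<xi>\<close>.\<close>
  have A: "?A n = (LINT z|lborel. m (\<xi> - c n *\<^sub>R z) * of_real (gauss z)) / P / of_real (gauss (0::real^'n))" for n
  proof -
    have ig: "integrable lborel (\<lambda>x::real^'n. gauss (c n *\<^sub>R x))"
      using integrable_lborel_affine[OF integrable_gauss, of "c n" 0] c0[of n] by simp
    have inner: "(LINT x|lborel. ee (- (x \<bullet> \<zeta>)) * of_real (gauss (c n *\<^sub>R x))) =
        of_real ((1 / c n) ^ CARD('n) * gauss ((1 / c n) *\<^sub>R \<zeta>) / gauss (0::real^'n))" for \<zeta> :: "real^'n"
    proof -
      define G where "G = (\<lambda>x. ee (- (x \<bullet> \<zeta>)) * complex_of_real (gauss (c n *\<^sub>R x)))"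
      have G: "G (0 + (1 / c n) *\<^sub>R x) = ee (- (x \<bullet> ((1 / c n) *\<^sub>R \<zeta>))) * of_real (gauss x)" for x
        using c0[of n] unfolding G_def by simp
      have "(LINT x|lborel. G x) = (\<bar>1 / c n\<bar> ^ CARD('n)) *\<^sub>R (LINT x|lborel. G (0 + (1 / c n) *\<^sub>R x))"
        using integral_lborel_affine[of "1 / c n" G 0] c0[of n] by simp
      also have "\<dots> = of_real ((1 / c n) ^ CARD('n) * gauss ((1 / c n) *\<^sub>R \<zeta>) / gauss (0::real^'n))"
        unfolding G fourier_gauss using c0[of n] by (simp add: scaleR_conv_of_real)
      finally show ?thesis unfolding G_def .
    qed
    have "?A n = (LINT x|lborel. LINT \<eta>|lborel. (ee (x \<bullet> \<eta>) * m \<eta>) / P * (ee (- (x \<bullet> \<xi>)) * of_real (gauss (c n *\<^sub>R x))))"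
    proof (rule Bochner_Integration.integral_cong[OF refl])
      fix x :: "real^'n"
      have "K x = (LINT \<eta>|lborel. (ee (x \<bullet> \<eta>) * m \<eta>) / P)"
        unfolding K_def inv_fourier_def P_def by (rule integral_divide_zero[symmetric])
      then have "K x * (ee (- (x \<bullet> \<xi>)) * of_real (gauss (c n *\<^sub>R x))) = (LINT \<eta>|lborel. (ee (x \<bullet> \<eta>) * m \<eta>) / P * (ee (- (x \<bullet> \<xi>)) * of_real (gauss (c n *\<^sub>R x))))"
        by (simp only: integral_mult_left_zero)
      moreover have "ee (- (x \<bullet> \<xi>)) * K x * of_real (gauss (c n *\<^sub>R x)) = K x * (ee (- (x \<bullet> \<xi>)) * of_real (gauss (c n *\<^sub>R x)))"
        by (simp only: mult_ac)
      ultimately show "ee (- (x \<bullet> \<xi>)) * K x * of_real (gauss (c n *\<^sub>R x)) = (LINT \<eta>|lborel. (ee (x \<bullet> \<eta>) * m \<eta>) / P * (ee (- (x \<bullet> \<xi>)) * of_real (gauss (c n *\<^sub>R x))))"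
        by (simp only:)
    qed
    also have "\<dots> = (LINT \<eta>|lborel. LINT x|lborel. (ee (x \<bullet> \<eta>) * m \<eta>) / P * (ee (- (x \<bullet> \<xi>)) * of_real (gauss (c n *\<^sub>R x))))"
    proof (rule lborel_Fubini[where f="\<lambda>x. gauss (c n *\<^sub>R x)" and g="\<lambda>\<eta>. norm (m \<eta>) / norm P" and u="\<lambda>x \<eta>. (ee (x \<bullet> \<eta>) * m \<eta>) / P * (ee (- (x \<bullet> \<xi>)) * of_real (gauss (c n *\<^sub>R x)))"])
      show "(\<lambda>(x, \<eta>). (ee (x \<bullet> \<eta>) * m \<eta>) / P * (ee (- (x \<bullet> \<xi>)) * of_real (gauss (c n *\<^sub>R x)))) \<in> borel_measurable (borel \<Otimes>\<^sub>M borel)"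
        by measurable
      show "integrable lborel (\<lambda>\<eta>. norm (m \<eta>) / norm P)"
        by (intro integrable_divide integrable_norm test_symbol_integrable m)
      show "norm ((ee (x \<bullet> \<eta>) * m \<eta>) / P * (ee (- (x \<bullet> \<xi>)) * of_real (gauss (c n *\<^sub>R x)))) \<le> gauss (c n *\<^sub>R x) * (norm (m \<eta>) / norm P)" for x \<eta>
        by (simp add: norm_mult norm_divide less_imp_le[OF gauss_pos] mult.commute)
    qed (rule ig)
    also have "\<dots> = (LINT \<eta>|lborel. m \<eta> / P * (LINT x|lborel. ee (- (x \<bullet> (\<xi> - \<eta>))) * of_real (gauss (c n *\<^sub>R x))))"
    proof -
      have "(ee (x \<bullet> \<eta>) * m \<eta>) / P * (ee (- (x \<bullet> \<xi>)) * of_real (gauss (c n *\<^sub>R x))) =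
          m \<eta> / P * (ee (- (x \<bullet> (\<xi> - \<eta>))) * of_real (gauss (c n *\<^sub>R x)))" for x \<eta>
      proof -
        have "ee (- (x \<bullet> (\<xi> - \<eta>))) = ee (x \<bullet> \<eta>) * ee (- (x \<bullet> \<xi>))"
          by (subst ee_mult[symmetric]) (simp add: inner_diff_right)
        then show ?thesis by simp
      qed
      then show ?thesis by (simp only: integral_mult_right_zero)
    qed
    also have "\<dots> = (LINT \<eta>|lborel. m \<eta> / P * of_real ((1 / c n) ^ CARD('n) * gauss ((1 / c n) *\<^sub>R (\<xi> - \<eta>)) / gauss (0::real^'n)))"
      unfolding inner ..
    also have "\<dots> = (LINT z|lborel. m (\<xi> - c n *\<^sub>R z) * of_real (gauss z)) / P / of_real (gauss (0::real^'n))"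
    proof -
      define G where "G = (\<lambda>\<eta>. m \<eta> / P * complex_of_real ((1 / c n) ^ CARD('n) * gauss ((1 / c n) *\<^sub>R (\<xi> - \<eta>)) / gauss (0::real^'n)))"
      have G: "\<bar>- c n\<bar> ^ CARD('n) *\<^sub>R G (\<xi> + (- c n) *\<^sub>R z) = m (\<xi> - c n *\<^sub>R z) * of_real (gauss z) / P / of_real (gauss (0::real^'n))" for z
      proof -
        have "(1 / c n) *\<^sub>R (\<xi> - (\<xi> + (- c n) *\<^sub>R z)) = z" using c0[of n] by simp
        moreover have "complex_of_real (c n) ^ CARD('n) * complex_of_real (1 / c n) ^ CARD('n) = 1"
          using c0[of n] by (simp add: power_mult_distrib[symmetric])
        ultimately show ?thesis
          using c0[of n] unfolding G_def by (simp add: scaleR_conv_of_real mult_ac)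
      qed
      have "(LINT x|lborel. G x) = (LINT x|lborel. \<bar>- c n\<bar> ^ CARD('n) *\<^sub>R G (\<xi> + (- c n) *\<^sub>R x))"
        using integral_lborel_affine[of "- c n" G \<xi>] c0[of n] by simp
      also have "\<dots> = (LINT z|lborel. m (\<xi> - c n *\<^sub>R z) * of_real (gauss z)) / P / of_real (gauss (0::real^'n))"
        unfolding G integral_divide_zero ..
      finally show ?thesis unfolding G_def .
    qed
    finally show ?thesis .
  qed
  have lim: "(\<lambda>n. LINT z|lborel. m (\<xi> - c n *\<^sub>R z) * of_real (gauss z)) \<longlonglongrightarrow> (LINT z|lborel. m \<xi> * of_real (gauss (z::real^'n)))"
  proof -
    obtain B where B: "\<And>x. norm (m x) \<le> B" using test_symbol_bounded[OF m] by blast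
    show ?thesis
    proof (rule integral_dominated_convergence[where w="\<lambda>x::real^'n. B * gauss x"])
      show "integrable lborel (\<lambda>x::real^'n. B * gauss x)" by (intro integrable_mult_right integrable_gauss)
      show "AE x in lborel. (\<lambda>n. m (\<xi> - c n *\<^sub>R x) * of_real (gauss x)) \<longlonglongrightarrow> m \<xi> * of_real (gauss x)"
      proof (rule AE_I2)
        fix x :: "real^'n"
        have "(\<lambda>n. \<xi> - c n *\<^sub>R x) \<longlonglongrightarrow> \<xi> - 0 *\<^sub>R x" by (intro tendsto_diff tendsto_scaleR tendsto_const c)
        then have "(\<lambda>n. m (\<xi> - c n *\<^sub>R x)) \<longlonglongrightarrow> m \<xi>"
          using test_symbol_continuous[OF m, of UNIV]
          by (intro isCont_tendsto_compose[of \<xi> m]) (auto simp: continuous_on_eq_continuous_at)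
        then show "(\<lambda>n. m (\<xi> - c n *\<^sub>R x) * of_real (gauss x)) \<longlonglongrightarrow> m \<xi> * of_real (gauss x)"
          by (rule tendsto_mult_right)
      qed
      show "AE x in lborel. norm (m (\<xi> - c n *\<^sub>R x) * of_real (gauss x)) \<le> B * gauss x" for n
      proof (rule AE_I2)
        fix x :: "real^'n"
        show "norm (m (\<xi> - c n *\<^sub>R x) * of_real (gauss x)) \<le> B * gauss x"
          using B[of "\<xi> - c n *\<^sub>R x"] less_imp_le[OF gauss_pos[of x]] by (simp add: norm_mult mult_right_mono)
      qed
      show "(\<lambda>z. m (\<xi> - c n *\<^sub>R z) * of_real (gauss z)) \<in> borel_measurable lborel" for n by measurable
      show "(\<lambda>z::real^'n. m \<xi> * of_real (gauss z)) \<in> borel_measurable lborel" by measurable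
    qed
  qed
  have eq: "(LINT z|lborel. m \<xi> * of_real (gauss (z::real^'n))) = m \<xi>"
  proof -
    have "(LINT z|lborel. complex_of_real (gauss (z::real^'n))) = 1"
    proof -
      have 1: "(LINT z|lborel. gauss (z::real^'n)) = 1" by (rule integral_gauss)
      show ?thesis by (simp only: integral_complex_of_real 1 of_real_1)
    qed
    then show ?thesis by (simp only: integral_mult_right_zero mult_1_right)
  qed
  have "(\<lambda>n. (LINT z|lborel. m (\<xi> - c n *\<^sub>R z) * of_real (gauss z)) / P / of_real (gauss (0::real^'n)))
      \<longlonglongrightarrow> m \<xi> / P / of_real (gauss (0::real^'n))"
    using P gauss_pos[of "0::real^'n"] lim[unfolded eq] by (intro tendsto_divide tendsto_const) auto
  then have "?A \<longlonglongrightarrow> m \<xi> / P / of_real (gauss (0::real^'n))"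
    by (simp only: A)
  with L1 have "fourier K \<xi> * of_real (gauss (0::real^'n)) = m \<xi> / P / of_real (gauss (0::real^'n))"
    by (rule LIMSEQ_unique)
  then have "fourier K \<xi> * of_real (gauss (0::real^'n)) * of_real (gauss (0::real^'n)) = m \<xi> / P"
    using gauss_pos[of "0::real^'n"] by (metis (no_types, lifting) nonzero_eq_divide_eq of_real_eq_0_iff less_irrefl)
  then have "fourier K \<xi> * of_real (gauss (0::real^'n) * gauss (0::real^'n)) = m \<xi> / P"
    by (simp only: of_real_mult mult.assoc)
  then have "fourier K \<xi> / P = m \<xi> / P"
    unfolding gauss_0 by (simp add: P_def)
  then show ?thesis using P by (simp add: K_def)
qed

section \<open>Convolution of tempered functions\<close>

definition conv :: "(real^'n \<Rightarrow> complex) \<Rightarrow> (real^'n \<Rightarrow> complex) \<Rightarrow> real^'n \<Rightarrow> complex"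
  where "conv k F x = (LINT y|lborel. k (x - y) * F y)"

text \<open>
  Peetre's inequality: the decay of a kernel around \<open>x\<close> is as good as decay around the origin,
  at the price of a polynomial factor in \<open>x\<close>.
\<close>

lemma peetre:
  fixes x y :: "'a::real_normed_vector"
  shows "1 / (1 + norm (x - y)) ^ N \<le> (1 + norm x) ^ N / (1 + norm y) ^ N"
proof -
  have "1 + norm y \<le> 1 + norm x + norm (x - y)" using norm_triangle_sub[of y x] by (simp add: norm_minus_commute)
  also have "\<dots> \<le> (1 + norm x) * (1 + norm (x - y))" by (simp add: algebra_simps)
  finally have "(1 + norm y) ^ N \<le> (1 + norm x) ^ N * (1 + norm (x - y)) ^ N"
    by (metis power_mono power_mult_distrib add_nonneg_nonneg norm_ge_zero zero_le_one)
  moreover have "(1 + norm y) ^ N > 0" "(1 + norm (x - y)) ^ N > 0"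
    by (intro zero_less_power add_pos_nonneg; simp)+
  ultimately show ?thesis by (simp add: divide_simps)
qed

text \<open>
  The weight is positive and continuous, so that measurability of the quotient is measurability
  of \<open>F\<close>.
\<close>

lemma tempered_measurable [measurable_dest]:
  assumes "tempered_fun F" shows "F \<in> borel_measurable borel"
proof -
  obtain N where "integrable lborel (\<lambda>x. F x / of_real ((1 + norm x) ^ N))"
    using assms by (auto simp: tempered_fun_def)
  then have m: "(\<lambda>x. F x / of_real ((1 + norm x) ^ N)) \<in> borel_measurable borel" by auto
  have "F = (\<lambda>x. F x / of_real ((1 + norm x) ^ N) * of_real ((1 + norm x) ^ N))"
  proof
    fix x :: "real^'a"
    have "1 + norm x > 0" by (simp add: add_pos_nonneg)
    then have "complex_of_real ((1 + norm x) ^ N) \<noteq> 0" by (simp del: of_real_add of_real_power)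
    then show "F x = F x / of_real ((1 + norm x) ^ N) * of_real ((1 + norm x) ^ N)" by simp
  qed
  also have "\<dots> \<in> borel_measurable borel" by (intro borel_measurable_times m) measurable
  finally show ?thesis .
qed

lemma tempered_iff:
  "tempered_fun F \<longleftrightarrow> F \<in> borel_measurable borel \<and> (\<exists>N::nat. integrable lborel (\<lambda>x. norm (F x) / (1 + norm x) ^ N))"
proof -
  have "integrable lborel (\<lambda>x. F x / of_real ((1 + norm x) ^ N)) \<longleftrightarrow> integrable lborel (\<lambda>x. norm (F x) / (1 + norm x) ^ N)"
    if [measurable]: "F \<in> borel_measurable borel" for N
  proof -
    have "norm (F x / of_real ((1 + norm x) ^ N)) = norm (F x) / (1 + norm x) ^ N" for x
      by (simp only: norm_divide norm_of_real) simp
    then show ?thesis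
      by (subst integrable_norm_iff[symmetric]) (auto simp del: of_real_power of_real_add)
  qed
  then show ?thesis using tempered_measurable unfolding tempered_fun_def by blast
qed

lemma tempered_weight:
  assumes "tempered_fun F"
  shows "\<exists>N. \<forall>M\<ge>N. integrable lborel (\<lambda>x. norm (F x) / (1 + norm x) ^ M)"
proof -
  obtain N where [measurable]: "F \<in> borel_measurable borel" and N: "integrable lborel (\<lambda>x. norm (F x) / (1 + norm x) ^ N)"
    using assms by (auto simp: tempered_iff)
  have "integrable lborel (\<lambda>x. norm (F x) / (1 + norm x) ^ M)" if "M \<ge> N" for M
    using N by (rule Bochner_Integration.integrable_bound)
      (use that in \<open>auto intro!: AE_I2 divide_left_mono power_increasing mult_pos_pos zero_less_power add_pos_nonneg\<close>)
  then show ?thesis by blast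
qed

lemma tempered_bound:
  assumes "tempered_fun F" and [measurable]: "G \<in> borel_measurable borel"
    and le: "\<And>x. norm (G x) \<le> C * (1 + norm x) ^ M * norm (F x)"
  shows "tempered_fun G"
proof -
  obtain N where [measurable]: "F \<in> borel_measurable borel" and N: "integrable lborel (\<lambda>x. norm (F x) / (1 + norm x) ^ N)"
    using assms by (auto simp: tempered_iff)
  have "integrable lborel (\<lambda>x. norm (G x) / (1 + norm x) ^ (M + N))"
  proof (rule Bochner_Integration.integrable_bound[OF integrable_mult_right[OF N, of C]])
    show "AE x in lborel. norm (norm (G x) / (1 + norm x) ^ (M + N)) \<le> norm (C * (norm (F x) / (1 + norm x) ^ N))"
    proof (intro AE_I2)
      fix x :: "real^'a"
      have p: "1 + norm x > 0" by (simp add: add_pos_nonneg)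
      have "norm (G x) / (1 + norm x) ^ (M + N) \<le> C * (1 + norm x) ^ M * norm (F x) / (1 + norm x) ^ (M + N)"
        using p by (intro divide_right_mono le) auto
      also have "\<dots> = C * (norm (F x) / (1 + norm x) ^ N)" using p by (simp add: power_add)
      also have "\<dots> \<le> norm (C * (norm (F x) / (1 + norm x) ^ N))" unfolding real_norm_def by (rule abs_ge_self)
      finally show "norm (norm (G x) / (1 + norm x) ^ (M + N)) \<le> norm (C * (norm (F x) / (1 + norm x) ^ N))"
        using p by simp
    qed
  qed measurable
  then show ?thesis by (auto simp: tempered_iff)
qed

lemma tempered_poly_growth:
  fixes G :: "real^'n \<Rightarrow> complex"
  assumes [measurable]: "G \<in> borel_measurable borel"
    and le: "\<And>x. norm (G x) \<le> C * (1 + norm x) ^ M"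
  shows "tempered_fun G"
proof (rule tempered_bound[where F="\<lambda>_. 1"])
  show "tempered_fun (\<lambda>_::real^'n. 1)"
    using integrable_inverse_weight[where 'n='n, OF order_refl] by (auto simp: tempered_iff)
qed (use le in auto)

lemma tempered_add:
  assumes "tempered_fun F" "tempered_fun G"
  shows "tempered_fun (\<lambda>x. F x + G x)"
proof -
  have [measurable]: "F \<in> borel_measurable borel" by (rule tempered_measurable[OF assms(1)])
  obtain N where N: "\<And>M. M \<ge> N \<Longrightarrow> integrable lborel (\<lambda>x. norm (F x) / (1 + norm x) ^ M)"
    using tempered_weight[OF assms(1)] by blast
  have [measurable]: "G \<in> borel_measurable borel" by (rule tempered_measurable[OF assms(2)])
  obtain N' where N': "\<And>M. M \<ge> N' \<Longrightarrow> integrable lborel (\<lambda>x. norm (G x) / (1 + norm x) ^ M)"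
    using tempered_weight[OF assms(2)] by blast
  have "integrable lborel (\<lambda>x. norm (F x) / (1 + norm x) ^ (N + N') + norm (G x) / (1 + norm x) ^ (N + N'))"
    by (intro Bochner_Integration.integrable_add N N') auto
  then have "integrable lborel (\<lambda>x. norm (F x + G x) / (1 + norm x) ^ (N + N'))"
    by (rule Bochner_Integration.integrable_bound)
      (auto simp: add_divide_distrib[symmetric] intro!: AE_I2 divide_right_mono norm_triangle_ineq)
  then show ?thesis by (auto simp: tempered_iff)
qed

lemma tempered_cmult:
  assumes "tempered_fun F"
  shows "tempered_fun (\<lambda>x. c * F x)"
  by (rule tempered_bound[OF assms, where C="norm c" and M=0])
    (use tempered_measurable[OF assms] in \<open>auto simp: norm_mult\<close>)

lemma tempered_diff:
  assumes "tempered_fun F" "tempered_fun G"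
  shows "tempered_fun (\<lambda>x. F x - G x)"
  using tempered_add[OF assms(1) tempered_cmult[OF assms(2), of "-1"]] by simp

lemma tempered_zero: "tempered_fun (\<lambda>_. 0)"
  using tempered_poly_growth[of "\<lambda>_. 0" 0 0] by simp

lemma tempered_sum: "(\<And>i. i \<in> I \<Longrightarrow> tempered_fun (F i)) \<Longrightarrow> tempered_fun (\<lambda>x. \<Sum>i\<in>I. F i x)"
  by (induction I rule: infinite_finite_induct) (auto intro: tempered_zero tempered_add)

lemma rapid_tempered: "rapid k \<Longrightarrow> tempered_fun k"
proof -
  assume k: "rapid k"
  obtain C where C: "\<And>x. norm (k x) \<le> C / (1 + norm x) ^ 0" using rapid_bound[OF k] by blast
  show ?thesis
    by (rule tempered_poly_growth[OF rapid_measurable[OF k], of C 0]) (use C in simp)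
qed

lemma rapid_reflect: "rapid k \<Longrightarrow> rapid (\<lambda>y. k (x - y))"
  unfolding rapid_def
proof (elim conjE, intro conjI allI)
  fix M assume [measurable]: "k \<in> borel_measurable borel" and "\<forall>M. \<exists>C. \<forall>x. norm (k x) \<le> C / (1 + norm x) ^ M"
  then obtain C where C: "\<And>x. norm (k x) \<le> C / (1 + norm x) ^ M" by blast
  have C0: "C \<ge> 0" using order_trans[OF norm_ge_zero C[of 0]] by simp
  have "norm (k (x - y)) \<le> (C * (1 + norm x) ^ M) / (1 + norm y) ^ M" for y
    using C[of "x - y"] mult_left_mono[OF peetre[of x y M] C0] by simp
  then show "\<exists>C. \<forall>y. norm (k (x - y)) \<le> C / (1 + norm y) ^ M" by blast
next
  assume [measurable]: "k \<in> borel_measurable borel"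
  show "(\<lambda>y. k (x - y)) \<in> borel_measurable borel" by measurable
qed

lemma rapid_shift: "rapid k \<Longrightarrow> rapid (\<lambda>y. k (y - x))"
  using rapid_reflect[OF rapid_reflect[of k 0], of x] by simp

lemma rapid_times_poly:
  fixes k :: "real^'n \<Rightarrow> complex"
  assumes "rapid k" and [measurable]: "G \<in> borel_measurable borel"
    and le: "\<And>x. norm (G x) \<le> C * (1 + norm x) ^ N"
  shows "rapid (\<lambda>x. k x * G x)"
  unfolding rapid_def
proof (intro conjI allI)
  have [measurable]: "k \<in> borel_measurable borel" using assms by (rule_tac rapid_measurable)
  show "(\<lambda>x. k x * G x) \<in> borel_measurable borel" by measurable
  fix M
  obtain D where D: "\<And>x. norm (k x) \<le> D / (1 + norm x) ^ (M + N)" using rapid_bound[OF assms(1)] by blast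
  have D0: "D \<ge> 0" using order_trans[OF norm_ge_zero D[of 0]] by simp
  have "norm (k x * G x) \<le> (D * C) / (1 + norm x) ^ M" for x
  proof -
    have p: "1 + norm x > 0" by (simp add: add_pos_nonneg)
    have "norm (k x * G x) \<le> D / (1 + norm x) ^ (M + N) * (C * (1 + norm x) ^ N)"
      unfolding norm_mult by (intro mult_mono D le) (use D0 p in auto)
    also have "\<dots> = (D * C) / (1 + norm x) ^ M" using p by (simp add: power_add)
    finally show ?thesis .
  qed
  then show "\<exists>C. \<forall>x. norm (k x * G x) \<le> C / (1 + norm x) ^ M" by blast
qed

lemma rapid_mult:
  assumes "rapid k" "rapid l" shows "rapid (\<lambda>x. k x * l x)"
proof -
  obtain C where C: "\<And>x. norm (l x) \<le> C / (1 + norm x) ^ 0" using rapid_bound[OF assms(2)] by blast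
  show ?thesis
    by (rule rapid_times_poly[OF assms(1) rapid_measurable[OF assms(2)], of C 0]) (use C in simp)
qed

lemma conv_integrable:
  fixes k F :: "real^'n \<Rightarrow> complex"
  assumes "rapid k" "tempered_fun F"
  shows "integrable lborel (\<lambda>y. k (x - y) * F y)"
proof -
  have [measurable]: "k \<in> borel_measurable borel" using assms by (rule_tac rapid_measurable)
  obtain N where [measurable]: "F \<in> borel_measurable borel" and N: "integrable lborel (\<lambda>x. norm (F x) / (1 + norm x) ^ N)"
    using assms(2) by (auto simp: tempered_iff)
  obtain D where D: "\<And>y. norm (k (x - y)) \<le> D / (1 + norm y) ^ N" using rapid_bound[OF rapid_reflect[OF assms(1)]] by blast
  have D0: "D \<ge> 0" using order_trans[OF norm_ge_zero D[of 0]] by simp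
  have "norm (k (x - y) * F y) \<le> D * (norm (F y) / (1 + norm y) ^ N)" for y
    using mult_right_mono[OF D[of y] norm_ge_zero[of "F y"]] by (simp add: norm_mult)
  then show ?thesis
    by (intro Bochner_Integration.integrable_bound[OF integrable_mult_right[OF N, of D]])
      (auto intro!: AE_I2 simp del: times_divide_eq_right simp: abs_mult D0)
qed

lemma tempered_times_rapid_integrable:
  assumes "tempered_fun G" "rapid \<psi>"
  shows "integrable lborel (\<lambda>x. G x * \<psi> x)"
  using conv_integrable[OF rapid_reflect[OF assms(2), of 0] assms(1), of 0] by (simp add: mult.commute)

lemma conv_measurable:
  assumes [measurable]: "k \<in> borel_measurable borel" "F \<in> borel_measurable borel"
  shows "conv k F \<in> borel_measurable borel"
  unfolding conv_def[abs_def] by measurable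

lemma conv_commute: "conv k F x = (LINT y|lborel. k y * F (x - y))"
  unfolding conv_def using integral_lborel_reflect[of "\<lambda>y. k (x - y) * F y" x] by simp

text \<open>
  The kernel is compared with the weight that makes \<open>F\<close> integrable, by Peetre's inequality.
\<close>

lemma conv_growth:
  fixes k F :: "real^'n \<Rightarrow> complex"
  assumes "rapid k" "tempered_fun F"
  shows "\<exists>C N. \<forall>x. norm (conv k F x) \<le> C * (1 + norm x) ^ N"
proof -
  obtain N where [measurable]: "F \<in> borel_measurable borel" and N: "integrable lborel (\<lambda>x. norm (F x) / (1 + norm x) ^ N)"
    using assms(2) by (auto simp: tempered_iff)
  obtain D where D: "\<And>y. norm (k y) \<le> D / (1 + norm y) ^ N" using rapid_bound[OF assms(1)] by blast
  have D0: "D \<ge> 0" using order_trans[OF norm_ge_zero D[of 0]] by simp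
  have "norm (conv k F x) \<le> D * (LINT y|lborel. norm (F y) / (1 + norm y) ^ N) * (1 + norm x) ^ N" for x
  proof -
    have le: "norm (k (x - y) * F y) \<le> D * (1 + norm x) ^ N * (norm (F y) / (1 + norm y) ^ N)" for y
    proof -
      have "norm (k (x - y)) \<le> D * (1 / (1 + norm (x - y)) ^ N)" using D[of "x - y"] by simp
      also have "\<dots> \<le> D * ((1 + norm x) ^ N / (1 + norm y) ^ N)" by (intro mult_left_mono peetre D0)
      finally show ?thesis using mult_right_mono[OF _ norm_ge_zero[of "F y"]] by (fastforce simp: norm_mult)
    qed
    have "norm (conv k F x) \<le> (LINT y|lborel. norm (k (x - y) * F y))" unfolding conv_def by (rule integral_norm_bound)
    also have "\<dots> \<le> (LINT y|lborel. D * (1 + norm x) ^ N * (norm (F y) / (1 + norm y) ^ N))"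
      by (intro integral_mono integrable_norm conv_integrable assms integrable_mult_right N le)
    also have "\<dots> = D * (1 + norm x) ^ N * (LINT y|lborel. norm (F y) / (1 + norm y) ^ N)"
      by (rule integral_mult_right_zero)
    finally show ?thesis by (simp add: mult_ac)
  qed
  then show ?thesis by blast
qed

lemma tempered_conv:
  assumes "rapid k" "tempered_fun F"
  shows "tempered_fun (conv k F)"
proof -
  obtain C N where "\<And>x. norm (conv k F x) \<le> C * (1 + norm x) ^ N" using conv_growth[OF assms] by blast
  moreover have "conv k F \<in> borel_measurable borel"
    by (intro conv_measurable rapid_measurable[OF assms(1)] tempered_measurable[OF assms(2)])
  ultimately show ?thesis by (rule_tac tempered_poly_growth[of _ C N])
qed

text \<open>
  Convolution is moved to the test function by Fubini; Peetre's inequality splits the integrand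
  into an integrable function of \<open>x\<close> times one of \<open>y\<close>.
\<close>

lemma integral_conv_times:
  fixes k F \<psi> :: "real^'n \<Rightarrow> complex"
  assumes "rapid k" "tempered_fun F" "rapid \<psi>"
  shows "(LINT x|lborel. conv k F x * \<psi> x) = (LINT y|lborel. F y * (LINT x|lborel. k (x - y) * \<psi> x))"
proof -
  have [measurable]: "k \<in> borel_measurable borel" "\<psi> \<in> borel_measurable borel" using assms by (auto dest: rapid_measurable)
  obtain N where [measurable]: "F \<in> borel_measurable borel" and N: "integrable lborel (\<lambda>x. norm (F x) / (1 + norm x) ^ N)"
    using assms(2) by (auto simp: tempered_iff)
  obtain D where D: "\<And>y. norm (k y) \<le> D / (1 + norm y) ^ N" using rapid_bound[OF assms(1)] by blast
  have D0: "D \<ge> 0" using order_trans[OF norm_ge_zero D[of 0]] by simp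
  have "(LINT x|lborel. conv k F x * \<psi> x) = (LINT x|lborel. LINT y|lborel. k (x - y) * F y * \<psi> x)"
    unfolding conv_def integral_mult_left_zero ..
  also have "\<dots> = (LINT y|lborel. LINT x|lborel. k (x - y) * F y * \<psi> x)"
  proof (rule lborel_Fubini[where u="\<lambda>x y. k (x - y) * F y * \<psi> x"])
    show "(\<lambda>(x, y). k (x - y) * F y * \<psi> x) \<in> borel_measurable (borel \<Otimes>\<^sub>M borel)" by measurable
    show "integrable lborel (\<lambda>x. (1 + norm x) ^ N * norm (\<psi> x))" by (rule rapid_weighted_integrable[OF assms(3)])
    show "integrable lborel (\<lambda>y. D * (norm (F y) / (1 + norm y) ^ N))" by (rule integrable_mult_right[OF N])
    show "norm (k (x - y) * F y * \<psi> x) \<le> ((1 + norm x) ^ N * norm (\<psi> x)) * (D * (norm (F y) / (1 + norm y) ^ N))" for x y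
    proof -
      have "norm (k (x - y)) \<le> D * (1 / (1 + norm (x - y)) ^ N)" using D[of "x - y"] by simp
      also have "\<dots> \<le> D * ((1 + norm x) ^ N / (1 + norm y) ^ N)" by (intro mult_left_mono peetre D0)
      finally have "norm (k (x - y)) * (norm (F y) * norm (\<psi> x)) \<le> D * ((1 + norm x) ^ N / (1 + norm y) ^ N) * (norm (F y) * norm (\<psi> x))"
        by (intro mult_right_mono) auto
      then show ?thesis by (simp add: norm_mult mult_ac)
    qed
  qed
  also have "\<dots> = (LINT y|lborel. F y * (LINT x|lborel. k (x - y) * \<psi> x))"
    unfolding integral_mult_right_zero[symmetric] by (simp only: mult_ac)
  finally show ?thesis .
qed

lemma fourier_ee: "fourier \<psi> \<xi> = (LINT x|lborel. ee (- (x \<bullet> \<xi>)) * \<psi> x)"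
  by (simp add: fourier_def)

lemma test_symbol_rapid: "test_symbol m \<Longrightarrow> rapid (inv_fourier m)"
  by (intro schwartz_rapid schwartz_inv_fourier)

lemma norm_ee_times [simp]: "norm (ee s * z) = norm z"
  by (simp add: norm_mult)

text \<open>
  The function that a multiplier produces out of a test function is the convolution of this
  test function with the reflected kernel.
\<close>

lemma fourier_times_inv_fourier:
  fixes m \<psi> :: "real^'n \<Rightarrow> complex"
  assumes m: "test_symbol m" and psi: "rapid \<psi>"
  shows "fourier (\<lambda>\<xi>. m \<xi> * inv_fourier \<psi> \<xi>) y = (LINT x|lborel. inv_fourier m (x - y) * \<psi> x)"
proof -
  define P where "P = complex_of_real ((2 * pi) ^ CARD('n))"
  have [measurable]: "m \<in> borel_measurable borel" "\<psi> \<in> borel_measurable borel"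
    by (rule test_symbol_measurable[OF m], rule rapid_measurable[OF psi])
  define u where "u = (\<lambda>\<xi> x. ee (- (\<xi> \<bullet> y)) * m \<xi> / P * (ee (\<xi> \<bullet> x) * \<psi> x))"
  have 1: "ee (- (\<xi> \<bullet> y)) * (m \<xi> * inv_fourier \<psi> \<xi>) = (LINT x|lborel. u \<xi> x)" for \<xi>
  proof -
    define I where "I = (LINT x|lborel. ee (\<xi> \<bullet> x) * \<psi> x)"
    have "inv_fourier \<psi> \<xi> = I / P" unfolding inv_fourier_def I_def P_def ..
    moreover have "(LINT x|lborel. u \<xi> x) = ee (- (\<xi> \<bullet> y)) * m \<xi> / P * I"
      unfolding u_def I_def by (rule integral_mult_right_zero)
    ultimately show ?thesis by simp
  qed
  have 2: "(LINT \<xi>|lborel. u \<xi> x) = inv_fourier m (x - y) * \<psi> x" for x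
  proof -
    have eq: "u \<xi> x = ee ((x - y) \<bullet> \<xi>) * m \<xi> / P * \<psi> x" for \<xi>
    proof -
      have "ee ((x - y) \<bullet> \<xi>) = ee (- (\<xi> \<bullet> y)) * ee (\<xi> \<bullet> x)"
      proof -
        have "(x - y) \<bullet> \<xi> = - (\<xi> \<bullet> y) + \<xi> \<bullet> x" by (simp add: inner_diff_left inner_diff_right inner_commute)
        then show ?thesis by (simp only: ee_mult)
      qed
      then show ?thesis by (simp add: u_def)
    qed
    show ?thesis unfolding eq inv_fourier_def P_def
      by (simp only: integral_mult_left_zero integral_divide_zero)
  qed
  have "(LINT \<xi>|lborel. LINT x|lborel. u \<xi> x) = (LINT x|lborel. LINT \<xi>|lborel. u \<xi> x)"
  proof (rule lborel_Fubini[where u=u and f="\<lambda>\<xi>. norm (m \<xi>) / norm P" and g="\<lambda>x. norm (\<psi> x)"])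
    show "(\<lambda>(x, y). u x y) \<in> borel_measurable (borel \<Otimes>\<^sub>M borel)" unfolding u_def by measurable
    show "integrable lborel (\<lambda>\<xi>. norm (m \<xi>) / norm P)"
      by (intro integrable_divide integrable_norm test_symbol_integrable m)
    show "integrable lborel (\<lambda>x. norm (\<psi> x))"
      by (intro integrable_norm rapid_integrable psi)
    show "norm (u \<xi> x) \<le> norm (m \<xi>) / norm P * norm (\<psi> x)" for \<xi> x
      unfolding u_def norm_mult norm_divide norm_ee by simp
  qed
  then show ?thesis unfolding fourier_ee 1 2 .
qed

lemma
  assumes "\<And>x. f differentiable (at x)"
  shows pd_shift: "pd j (\<lambda>x. f (x - y)) x = pd j f (x - y)"
    and differentiable_shift: "(\<lambda>x. f (x - y)) differentiable (at x)"
    and pd_reflect: "pd j (\<lambda>x. f (y - x)) x = - pd j f (y - x)"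
    and differentiable_reflect: "(\<lambda>x. f (y - x)) differentiable (at x)"
  using pd_affine[of f 1 x "- y" j] differentiable_affine[of f 1 "-y" x]
    pd_affine[of f "-1" x y j] differentiable_affine[of f "-1" y x] assms
  by simp_all

lemma schwartz_reflect:
  fixes k :: "real^'n \<Rightarrow> complex"
  assumes "schwartz k"
  shows "schwartz (\<lambda>y. k (x - y))"
proof (rule schwartz_coinduct[where P="\<lambda>g. \<exists>f c. schwartz f \<and> g = (\<lambda>y. c * f (x - y))"])
  show "\<exists>f c. schwartz f \<and> (\<lambda>y. k (x - y)) = (\<lambda>y. c * f (x - y))"
    using assms by (intro exI[of _ k] exI[of _ 1]) simp
next
  fix g z assume "\<exists>f c. schwartz f \<and> g = (\<lambda>y. c * f (x - y))"
  then obtain f c where f: "schwartz f" "g = (\<lambda>y. c * f (x - y))" by blast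
  show "g differentiable (at z)" unfolding f
    by (intro differentiable_mult differentiable_const differentiable_reflect smooth_differentiable schwartz_smooth f)
next
  fix g j assume "\<exists>f c. schwartz f \<and> g = (\<lambda>y. c * f (x - y))"
  then obtain f c where f: "schwartz f" "g = (\<lambda>y. c * f (x - y))" by blast
  have fd: "f differentiable (at x)" for x by (intro smooth_differentiable schwartz_smooth f)
  have "pd j g = (\<lambda>y. (- c) * pd j f (x - y))"
    unfolding f(2) by (rule ext) (simp add: pd_cmult[OF differentiable_reflect[OF fd]] pd_reflect[OF fd])
  then show "\<exists>f c. schwartz f \<and> pd j g = (\<lambda>y. c * f (x - y))" using schwartz_pd[OF f(1)] by blast
next
  fix g k assume "\<exists>f c. schwartz f \<and> g = (\<lambda>y. c * f (x - y))"
  then obtain f c where f: "schwartz f" "g = (\<lambda>y. c * f (x - y))" by blast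
  obtain C where C: "\<forall>y. norm (f (x - y)) \<le> C / (1 + norm y) ^ k"
    using rapid_bound[OF rapid_reflect[OF schwartz_rapid[OF f(1)]]] by blast
  then have C0: "C \<ge> 0" by (rule rapid_bound_nonneg)
  have "norm y ^ k * norm (g y) \<le> norm c * C" for y
  proof -
    have "(1 + norm y) ^ k > 0" by (intro zero_less_power add_pos_nonneg) auto
    then have "(1 + norm y) ^ k * norm (f (x - y)) \<le> C"
      using C[rule_format, of y] by (simp add: pos_le_divide_eq mult.commute)
    moreover have "norm y ^ k * norm (f (x - y)) \<le> (1 + norm y) ^ k * norm (f (x - y))"
      by (intro mult_right_mono power_mono) auto
    ultimately have "norm y ^ k * norm (f (x - y)) \<le> C" by (rule order_trans[rotated])
    then have "norm c * (norm y ^ k * norm (f (x - y))) \<le> norm c * C" by (intro mult_left_mono) auto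
    then show ?thesis unfolding f(2) norm_mult by (simp only: mult_ac)
  qed
  then show "bounded (range (\<lambda>y. norm y ^ k * norm (g y)))" unfolding bounded_iff by auto
qed

lemma schwartz_bounded: "schwartz \<psi> \<Longrightarrow> \<exists>B. \<forall>x. norm (\<psi> x) \<le> B"
  using rapid_bound[OF schwartz_rapid, of \<psi> 0] by simp

text \<open>
  Here the smoothness is that of the function, in \<open>pd_conv\<close> below it is that of the kernel.
\<close>

lemma
  fixes k \<psi> :: "real^'n \<Rightarrow> complex"
  assumes k: "rapid k" and psi: "schwartz \<psi>"
  shows conv_schwartz_differentiable: "conv k \<psi> differentiable (at x)"
    and pd_conv_schwartz: "pd j (conv k \<psi>) x = conv k (pd j \<psi>) x"
proof -
  have pdd: "\<psi> differentiable (at x)" for x by (intro smooth_differentiable schwartz_smooth psi)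
  have [measurable]: "k \<in> borel_measurable borel" "pd j \<psi> \<in> borel_measurable borel" for j
    by (rule rapid_measurable[OF k], rule rapid_measurable[OF schwartz_rapid[OF schwartz_pd[OF psi]]])
  define u where "u = (\<lambda>x y. k y * \<psi> (x - y))"
  have eq: "conv k \<psi> = (\<lambda>x. LINT y|lborel. u x y)"
    unfolding u_def by (rule ext) (rule conv_commute)
  have pdu: "pd j (\<lambda>x. u x y) x = k y * pd j \<psi> (x - y)" for j x y
    unfolding u_def by (simp add: pd_cmult[OF differentiable_shift[OF pdd]] pd_shift[OF pdd])
  have "\<exists>B. \<forall>j x. norm (pd j \<psi> x) \<le> B"
  proof -
    obtain B where B: "\<And>j x. norm (pd j \<psi> x) \<le> B j" using schwartz_bounded[OF schwartz_pd[OF psi]] by metis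
    then have "norm (pd j \<psi> x) \<le> (\<Sum>j\<in>UNIV. B j)" for j x
      using member_le_sum[of j UNIV B] order_trans[OF norm_ge_zero B] order_trans[OF B] by simp
    then show ?thesis by blast
  qed
  then obtain B where B: "\<And>j x. norm (pd j \<psi> x) \<le> B" by blast
  have 1: "(\<lambda>x. u x y) differentiable (at x)" for x y
    unfolding u_def by (intro differentiable_mult differentiable_const differentiable_shift pdd)
  have 2: "integrable lborel (u x)" for x
  proof -
    have "integrable lborel (\<lambda>y. \<psi> (x - y) * k y)"
      by (intro conv_integrable schwartz_rapid psi rapid_tempered k)
    then show ?thesis unfolding u_def by (simp only: mult.commute)
  qed
  have 3: "(\<lambda>y. pd j (\<lambda>x. u x y) x) \<in> borel_measurable lborel" for j x unfolding pdu by measurable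
  have 4: "integrable lborel (\<lambda>y. norm (k y) * B)"
    by (intro integrable_mult_left integrable_norm rapid_integrable k)
  have 5: "norm (pd j (\<lambda>x. u x y) x) \<le> norm (k y) * B" for j x y
    unfolding pdu norm_mult by (intro mult_left_mono B) auto
  show "conv k \<psi> differentiable (at x)"
    unfolding eq by (rule pd_integral(1)[OF 1 2 3 4]) (rule 5)
  show "pd j (conv k \<psi>) x = conv k (pd j \<psi>) x"
  proof -
    have "pd j (\<lambda>x. LINT y|lborel. u x y) x = (LINT y|lborel. pd j (\<lambda>x. u x y) x)"
      by (rule pd_integral(2)[OF 1 2 3 4]) (rule 5)
    then show ?thesis unfolding eq[symmetric] pdu conv_commute[of k "pd j \<psi>"] .
  qed
qed

text \<open>
  Convolution with a decaying kernel preserves the class of Schwartz functions because it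
  commutes with derivatives, and decay is preserved by Peetre's inequality.
\<close>

lemma schwartz_conv:
  fixes k \<psi> :: "real^'n \<Rightarrow> complex"
  assumes k: "rapid k" and psi: "schwartz \<psi>"
  shows "schwartz (conv k \<psi>)"
proof (rule schwartz_coinduct[where P="\<lambda>g. \<exists>f. schwartz f \<and> g = conv k f"])
  show "\<exists>f. schwartz f \<and> conv k \<psi> = conv k f" using psi by blast
next
  fix g z assume "\<exists>f. schwartz f \<and> g = conv k f"
  then show "g differentiable (at z)" using conv_schwartz_differentiable[OF k] by blast
next
  fix g j assume "\<exists>f. schwartz f \<and> g = conv k f"
  then obtain f where f: "schwartz f" "g = conv k f" by blast
  have "pd j g = conv k (pd j f)" unfolding f(2) by (rule ext) (rule pd_conv_schwartz[OF k f(1)])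
  then show "\<exists>f. schwartz f \<and> pd j g = conv k f" using schwartz_pd[OF f(1)] by blast
next
  fix g N assume "\<exists>f. schwartz f \<and> g = conv k f"
  then obtain f where f: "schwartz f" "g = conv k f" by blast
  obtain C where C: "\<forall>x. norm (f x) \<le> C / (1 + norm x) ^ N"
    using rapid_bound[OF schwartz_rapid[OF f(1)]] by blast
  then have C0: "C \<ge> 0" by (rule rapid_bound_nonneg)
  define J where "J = (LINT y|lborel. C * ((1 + norm y) ^ N * norm (k y)))"
  have iJ: "integrable lborel (\<lambda>y. C * ((1 + norm y) ^ N * norm (k y)))"
    by (intro integrable_mult_right rapid_weighted_integrable k)
  have "norm x ^ N * norm (g x) \<le> J" for x
  proof -
    have p: "(1 + norm x) ^ N > 0" by (intro zero_less_power add_pos_nonneg) auto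
    have le: "norm (k y * f (x - y)) \<le> 1 / (1 + norm x) ^ N * (C * ((1 + norm y) ^ N * norm (k y)))" for y
    proof -
      have "norm (f (x - y)) \<le> C * (1 / (1 + norm (y - x)) ^ N)"
        using C[rule_format, of "x - y"] by (simp add: norm_minus_commute)
      also have "\<dots> \<le> C * ((1 + norm y) ^ N / (1 + norm x) ^ N)"
        by (intro mult_left_mono peetre C0)
      finally have "norm (k y) * norm (f (x - y)) \<le> norm (k y) * (C * ((1 + norm y) ^ N / (1 + norm x) ^ N))"
        by (intro mult_left_mono) auto
      then show ?thesis by (simp add: norm_mult mult_ac)
    qed
    have i: "integrable lborel (\<lambda>y. k y * f (x - y))"
    proof -
      have "integrable lborel (\<lambda>y. f (x - y) * k y)"
        by (intro conv_integrable schwartz_rapid f rapid_tempered k)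
      then show ?thesis by (simp only: mult.commute)
    qed
    have "norm (g x) \<le> (LINT y|lborel. norm (k y * f (x - y)))"
      unfolding f(2) conv_commute by (rule integral_norm_bound)
    also have "\<dots> \<le> (LINT y|lborel. 1 / (1 + norm x) ^ N * (C * ((1 + norm y) ^ N * norm (k y))))"
      by (intro integral_mono integrable_norm i integrable_mult_right[OF iJ] le)
    also have "\<dots> = 1 / (1 + norm x) ^ N * J" unfolding J_def by (rule integral_mult_right_zero)
    finally have "(1 + norm x) ^ N * norm (g x) \<le> J" using p by (simp add: field_simps)
    moreover have "norm x ^ N * norm (g x) \<le> (1 + norm x) ^ N * norm (g x)"
      by (intro mult_right_mono power_mono) auto
    ultimately show ?thesis by linarith
  qed
  then show "bounded (range (\<lambda>x. norm x ^ N * norm (g x)))" unfolding bounded_iff by auto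
qed

text \<open>
  Locally uniform domination: for \<open>x\<close> within distance \<open>1\<close> of \<open>x0\<close>, the derivative of the kernel
  is bounded, up to a constant, by \<open>(2 + \<bar>x0\<bar>)\<^sup>N\<close> times the weight that makes
  \<open>F\<close> integrable.
\<close>

lemma
  fixes k F :: "real^'n \<Rightarrow> complex"
  assumes k: "schwartz k" and F: "tempered_fun F"
  shows conv_differentiable: "conv k F differentiable (at x)"
    and pd_conv: "pd j (conv k F) x = conv (pd j k) F x"
proof -
  have kd: "k differentiable (at x)" for x by (intro smooth_differentiable schwartz_smooth k)
  obtain N where [measurable]: "F \<in> borel_measurable borel" and N: "integrable lborel (\<lambda>x. norm (F x) / (1 + norm x) ^ N)"
    using F by (auto simp: tempered_iff)
  have [measurable]: "pd j k \<in> borel_measurable borel" for j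
    by (rule rapid_measurable[OF schwartz_rapid[OF schwartz_pd[OF k]]])
  define u where "u = (\<lambda>x y. k (x - y) * F y)"
  have eq: "conv k F = (\<lambda>x. LINT y|lborel. u x y)"
    unfolding u_def by (rule ext) (rule conv_def)
  have pdu: "pd j (\<lambda>x. u x y) x = pd j k (x - y) * F y" for j x y
    unfolding u_def by (simp add: pd_mult_const[OF differentiable_shift[OF kd]] pd_shift[OF kd])
  have "\<exists>B. \<forall>j x. norm (pd j k x) \<le> B / (1 + norm x) ^ N"
  proof -
    have "\<forall>j. \<exists>B. \<forall>x. norm (pd j k x) \<le> B / (1 + norm x) ^ N"
      using rapid_bound[OF schwartz_rapid[OF schwartz_pd[OF k]]] by blast
    then obtain B where B: "\<And>j. \<forall>x. norm (pd j k x) \<le> B j / (1 + norm x) ^ N" by metis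
    have B0: "B j \<ge> 0" for j using B[of j] by (rule rapid_bound_nonneg)
    have "norm (pd j k x) \<le> (\<Sum>j\<in>UNIV. B j) / (1 + norm x) ^ N" for j x
      by (rule order_trans[OF B[rule_format]], rule divide_right_mono, rule member_le_sum) (auto simp: B0)
    then show ?thesis by blast
  qed
  then obtain B where B: "\<And>j. \<forall>x. norm (pd j k x) \<le> B / (1 + norm x) ^ N" by blast
  then have B0: "B \<ge> 0" using rapid_bound_nonneg by blast
  have 1: "(\<lambda>x. u x y) differentiable (at x)" for x y
    unfolding u_def by (intro differentiable_mult differentiable_const differentiable_shift kd)
  have 2: "integrable lborel (u x)" for x
    unfolding u_def by (intro conv_integrable schwartz_rapid k F)
  have 3: "(\<lambda>y. pd j (\<lambda>x. u x y) x) \<in> borel_measurable lborel" for j x unfolding pdu by measurable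
  have 4: "integrable lborel (\<lambda>y. (B * (2 + norm x) ^ N) * (norm (F y) / (1 + norm y) ^ N))" for x
    by (intro integrable_mult_right N)
  have 5: "norm (pd j (\<lambda>x. u x y) x) \<le> (B * (2 + norm x0) ^ N) * (norm (F y) / (1 + norm y) ^ N)"
    if "dist x0 x < 1" for j x y x0
  proof -
    have "norm x \<le> norm x0 + 1" using that norm_triangle_sub[of x x0] by (simp add: dist_norm norm_minus_commute)
    have "norm (pd j k (x - y)) \<le> B * (1 / (1 + norm (x - y)) ^ N)" using B by simp
    also have "\<dots> \<le> B * ((1 + norm x) ^ N / (1 + norm y) ^ N)" by (intro mult_left_mono peetre B0)
    also have "\<dots> \<le> B * ((2 + norm x0) ^ N / (1 + norm y) ^ N)"
      using \<open>norm x \<le> norm x0 + 1\<close> by (intro mult_left_mono divide_right_mono power_mono B0) auto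
    finally have "norm (pd j k (x - y)) * norm (F y) \<le> B * ((2 + norm x0) ^ N / (1 + norm y) ^ N) * norm (F y)"
      by (intro mult_right_mono) auto
    then show ?thesis unfolding pdu norm_mult by simp
  qed
  show "conv k F differentiable (at x)"
    unfolding eq by (rule pd_integral(1)[OF 1 2 3 4]) (rule 5)
  show "pd j (conv k F) x = conv (pd j k) F x"
  proof -
    have "pd j (\<lambda>x. LINT y|lborel. u x y) x = (LINT y|lborel. pd j (\<lambda>x. u x y) x)"
      by (rule pd_integral(2)[OF 1 2 3 4]) (rule 5)
    then show ?thesis unfolding eq[symmetric] pdu conv_def[of "pd j k"] .
  qed
qed

section \<open>Fourier multipliers as convolutions\<close>

lemma integral_eq_conv_reflect: "(LINT x|lborel. K (x - y) * \<psi> x) = conv (\<lambda>z. K (- z)) \<psi> y"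
  unfolding conv_def by simp

lemma rapid_uminus: "rapid K \<Longrightarrow> rapid (\<lambda>z. K (- z))"
  using rapid_reflect[of K 0] by simp

lemma fourier_multiplier_eq:
  fixes m :: "real^'n \<Rightarrow> real"
  assumes m: "test_symbol (\<lambda>\<xi>. complex_of_real (m \<xi>))" and psi: "rapid \<psi>"
  shows "fourier_multiplier m u \<psi> = u (conv (\<lambda>z. inv_fourier (\<lambda>\<xi>. complex_of_real (m \<xi>)) (- z)) \<psi>)"
proof -
  have "fourier (\<lambda>\<xi>. of_real (m \<xi>) * inv_fourier \<psi> \<xi>) =
      conv (\<lambda>z. inv_fourier (\<lambda>\<xi>. complex_of_real (m \<xi>)) (- z)) \<psi>"
    by (rule ext) (simp only: fourier_times_inv_fourier[OF m psi] integral_eq_conv_reflect)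
  then show ?thesis
    unfolding fourier_multiplier_def dist_inv_fourier_def dist_times_def dist_fourier_def by simp
qed

lemma represents_fourier_multiplier:
  fixes m :: "real^'n \<Rightarrow> real"
  assumes m: "test_symbol (\<lambda>\<xi>. complex_of_real (m \<xi>))" and H: "represents H u"
  shows "represents (conv (inv_fourier (\<lambda>\<xi>. complex_of_real (m \<xi>))) H) (fourier_multiplier m u)"
proof -
  let ?K = "inv_fourier (\<lambda>\<xi>. complex_of_real (m \<xi>))"
  have K: "rapid ?K" by (rule test_symbol_rapid[OF m])
  have tH: "tempered_fun H" using H by (simp add: represents_def)
  have "fourier_multiplier m u \<psi> = dist_of (conv ?K H) \<psi>" if psi: "schwartz \<psi>" for \<psi>
  proof -
    have "fourier_multiplier m u \<psi> = u (conv (\<lambda>z. ?K (- z)) \<psi>)"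
      by (rule fourier_multiplier_eq[OF m schwartz_rapid[OF psi]])
    also have "\<dots> = dist_of H (conv (\<lambda>z. ?K (- z)) \<psi>)"
      using H schwartz_conv[OF rapid_uminus[OF K] psi] by (simp add: represents_def)
    also have "\<dots> = dist_of (conv ?K H) \<psi>"
      unfolding dist_of_def integral_eq_conv_reflect[symmetric]
      by (rule integral_conv_times[OF K tH schwartz_rapid[OF psi], symmetric])
    finally show ?thesis .
  qed
  then show ?thesis using tempered_conv[OF K tH] by (simp add: represents_def)
qed

lemma represents_dist_of: "tempered_fun F \<Longrightarrow> represents F (dist_of F)"
  by (simp add: represents_def)

text \<open>
  Both the multiplier and the derivative move to the test function, where they combine into
  convolution with the reflected derivative of the kernel.
\<close>

lemma represents_fourier_multiplier_dpartial:
  fixes m :: "real^'n \<Rightarrow> real"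
  assumes m: "test_symbol (\<lambda>\<xi>. complex_of_real (m \<xi>))" and F: "tempered_fun F"
  shows "represents (conv (pd j (inv_fourier (\<lambda>\<xi>. complex_of_real (m \<xi>)))) F)
    (fourier_multiplier m (dpartial j (dist_of F)))"
proof -
  let ?K = "inv_fourier (\<lambda>\<xi>. complex_of_real (m \<xi>))"
  have K: "schwartz ?K" by (rule schwartz_inv_fourier[OF m])
  have Kd: "?K differentiable (at x)" for x by (intro smooth_differentiable schwartz_smooth K)
  have rdK: "rapid (pd j ?K)" by (intro schwartz_rapid schwartz_pd K)
  have K': "schwartz (\<lambda>z. ?K (- z))" using schwartz_reflect[OF K, of 0] by simp
  have pdK': "pd j (\<lambda>z. ?K (- z)) = (\<lambda>z. - pd j ?K (- z))"
    by (rule ext) (use pd_reflect[OF Kd, of j 0] in simp)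
  have "fourier_multiplier m (dpartial j (dist_of F)) \<psi> = dist_of (conv (pd j ?K) F) \<psi>" if psi: "schwartz \<psi>" for \<psi>
  proof -
    have pdc: "pd j (conv (\<lambda>z. ?K (- z)) \<psi>) y = - (LINT x|lborel. pd j ?K (x - y) * \<psi> x)" for y
    proof -
      have "pd j (conv (\<lambda>z. ?K (- z)) \<psi>) y = conv (\<lambda>z. - pd j ?K (- z)) \<psi> y"
        by (simp only: pd_conv[OF K' rapid_tempered[OF schwartz_rapid[OF psi]]] pdK')
      also have "\<dots> = - (LINT x|lborel. pd j ?K (x - y) * \<psi> x)"
        unfolding conv_def by (simp only: mult_minus_left integral_minus minus_diff_eq)
      finally show ?thesis .
    qed
    have "fourier_multiplier m (dpartial j (dist_of F)) \<psi> = dpartial j (dist_of F) (conv (\<lambda>z. ?K (- z)) \<psi>)"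
      by (rule fourier_multiplier_eq[OF m schwartz_rapid[OF psi]])
    also have "\<dots> = - (LINT y|lborel. F y * - (LINT x|lborel. pd j ?K (x - y) * \<psi> x))"
      unfolding dpartial_def dist_of_def pdc ..
    also have "\<dots> = (LINT y|lborel. F y * (LINT x|lborel. pd j ?K (x - y) * \<psi> x))"
      by (simp only: mult_minus_right integral_minus minus_minus)
    also have "\<dots> = dist_of (conv (pd j ?K) F) \<psi>"
      unfolding dist_of_def
      by (rule integral_conv_times[OF rdK F schwartz_rapid[OF psi], symmetric])
    finally show ?thesis .
  qed
  then show ?thesis using tempered_conv[OF rdK F] by (simp add: represents_def)
qed

text \<open>The function \<open>y \<mapsto> K (x - y)\<close> is an admissible test function.\<close>

lemma conv_represents_dpartial:
  assumes K: "schwartz K" and H: "represents H (dpartial j (dist_of F))"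
  shows "conv K H x = conv (pd j K) F x"
proof -
  have Kd: "K differentiable (at x)" for x by (intro smooth_differentiable schwartz_smooth K)
  have "dpartial j (dist_of F) (\<lambda>y. K (x - y)) = dist_of H (\<lambda>y. K (x - y))"
    using H schwartz_reflect[OF K] by (simp add: represents_def)
  moreover have "dist_of H (\<lambda>y. K (x - y)) = conv K H x"
    unfolding dist_of_def conv_def by (simp only: mult.commute)
  moreover have "dpartial j (dist_of F) (\<lambda>y. K (x - y)) = conv (pd j K) F x"
    unfolding dpartial_def dist_of_def conv_def pd_reflect[OF Kd]
    by (simp only: mult_minus_right integral_minus minus_minus mult.commute)
  ultimately show ?thesis by simp
qed

section \<open>Approximate identities and uniqueness of representing functions\<close>

lemma inv_fourier_dilate:
  fixes m :: "real^'n \<Rightarrow> complex"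
  assumes c: "c > 0"
  shows "inv_fourier (\<lambda>\<xi>. m (c *\<^sub>R \<xi>)) x = of_real ((1 / c) ^ CARD('n)) * inv_fourier m ((1 / c) *\<^sub>R x)"
proof -
  define g where "g = (\<lambda>\<xi>. ee (x \<bullet> \<xi>) * m (c *\<^sub>R \<xi>))"
  have g: "g (0 + (1 / c) *\<^sub>R \<eta>) = ee (((1 / c) *\<^sub>R x) \<bullet> \<eta>) * m \<eta>" for \<eta>
    using c by (simp add: g_def)
  have "(LINT \<xi>|lborel. g \<xi>) = (\<bar>1 / c\<bar> ^ CARD('n)) *\<^sub>R (LINT \<eta>|lborel. g (0 + (1 / c) *\<^sub>R \<eta>))"
    using integral_lborel_affine[of "1 / c" g 0] c by simp
  also have "\<dots> = of_real ((1 / c) ^ CARD('n)) * (LINT \<eta>|lborel. ee (((1 / c) *\<^sub>R x) \<bullet> \<eta>) * m \<eta>)"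
    unfolding g using c by (simp add: scaleR_conv_of_real)
  finally have eq: "(LINT \<xi>|lborel. g \<xi>) = of_real ((1 / c) ^ CARD('n)) * (LINT \<eta>|lborel. ee (((1 / c) *\<^sub>R x) \<bullet> \<eta>) * m \<eta>)" .
  show ?thesis unfolding inv_fourier_def g_def[symmetric] eq times_divide_eq_right ..
qed

lemma integral_inv_fourier:
  assumes "test_symbol m"
  shows "(LINT x|lborel. inv_fourier m x) = m 0"
  using fourier_inv_fourier[OF assms, of 0] by (simp add: fourier_ee)

text \<open>Dilating the symbol concentrates the kernel, here seen on the test function.\<close>

lemma conv_dilate_dual:
  fixes m :: "real^'n \<Rightarrow> complex"
  assumes c: "c > 0"
  shows "(LINT x|lborel. inv_fourier (\<lambda>\<xi>. m (c *\<^sub>R \<xi>)) (x - y) * \<psi> x) = (LINT z|lborel. inv_fourier m z * \<psi> (y + c *\<^sub>R z))"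
proof -
  define h where "h = (\<lambda>x. inv_fourier (\<lambda>\<xi>. m (c *\<^sub>R \<xi>)) (x - y) * \<psi> x)"
  have h: "(\<bar>c\<bar> ^ CARD('n)) *\<^sub>R h (y + c *\<^sub>R z) = inv_fourier m z * \<psi> (y + c *\<^sub>R z)" for z
    using c unfolding h_def inv_fourier_dilate[OF c]
    by (simp add: scaleR_conv_of_real[where 'a=complex] power_one_over)
  have "(LINT x|lborel. h x) = (LINT z|lborel. (\<bar>c\<bar> ^ CARD('n)) *\<^sub>R h (y + c *\<^sub>R z))"
    using integral_lborel_affine[of c h y] c by simp
  then show ?thesis unfolding h unfolding h_def .
qed

text \<open>
  After the convolution is moved to \<open>\<psi>\<close>, the kernel of integral \<open>m 0 = 1\<close> averages
  \<open>\<psi>\<close> at the scale \<open>c n\<close>. This needs only continuity of \<open>\<psi>\<close>, and domination by the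
  weight of \<open>F\<close> only its decay; in this generality the limit decides whether two functions
  agree almost everywhere.
\<close>

theorem conv_approximate_identity:
  fixes m F \<psi> :: "real^'n \<Rightarrow> complex"
  assumes m: "test_symbol m" and m0: "m 0 = 1"
    and F: "tempered_fun F" and psi: "rapid \<psi>" "continuous_on UNIV \<psi>"
    and c: "c \<longlonglongrightarrow> 0" "\<And>n::nat. c n > 0" "\<And>n. c n \<le> 1"
  shows "(\<lambda>n. LINT x|lborel. conv (inv_fourier (\<lambda>\<xi>. m (c n *\<^sub>R \<xi>))) F x * \<psi> x) \<longlonglongrightarrow> (LINT x|lborel. F x * \<psi> x)"
proof -
  define \<theta> where "\<theta> = inv_fourier m"
  have th: "rapid \<theta>" unfolding \<theta>_def by (rule test_symbol_rapid[OF m])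
  have [measurable]: "\<theta> \<in> borel_measurable borel" "\<psi> \<in> borel_measurable borel"
    by (rule rapid_measurable[OF th], rule rapid_measurable[OF psi(1)])
  obtain N where [measurable]: "F \<in> borel_measurable borel" and N: "integrable lborel (\<lambda>x. norm (F x) / (1 + norm x) ^ N)"
    using F by (auto simp: tempered_iff)
  obtain C where C: "\<forall>x. norm (\<psi> x) \<le> C / (1 + norm x) ^ N"
    using rapid_bound[OF psi(1)] by blast
  then have C0: "C \<ge> 0" by (rule rapid_bound_nonneg)
  obtain B where B: "\<forall>x. norm (\<psi> x) \<le> B" using rapid_bound[OF psi(1), of 0] by auto
  define g where "g = (\<lambda>n y. LINT z|lborel. \<theta> z * \<psi> (y + c n *\<^sub>R z))"
  have [measurable]: "g n \<in> borel_measurable borel" for n unfolding g_def by measurable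
  have eq: "(LINT x|lborel. conv (inv_fourier (\<lambda>\<xi>. m (c n *\<^sub>R \<xi>))) F x * \<psi> x) = (LINT y|lborel. F y * g n y)" for n
  proof -
    have t: "test_symbol (\<lambda>\<xi>. m (c n *\<^sub>R \<xi>))"
      by (rule test_symbol_scale[OF m]) (use c(2)[of n] in simp)
    show ?thesis
      unfolding integral_conv_times[OF test_symbol_rapid[OF t] F psi(1)]
        conv_dilate_dual[OF c(2)] g_def \<theta>_def ..
  qed
  have lim: "(\<lambda>n. g n y) \<longlonglongrightarrow> \<psi> y" for y
  proof -
    have "(\<lambda>n. g n y) \<longlonglongrightarrow> (LINT z|lborel. \<theta> z * \<psi> y)"
      unfolding g_def
    proof (rule integral_dominated_convergence[where w="\<lambda>z. norm (\<theta> z) * B"])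
      show "integrable lborel (\<lambda>z. norm (\<theta> z) * B)"
        by (intro integrable_mult_left integrable_norm rapid_integrable th)
      show "AE z in lborel. (\<lambda>n. \<theta> z * \<psi> (y + c n *\<^sub>R z)) \<longlonglongrightarrow> \<theta> z * \<psi> y"
      proof (rule AE_I2)
        fix z :: "real^'n"
        have "(\<lambda>n. y + c n *\<^sub>R z) \<longlonglongrightarrow> y + 0 *\<^sub>R z" by (intro tendsto_add tendsto_scaleR tendsto_const c)
        then have "(\<lambda>n. \<psi> (y + c n *\<^sub>R z)) \<longlonglongrightarrow> \<psi> y"
          using psi(2) by (intro isCont_tendsto_compose[of y \<psi>]) (auto simp: continuous_on_eq_continuous_at)
        then show "(\<lambda>n. \<theta> z * \<psi> (y + c n *\<^sub>R z)) \<longlonglongrightarrow> \<theta> z * \<psi> y" by (rule tendsto_mult_left)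
      qed
      show "AE z in lborel. norm (\<theta> z * \<psi> (y + c n *\<^sub>R z)) \<le> norm (\<theta> z) * B" for n
        unfolding norm_mult by (intro AE_I2 mult_left_mono B[rule_format]) auto
      show "(\<lambda>z. \<theta> z * \<psi> (y + c n *\<^sub>R z)) \<in> borel_measurable lborel" for n by measurable
      show "(\<lambda>z. \<theta> z * \<psi> y) \<in> borel_measurable lborel" by measurable
    qed
    moreover have "(LINT z|lborel. \<theta> z * \<psi> y) = \<psi> y"
      unfolding integral_mult_left_zero using integral_inv_fourier[OF m] m0 by (simp add: \<theta>_def)
    ultimately show ?thesis by (simp only:)
  qed
  define J where "J = (LINT z|lborel. C * ((1 + norm z) ^ N * norm (\<theta> z)))"
  have iJ: "integrable lborel (\<lambda>z. C * ((1 + norm z) ^ N * norm (\<theta> z)))"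
    by (intro integrable_mult_right rapid_weighted_integrable th)
  have gb: "norm (g n y) \<le> 1 / (1 + norm y) ^ N * J" for n y
  proof -
    have le: "norm (\<theta> z * \<psi> (y + c n *\<^sub>R z)) \<le> 1 / (1 + norm y) ^ N * (C * ((1 + norm z) ^ N * norm (\<theta> z)))" for z
    proof -
      have cz: "norm (c n *\<^sub>R z) \<le> norm z"
        using c(2)[of n] c(3)[of n] by (simp add: mult_left_le_one_le)
      have "norm (\<psi> (y + c n *\<^sub>R z)) \<le> C * (1 / (1 + norm (- (c n *\<^sub>R z) - y)) ^ N)"
      proof -
        have "- (c n *\<^sub>R z) - y = - (y + c n *\<^sub>R z)" by simp
        then have "norm (- (c n *\<^sub>R z) - y) = norm (y + c n *\<^sub>R z)" by (simp only: norm_minus_cancel)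
        then show ?thesis using C[rule_format, of "y + c n *\<^sub>R z"] by (simp only: times_divide_eq_right mult_1_right)
      qed
      also have "\<dots> \<le> C * ((1 + norm (- (c n *\<^sub>R z))) ^ N / (1 + norm y) ^ N)"
        by (intro mult_left_mono peetre C0)
      also have "\<dots> \<le> C * ((1 + norm z) ^ N / (1 + norm y) ^ N)"
        using cz by (intro mult_left_mono divide_right_mono power_mono C0) auto
      finally have "norm (\<theta> z) * norm (\<psi> (y + c n *\<^sub>R z)) \<le> norm (\<theta> z) * (C * ((1 + norm z) ^ N / (1 + norm y) ^ N))"
        by (intro mult_left_mono) auto
      then show ?thesis unfolding norm_mult by (simp add: mult_ac)
    qed
    have i: "integrable lborel (\<lambda>z. \<theta> z * \<psi> (y + c n *\<^sub>R z))"
    proof (rule Bochner_Integration.integrable_bound[OF integrable_mult_left[OF integrable_norm[OF rapid_integrable[OF th]], of B]])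
      show "(\<lambda>z. \<theta> z * \<psi> (y + c n *\<^sub>R z)) \<in> borel_measurable lborel" by measurable
      show "AE z in lborel. norm (\<theta> z * \<psi> (y + c n *\<^sub>R z)) \<le> norm (norm (\<theta> z) * B)"
      proof (rule AE_I2)
        fix z show "norm (\<theta> z * \<psi> (y + c n *\<^sub>R z)) \<le> norm (norm (\<theta> z) * B)"
          using B[rule_format, of "y + c n *\<^sub>R z"] order_trans[OF norm_ge_zero B[rule_format, of y]]
          by (simp add: norm_mult mult_left_mono)
      qed
    qed
    have "norm (g n y) \<le> (LINT z|lborel. norm (\<theta> z * \<psi> (y + c n *\<^sub>R z)))"
      unfolding g_def by (rule integral_norm_bound)
    also have "\<dots> \<le> (LINT z|lborel. 1 / (1 + norm y) ^ N * (C * ((1 + norm z) ^ N * norm (\<theta> z))))"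
      by (intro integral_mono integrable_norm i integrable_mult_right[OF iJ] le)
    also have "\<dots> = 1 / (1 + norm y) ^ N * J" unfolding J_def by (rule integral_mult_right_zero)
    finally show ?thesis .
  qed
  have "(\<lambda>n. LINT y|lborel. F y * g n y) \<longlonglongrightarrow> (LINT y|lborel. F y * \<psi> y)"
  proof (rule integral_dominated_convergence[where w="\<lambda>y. norm (F y) / (1 + norm y) ^ N * J"])
    show "integrable lborel (\<lambda>y. norm (F y) / (1 + norm y) ^ N * J)" by (intro integrable_mult_left N)
    show "AE y in lborel. (\<lambda>n. F y * g n y) \<longlonglongrightarrow> F y * \<psi> y" by (intro AE_I2 tendsto_mult_left lim)
    show "AE y in lborel. norm (F y * g n y) \<le> norm (F y) / (1 + norm y) ^ N * J" for n
    proof (rule AE_I2)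
      fix y show "norm (F y * g n y) \<le> norm (F y) / (1 + norm y) ^ N * J"
        using mult_left_mono[OF gb[of n y] norm_ge_zero[of "F y"]] by (simp add: norm_mult)
    qed
    show "(\<lambda>y. F y * g n y) \<in> borel_measurable lborel" for n by measurable
    show "(\<lambda>y. F y * \<psi> y) \<in> borel_measurable lborel" by measurable
  qed
  then show ?thesis unfolding eq .
qed

lemma rapid_bounded_support:
  fixes k :: "real^'n \<Rightarrow> complex"
  assumes "k \<in> borel_measurable borel" "\<And>x. norm (k x) \<le> B" "\<And>x. norm x > R \<Longrightarrow> k x = 0"
  shows "rapid k"
  unfolding rapid_def
proof (intro conjI allI)
  fix M
  have B0: "B \<ge> 0" using order_trans[OF norm_ge_zero assms(2)] .
  have "norm (k x) \<le> (B * (1 + \<bar>R\<bar>) ^ M) / (1 + norm x) ^ M" for x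
  proof (cases "norm x > R")
    case True
    then show ?thesis using B0 assms(3) by simp
  next
    case False
    have "(1 + norm x) ^ M > 0" by (intro zero_less_power add_pos_nonneg) auto
    moreover have "(1 + norm x) ^ M \<le> (1 + \<bar>R\<bar>) ^ M" using False by (intro power_mono) auto
    then have "norm (k x) * (1 + norm x) ^ M \<le> B * (1 + \<bar>R\<bar>) ^ M"
      using assms(2) B0 by (intro mult_mono) auto
    ultimately show ?thesis by (simp add: pos_le_divide_eq)
  qed
  then show "\<exists>C. \<forall>x. norm (k x) \<le> C / (1 + norm x) ^ M" by blast
qed (rule assms)

text \<open>
  The sets over which the integral vanishes form a Dynkin system, and closed sets are a
  generator of the Borel sets that is closed under intersections.
\<close>

lemma AE_zero_of_closed_integrals:
  fixes G :: "real^'n \<Rightarrow> complex"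
  assumes G: "integrable lborel G"
    and closed: "\<And>A. closed A \<Longrightarrow> (LINT x|lborel. indicat_real A x *\<^sub>R G x) = 0"
  shows "AE x in lborel. G x = 0"
proof (rule sigma_finite_measure.density_zero[OF lborel.sigma_finite_measure_axioms G])
  fix A :: "(real^'n) set" assume "A \<in> sets lborel"
  then have A: "A \<in> sigma_sets UNIV (Collect closed)"
    by (simp add: borel_eq_closed)
  have B: "B \<in> sets borel" if "B \<in> sigma_sets UNIV (Collect closed)" for B :: "(real^'n) set"
    using that by (simp add: borel_eq_closed)
  have "Int_stable (Collect (closed :: (real^'n) set \<Rightarrow> bool))" by (auto simp: Int_stable_def)
  moreover have "Collect closed \<subseteq> Pow (UNIV :: (real^'n) set)" by simp
  ultimately have "set_lebesgue_integral lborel A G = 0" using A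
  proof (induction A rule: sigma_sets_induct_disjoint)
    case (basic A) then show ?case using closed by (simp add: set_lebesgue_integral_def)
  next
    case empty show ?case by (simp add: set_lebesgue_integral_def)
  next
    case (compl A)
    have "integrable lborel (\<lambda>x. indicat_real A x *\<^sub>R G x)"
      using B[OF compl(1)] by (intro integrable_mult_indicator G) simp
    moreover have "(LINT x|lborel. G x) = 0" using closed[of UNIV] by simp
    moreover have "(\<lambda>x. indicat_real (UNIV - A) x *\<^sub>R G x) = (\<lambda>x. G x - indicat_real A x *\<^sub>R G x)"
      by (auto simp: indicator_def)
    ultimately show ?case using compl(2) G by (simp add: set_lebesgue_integral_def)
  next
    case (union A)
    have AB: "A i \<in> sets lborel" for i using B union(2) by auto
    have "set_lebesgue_integral lborel (\<Union>i. A i) G = (\<Sum>i. set_lebesgue_integral lborel (A i) G)"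
    proof (rule lebesgue_integral_countable_add[OF AB])
      show "A i \<inter> A j = {}" if "i \<noteq> j" for i j
        using union(1) that by (auto simp: disjoint_family_on_def)
      show "set_integrable lborel (\<Union>i. A i) G"
        unfolding set_integrable_def using AB by (intro integrable_mult_indicator G) auto
    qed
    then show ?case using union(3) by simp
  qed
  then show "set_lebesgue_integral lborel A G = 0" .
qed

text \<open>
  The indicator function of a closed set is the pointwise limit of continuous functions of
  bounded support; the weight \<open>w\<close> makes \<open>F\<close> integrable, so that the limit can be taken.
\<close>

lemma AE_zero_of_continuous_tests:
  fixes F :: "real^'n \<Rightarrow> complex"
  assumes F: "tempered_fun F"
    and zero: "\<And>\<psi>. rapid \<psi> \<Longrightarrow> continuous_on UNIV \<psi> \<Longrightarrow> (LINT x|lborel. F x * \<psi> x) = 0"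
  shows "AE x in lborel. F x = 0"
proof -
  obtain N where [measurable]: "F \<in> borel_measurable borel" and N: "integrable lborel (\<lambda>x. norm (F x) / (1 + norm x) ^ N)"
    using F by (auto simp: tempered_iff)
  have pos: "(1 + norm x) ^ N > 0" for x :: "real^'n" by (intro zero_less_power add_pos_nonneg) auto
  define w where "w = (\<lambda>x::real^'n. 1 / (1 + norm x) ^ N)"
  have w0: "w x > 0" for x using pos by (simp add: w_def)
  have wcont: "continuous_on UNIV w"
    unfolding w_def by (intro continuous_intros) (metis pos less_irrefl)
  have [measurable]: "w \<in> borel_measurable borel" by (rule borel_measurable_continuous_onI[OF wcont])
  define G where "G = (\<lambda>x. F x * of_real (w x))"
  have G: "integrable lborel G"
    unfolding G_def
    by (rule Bochner_Integration.integrable_bound[OF N]) (auto simp: norm_mult w_def abs_of_pos[OF pos] simp del: of_real_power of_real_add of_real_divide)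
  have "AE x in lborel. G x = 0"
  proof (rule AE_zero_of_closed_integrals[OF G])
    fix A :: "(real^'n) set" assume A: "closed A"
    show "(LINT x|lborel. indicat_real A x *\<^sub>R G x) = 0"
    proof (cases "A = {}")
      case False
      \<comment> \<open>The first factor decreases to the indicator of \<open>A\<close>, the second cuts off outside the ball of
        radius \<open>n\<close>.\<close>
      define e where "e = (\<lambda>(n::nat) x. max 0 (1 - real n * infdist x A) * max 0 (min 1 (real n - norm x)))"
      have econt: "continuous_on UNIV (e n)" for n unfolding e_def by (intro continuous_intros)
      have [measurable]: "e n \<in> borel_measurable borel" for n by (rule borel_measurable_continuous_onI[OF econt])
      have [measurable]: "A \<in> sets borel" using A by simp
      have e01: "0 \<le> e n x" "e n x \<le> 1" for n x
        unfolding e_def by (auto intro!: mult_le_one mult_nonneg_nonneg infdist_nonneg)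
      have e0: "e n x = 0" if "norm x > real n" for n x using that by (simp add: e_def)
      have z: "(LINT x|lborel. G x * of_real (e n x)) = 0" for n
      proof -
        define k where "k = (\<lambda>x. complex_of_real (w x * e n x))"
        have kc: "continuous_on UNIV k" unfolding k_def by (intro continuous_intros wcont econt)
        have "rapid k"
        proof (rule rapid_bounded_support[where B=1 and R="real n"])
          show "k \<in> borel_measurable borel" by (rule borel_measurable_continuous_onI[OF kc])
          have "w x \<le> 1" for x unfolding w_def using one_le_power[of "1 + norm x" N] pos[of x] by (simp add: pos_divide_le_eq)
          then show "norm (k x) \<le> 1" for x unfolding k_def
            using e01[of n x] w0[of x] by (simp add: norm_mult abs_mult mult_le_one less_imp_le)
        qed (simp add: k_def e0)
        then have "(LINT x|lborel. F x * k x) = 0" using zero kc by blast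
        then show ?thesis by (simp add: k_def G_def mult.assoc)
      qed
      have "(\<lambda>n. LINT x|lborel. G x * of_real (e n x)) \<longlonglongrightarrow> (LINT x|lborel. indicat_real A x *\<^sub>R G x)"
      proof (rule integral_dominated_convergence[where w="\<lambda>x. norm (G x)"])
        show "integrable lborel (\<lambda>x. norm (G x))" using G by simp
        show "AE x in lborel. (\<lambda>n. G x * of_real (e n x)) \<longlonglongrightarrow> indicat_real A x *\<^sub>R G x"
        proof (rule AE_I2)
          fix x :: "real^'n"
          have "(\<lambda>n. e n x) \<longlonglongrightarrow> indicat_real A x"
          proof (rule tendsto_eventually)
            obtain n0 where n0: "real n0 \<ge> norm x + 1" using real_arch_simple by blast
            show "\<forall>\<^sub>F n in sequentially. e n x = indicat_real A x"
            proof (cases "x \<in> A")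
              case True
              have "e n x = 1" if "n \<ge> n0" for n using True n0 that by (simp add: e_def)
              then show ?thesis using True unfolding eventually_sequentially by auto
            next
              case x: False
              then have "infdist x A > 0" using A False in_closed_iff_infdist_zero[of A x] infdist_nonneg[of x A] by simp
              then obtain n1 where n1: "real n1 * infdist x A > 1" using ex_less_of_nat_mult by blast
              have "e n x = 0" if "n \<ge> n1" for n
              proof -
                have "real n1 * infdist x A \<le> real n * infdist x A" using that by (intro mult_right_mono infdist_nonneg) auto
                then show ?thesis using n1 by (simp add: e_def)
              qed
              then show ?thesis using x unfolding eventually_sequentially by auto
            qed
          qed
          then have "(\<lambda>n. G x * of_real (e n x)) \<longlonglongrightarrow> G x * of_real (indicat_real A x)"
            by (intro tendsto_mult tendsto_const tendsto_of_real)
          then show "(\<lambda>n. G x * of_real (e n x)) \<longlonglongrightarrow> indicat_real A x *\<^sub>R G x"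
            by (simp add: scaleR_conv_of_real mult.commute)
        qed
        show "AE x in lborel. norm (G x * of_real (e n x)) \<le> norm (G x)" for n
        proof (rule AE_I2)
          fix x show "norm (G x * of_real (e n x)) \<le> norm (G x)"
            using e01[of n x] by (simp add: norm_mult mult_left_le)
        qed
        show "(\<lambda>x. G x * of_real (e n x)) \<in> borel_measurable lborel" for n using G by measurable
        show "(\<lambda>x. indicat_real A x *\<^sub>R G x) \<in> borel_measurable lborel" using G by measurable
      qed
      then show ?thesis unfolding z using LIMSEQ_unique tendsto_const by blast
    qed simp
  qed
  then show ?thesis
    by eventually_elim (use w0 in \<open>auto simp: G_def less_imp_neq[symmetric]\<close>)
qed

text \<open>
  Regularizations of \<open>F\<close> by Schwartz kernels are values of \<open>F\<close> on Schwartz functions, so they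
  vanish; they approximate \<open>F\<close> when tested against continuous functions.
\<close>

theorem AE_zero_of_schwartz_tests:
  fixes F m :: "real^'n \<Rightarrow> complex"
  assumes m: "test_symbol m" and m0: "m 0 = 1"
    and F: "tempered_fun F" and zero: "\<And>\<psi>. schwartz \<psi> \<Longrightarrow> (LINT x|lborel. F x * \<psi> x) = 0"
  shows "AE x in lborel. F x = 0"
proof (rule AE_zero_of_continuous_tests[OF F])
  fix \<psi> :: "real^'n \<Rightarrow> complex" assume psi: "rapid \<psi>" "continuous_on UNIV \<psi>"
  define c where "c = (\<lambda>n::nat. 1 / real (Suc n))"
  have c: "c n > 0" "c n \<le> 1" for n by (simp_all add: c_def)
  have cl: "c \<longlonglongrightarrow> 0" unfolding c_def using LIMSEQ_Suc[OF lim_1_over_n] by simp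
  have "conv (inv_fourier (\<lambda>\<xi>. m (c n *\<^sub>R \<xi>))) F x = 0" for n x
  proof -
    have t: "test_symbol (\<lambda>\<xi>. m (c n *\<^sub>R \<xi>))"
      by (rule test_symbol_scale[OF m]) (use c(1)[of n] in simp)
    show ?thesis
      unfolding conv_def using zero[OF schwartz_reflect[OF schwartz_inv_fourier[OF t]]] by (simp only: mult.commute)
  qed
  then have "(\<lambda>n::nat. 0) \<longlonglongrightarrow> (LINT x|lborel. F x * \<psi> x)"
    using conv_approximate_identity[OF m m0 F psi cl c] by simp
  then show "(LINT x|lborel. F x * \<psi> x) = 0" using LIMSEQ_unique tendsto_const by blast
qed

text \<open>
  The symbol \<open>m\<close> provides the approximate identity that separates functions.
\<close>

corollary represents_unique:
  fixes F F' m :: "real^'n \<Rightarrow> complex"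
  assumes m: "test_symbol m" and m0: "m 0 = 1"
    and F: "represents F u" and F': "represents F' u"
  shows "AE x in lborel. F x = F' x"
proof -
  have t: "tempered_fun F" "tempered_fun F'" using F F' by (auto simp: represents_def)
  have "AE x in lborel. F x - F' x = 0"
  proof (rule AE_zero_of_schwartz_tests[OF m m0 tempered_diff[OF t]])
    fix \<psi> :: "real^'n \<Rightarrow> complex" assume psi: "schwartz \<psi>"
    have "(LINT x|lborel. F x * \<psi> x) = (LINT x|lborel. F' x * \<psi> x)"
      using F F' psi by (simp add: represents_def dist_of_def)
    then show "(LINT x|lborel. (F x - F' x) * \<psi> x) = 0"
      using tempered_times_rapid_integrable[OF t(1) schwartz_rapid[OF psi]]
        tempered_times_rapid_integrable[OF t(2) schwartz_rapid[OF psi]] by (simp add: left_diff_distrib)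
  qed
  then show ?thesis by simp
qed

section \<open>Spectral calculus of convolutions\<close>

text \<open>Parseval's formula, with the transform of \<open>u\<close> written out.\<close>

lemma integral_times_inv_fourier:
  fixes b u :: "real^'n \<Rightarrow> complex"
  assumes b: "test_symbol b" and u: "rapid u"
  shows "(LINT y|lborel. u y * inv_fourier b (y - w)) =
    (LINT \<eta>|lborel. ee (- (w \<bullet> \<eta>)) * b \<eta> * (LINT y|lborel. ee (y \<bullet> \<eta>) * u y)) / of_real ((2 * pi) ^ CARD('n))"
proof -
  define P where "P = complex_of_real ((2 * pi) ^ CARD('n))"
  have [measurable]: "b \<in> borel_measurable borel" "u \<in> borel_measurable borel"
    by (rule test_symbol_measurable[OF b], rule rapid_measurable[OF u])
  define v where "v = (\<lambda>y \<eta>. u y * (ee ((y - w) \<bullet> \<eta>) * b \<eta>))"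
  have 1: "u y * inv_fourier b (y - w) = (LINT \<eta>|lborel. v y \<eta>) / P" for y
    unfolding v_def inv_fourier_def P_def by (simp only: integral_mult_right_zero times_divide_eq_right)
  have 2: "(LINT y|lborel. v y \<eta>) = ee (- (w \<bullet> \<eta>)) * b \<eta> * (LINT y|lborel. ee (y \<bullet> \<eta>) * u y)" for \<eta>
  proof -
    have "v y \<eta> = ee (- (w \<bullet> \<eta>)) * b \<eta> * (ee (y \<bullet> \<eta>) * u y)" for y
    proof -
      have "(y - w) \<bullet> \<eta> = - (w \<bullet> \<eta>) + y \<bullet> \<eta>" by (simp add: inner_diff_left)
      then have "ee ((y - w) \<bullet> \<eta>) = ee (- (w \<bullet> \<eta>)) * ee (y \<bullet> \<eta>)" by (simp only: ee_mult)
      then show ?thesis by (simp add: v_def)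
    qed
    then show ?thesis by (simp only: integral_mult_right_zero)
  qed
  have "(LINT y|lborel. LINT \<eta>|lborel. v y \<eta>) = (LINT \<eta>|lborel. LINT y|lborel. v y \<eta>)"
  proof (rule lborel_Fubini[where u=v and f="\<lambda>y. norm (u y)" and g="\<lambda>\<eta>. norm (b \<eta>)"])
    show "(\<lambda>(x, y). v x y) \<in> borel_measurable (borel \<Otimes>\<^sub>M borel)" unfolding v_def by measurable
    show "integrable lborel (\<lambda>y. norm (u y))" "integrable lborel (\<lambda>\<eta>. norm (b \<eta>))"
      by (intro integrable_norm rapid_integrable u, intro integrable_norm test_symbol_integrable b)
    show "norm (v y \<eta>) \<le> norm (u y) * norm (b \<eta>)" for y \<eta>
      unfolding v_def norm_mult norm_ee by simp
  qed
  then show ?thesis unfolding 1 P_def[symmetric] unfolding integral_divide_zero 2 by (simp only:)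
qed

lemma integral_ee_inv_fourier_reflect:
  assumes k: "test_symbol k"
  shows "(LINT y|lborel. ee (y \<bullet> \<eta>) * inv_fourier k (x - y)) = ee (x \<bullet> \<eta>) * k \<eta>"
proof -
  define g where "g = (\<lambda>y. ee (y \<bullet> \<eta>) * inv_fourier k (x - y))"
  have g: "g (x - y) = ee (x \<bullet> \<eta>) * (ee (- (y \<bullet> \<eta>)) * inv_fourier k y)" for y
  proof -
    have "(x - y) \<bullet> \<eta> = x \<bullet> \<eta> + - (y \<bullet> \<eta>)" by (simp add: inner_diff_left)
    then have "ee ((x - y) \<bullet> \<eta>) = ee (x \<bullet> \<eta>) * ee (- (y \<bullet> \<eta>))" by (simp only: ee_mult)
    then show ?thesis by (simp add: g_def)
  qed
  have "(LINT y|lborel. g y) = (LINT y|lborel. g (x - y))" by (rule integral_lborel_reflect[symmetric])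
  also have "\<dots> = ee (x \<bullet> \<eta>) * fourier (inv_fourier k) \<eta>"
    unfolding g fourier_ee by (rule integral_mult_right_zero)
  also have "\<dots> = ee (x \<bullet> \<eta>) * k \<eta>" by (simp only: fourier_inv_fourier[OF k])
  finally show ?thesis unfolding g_def .
qed

text \<open>
  By Parseval's formula the composition of two kernels has the product of their symbols; Fubini
  then composes them on functions of tempered growth.
\<close>

lemma conv_conv:
  fixes k1 k2 F :: "real^'n \<Rightarrow> complex"
  assumes k: "test_symbol k1" "test_symbol k2" and F: "tempered_fun F"
  shows "conv (inv_fourier k1) (conv (inv_fourier k2) F) x = conv (inv_fourier (\<lambda>\<xi>. k1 \<xi> * k2 \<xi>)) F x"
proof -
  have r: "rapid (\<lambda>y. inv_fourier k1 (x - y))" by (intro rapid_reflect test_symbol_rapid k)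
  have inner: "(LINT y|lborel. inv_fourier k2 (y - w) * inv_fourier k1 (x - y)) = inv_fourier (\<lambda>\<xi>. k1 \<xi> * k2 \<xi>) (x - w)" for w
  proof -
    have "(LINT y|lborel. inv_fourier k2 (y - w) * inv_fourier k1 (x - y)) = (LINT y|lborel. inv_fourier k1 (x - y) * inv_fourier k2 (y - w))"
      by (simp only: mult.commute)
    also have "\<dots> = (LINT \<eta>|lborel. ee (- (w \<bullet> \<eta>)) * k2 \<eta> * (ee (x \<bullet> \<eta>) * k1 \<eta>)) / of_real ((2 * pi) ^ CARD('n))"
      unfolding integral_times_inv_fourier[OF k(2) r] integral_ee_inv_fourier_reflect[OF k(1)] ..
    also have "\<dots> = inv_fourier (\<lambda>\<xi>. k1 \<xi> * k2 \<xi>) (x - w)"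
    proof -
      have "ee (- (w \<bullet> \<eta>)) * k2 \<eta> * (ee (x \<bullet> \<eta>) * k1 \<eta>) = ee ((x - w) \<bullet> \<eta>) * (k1 \<eta> * k2 \<eta>)" for \<eta>
      proof -
        have "(x - w) \<bullet> \<eta> = - (w \<bullet> \<eta>) + x \<bullet> \<eta>" by (simp add: inner_diff_left)
        then have "ee ((x - w) \<bullet> \<eta>) = ee (- (w \<bullet> \<eta>)) * ee (x \<bullet> \<eta>)" by (simp only: ee_mult)
        then show ?thesis by simp
      qed
      then show ?thesis unfolding inv_fourier_def by (simp only:)
    qed
    finally show ?thesis .
  qed
  have "conv (inv_fourier k1) (conv (inv_fourier k2) F) x = (LINT y|lborel. conv (inv_fourier k2) F y * inv_fourier k1 (x - y))"
    unfolding conv_def[of "inv_fourier k1"] by (simp only: mult.commute)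
  also have "\<dots> = (LINT w|lborel. F w * inv_fourier (\<lambda>\<xi>. k1 \<xi> * k2 \<xi>) (x - w))"
    unfolding integral_conv_times[OF test_symbol_rapid[OF k(2)] F r] inner ..
  also have "\<dots> = conv (inv_fourier (\<lambda>\<xi>. k1 \<xi> * k2 \<xi>)) F x"
    unfolding conv_def by (simp only: mult.commute)
  finally show ?thesis .
qed

text \<open>
  Frequencies \<open>\<xi>\<close> of the first factor and \<open>\<eta>\<close> of the second add up to \<open>\<xi> + \<eta>\<close>
  in the product. This is seen on the kernels, without transforms of \<open>f\<close> and \<open>h\<close>: expanding the
  two inner convolutions reduces the claim to an integral of three kernels, and by Parseval's
  formula, used twice, that integral is an integral of
  \<open>k (\<xi> + \<eta>) * a \<xi> * b \<eta>\<close>.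
\<close>

theorem conv_spectral_localization:
  fixes k a b f h :: "real^'n \<Rightarrow> complex"
  assumes t: "test_symbol k" "test_symbol a" "test_symbol b"
    and f: "tempered_fun f" and h: "tempered_fun h"
    and disj: "\<And>\<xi> \<eta>. a \<xi> \<noteq> 0 \<Longrightarrow> b \<eta> \<noteq> 0 \<Longrightarrow> k (\<xi> + \<eta>) = 0"
  shows "conv (inv_fourier k) (\<lambda>y. conv (inv_fourier a) f y * conv (inv_fourier b) h y) x = 0"
proof -
  define K A B where "K = inv_fourier k" and "A = inv_fourier a" and "B = inv_fourier b"
  have r: "rapid K" "rapid A" "rapid B" unfolding K_def A_def B_def by (intro test_symbol_rapid t)+
  have [measurable]: "K \<in> borel_measurable borel" "A \<in> borel_measurable borel" "B \<in> borel_measurable borel"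
    by (intro rapid_measurable r)+
  have rKx: "rapid (\<lambda>y. K (x - y))" by (rule rapid_reflect[OF r(1)])
  have triple: "(LINT y|lborel. (K (x - y) * A (y - z)) * B (y - w)) = 0" for z w
  proof -
    have rKA: "rapid (\<lambda>y. K (x - y) * A (y - z))" by (intro rapid_mult rKx rapid_shift r)
    have in0: "b \<eta> * (LINT y|lborel. ee (y \<bullet> \<eta>) * (K (x - y) * A (y - z))) = 0" for \<eta>
    proof (cases "b \<eta> = 0")
      case False
      have re: "rapid (\<lambda>y. K (x - y) * ee (y \<bullet> \<eta>))"
        by (rule rapid_times_poly[OF rKx, where C=1 and N=0]) simp_all
      have in1: "a \<xi> * (LINT y|lborel. ee (y \<bullet> \<xi>) * (K (x - y) * ee (y \<bullet> \<eta>))) = 0" for \<xi>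
      proof (cases "a \<xi> = 0")
        case a: False
        have "ee (y \<bullet> \<xi>) * (K (x - y) * ee (y \<bullet> \<eta>)) = ee (y \<bullet> (\<xi> + \<eta>)) * K (x - y)" for y
        proof -
          have "ee (y \<bullet> (\<xi> + \<eta>)) = ee (y \<bullet> \<xi>) * ee (y \<bullet> \<eta>)" by (simp only: inner_add_right ee_mult)
          then show ?thesis by simp
        qed
        then have "(LINT y|lborel. ee (y \<bullet> \<xi>) * (K (x - y) * ee (y \<bullet> \<eta>))) = ee (x \<bullet> (\<xi> + \<eta>)) * k (\<xi> + \<eta>)"
          unfolding K_def by (simp only: integral_ee_inv_fourier_reflect[OF t(1)])
        then show ?thesis using disj[OF a False] by simp
      qed simp
      have "(LINT y|lborel. (K (x - y) * ee (y \<bullet> \<eta>)) * A (y - z)) = 0"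
        unfolding A_def integral_times_inv_fourier[OF t(2) re] mult.assoc[of _ "a _"] in1 by simp
      moreover have "ee (y \<bullet> \<eta>) * (K (x - y) * A (y - z)) = (K (x - y) * ee (y \<bullet> \<eta>)) * A (y - z)" for y
        by (simp only: mult_ac)
      ultimately show ?thesis by (simp only: mult_zero_right)
    qed simp
    show ?thesis
      unfolding B_def integral_times_inv_fourier[OF t(3) rKA] mult.assoc[of _ "b _"] in0 by simp
  qed
  have inner: "(LINT y|lborel. A (y - z) * (K (x - y) * conv B h y)) = 0" for z
  proof -
    have rKA: "rapid (\<lambda>y. K (x - y) * A (y - z))" by (intro rapid_mult rKx rapid_shift r)
    have "(LINT y|lborel. A (y - z) * (K (x - y) * conv B h y)) = (LINT y|lborel. conv B h y * (K (x - y) * A (y - z)))"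
      by (simp only: mult_ac)
    also have "\<dots> = (LINT w|lborel. h w * (LINT y|lborel. B (y - w) * (K (x - y) * A (y - z))))"
      by (rule integral_conv_times[OF r(3) h rKA])
    also have "\<dots> = 0"
    proof -
      have "(LINT y|lborel. B (y - w) * (K (x - y) * A (y - z))) = 0" for w
        using triple[of z w] by (simp only: mult.commute)
      then show ?thesis by simp
    qed
    finally show ?thesis .
  qed
  obtain C N where g: "\<And>y. norm (conv B h y) \<le> C * (1 + norm y) ^ N" using conv_growth[OF r(3) h] by blast
  have rG: "rapid (\<lambda>y. K (x - y) * conv B h y)"
    by (rule rapid_times_poly[OF rKx tempered_measurable[OF tempered_conv[OF r(3) h]] g])
  have "conv K (\<lambda>y. conv A f y * conv B h y) x = (LINT y|lborel. conv A f y * (K (x - y) * conv B h y))"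
    unfolding conv_def[of K] by (simp only: mult_ac)
  also have "\<dots> = 0"
    unfolding integral_conv_times[OF r(2) f rG] inner by simp
  finally show ?thesis unfolding K_def A_def B_def .
qed

section \<open>Lebesgue norms of nonnegative functions\<close>

lemma epowr_zero [simp]: "epowr 0 a = 0"
  by (simp add: epowr_def)

lemma epowr_top [simp]: "epowr top a = top"
  by (simp add: epowr_def infinity_ennreal_def)

lemma epowr_ennreal: "t \<ge> 0 \<Longrightarrow> epowr (ennreal t) a = ennreal (t powr a)"
  by (simp add: epowr_def infinity_ennreal_def)

lemma epowr_one [simp]: "epowr 1 a = 1"
  using epowr_ennreal[of 1 a] by simp

lemma epowr_by_1 [simp]: "epowr x 1 = x"
  by (cases x) (simp_all add: epowr_ennreal)

lemma epowr_eq_0_iff [simp]: "epowr x a = 0 \<longleftrightarrow> x = 0"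
  by (cases x) (auto simp: epowr_ennreal ennreal_eq_0_iff)

lemma epowr_eq_top_iff [simp]: "epowr x a = top \<longleftrightarrow> x = top"
  by (cases x) (auto simp: epowr_ennreal)

lemma epowr_mono: "a \<ge> 0 \<Longrightarrow> x \<le> y \<Longrightarrow> epowr x a \<le> epowr y a"
  by (cases x; cases y) (auto simp: epowr_ennreal powr_mono2 ennreal_leI top_unique)

lemma epowr_mult: "a > 0 \<Longrightarrow> epowr (x * y) a = epowr x a * epowr y a"
proof (cases x; cases y)
  fix r s assume "a > 0" "x = ennreal r" "0 \<le> r" "y = ennreal s" "0 \<le> s"
  then show "epowr (x * y) a = epowr x a * epowr y a"
    by (simp add: epowr_ennreal ennreal_mult[symmetric] powr_mult)
qed (auto simp: ennreal_mult_top ennreal_top_mult epowr_ennreal ennreal_eq_0_iff split: if_splits)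

lemma epowr_epowr: "epowr (epowr x a) b = epowr x (a * b)"
  by (cases x) (simp_all add: epowr_ennreal powr_powr)

lemma epowr_add: "epowr x (a + b) = epowr x a * epowr x b"
  by (cases x) (simp_all add: epowr_ennreal ennreal_mult[symmetric] powr_add)

lemma epowr_measurable [measurable]:
  assumes [measurable]: "u \<in> borel_measurable M"
  shows "(\<lambda>x. epowr (u x) a) \<in> borel_measurable M"
  unfolding epowr_def infinity_ennreal_def by measurable

text \<open>
  Young's inequality for \<open>U / A\<close> and \<open>V / B\<close>. Normalized like this, it integrates to Hoelder's
  inequality when \<open>A\<close> and \<open>B\<close> are the integrals.
\<close>

lemma epowr_Young:
  assumes ab: "a > 0" "b > 0" "a + b = 1" and A: "A > 0" and B: "B > 0"
  shows "epowr U a * epowr V b \<le>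
    ennreal (A powr a * B powr b) * (ennreal (a / A) * U + ennreal (b / B) * V)"
proof -
  have pos: "A powr a * B powr b > 0" using A B by simp
  show ?thesis
  proof (cases "U = top \<or> V = top")
    case True
    then show ?thesis using pos ab A B
      by (auto simp: ennreal_mult_top ennreal_top_mult ennreal_eq_0_iff not_le divide_le_0_iff)
  next
    case False
    then obtain u v where uv: "U = ennreal u" "V = ennreal v" "u \<ge> 0" "v \<ge> 0"
      by (metis ennreal_cases)
    have "u powr a * v powr b \<le> (A powr a * B powr b) * (a / A * u + b / B * v)"
    proof (cases "u = 0 \<or> v = 0")
      case True
      then show ?thesis using ab A B uv by auto
    next
      case False
      then have "u > 0" "v > 0" using uv by auto
      then have "(u / A) powr a * (v / B) powr b \<le> a * (u / A) + b * (v / B)"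
        using ab A B by (intro Youngs_inequality_0) auto
      then have "(A powr a * B powr b) * ((u / A) powr a * (v / B) powr b) \<le> (A powr a * B powr b) * (a * (u / A) + b * (v / B))"
        using pos by (intro mult_left_mono) auto
      moreover have "(A powr a * B powr b) * ((u / A) powr a * (v / B) powr b) = u powr a * v powr b"
        using A B \<open>u > 0\<close> \<open>v > 0\<close> by (simp add: powr_divide)
      ultimately show ?thesis by simp
    qed
    moreover have "epowr U a * epowr V b = ennreal (u powr a * v powr b)"
      using uv by (simp add: epowr_ennreal ennreal_mult)
    moreover have "ennreal (A powr a * B powr b) * (ennreal (a / A) * U + ennreal (b / B) * V) =
        ennreal ((A powr a * B powr b) * (a / A * u + b / B * v))"
      using uv ab A B by (simp add: ennreal_mult[symmetric] ennreal_plus[symmetric] del: ennreal_plus)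
    ultimately show ?thesis by (simp only: ennreal_leI)
  qed
qed

lemma nn_integral_Holder:
  assumes [measurable]: "U \<in> borel_measurable M" "V \<in> borel_measurable M"
    and ab: "a > 0" "b > 0" "a + b = 1"
  shows "(\<integral>\<^sup>+x. epowr (U x) a * epowr (V x) b \<partial>M) \<le> epowr (\<integral>\<^sup>+x. U x \<partial>M) a * epowr (\<integral>\<^sup>+x. V x \<partial>M) b"
proof -
  let ?A = "\<integral>\<^sup>+x. U x \<partial>M" and ?B = "\<integral>\<^sup>+x. V x \<partial>M"
  consider "?A = 0" | "?B = 0" | "?A \<noteq> 0" "?B \<noteq> 0" "?A = top \<or> ?B = top" | A B where "?A = ennreal A" "?B = ennreal B" "A > 0" "B > 0"
    by (cases ?A; cases ?B) (force simp: less_le)+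
  then show ?thesis
  proof cases
    case 1
    then have "AE x in M. U x = 0" by (simp add: nn_integral_0_iff_AE)
    then have "AE x in M. epowr (U x) a * epowr (V x) b = 0" by eventually_elim simp
    then have "(\<integral>\<^sup>+x. epowr (U x) a * epowr (V x) b \<partial>M) = (\<integral>\<^sup>+x. 0 \<partial>M)" by (rule nn_integral_cong_AE)
    then show ?thesis by simp
  next
    case 2
    then have "AE x in M. V x = 0" by (simp add: nn_integral_0_iff_AE)
    then have "AE x in M. epowr (U x) a * epowr (V x) b = 0" by eventually_elim simp
    then have "(\<integral>\<^sup>+x. epowr (U x) a * epowr (V x) b \<partial>M) = (\<integral>\<^sup>+x. 0 \<partial>M)" by (rule nn_integral_cong_AE)
    then show ?thesis by simp
  next
    case 3
    then have "epowr ?A a * epowr ?B b = top" by (auto simp: ennreal_mult_top ennreal_top_mult)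
    then show ?thesis by simp
  next
    case (4 A B)
    have "(\<integral>\<^sup>+x. epowr (U x) a * epowr (V x) b \<partial>M) \<le>
        (\<integral>\<^sup>+x. ennreal (A powr a * B powr b) * (ennreal (a / A) * U x + ennreal (b / B) * V x) \<partial>M)"
      by (intro nn_integral_mono epowr_Young ab 4)
    also have "\<dots> = ennreal (A powr a * B powr b) * (ennreal (a / A) * ?A + ennreal (b / B) * ?B)"
      by (simp add: nn_integral_cmult nn_integral_add)
    also have "\<dots> = ennreal (A powr a * B powr b) * ennreal (a + b)"
      unfolding 4 using ab 4(3,4) by (simp add: ennreal_mult[symmetric] ennreal_plus[symmetric] del: ennreal_plus)
    also have "\<dots> = epowr ?A a * epowr ?B b"
      unfolding 4 ab(3) using 4 by (simp add: epowr_ennreal ennreal_mult)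
    finally show ?thesis .
  qed
qed

text \<open>
  The norm of a nonnegative function with values in \<open>[0, \<infinity>]\<close>, on an arbitrary measure
  space. Used for \<open>lborel\<close> and for sequences alike, it lets Minkowski's inequality be applied
  without integrability conditions.
\<close>

definition Lpe :: "'a measure \<Rightarrow> ennreal \<Rightarrow> ('a \<Rightarrow> ennreal) \<Rightarrow> ennreal"
  where "Lpe M p u = (if p = \<infinity> then esssup M u
    else epowr (\<integral>\<^sup>+x. epowr (u x) (enn2real p) \<partial>M) (1 / enn2real p))"

lemma Lpe_infinity: "Lpe M top u = esssup M u"
  by (simp add: Lpe_def infinity_ennreal_def)

lemma Lpe_ennreal: "P > 0 \<Longrightarrow> Lpe M (ennreal P) u = epowr (\<integral>\<^sup>+x. epowr (u x) P \<partial>M) (1 / P)"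
  by (simp add: Lpe_def infinity_ennreal_def)

lemma exponent_cases:
  assumes "1 \<le> (p::ennreal)"
  obtains "p = top" | P where "p = ennreal P" "P \<ge> 1"
  using assms by (cases p) (auto simp: ennreal_1[symmetric] simp del: ennreal_1)

lemma Lp_norm_fun_eq_Lpe:
  assumes "1 \<le> p" shows "Lp_norm_fun p h = Lpe lborel p (\<lambda>x. ennreal \<bar>h x\<bar>)"
  using assms
proof (cases rule: exponent_cases)
  case 1 then show ?thesis by (simp add: Lp_norm_fun_def Lpe_infinity infinity_ennreal_def)
next
  case (2 P) then show ?thesis by (simp add: Lp_norm_fun_def Lpe_ennreal epowr_ennreal infinity_ennreal_def)
qed

lemma Lpe_mono_AE:
  assumes "1 \<le> p" and [measurable]: "u \<in> borel_measurable M" and ae: "AE x in M. u x \<le> v x"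
  shows "Lpe M p u \<le> Lpe M p v"
  using assms(1)
proof (cases rule: exponent_cases)
  case 1 then show ?thesis using ae by (simp add: Lpe_infinity esssup_AE_mono)
next
  case (2 P)
  have "(\<integral>\<^sup>+x. epowr (u x) P \<partial>M) \<le> (\<integral>\<^sup>+x. epowr (v x) P \<partial>M)"
    using ae 2 by (intro nn_integral_mono_AE) (auto intro!: epowr_mono elim: eventually_mono)
  then show ?thesis using 2 by (simp add: Lpe_ennreal epowr_mono)
qed

lemma Lpe_mono:
  assumes "1 \<le> p" "u \<in> borel_measurable M" "\<And>x. u x \<le> v x"
  shows "Lpe M p u \<le> Lpe M p v"
  using Lpe_mono_AE[OF assms(1,2)] assms(3) by simp

lemma Lpe_cong_AE:
  assumes "1 \<le> p" "u \<in> borel_measurable M" "v \<in> borel_measurable M" "AE x in M. u x = v x"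
  shows "Lpe M p u = Lpe M p v"
  using assms by (intro antisym Lpe_mono_AE) (auto elim: eventually_mono)

lemma Lpe_zero_AE:
  assumes "1 \<le> p" and [measurable]: "u \<in> borel_measurable M" and "Lpe M p u = 0"
  shows "AE x in M. u x = 0"
  using assms(1)
proof (cases rule: exponent_cases)
  case 1 then show ?thesis using assms(3) esssup_AE[of u M] by (simp add: Lpe_infinity)
next
  case (2 P) then show ?thesis using assms(3) by (simp add: Lpe_ennreal nn_integral_0_iff_AE)
qed

lemma Lpe_cmult_le:
  assumes "1 \<le> p" and [measurable]: "u \<in> borel_measurable M"
  shows "Lpe M p (\<lambda>x. c * u x) \<le> c * Lpe M p u"
  using assms(1)
proof (cases rule: exponent_cases)
  case 1
  have "AE x in M. c * u x \<le> c * esssup M u"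
    using esssup_AE[of u M] by eventually_elim (rule mult_left_mono, auto)
  then show ?thesis unfolding 1 Lpe_infinity by (intro esssup_I) auto
next
  case (2 P)
  then have "epowr (\<integral>\<^sup>+x. epowr (c * u x) P \<partial>M) (1 / P) = c * epowr (\<integral>\<^sup>+x. epowr (u x) P \<partial>M) (1 / P)"
    by (simp add: epowr_mult nn_integral_cmult epowr_epowr)
  then show ?thesis using 2 by (simp add: Lpe_ennreal)
qed

lemma ennreal_inverse_inj: "1 / (p::ennreal) = 1 / q \<Longrightarrow> p = q"
proof -
  assume eq: "1 / p = 1 / q"
  have inv: "1 / (1 / x) = x" for x :: ennreal
  proof (cases x)
    case (real r)
    show ?thesis
    proof (cases "r = 0")
      case False
      then show ?thesis using real by (simp add: divide_ennreal_def inverse_ennreal less_le)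
    qed (use real in \<open>simp add: divide_ennreal_def\<close>)
  qed (simp add: divide_ennreal_def)
  show ?thesis by (metis inv eq)
qed

text \<open>
  With \<open>a = P / P1\<close> and \<open>b = P / P2\<close>, which add up to \<open>1\<close>, this is Hoelder's inequality for the
  \<open>P1\<close>-th and \<open>P2\<close>-th powers; infinite exponents are the trivial cases.
\<close>

theorem Lpe_Holder:
  assumes p: "1 \<le> p" "1 \<le> p1" "1 \<le> p2" "1 / p = 1 / p1 + 1 / p2"
    and [measurable]: "u \<in> borel_measurable M" "v \<in> borel_measurable M"
  shows "Lpe M p (\<lambda>x. u x * v x) \<le> Lpe M p1 u * Lpe M p2 v"
  using p(2)
proof (cases rule: exponent_cases)
  case 1
  then have pp: "p = p2" using p(4) ennreal_inverse_inj[of p p2] by simp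
  have "AE x in M. u x * v x \<le> esssup M u * v x"
    using esssup_AE[of u M] by eventually_elim (rule mult_right_mono, auto)
  then have "Lpe M p (\<lambda>x. u x * v x) \<le> Lpe M p (\<lambda>x. esssup M u * v x)"
    by (intro Lpe_mono_AE p) auto
  also have "\<dots> \<le> esssup M u * Lpe M p v" by (intro Lpe_cmult_le p) auto
  finally show ?thesis unfolding 1 Lpe_infinity pp .
next
  case P1: (2 P1)
  show ?thesis using p(3)
  proof (cases rule: exponent_cases)
    case 1
    then have pp: "p = p1" using p(4) ennreal_inverse_inj[of p p1] by simp
    have "AE x in M. u x * v x \<le> esssup M v * u x"
      using esssup_AE[of v M] by eventually_elim (metis mult.commute mult_left_mono zero_le)
    then have "Lpe M p (\<lambda>x. u x * v x) \<le> Lpe M p (\<lambda>x. esssup M v * u x)"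
      by (intro Lpe_mono_AE p) auto
    also have "\<dots> \<le> esssup M v * Lpe M p u" by (intro Lpe_cmult_le p) auto
    finally show ?thesis unfolding 1 Lpe_infinity pp by (simp add: mult.commute)
  next
    case P2: (2 P2)
    have inv: "1 / p = ennreal (1 / P1 + 1 / P2)"
      using P1 P2 p(4) by (simp add: divide_ennreal[symmetric] ennreal_plus)
    have "1 / P1 + 1 / P2 > 0" using P1 P2 by (intro add_pos_pos) auto
    then obtain P where P: "p = ennreal P" "P \<ge> 1"
      using p(1) P1 inv by (cases rule: exponent_cases[OF p(1)]) (auto simp: ennreal_eq_0_iff)
    have rel: "1 / P = 1 / P1 + 1 / P2"
    proof -
      have "1 / ennreal P = ennreal (1 / P)" using P divide_ennreal[of 1 P] by simp
      then have "ennreal (1 / P) = ennreal (1 / P1 + 1 / P2)" using inv unfolding P(1) by (simp only:)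
      then show ?thesis
        by (subst (asm) ennreal_inj) (use P P1 P2 in \<open>auto intro!: add_nonneg_nonneg\<close>)
    qed
    define a b where "a = P / P1" and "b = P / P2"
    have ab: "a > 0" "b > 0" "a + b = 1"
    proof -
      show "a > 0" "b > 0" using P P1 P2 by (auto simp: a_def b_def)
      have "a + b = P * (1 / P1 + 1 / P2)" by (simp add: a_def b_def algebra_simps)
      then show "a + b = 1" unfolding rel[symmetric] using P by simp
    qed
    have "(\<integral>\<^sup>+x. epowr (u x * v x) P \<partial>M) = (\<integral>\<^sup>+x. epowr (epowr (u x) P1) a * epowr (epowr (v x) P2) b \<partial>M)"
      using P P1 P2 by (simp add: epowr_mult epowr_epowr a_def b_def)
    also have "\<dots> \<le> epowr (\<integral>\<^sup>+x. epowr (u x) P1 \<partial>M) a * epowr (\<integral>\<^sup>+x. epowr (v x) P2 \<partial>M) b"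
      by (intro nn_integral_Holder ab) auto
    finally have "epowr (\<integral>\<^sup>+x. epowr (u x * v x) P \<partial>M) (1 / P) \<le>
        epowr (epowr (\<integral>\<^sup>+x. epowr (u x) P1 \<partial>M) a * epowr (\<integral>\<^sup>+x. epowr (v x) P2 \<partial>M) b) (1 / P)"
      using P by (intro epowr_mono) auto
    also have "\<dots> = epowr (\<integral>\<^sup>+x. epowr (u x) P1 \<partial>M) (1 / P1) * epowr (\<integral>\<^sup>+x. epowr (v x) P2 \<partial>M) (1 / P2)"
      using P by (simp add: epowr_mult epowr_epowr a_def b_def)
    finally show ?thesis using P P1 P2 by (simp add: Lpe_ennreal)
  qed
qed

text \<open>
  A bound \<open>w y\<close> takes the place of the norm of \<open>u y\<close>, whose measurability in \<open>y\<close> is thereby not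
  an issue. For \<open>P > 1\<close>, divide \<open>u y\<close> by \<open>w y\<close> and apply Hoelder's inequality to the measure
  \<open>w y dy\<close>, of total mass \<open>A\<close>; integrating over \<open>x\<close> leaves a factor at most \<open>A\<close>.
\<close>

theorem Lpe_Minkowski:
  assumes sf: "sigma_finite_measure M" "sigma_finite_measure N"
    and p: "1 \<le> p"
    and meas[measurable]: "(\<lambda>(y, x). u y x) \<in> borel_measurable (N \<Otimes>\<^sub>M M)"
    and w[measurable]: "w \<in> borel_measurable N"
    and le: "\<And>y. y \<in> space N \<Longrightarrow> Lpe M p (u y) \<le> w y"
  shows "Lpe M p (\<lambda>x. \<integral>\<^sup>+y. u y x \<partial>N) \<le> (\<integral>\<^sup>+y. w y \<partial>N)"
proof -
  interpret M: sigma_finite_measure M by fact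
  interpret N: sigma_finite_measure N by fact
  interpret pair_sigma_finite N M ..
  have um[measurable]: "u y \<in> borel_measurable M" if "y \<in> space N" for y
    using that by measurable
  show ?thesis using p
  proof (cases rule: exponent_cases)
    case 1
    have "AE y in N. AE x in M. u y x \<le> w y"
    proof (rule AE_I2)
      fix y assume y: "y \<in> space N"
      show "AE x in M. u y x \<le> w y"
        using esssup_AE[of "u y" M] le[OF y] by (auto simp: 1 Lpe_infinity elim: eventually_mono)
    qed
    moreover have "{z \<in> space (N \<Otimes>\<^sub>M M). u (fst z) (snd z) \<le> w (fst z)} \<in> sets (N \<Otimes>\<^sub>M M)" by measurable
    ultimately have "AE x in M. AE y in N. u y x \<le> w y"
      using AE_commute[of "\<lambda>y x. u y x \<le> w y"] by simp
    then have "AE x in M. (\<integral>\<^sup>+y. u y x \<partial>N) \<le> (\<integral>\<^sup>+y. w y \<partial>N)"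
      by eventually_elim (rule nn_integral_mono_AE)
    then show ?thesis unfolding 1 Lpe_infinity by (intro esssup_I) auto
  next
    case (2 P)
    define A where "A = (\<integral>\<^sup>+y. w y \<partial>N)"
    have bound: "(\<integral>\<^sup>+x. epowr (u y x) P \<partial>M) \<le> epowr (w y) P" if "y \<in> space N" for y
    proof -
      have "epowr (epowr (\<integral>\<^sup>+x. epowr (u y x) P \<partial>M) (1 / P)) P \<le> epowr (w y) P"
        using le[OF that] 2 by (intro epowr_mono) (auto simp: Lpe_ennreal)
      then show ?thesis using 2 by (simp add: epowr_epowr)
    qed
    have main: "(\<integral>\<^sup>+x. epowr (\<integral>\<^sup>+y. u y x \<partial>N) P \<partial>M) \<le> epowr A P" if A: "A \<noteq> top"
    proof (cases "P = 1")
      case True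
      have "(\<integral>\<^sup>+x. (\<integral>\<^sup>+y. u y x \<partial>N) \<partial>M) = (\<integral>\<^sup>+y. (\<integral>\<^sup>+x. u y x \<partial>M) \<partial>N)"
        by (rule Fubini') measurable
      also have "\<dots> \<le> A" unfolding A_def by (rule nn_integral_mono) (use bound True in simp)
      finally show ?thesis using True by simp
    next
      case False
      then have P: "P > 1" using 2 by simp
      \<comment> \<open>Where \<open>w y = 0\<close>, the function \<open>u y\<close> vanishes almost everywhere, so that
        \<open>u y x = v y x * w y\<close>.\<close>
      define v where "v = (\<lambda>y x. if w y = 0 then 0 else u y x * inverse (w y))"
      have vm[measurable]: "(\<lambda>(y, x). v y x) \<in> borel_measurable (N \<Otimes>\<^sub>M M)" unfolding v_def by measurable
      have wfin: "AE y in N. w y \<noteq> top" using A unfolding A_def by (intro nn_integral_noteq_infinite[unfolded infinity_ennreal_def] w)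
      have "AE y in N. AE x in M. w y = 0 \<longrightarrow> u y x = 0"
      proof (rule AE_I2)
        fix y assume y: "y \<in> space N"
        show "AE x in M. w y = 0 \<longrightarrow> u y x = 0"
        proof (cases "w y = 0")
          case True
          then have "Lpe M p (u y) = 0" using le[OF y] by simp
          then show ?thesis using Lpe_zero_AE[OF p um[OF y]] by simp
        qed simp
      qed
      moreover have "{z \<in> space (N \<Otimes>\<^sub>M M). w (fst z) = 0 \<longrightarrow> u (fst z) (snd z) = 0} \<in> sets (N \<Otimes>\<^sub>M M)" by measurable
      ultimately have "AE x in M. AE y in N. w y = 0 \<longrightarrow> u y x = 0"
        using AE_commute[of "\<lambda>y x. w y = 0 \<longrightarrow> u y x = 0"] by simp
      then have "AE x in M. AE y in N. u y x = v y x * w y"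
      proof eventually_elim
        case (elim x)
        from elim wfin show ?case
        proof eventually_elim
          case (elim y)
          show ?case
          proof (cases "w y = 0")
            case False
            have "w y / w y = 1" using False elim by (intro ennreal_divide_self) (auto simp: less_top)
            then have "inverse (w y) * w y = 1" unfolding divide_ennreal_def by (simp only: mult.commute)
            then show ?thesis using False by (simp add: v_def mult.assoc)
          qed (use elim in simp)
        qed
      qed
      moreover have "AE x in M. x \<in> space M" by (rule AE_space)
      ultimately have "AE x in M. epowr (\<integral>\<^sup>+y. u y x \<partial>N) P \<le> (\<integral>\<^sup>+y. epowr (v y x) P * w y \<partial>N) * epowr A (P - 1)"
      proof eventually_elim
        case (elim x)
        note [measurable] = elim(2)
        have eq: "v y x * w y = epowr (epowr (v y x) P * w y) (1 / P) * epowr (w y) (1 - 1 / P)" for y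
          using P epowr_add[of "w y" "1 / P" "1 - 1 / P"] by (simp add: epowr_mult epowr_epowr mult.assoc)
        have "(\<integral>\<^sup>+y. u y x \<partial>N) = (\<integral>\<^sup>+y. epowr (epowr (v y x) P * w y) (1 / P) * epowr (w y) (1 - 1 / P) \<partial>N)"
          unfolding eq[symmetric] using elim(1) by (rule nn_integral_cong_AE)
        also have "\<dots> \<le> epowr (\<integral>\<^sup>+y. epowr (v y x) P * w y \<partial>N) (1 / P) * epowr A (1 - 1 / P)"
          unfolding A_def using P by (intro nn_integral_Holder) (auto simp: field_simps)
        finally have "epowr (\<integral>\<^sup>+y. u y x \<partial>N) P \<le> epowr (epowr (\<integral>\<^sup>+y. epowr (v y x) P * w y \<partial>N) (1 / P) * epowr A (1 - 1 / P)) P"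
          using P by (intro epowr_mono) auto
        also have "\<dots> = (\<integral>\<^sup>+y. epowr (v y x) P * w y \<partial>N) * epowr A (P - 1)"
          using P by (simp add: epowr_mult epowr_epowr left_diff_distrib)
        finally show ?case .
      qed
      then have E: "(\<integral>\<^sup>+x. epowr (\<integral>\<^sup>+y. u y x \<partial>N) P \<partial>M) \<le> (\<integral>\<^sup>+x. (\<integral>\<^sup>+y. epowr (v y x) P * w y \<partial>N) * epowr A (P - 1) \<partial>M)"
        by (rule nn_integral_mono_AE)
      have E2: "(\<integral>\<^sup>+x. (\<integral>\<^sup>+y. epowr (v y x) P * w y \<partial>N) * epowr A (P - 1) \<partial>M) = (\<integral>\<^sup>+x. (\<integral>\<^sup>+y. epowr (v y x) P * w y \<partial>N) \<partial>M) * epowr A (P - 1)"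
        by (rule nn_integral_multc) measurable
      have "(\<integral>\<^sup>+x. (\<integral>\<^sup>+y. epowr (v y x) P * w y \<partial>N) \<partial>M) = (\<integral>\<^sup>+y. (\<integral>\<^sup>+x. epowr (v y x) P * w y \<partial>M) \<partial>N)"
        by (rule Fubini') measurable
      also have "\<dots> \<le> A"
        unfolding A_def
      proof (rule nn_integral_mono)
        fix y assume y: "y \<in> space N"
        note [measurable] = um[OF y]
        show "(\<integral>\<^sup>+x. epowr (v y x) P * w y \<partial>M) \<le> w y"
        proof (cases "w y = 0")
          case False
          have "(\<integral>\<^sup>+x. epowr (v y x) P * w y \<partial>M) = (\<integral>\<^sup>+x. epowr (u y x) P \<partial>M) * (epowr (inverse (w y)) P * w y)"
            using False P by (simp add: v_def epowr_mult mult.assoc nn_integral_multc)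
          also have "\<dots> \<le> epowr (w y) P * (epowr (inverse (w y)) P * w y)"
            using bound[OF y] by (intro mult_right_mono) auto
          also have "\<dots> = epowr (w y * inverse (w y)) P * w y" using P by (simp add: epowr_mult mult.assoc)
          also have "\<dots> \<le> epowr 1 P * w y"
          proof (intro mult_right_mono epowr_mono)
            show "w y * inverse (w y) \<le> 1"
              using False ennreal_divide_self[of "w y"] by (cases "w y = top") (simp_all add: divide_ennreal_def[symmetric] less_top)
          qed (use P in auto)
          finally show ?thesis by simp
        qed simp
      qed
      finally have E3: "(\<integral>\<^sup>+x. (\<integral>\<^sup>+y. epowr (v y x) P * w y \<partial>N) \<partial>M) \<le> A" .
      have "(\<integral>\<^sup>+x. epowr (\<integral>\<^sup>+y. u y x \<partial>N) P \<partial>M) \<le> A * epowr A (P - 1)"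
        using E unfolding E2 by (rule order_trans) (rule mult_right_mono[OF E3], simp)
      also have "\<dots> = epowr A P" using epowr_add[of A 1 "P - 1"] by simp
      finally show ?thesis .
    qed
    show ?thesis
    proof (cases "A = top")
      case False
      have "epowr (\<integral>\<^sup>+x. epowr (\<integral>\<^sup>+y. u y x \<partial>N) P \<partial>M) (1 / P) \<le> epowr (epowr A P) (1 / P)"
        using main[OF False] 2 by (intro epowr_mono) auto
      then show ?thesis using 2 by (simp add: Lpe_ennreal epowr_epowr A_def)
    qed (simp add: A_def)
  qed
qed

corollary Lpe_count_sum:
  assumes sf: "sigma_finite_measure M" and p: "1 \<le> p" and I: "countable I"
    and meas: "\<And>i. i \<in> I \<Longrightarrow> u i \<in> borel_measurable M"
    and le: "\<And>i. i \<in> I \<Longrightarrow> Lpe M p (u i) \<le> w i"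
  shows "Lpe M p (\<lambda>x. \<integral>\<^sup>+i. u i x \<partial>count_space I) \<le> (\<integral>\<^sup>+i. w i \<partial>count_space I)"
proof (rule Lpe_Minkowski[OF sf sigma_finite_measure_count_space_countable[OF I] p])
  show "(\<lambda>(i, x). u i x) \<in> borel_measurable (count_space I \<Otimes>\<^sub>M M)"
    using meas by (intro measurable_pair_measure_countable1[OF I]) auto
qed (use le in auto)

corollary Lpe_sum:
  assumes sf: "sigma_finite_measure M" and p: "1 \<le> p" and I: "finite I"
    and meas: "\<And>i. i \<in> I \<Longrightarrow> u i \<in> borel_measurable M"
  shows "Lpe M p (\<lambda>x. \<Sum>i\<in>I. u i x) \<le> (\<Sum>i\<in>I. Lpe M p (u i))"
  using Lpe_count_sum[OF sf p countable_finite[OF I] meas order_refl] I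
  by (simp add: nn_integral_count_space_finite)

corollary Lpe_add:
  assumes sf: "sigma_finite_measure M" and p: "1 \<le> p"
    and meas: "u \<in> borel_measurable M" "v \<in> borel_measurable M"
  shows "Lpe M p (\<lambda>x. u x + v x) \<le> Lpe M p u + Lpe M p v"
  using Lpe_sum[OF sf p, of "{True, False}" "\<lambda>b. if b then u else v"] meas by simp

lemma Lpe_lborel_translate:
  fixes u :: "'a::euclidean_space \<Rightarrow> ennreal"
  assumes p: "1 \<le> p" and [measurable]: "u \<in> borel_measurable borel"
  shows "Lpe lborel p (\<lambda>x. u (x - y)) = Lpe lborel p u"
  using p
proof (cases rule: exponent_cases)
  case 1
  have le: "esssup lborel (\<lambda>x. v (x - z)) \<le> esssup lborel v" if [measurable]: "v \<in> borel_measurable borel"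
    for v :: "'a \<Rightarrow> ennreal" and z
  proof (rule esssup_I)
    show "AE x in lborel. v (x - z) \<le> esssup lborel v"
      using AE_lborel_affine[of 1 "\<lambda>x. v x \<le> esssup lborel v" "- z"] esssup_AE[of v lborel] by simp
  qed measurable
  have "esssup lborel (\<lambda>x. (\<lambda>x. u (x - y)) (x - - y)) \<le> esssup lborel (\<lambda>x. u (x - y))"
    by (rule le) measurable
  then show ?thesis unfolding 1 Lpe_infinity using le[of u y] by (intro antisym) auto
next
  case (2 P)
  have "(\<integral>\<^sup>+x. epowr (u (- y + x)) P \<partial>lborel) = (\<integral>\<^sup>+x. epowr (u x) P \<partial>lborel)"
    by (rule nn_integral_lborel_shift) measurable
  then show ?thesis using 2 by (simp add: Lpe_ennreal)
qed

lemmas sigma_finite_lborel = lborel.sigma_finite_measure_axioms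

text \<open>Minkowski's inequality for a superposition of translates of \<open>u\<close>.\<close>

theorem Lpe_Young:
  fixes u k :: "'a::euclidean_space \<Rightarrow> ennreal"
  assumes p: "1 \<le> p" and [measurable]: "u \<in> borel_measurable borel" "k \<in> borel_measurable borel"
  shows "Lpe lborel p (\<lambda>x. \<integral>\<^sup>+y. k y * u (x - y) \<partial>lborel) \<le> (\<integral>\<^sup>+y. k y \<partial>lborel) * Lpe lborel p u"
proof -
  have "Lpe lborel p (\<lambda>x. \<integral>\<^sup>+y. k y * u (x - y) \<partial>lborel) \<le> (\<integral>\<^sup>+y. k y * Lpe lborel p u \<partial>lborel)"
  proof (rule Lpe_Minkowski[OF sigma_finite_lborel sigma_finite_lborel p])
    show "(\<lambda>(y, x). k y * u (x - y)) \<in> borel_measurable (lborel \<Otimes>\<^sub>M lborel)" by measurable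
    show "Lpe lborel p (\<lambda>x. k y * u (x - y)) \<le> k y * Lpe lborel p u" for y
      using Lpe_cmult_le[OF p, of "\<lambda>x. u (x - y)" lborel "k y"] Lpe_lborel_translate[OF p, of u y] by simp
  qed measurable
  also have "\<dots> = (\<integral>\<^sup>+y. k y \<partial>lborel) * Lpe lborel p u" by (rule nn_integral_multc) measurable
  finally show ?thesis .
qed

section \<open>Sequence norms\<close>

lemma esssup_count_space:
  "esssup (count_space A) (a :: 'a \<Rightarrow> ennreal) = (SUP q\<in>A. a q)"
proof (rule antisym)
  show "esssup (count_space A) a \<le> (SUP q\<in>A. a q)"
    by (rule esssup_I) (auto simp: AE_count_space intro: SUP_upper)
  show "(SUP q\<in>A. a q) \<le> esssup (count_space A) a"
    using esssup_AE[of a "count_space A"] by (intro SUP_least) (auto simp: AE_count_space)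
qed

text \<open>
  Sequence norms are Lebesgue norms for the counting measure, which makes the inequalities
  above available.
\<close>

lemma lr_norm_eq_Lpe: "lr_norm r a = Lpe (count_space {-1..}) r a"
  by (simp add: lr_norm_def Lpe_def esssup_count_space)

lemma lr_norm_mono:
  assumes "1 \<le> r" "\<And>q. q \<ge> -1 \<Longrightarrow> a q \<le> b q" shows "lr_norm r a \<le> lr_norm r b"
  unfolding lr_norm_eq_Lpe using assms by (intro Lpe_mono_AE) (auto simp: AE_count_space)

lemma lr_norm_cmult_le: "1 \<le> r \<Longrightarrow> lr_norm r (\<lambda>q. c * a q) \<le> c * lr_norm r a"
  unfolding lr_norm_eq_Lpe by (rule Lpe_cmult_le) auto

lemma lr_norm_add: "1 \<le> r \<Longrightarrow> lr_norm r (\<lambda>q. a q + b q) \<le> lr_norm r a + lr_norm r b"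
  unfolding lr_norm_eq_Lpe
  by (rule Lpe_add[OF sigma_finite_measure_count_space_countable]) auto

lemma lr_norm_component:
  assumes r: "1 \<le> r" and q: "q \<ge> -1" shows "a q \<le> lr_norm r a"
  using r
proof (cases rule: exponent_cases)
  case 1 then show ?thesis using q by (auto simp: lr_norm_def infinity_ennreal_def intro: SUP_upper)
next
  case (2 P)
  have "epowr (a q) P = (\<integral>\<^sup>+x. epowr (a q) P * indicator {q} x \<partial>count_space {-1..})"
    using q by (subst nn_integral_cmult_indicator) auto
  also have "\<dots> \<le> (\<integral>\<^sup>+x. epowr (a x) P \<partial>count_space {-1..})"
    by (intro nn_integral_mono) (auto simp: indicator_def)
  finally have "epowr (epowr (a q) P) (1 / P) \<le> epowr (\<integral>\<^sup>+x. epowr (a x) P \<partial>count_space {-1..}) (1 / P)"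
    using 2 by (intro epowr_mono) auto
  then show ?thesis using 2 by (simp add: epowr_epowr lr_norm_def infinity_ennreal_def)
qed

lemma lr_norm_shift_le:
  assumes r: "1 \<le> r"
  shows "lr_norm r (\<lambda>q. if q - l \<ge> -1 then a (q - l) else 0) \<le> lr_norm r a"
  using r
proof (cases rule: exponent_cases)
  case 1
  have "(if q - l \<ge> -1 then a (q - l) else 0) \<le> (SUP q\<in>{-1..}. a q)" for q
    by (auto intro: SUP_upper)
  then have "(SUP q\<in>{-1..}. if q - l \<ge> -1 then a (q - l) else 0) \<le> (SUP q\<in>{-1..}. a q)"
    by (intro SUP_least)
  then show ?thesis unfolding lr_norm_def infinity_ennreal_def using 1 by (simp only: simp_thms if_True)
next
  case (2 P)
  have "(\<integral>\<^sup>+q. epowr (if q - l \<ge> -1 then a (q - l) else 0) P \<partial>count_space {-1..}) \<le>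
      (\<integral>\<^sup>+q. epowr (if q - l \<ge> -1 then a (q - l) else 0) P \<partial>count_space UNIV)"
    by (subst nn_integral_count_space_indicator) (auto intro!: nn_integral_mono simp: indicator_def)
  also have "\<dots> = (\<integral>\<^sup>+q. epowr (if q \<ge> -1 then a q else 0) P \<partial>count_space UNIV)"
    using nn_integral_bij_count_space[of "\<lambda>q. q - l" UNIV UNIV "\<lambda>q. epowr (if q \<ge> -1 then a q else 0) P"]
      bij_betw_byWitness[of UNIV "\<lambda>q. q + l" "\<lambda>q. q - l" UNIV] by simp
  also have "\<dots> = (\<integral>\<^sup>+q. epowr (a q) P \<partial>count_space {-1..})"
  proof -
    have "(\<integral>\<^sup>+q. epowr (a q) P \<partial>count_space {-1..}) = (\<integral>\<^sup>+q. epowr (if q \<ge> -1 then a q else 0) P \<partial>count_space {-1..})"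
      by (rule nn_integral_cong) auto
    also have "\<dots> = (\<integral>\<^sup>+q. epowr (if q \<ge> -1 then a q else 0) P \<partial>count_space UNIV)"
      by (rule nn_integral_count_space_eq) auto
    finally show ?thesis ..
  qed
  finally show ?thesis using 2 by (simp add: lr_norm_def infinity_ennreal_def epowr_mono)
qed

text \<open>Minkowski's inequality for a superposition of shifts, as for functions.\<close>

theorem lr_norm_convolution:
  assumes r: "1 \<le> r"
  shows "lr_norm r (\<lambda>q. \<integral>\<^sup>+l. W l * (if q - l \<ge> -1 then a (q - l) else 0) \<partial>count_space UNIV)
    \<le> (\<integral>\<^sup>+l. W l \<partial>count_space UNIV) * lr_norm r a"
proof -
  have "lr_norm r (\<lambda>q. \<integral>\<^sup>+l. W l * (if q - l \<ge> -1 then a (q - l) else 0) \<partial>count_space UNIV)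
      \<le> (\<integral>\<^sup>+l. W l * lr_norm r a \<partial>count_space UNIV)"
    unfolding lr_norm_eq_Lpe
  proof (rule Lpe_count_sum[OF sigma_finite_measure_count_space_countable r])
    show "Lpe (count_space {-1..}) r (\<lambda>q. W l * (if q - l \<ge> -1 then a (q - l) else 0)) \<le> W l * Lpe (count_space {-1..}) r a" for l
      unfolding lr_norm_eq_Lpe[symmetric]
      by (rule order_trans[OF lr_norm_cmult_le[OF r] mult_left_mono[OF lr_norm_shift_le[OF r]]]) auto
  qed auto
  also have "\<dots> = (\<integral>\<^sup>+l. W l \<partial>count_space UNIV) * lr_norm r a" by (rule nn_integral_multc) auto
  finally show ?thesis .
qed

section \<open>Vector-valued norms\<close>

definition vec_norm :: "'i set \<Rightarrow> ('i \<Rightarrow> 'a \<Rightarrow> complex) \<Rightarrow> 'a \<Rightarrow> real"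
  where "vec_norm I F x = L2_set (\<lambda>i. norm (F i x)) I"

definition Lpn :: "ennreal \<Rightarrow> 'i set \<Rightarrow> ('i \<Rightarrow> real^'n \<Rightarrow> complex) \<Rightarrow> ennreal"
  where "Lpn p I F = Lpe lborel p (\<lambda>x. ennreal (vec_norm I F x))"

lemma vec_norm_nonneg [simp]: "vec_norm I F x \<ge> 0"
  by (simp add: vec_norm_def)

lemma vec_norm_measurable:
  assumes "\<And>i. i \<in> I \<Longrightarrow> F i \<in> borel_measurable M"
  shows "vec_norm I F \<in> borel_measurable M"
proof -
  have [measurable]: "(\<lambda>x. \<Sum>i\<in>I. (norm (F i x))\<^sup>2) \<in> borel_measurable M"
  proof (rule borel_measurable_sum)
    fix i assume "i \<in> I"
    note [measurable] = assms[OF this]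
    show "(\<lambda>x. (norm (F i x))\<^sup>2) \<in> borel_measurable M" by measurable
  qed
  show ?thesis unfolding vec_norm_def[abs_def] L2_set_def by measurable
qed

lemma ennreal_vec_norm_measurable:
  assumes "\<And>i. i \<in> I \<Longrightarrow> F i \<in> borel_measurable M"
  shows "(\<lambda>x. ennreal (vec_norm I F x)) \<in> borel_measurable M"
  using vec_norm_measurable[OF assms] by measurable

lemma norm_le_vec_norm: "finite I \<Longrightarrow> i \<in> I \<Longrightarrow> norm (F i x) \<le> vec_norm I F x"
  unfolding vec_norm_def using member_le_L2_set[of I i "\<lambda>i. norm (F i x)"] by simp

lemma L2_set_subset:
  assumes "finite B" "A \<subseteq> B" shows "L2_set f A \<le> L2_set f B"
  unfolding L2_set_def using assms by (intro real_sqrt_le_mono sum_mono2) auto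

text \<open>
  Pairing the integral with its own value \<open>v\<close>, of length \<open>S\<close>, gives \<open>S\<^sup>2 \<le> S R\<close> by
  the Cauchy-Schwarz inequality under the integral.
\<close>

lemma L2_set_integral_le:
  fixes h :: "'i \<Rightarrow> 'a \<Rightarrow> complex"
  assumes I: "finite I" and meas: "\<And>i. i \<in> I \<Longrightarrow> h i \<in> borel_measurable N"
  shows "ennreal (L2_set (\<lambda>i. norm (LINT y|N. h i y)) I) \<le> (\<integral>\<^sup>+y. ennreal (L2_set (\<lambda>i. norm (h i y)) I) \<partial>N)"
proof -
  \<comment> \<open>The integral of a function that is not integrable is \<open>0\<close> by convention, so that such components
    drop out.\<close>
  define J where "J = {i\<in>I. integrable N (h i)}"
  have J: "finite J" "J \<subseteq> I" using I by (auto simp: J_def)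
  define v where "v = (\<lambda>i. LINT y|N. h i y)"
  have v0: "v i = 0" if "i \<in> I - J" for i using that by (auto simp: v_def J_def not_integrable_integral_eq)
  define S where "S = L2_set (\<lambda>i. norm (v i)) J"
  have LS: "L2_set (\<lambda>i. norm (v i)) I = S"
    unfolding S_def L2_set_def using v0 J I by (intro arg_cong[where f=sqrt] sum.mono_neutral_right) auto
  have S0: "S \<ge> 0" by (simp add: S_def)
  define R where "R = (\<integral>\<^sup>+y. ennreal (L2_set (\<lambda>i. norm (h i y)) J) \<partial>N)"
  have "ennreal S * ennreal S \<le> ennreal S * R"
  proof -
    have i1: "integrable N (\<lambda>y. cnj (v i) * h i y)" if "i \<in> J" for i
      using that by (auto simp: J_def)
    have "S * S = (\<Sum>i\<in>J. (norm (v i))\<^sup>2)"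
      unfolding S_def L2_set_def power2_eq_square[symmetric] by (rule real_sqrt_pow2) (simp add: sum_nonneg)
    then have "complex_of_real (S * S) = (\<Sum>i\<in>J. cnj (v i) * v i)"
      by (simp add: complex_norm_square[symmetric] mult.commute[of "cnj _"])
    also have "\<dots> = (\<Sum>i\<in>J. LINT y|N. cnj (v i) * h i y)"
    proof (rule sum.cong[OF refl])
      fix i assume "i \<in> J"
      show "cnj (v i) * v i = (LINT y|N. cnj (v i) * h i y)"
        unfolding integral_mult_right_zero v_def ..
    qed
    also have "\<dots> = (LINT y|N. (\<Sum>i\<in>J. cnj (v i) * h i y))"
      using i1 by (intro Bochner_Integration.integral_sum[symmetric]) auto
    finally have eq: "complex_of_real (S * S) = (LINT y|N. (\<Sum>i\<in>J. cnj (v i) * h i y))" .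
    have "ennreal S * ennreal S = ennreal (norm (complex_of_real (S * S)))"
      using S0 by (simp add: ennreal_mult norm_mult)
    also have "\<dots> \<le> (\<integral>\<^sup>+y. ennreal (norm (\<Sum>i\<in>J. cnj (v i) * h i y)) \<partial>N)"
      unfolding eq using i1 by (intro integral_norm_bound_ennreal Bochner_Integration.integrable_sum) auto
    also have "\<dots> \<le> (\<integral>\<^sup>+y. ennreal S * ennreal (L2_set (\<lambda>i. norm (h i y)) J) \<partial>N)"
    proof (rule nn_integral_mono)
      fix y
      have "norm (\<Sum>i\<in>J. cnj (v i) * h i y) \<le> (\<Sum>i\<in>J. \<bar>norm (v i)\<bar> * \<bar>norm (h i y)\<bar>)"
        by (rule order_trans[OF norm_sum]) (simp add: norm_mult)
      also have "\<dots> \<le> S * L2_set (\<lambda>i. norm (h i y)) J" unfolding S_def by (rule L2_set_mult_ineq)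
      finally show "ennreal (norm (\<Sum>i\<in>J. cnj (v i) * h i y)) \<le> ennreal S * ennreal (L2_set (\<lambda>i. norm (h i y)) J)"
        using S0 by (simp add: ennreal_mult[symmetric] ennreal_leI)
    qed
    also have "\<dots> = ennreal S * R"
      unfolding R_def
    proof (rule nn_integral_cmult)
      have "\<And>i. i \<in> J \<Longrightarrow> h i \<in> borel_measurable N" using meas J by auto
      then show "(\<lambda>y. ennreal (L2_set (\<lambda>i. norm (h i y)) J)) \<in> borel_measurable N"
        using ennreal_vec_norm_measurable[of J h N] by (simp add: vec_norm_def)
    qed
    finally show ?thesis .
  qed
  then have "ennreal S \<le> R"
  proof (cases "S = 0")
    case False
    then have "ennreal S \<noteq> 0" "ennreal S \<noteq> top" using S0 by auto
    then show ?thesis using \<open>ennreal S * ennreal S \<le> ennreal S * R\<close>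
      by (subst (asm) ennreal_mult_le_mult_iff) (auto simp: less_le)
  qed simp
  also have "R \<le> (\<integral>\<^sup>+y. ennreal (L2_set (\<lambda>i. norm (h i y)) I) \<partial>N)"
    unfolding R_def by (intro nn_integral_mono ennreal_leI L2_set_subset I J)
  finally show ?thesis using LS by (simp add: v_def)
qed

lemma Lpn_mono_pointwise:
  assumes "1 \<le> p" "\<And>i. i \<in> I \<Longrightarrow> F i \<in> borel_measurable lborel" "\<And>x. ennreal (vec_norm I F x) \<le> u x"
  shows "Lpn p I F \<le> Lpe lborel p u"
  unfolding Lpn_def using assms by (intro Lpe_mono ennreal_vec_norm_measurable)

text \<open>
  Stated separately because it serves two estimates: Young's inequality and Bernstein's.
\<close>

lemma Lpn_conv_pointwise:
  fixes k :: "real^'n \<Rightarrow> complex"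
  assumes p: "1 \<le> p" and I: "finite I" and k: "rapid k" and F: "\<And>i. i \<in> I \<Longrightarrow> tempered_fun (F i)"
  shows "Lpn p I (\<lambda>i. conv k (F i)) \<le> Lpe lborel p (\<lambda>x. \<integral>\<^sup>+y. ennreal (norm (k y)) * ennreal (vec_norm I F (x - y)) \<partial>lborel)"
proof -
  have km[measurable]: "k \<in> borel_measurable borel" by (rule rapid_measurable[OF k])
  have Fm: "F i \<in> borel_measurable borel" if "i \<in> I" for i by (rule tempered_measurable[OF F[OF that]])
  show ?thesis
  proof (rule Lpn_mono_pointwise[OF p])
    fix i assume "i \<in> I" then show "conv k (F i) \<in> borel_measurable lborel"
      using conv_measurable[OF km Fm] by simp
  next
    fix x
    have m: "(\<lambda>y. k y * F i (x - y)) \<in> borel_measurable lborel" if "i \<in> I" for i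
    proof -
      note [measurable] = Fm[OF that]
      show ?thesis by measurable
    qed
    have "ennreal (vec_norm I (\<lambda>i. conv k (F i)) x) \<le> (\<integral>\<^sup>+y. ennreal (L2_set (\<lambda>i. norm (k y * F i (x - y))) I) \<partial>lborel)"
      unfolding vec_norm_def conv_commute by (rule L2_set_integral_le[OF I m])
    also have "\<dots> = (\<integral>\<^sup>+y. ennreal (norm (k y)) * ennreal (vec_norm I F (x - y)) \<partial>lborel)"
      unfolding vec_norm_def norm_mult by (simp add: L2_set_right_distrib[symmetric] ennreal_mult)
    finally show "ennreal (vec_norm I (\<lambda>i. conv k (F i)) x) \<le> (\<integral>\<^sup>+y. ennreal (norm (k y)) * ennreal (vec_norm I F (x - y)) \<partial>lborel)" .
  qed
qed

lemma Lpn_conv: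
  fixes k :: "real^'n \<Rightarrow> complex"
  assumes p: "1 \<le> p" and I: "finite I" and k: "rapid k" and F: "\<And>i. i \<in> I \<Longrightarrow> tempered_fun (F i)"
  shows "Lpn p I (\<lambda>i. conv k (F i)) \<le> (\<integral>\<^sup>+y. ennreal (norm (k y)) \<partial>lborel) * Lpn p I F"
proof (rule order_trans[OF Lpn_conv_pointwise[OF p I k F]])
  have km[measurable]: "k \<in> borel_measurable borel" by (rule rapid_measurable[OF k])
  have [measurable]: "vec_norm I F \<in> borel_measurable borel" by (rule vec_norm_measurable[OF tempered_measurable[OF F]])
  show "Lpe lborel p (\<lambda>x. \<integral>\<^sup>+y. ennreal (norm (k y)) * ennreal (vec_norm I F (x - y)) \<partial>lborel) \<le> (\<integral>\<^sup>+y. ennreal (norm (k y)) \<partial>lborel) * Lpn p I F"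
    unfolding Lpn_def by (rule Lpe_Young[OF p]) measurable
qed

section \<open>Commutators with differentiable functions\<close>

text \<open>
  The fundamental theorem of calculus along the segment from \<open>x - y\<close> to \<open>x\<close>. An integral over
  the segment, unlike a supremum, has the right \<open>L\<^sup>p\<close> norm by Minkowski's inequality.
\<close>

lemma difference_le_line_integral:
  fixes a :: "real^'n \<Rightarrow> complex"
  assumes diff: "\<And>x. a differentiable (at x)" and cont: "\<And>j. continuous_on UNIV (pd j a)"
  shows "ennreal (norm (a x - a (x - y))) \<le>
    ennreal (norm y) * (\<integral>\<^sup>+t. ennreal (vec_norm UNIV (\<lambda>j. pd j a) (x - t *\<^sub>R y)) * indicator {0..1} t \<partial>lborel)"
proof -
  define \<phi> where "\<phi> = (\<lambda>t::real. a (x - t *\<^sub>R y))"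
  define \<phi>' where "\<phi>' = (\<lambda>t::real. \<Sum>j\<in>UNIV. (- y $ j) *\<^sub>R pd j a (x - t *\<^sub>R y))"
  have contp: "continuous_on S (\<lambda>t. pd j a (x - t *\<^sub>R y))" for j S
    by (rule continuous_on_compose2[OF cont]) (auto intro!: continuous_intros)
  have D: "(\<phi> has_vector_derivative \<phi>' t) (at t)" for t
  proof -
    have "((\<lambda>t. x - t *\<^sub>R y) has_derivative (\<lambda>h. - (h *\<^sub>R y))) (at t)"
      by (auto intro!: derivative_eq_intros)
    from diff_chain_at[OF this frechet_derivative_eq_sum_pd[OF diff]]
    have "(\<phi> has_derivative (\<lambda>h. \<Sum>j\<in>UNIV. (- (h *\<^sub>R y) $ j) *\<^sub>R pd j a (x - t *\<^sub>R y))) (at t)"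
      by (simp add: o_def \<phi>_def)
    moreover have "(\<lambda>h. \<Sum>j\<in>UNIV. (- (h *\<^sub>R y) $ j) *\<^sub>R pd j a (x - t *\<^sub>R y)) = (\<lambda>h. h *\<^sub>R \<phi>' t)"
      by (simp add: \<phi>'_def scaleR_sum_right mult_ac fun_eq_iff)
    ultimately show ?thesis by (simp add: has_vector_derivative_def)
  qed
  have "continuous_on {0..1} \<phi>'" unfolding \<phi>'_def by (intro continuous_intros contp)
  then have B: "has_bochner_integral lborel (\<lambda>t. indicator {0..1} t *\<^sub>R \<phi>' t) (\<phi> 1 - \<phi> 0)"
    by (intro has_bochner_integral_FTC_Icc has_vector_derivative_at_within[OF D]) auto
  then have i: "integrable lborel (\<lambda>t. indicator {0..1} t *\<^sub>R \<phi>' t)" and e: "(LINT t|lborel. indicator {0..1} t *\<^sub>R \<phi>' t) = \<phi> 1 - \<phi> 0"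
    by (auto simp: has_bochner_integral_iff)
  have pow2: "norm (\<phi>' t) \<le> norm y * vec_norm UNIV (\<lambda>j. pd j a) (x - t *\<^sub>R y)" for t
  proof -
    have "norm (\<phi>' t) \<le> (\<Sum>j\<in>UNIV. \<bar>y $ j\<bar> * \<bar>norm (pd j a (x - t *\<^sub>R y))\<bar>)"
      unfolding \<phi>'_def by (rule order_trans[OF norm_sum]) simp
    also have "\<dots> \<le> L2_set (\<lambda>j. y $ j) UNIV * vec_norm UNIV (\<lambda>j. pd j a) (x - t *\<^sub>R y)"
      unfolding vec_norm_def by (rule L2_set_mult_ineq)
    also have "L2_set (\<lambda>j. y $ j) UNIV = norm y" by (simp add: norm_vec_def L2_set_def)
    finally show ?thesis .
  qed
  have vc: "continuous_on UNIV (vec_norm UNIV (\<lambda>j. pd j a))"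
    unfolding vec_norm_def[abs_def] L2_set_def by (intro continuous_intros cont)
  have [measurable]: "vec_norm UNIV (\<lambda>j. pd j a) \<in> borel_measurable borel" by (rule borel_measurable_continuous_onI[OF vc])
  have "ennreal (norm (a x - a (x - y))) = ennreal (norm (\<phi> 1 - \<phi> 0))"
    by (simp add: \<phi>_def norm_minus_commute)
  also have "\<dots> \<le> (\<integral>\<^sup>+t. ennreal (norm (indicator {0..1} t *\<^sub>R \<phi>' t)) \<partial>lborel)"
    unfolding e[symmetric] by (rule integral_norm_bound_ennreal[OF i])
  also have "\<dots> \<le> (\<integral>\<^sup>+t. ennreal (norm y) * (ennreal (vec_norm UNIV (\<lambda>j. pd j a) (x - t *\<^sub>R y)) * indicator {0..1} t) \<partial>lborel)"
  proof (rule nn_integral_mono)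
    fix t :: real
    show "ennreal (norm (indicator {0..1} t *\<^sub>R \<phi>' t)) \<le> ennreal (norm y) * (ennreal (vec_norm UNIV (\<lambda>j. pd j a) (x - t *\<^sub>R y)) * indicator {0..1} t)"
    proof (cases "t \<in> {0..1}")
      case True
      then show ?thesis using ennreal_leI[OF pow2[of t]] by (simp add: ennreal_mult)
    next
      case False
      then have "indicator {0..1} t = (0::real)" by (auto simp: indicator_def)
      then show ?thesis by simp
    qed
  qed
  also have "\<dots> = ennreal (norm y) * (\<integral>\<^sup>+t. ennreal (vec_norm UNIV (\<lambda>j. pd j a) (x - t *\<^sub>R y)) * indicator {0..1} t \<partial>lborel)"
    by (rule nn_integral_cmult) measurable
  finally show ?thesis .
qed

text \<open>
  The gain of the commutator: \<open>a x - a (x - y)\<close> is bounded by \<open>\<bar>y\<bar>\<close> times an average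
  of translates of the gradient of \<open>a\<close>. Minkowski's inequality in \<open>y\<close> and in the segment
  parameter \<open>t\<close> reduces the claim to Hoelder's inequality for translates, whose norms do not
  depend on \<open>y\<close> and \<open>t\<close>.
\<close>

theorem Lpn_commutator:
  fixes a k :: "real^'n \<Rightarrow> complex"
  assumes p: "1 \<le> p" "1 \<le> p1" "1 \<le> p2" "1 / p = 1 / p1 + 1 / p2" and I: "finite I"
    and diff: "\<And>x. a differentiable (at x)" and cont: "\<And>j. continuous_on UNIV (pd j a)"
    and km[measurable]: "k \<in> borel_measurable borel" and bm: "\<And>i. i \<in> I \<Longrightarrow> b i \<in> borel_measurable borel"
  shows "Lpn p I (\<lambda>i x. LINT y|lborel. k y * (a x - a (x - y)) * b i (x - y)) \<le>
    (\<integral>\<^sup>+y. ennreal (norm y * norm (k y)) \<partial>lborel) * (Lpn p1 UNIV (\<lambda>j. pd j a) * Lpn p2 I b)"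
proof -
  have ac: "continuous_on UNIV a"
    using diff by (meson continuous_at_imp_continuous_on differentiable_imp_continuous_within)
  have am[measurable]: "a \<in> borel_measurable borel" by (rule borel_measurable_continuous_onI[OF ac])
  define D where "D = vec_norm UNIV (\<lambda>j. pd j a)"
  have [measurable]: "D \<in> borel_measurable borel" unfolding D_def
    by (rule vec_norm_measurable) (rule borel_measurable_continuous_onI[OF cont])
  define B where "B = vec_norm I b"
  have [measurable]: "B \<in> borel_measurable borel" unfolding B_def by (rule vec_norm_measurable[OF bm])
  have nn: "D x \<ge> 0" "B x \<ge> 0" for x by (simp_all add: D_def B_def)
  define Q where "Q = Lpn p1 UNIV (\<lambda>j. pd j a) * Lpn p2 I b"
  define L where "L = (\<lambda>y x. (\<integral>\<^sup>+t. ennreal (D (x - t *\<^sub>R y)) * indicator {0..1} t \<partial>lborel) * ennreal (B (x - y)))"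
  have Lm[measurable]: "(\<lambda>(y, x). L y x) \<in> borel_measurable (borel \<Otimes>\<^sub>M borel)"
    unfolding L_def by measurable
  have Lb: "Lpe lborel p (L y) \<le> Q" for y
  proof -
    have "L y = (\<lambda>x. \<integral>\<^sup>+t. (ennreal (D (x - t *\<^sub>R y)) * ennreal (B (x - y))) * indicator {0..1} t \<partial>lborel)"
      unfolding L_def by (subst nn_integral_multc[symmetric]) (auto simp: mult_ac)
    moreover have "Lpe lborel p (\<lambda>x. \<integral>\<^sup>+t. (ennreal (D (x - t *\<^sub>R y)) * ennreal (B (x - y))) * indicator {0..1} t \<partial>lborel)
        \<le> (\<integral>\<^sup>+t. Q * indicator {0..1} t \<partial>(lborel :: real measure))"
    proof (rule Lpe_Minkowski[OF sigma_finite_lborel sigma_finite_lborel p(1)])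
      show "(\<lambda>(t, x). (ennreal (D (x - t *\<^sub>R y)) * ennreal (B (x - y))) * indicator {0..1} t) \<in> borel_measurable ((lborel :: real measure) \<Otimes>\<^sub>M lborel)"
        by measurable
      fix t :: real
      have first: "Lpe lborel p (\<lambda>x. indicator {0..1} t * (ennreal (D (x - t *\<^sub>R y)) * ennreal (B (x - y)))) \<le>
          indicator {0..1} t * Lpe lborel p (\<lambda>x. ennreal (D (x - t *\<^sub>R y)) * ennreal (B (x - y)))"
        by (rule Lpe_cmult_le[OF p(1)]) measurable
      have "Lpe lborel p (\<lambda>x. ennreal (D (x - t *\<^sub>R y)) * ennreal (B (x - y))) \<le>
          Lpe lborel p1 (\<lambda>x. ennreal (D (x - t *\<^sub>R y))) * Lpe lborel p2 (\<lambda>x. ennreal (B (x - y)))"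
        by (rule Lpe_Holder[OF p]) measurable
      also have "\<dots> = Q"
        using Lpe_lborel_translate[OF p(2), of "\<lambda>x. ennreal (D x)" "t *\<^sub>R y"] Lpe_lborel_translate[OF p(3), of "\<lambda>x. ennreal (B x)" y]
        by (simp add: Q_def Lpn_def D_def[symmetric] B_def[symmetric])
      finally have "indicator {0..1} t * Lpe lborel p (\<lambda>x. ennreal (D (x - t *\<^sub>R y)) * ennreal (B (x - y))) \<le> indicator {0..1} t * Q"
        by (rule mult_left_mono) simp
      with first have "Lpe lborel p (\<lambda>x. indicator {0..1} t * (ennreal (D (x - t *\<^sub>R y)) * ennreal (B (x - y)))) \<le> indicator {0..1} t * Q"
        by (rule order_trans)
      then show "Lpe lborel p (\<lambda>x. (ennreal (D (x - t *\<^sub>R y)) * ennreal (B (x - y))) * indicator {0..1} t) \<le> Q * indicator {0..1} t"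
        by (simp only: mult.commute)
    qed measurable
    moreover have "(\<integral>\<^sup>+t. Q * indicator {0..1} t \<partial>(lborel :: real measure)) = Q"
      by (simp add: nn_integral_cmult)
    ultimately show ?thesis by simp
  qed
  have "Lpn p I (\<lambda>i x. LINT y|lborel. k y * (a x - a (x - y)) * b i (x - y)) \<le>
      Lpe lborel p (\<lambda>x. \<integral>\<^sup>+y. ennreal (norm y * norm (k y)) * L y x \<partial>lborel)"
  proof (rule Lpn_mono_pointwise[OF p(1)])
    fix i assume "i \<in> I"
    note [measurable] = bm[OF this]
    show "(\<lambda>x. LINT y|lborel. k y * (a x - a (x - y)) * b i (x - y)) \<in> borel_measurable lborel" by measurable
  next
    fix x
    have m: "(\<lambda>y. k y * (a x - a (x - y)) * b i (x - y)) \<in> borel_measurable lborel" if "i \<in> I" for i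
    proof -
      note [measurable] = bm[OF that]
      show ?thesis by measurable
    qed
    have "ennreal (vec_norm I (\<lambda>i x. LINT y|lborel. k y * (a x - a (x - y)) * b i (x - y)) x) \<le>
        (\<integral>\<^sup>+y. ennreal (L2_set (\<lambda>i. norm (k y * (a x - a (x - y)) * b i (x - y))) I) \<partial>lborel)"
      unfolding vec_norm_def by (rule L2_set_integral_le[OF I m])
    also have "\<dots> \<le> (\<integral>\<^sup>+y. ennreal (norm y * norm (k y)) * L y x \<partial>lborel)"
    proof (rule nn_integral_mono)
      fix y
      define T where "T = (\<integral>\<^sup>+t. ennreal (D (x - t *\<^sub>R y)) * indicator {0..1} t \<partial>lborel)"
      have d: "ennreal (norm (a x - a (x - y))) \<le> ennreal (norm y) * T"
        unfolding T_def D_def by (rule difference_le_line_integral[OF diff cont])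
      have "L2_set (\<lambda>i. norm (k y * (a x - a (x - y)) * b i (x - y))) I = norm (k y) * norm (a x - a (x - y)) * B (x - y)"
        unfolding B_def vec_norm_def norm_mult by (simp add: L2_set_right_distrib)
      then have "ennreal (L2_set (\<lambda>i. norm (k y * (a x - a (x - y)) * b i (x - y))) I) =
          ennreal (norm (k y)) * ennreal (norm (a x - a (x - y))) * ennreal (B (x - y))"
        by (simp add: ennreal_mult nn)
      also have "\<dots> \<le> ennreal (norm (k y)) * (ennreal (norm y) * T) * ennreal (B (x - y))"
        by (intro mult_right_mono mult_left_mono d) auto
      also have "\<dots> = ennreal (norm y * norm (k y)) * L y x"
      proof -
        have "L y x = T * ennreal (B (x - y))" by (simp only: L_def T_def)
        then show ?thesis by (simp add: ennreal_mult mult_ac)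
      qed
      finally show "ennreal (L2_set (\<lambda>i. norm (k y * (a x - a (x - y)) * b i (x - y))) I) \<le> ennreal (norm y * norm (k y)) * L y x" .
    qed
    finally show "ennreal (vec_norm I (\<lambda>i x. LINT y|lborel. k y * (a x - a (x - y)) * b i (x - y)) x) \<le> (\<integral>\<^sup>+y. ennreal (norm y * norm (k y)) * L y x \<partial>lborel)" .
  qed
  also have "\<dots> \<le> (\<integral>\<^sup>+y. ennreal (norm y * norm (k y)) * Q \<partial>lborel)"
  proof (rule Lpe_Minkowski[OF sigma_finite_lborel sigma_finite_lborel p(1)])
    show "(\<lambda>(y, x). ennreal (norm y * norm (k y)) * L y x) \<in> borel_measurable (lborel \<Otimes>\<^sub>M lborel)" by measurable
    fix y :: "real^'n"
    have "Lpe lborel p (\<lambda>x. ennreal (norm y * norm (k y)) * L y x) \<le> ennreal (norm y * norm (k y)) * Lpe lborel p (L y)"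
    proof (rule Lpe_cmult_le[OF p(1)])
      show "L y \<in> borel_measurable lborel" using measurable_Pair2[OF Lm, of y] by simp
    qed
    also have "\<dots> \<le> ennreal (norm y * norm (k y)) * Q" by (rule mult_left_mono[OF Lb]) simp
    finally show "Lpe lborel p (\<lambda>x. ennreal (norm y * norm (k y)) * L y x) \<le> ennreal (norm y * norm (k y)) * Q" .
  qed measurable
  also have "\<dots> = (\<integral>\<^sup>+y. ennreal (norm y * norm (k y)) \<partial>lborel) * Q"
    by (rule nn_integral_multc) measurable
  finally show ?thesis unfolding Q_def .
qed

section \<open>Lebesgue spaces and tempered functions\<close>

lemma Lpe_finite_AE:
  assumes p: "1 \<le> p" and [measurable]: "u \<in> borel_measurable M" and fin: "Lpe M p u < top"
  shows "AE x in M. u x < top"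
  using p
proof (cases rule: exponent_cases)
  case 1
  then show ?thesis using fin esssup_AE[of u M] unfolding 1 Lpe_infinity
    by (auto elim!: eventually_mono)
next
  case (2 P)
  then have "(\<integral>\<^sup>+x. epowr (u x) P \<partial>M) \<noteq> top" using fin by (auto simp: Lpe_ennreal)
  then have "AE x in M. epowr (u x) P \<noteq> top"
    by (intro nn_integral_noteq_infinite[unfolded infinity_ennreal_def]) measurable
  then show ?thesis by (simp add: less_top[symmetric])
qed

text \<open>
  Since the weight is at most \<open>1\<close>, the product is at most the weight where \<open>u \<le> 1\<close> and at
  most \<open>epowr (u x) P\<close> where \<open>u > 1\<close>.
\<close>

lemma Lpe_weighted_integral:
  fixes u :: "real^'n \<Rightarrow> ennreal"
  assumes p: "1 \<le> p" and um[measurable]: "u \<in> borel_measurable borel" and fin: "Lpe lborel p u < top"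
  shows "(\<integral>\<^sup>+x. u x * ennreal (1 / (1 + norm x) ^ (2 * CARD('n))) \<partial>lborel) < top"
proof -
  let ?w = "\<lambda>x::real^'n. 1 / (1 + norm x) ^ (2 * CARD('n))"
  have w0: "?w x \<ge> 0" for x by simp
  have w1: "?w x \<le> 1" for x 
  proof -
    have "1 \<le> (1 + norm x) ^ (2 * CARD('n))" by (rule one_le_power) simp
    moreover have "0 < (1 + norm x) ^ (2 * CARD('n))" by (intro zero_less_power add_pos_nonneg) auto
    ultimately show ?thesis by (simp add: pos_divide_le_eq)
  qed
  have iw: "(\<integral>\<^sup>+x. ennreal (?w x) \<partial>lborel) < top"
  proof -
    have "(\<integral>\<^sup>+x. ennreal (?w x) \<partial>lborel) = ennreal (LINT x|lborel. ?w x)"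
      by (rule nn_integral_eq_integral[OF integrable_inverse_weight[OF order_refl]]) simp
    then show ?thesis by (simp only: ennreal_less_top)
  qed
  show ?thesis using p
  proof (cases rule: exponent_cases)
    case 1
    have "(\<integral>\<^sup>+x. u x * ennreal (?w x) \<partial>lborel) \<le> (\<integral>\<^sup>+x. esssup lborel u * ennreal (?w x) \<partial>lborel)"
      using esssup_AE[of u lborel] by (intro nn_integral_mono_AE) (auto elim!: eventually_mono intro: mult_right_mono)
    also have "\<dots> = esssup lborel u * (\<integral>\<^sup>+x. ennreal (?w x) \<partial>lborel)" by (rule nn_integral_cmult) measurable
    also have "\<dots> < top" using fin iw unfolding 1 Lpe_infinity by (simp add: ennreal_mult_less_top)
    finally show ?thesis .
  next
    case (2 P)
    have le: "u x * ennreal (?w x) \<le> ennreal (?w x) + epowr (u x) P" for x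
    proof (cases "u x \<le> 1")
      case True
      then have "u x * ennreal (?w x) \<le> 1 * ennreal (?w x)" by (intro mult_right_mono) auto
      then show ?thesis by (simp add: add_increasing2)
    next
      case False
      have "u x * ennreal (?w x) \<le> u x * 1" using w1[of x] by (intro mult_left_mono) (auto simp: ennreal_le_1)
      also have "u x \<le> epowr (u x) P"
      proof (cases "u x")
        case (real r)
        with False have "r \<ge> 1" by (simp add: ennreal_le_1)
        then have "r powr 1 \<le> r powr P" using 2 by (intro powr_mono) auto
        then show ?thesis using real \<open>r \<ge> 1\<close> by (simp add: epowr_ennreal ennreal_leI)
      qed simp
      finally show ?thesis by (simp add: add_increasing)
    qed
    have "(\<integral>\<^sup>+x. u x * ennreal (?w x) \<partial>lborel) \<le> (\<integral>\<^sup>+x. ennreal (?w x) + epowr (u x) P \<partial>lborel)"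
      by (intro nn_integral_mono le)
    also have "\<dots> = (\<integral>\<^sup>+x. ennreal (?w x) \<partial>lborel) + (\<integral>\<^sup>+x. epowr (u x) P \<partial>lborel)"
      by (rule nn_integral_add) measurable
    also have "\<dots> < top" using iw fin 2 by (auto simp: Lpe_ennreal less_top[symmetric])
    finally show ?thesis .
  qed
qed

lemma tempered_of_Lpe:
  fixes F :: "real^'n \<Rightarrow> complex"
  assumes p: "1 \<le> p" and [measurable]: "F \<in> borel_measurable borel" and fin: "Lpe lborel p (\<lambda>x. ennreal (norm (F x))) < top"
  shows "tempered_fun F"
proof -
  have "(\<integral>\<^sup>+x. ennreal (norm (F x)) * ennreal (1 / (1 + norm x) ^ (2 * CARD('n))) \<partial>lborel) < top"
    by (rule Lpe_weighted_integral[OF p _ fin]) measurable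
  then have "integrable lborel (\<lambda>x. norm (F x) / (1 + norm x) ^ (2 * CARD('n)))"
    by (intro integrableI_bounded) (auto simp: ennreal_mult[symmetric] divide_inverse)
  then show ?thesis by (auto simp: tempered_iff)
qed

lemma tempered_of_Lpn:
  fixes F :: "'i \<Rightarrow> real^'n \<Rightarrow> complex"
  assumes p: "1 \<le> p" and I: "finite I" and m: "\<And>i. i \<in> I \<Longrightarrow> F i \<in> borel_measurable borel"
    and fin: "Lpn p I F < top" and i: "i \<in> I"
  shows "tempered_fun (F i)"
proof (rule tempered_of_Lpe[OF p m[OF i]])
  have "Lpe lborel p (\<lambda>x. ennreal (norm (F i x))) \<le> Lpn p I F"
    unfolding Lpn_def using m[OF i] by (intro Lpe_mono p ennreal_leI norm_le_vec_norm I i) measurable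
  then show "Lpe lborel p (\<lambda>x. ennreal (norm (F i x))) < top" using fin by (rule order_le_less_trans)
qed

text \<open>
  All representing functions agree almost everywhere, so that the infimum is attained by any of
  them.
\<close>

lemma Lp_norm_eq_Lpn:
  fixes m :: "real^'n \<Rightarrow> complex" and F :: "'i \<Rightarrow> real^'n \<Rightarrow> complex"
  assumes m: "test_symbol m" "m 0 = 1" and p: "1 \<le> p" and I: "finite I"
    and F: "\<And>i. i \<in> I \<Longrightarrow> represents (F i) (u i)"
  shows "Lp_norm p I u = Lpn p I F"
proof -
  have eq: "Lp_norm_fun p (\<lambda>x. L2_set (\<lambda>i. norm (G i x)) I) = Lpn p I G" for G :: "'i \<Rightarrow> real^'n \<Rightarrow> complex"
    unfolding Lp_norm_fun_eq_Lpe[OF p] Lpn_def vec_norm_def by simp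
  have "Lpn p I G = Lpn p I F" if G: "\<forall>i\<in>I. represents (G i) (u i)" for G
  proof -
    have "AE x in lborel. \<forall>i\<in>I. G i x = F i x"
      using I G F represents_unique[OF m] by (intro AE_finite_allI) auto
    then have "AE x in lborel. ennreal (vec_norm I G x) = ennreal (vec_norm I F x)"
      by eventually_elim (auto simp: vec_norm_def intro!: arg_cong[where f=ennreal] L2_set_cong)
    moreover have "G i \<in> borel_measurable lborel" "F i \<in> borel_measurable lborel" if "i \<in> I" for i
      using that G F by (auto simp: represents_def dest: tempered_measurable)
    ultimately show ?thesis unfolding Lpn_def by (intro Lpe_cong_AE p ennreal_vec_norm_measurable)
  qed
  note * = this
  show ?thesis unfolding Lp_norm_def eq
  proof (rule antisym)
    show "(INF G\<in>{G. \<forall>i\<in>I. represents (G i) (u i)}. Lpn p I G) \<le> Lpn p I F"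
      by (rule INF_lower) (use F in simp)
    show "Lpn p I F \<le> (INF G\<in>{G. \<forall>i\<in>I. represents (G i) (u i)}. Lpn p I G)"
      by (rule INF_greatest) (simp add: *)
  qed
qed

section \<open>Convergent series in Lebesgue spaces\<close>

lemma measurable_pair_count:
  fixes v :: "nat \<Rightarrow> 'a \<Rightarrow> 'b::{second_countable_topology, topological_space}"
  assumes "\<And>k. v k \<in> borel_measurable M"
  shows "(\<lambda>(x, k). v k x) \<in> borel_measurable (M \<Otimes>\<^sub>M count_space UNIV)"
proof -
  have "(\<lambda>(k, x). v k x) \<in> borel_measurable (count_space UNIV \<Otimes>\<^sub>M M)"
    using assms by (intro measurable_pair_measure_countable1) auto
  then have "(\<lambda>z. (\<lambda>(k, x). v k x) (snd z, fst z)) \<in> borel_measurable (M \<Otimes>\<^sub>M count_space UNIV)"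
    by measurable
  then show ?thesis by (simp add: case_prod_beta)
qed

text \<open>
  An absolutely convergent series in \<open>L\<^sup>p\<close>. The sum \<open>G\<close> of the pointwise lengths has
  finite norm by Minkowski's inequality, hence is finite almost everywhere; it dominates all
  partial sums, also after multiplication by a decaying test function.
\<close>

lemma Lpn_series:
  fixes v :: "nat \<Rightarrow> 'i \<Rightarrow> real^'n \<Rightarrow> complex"
  assumes p: "1 \<le> p" and I: "finite I" and vm: "\<And>k i. i \<in> I \<Longrightarrow> v k i \<in> borel_measurable borel"
    and fin: "(\<Sum>k. Lpn p I (v k)) < top"
  shows "\<exists>F. (\<forall>i\<in>I. tempered_fun (F i)) \<and> Lpn p I F \<le> (\<Sum>k. Lpn p I (v k)) \<and>
    (\<forall>i\<in>I. \<forall>\<psi>. rapid \<psi> \<longrightarrow> (\<lambda>n. LINT x|lborel. (\<Sum>k<n. v k i x) * \<psi> x) \<longlonglongrightarrow> (LINT x|lborel. F i x * \<psi> x))"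
proof -
  define F where "F = (\<lambda>i x. if i \<in> I then LINT k|count_space UNIV. v k i x else 0)"
  define G where "G = (\<lambda>x. \<integral>\<^sup>+k. ennreal (vec_norm I (v k) x) \<partial>count_space UNIV)"
  have vnm[measurable]: "vec_norm I (v k) \<in> borel_measurable borel" for k by (rule vec_norm_measurable[OF vm])
  have Gm[measurable]: "G \<in> borel_measurable borel"
    unfolding G_def nn_integral_count_space_nat by measurable
  have Fm: "F i \<in> borel_measurable borel" if i: "i \<in> I" for i
  proof -
    interpret C: sigma_finite_measure "count_space (UNIV :: nat set)" by (rule sigma_finite_measure_count_space)
    have "(\<lambda>x. LINT k|count_space UNIV. v k i x) \<in> borel_measurable borel"
      by (rule C.borel_measurable_lebesgue_integral) (rule measurable_pair_count[OF vm[OF i]])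
    then show ?thesis using i by (simp add: F_def[abs_def])
  qed
  have FG: "ennreal (vec_norm I F x) \<le> G x" for x
  proof -
    have "vec_norm I F x = L2_set (\<lambda>i. norm (LINT k|count_space UNIV. v k i x)) I"
      unfolding vec_norm_def F_def by (intro L2_set_cong) auto
    then show ?thesis unfolding G_def vec_norm_def[of I "v _"]
      using L2_set_integral_le[OF I, of "\<lambda>i k. v k i x" "count_space UNIV"] by simp
  qed
  have GL: "Lpe lborel p G \<le> (\<Sum>k. Lpn p I (v k))"
  proof -
    have "Lpe lborel p (\<lambda>x. \<integral>\<^sup>+k. ennreal (vec_norm I (v k) x) \<partial>count_space UNIV) \<le> (\<integral>\<^sup>+k. Lpn p I (v k) \<partial>count_space UNIV)"
      by (rule Lpe_count_sum[OF sigma_finite_lborel p]) (auto simp: Lpn_def)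
    then show ?thesis unfolding G_def nn_integral_count_space_nat .
  qed
  then have GL': "Lpe lborel p G < top" using fin by (rule order_le_less_trans)
  have FL: "Lpn p I F \<le> (\<Sum>k. Lpn p I (v k))"
    by (rule order_trans[OF Lpn_mono_pointwise[OF p _ FG] GL]) (simp add: Fm)
  have Ft: "tempered_fun (F i)" if "i \<in> I" for i
    by (rule tempered_of_Lpn[OF p I Fm order_le_less_trans[OF FL fin] that])
  have Gfin: "AE x in lborel. G x < top" by (rule Lpe_finite_AE[OF p _ GL']) simp
  have lim: "(\<lambda>n. LINT x|lborel. (\<Sum>k<n. v k i x) * \<psi> x) \<longlonglongrightarrow> (LINT x|lborel. F i x * \<psi> x)"
    if i: "i \<in> I" and psi: "rapid \<psi>" for i \<psi>
  proof (rule integral_dominated_convergence[where w="\<lambda>x. enn2real (G x) * norm (\<psi> x)"])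
    note [measurable] = vm[OF i] Fm[OF i] rapid_measurable[OF psi]
    show "(\<lambda>x. F i x * \<psi> x) \<in> borel_measurable lborel" by measurable
    show "(\<lambda>x. (\<Sum>k<n. v k i x) * \<psi> x) \<in> borel_measurable lborel" for n by measurable
    define H where "H = (\<lambda>x. complex_of_real (enn2real (G x)))"
    have Hm: "H \<in> borel_measurable borel" unfolding H_def by measurable
    have "Lpe lborel p (\<lambda>x. ennreal (norm (H x))) \<le> Lpe lborel p G"
      using Hm by (intro Lpe_mono p) (auto simp: H_def ennreal_enn2real_if)
    then have "tempered_fun H" using GL' Hm by (intro tempered_of_Lpe[OF p]) auto
    then have "integrable lborel (\<lambda>y. norm (H y * \<psi> y))"
      by (intro integrable_norm tempered_times_rapid_integrable psi)
    then show "integrable lborel (\<lambda>x. enn2real (G x) * norm (\<psi> x))"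
      by (simp add: H_def norm_mult)
    have comp: "(\<Sum>k<n. norm (v k i x)) \<le> enn2real (G x)" if "G x < top" for n x
    proof -
      have "ennreal (\<Sum>k<n. norm (v k i x)) = (\<Sum>k<n. ennreal (norm (v k i x)))" by (rule sum_ennreal[symmetric]) simp
      also have "\<dots> \<le> (\<Sum>k<n. ennreal (vec_norm I (v k) x))" by (intro sum_mono ennreal_leI norm_le_vec_norm I i)
      also have "\<dots> \<le> G x" unfolding G_def nn_integral_count_space_nat by (rule sum_le_suminf) auto
      also have "\<dots> = ennreal (enn2real (G x))" using that by simp
      finally show ?thesis by (subst (asm) ennreal_le_iff) auto
    qed
    show "AE x in lborel. norm ((\<Sum>k<n. v k i x) * \<psi> x) \<le> enn2real (G x) * norm (\<psi> x)" for n
      using Gfin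
    proof eventually_elim
      case (elim x)
      show ?case unfolding norm_mult
        by (intro mult_right_mono order_trans[OF norm_sum comp[OF elim]]) auto
    qed
    show "AE x in lborel. (\<lambda>n. (\<Sum>k<n. v k i x) * \<psi> x) \<longlonglongrightarrow> F i x * \<psi> x"
      using Gfin
    proof eventually_elim
      case (elim x)
      have "summable (\<lambda>k. norm (v k i x))"
        by (rule summableI_nonneg_bounded[OF _ comp[OF elim]]) simp
      then have int: "integrable (count_space UNIV) (\<lambda>k. v k i x)"
        and s: "summable (\<lambda>k. v k i x)"
        by (auto simp: integrable_count_space_nat_iff intro: summable_norm_cancel)
      have "F i x = (\<Sum>k. v k i x)" using integral_count_space_nat[OF int] i by (simp add: F_def)
      then show ?case using summable_LIMSEQ[OF s] by (intro tendsto_mult_right) simp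
    qed
  qed
  show ?thesis using FL Ft lim by (intro exI[of _ F]) blast
qed

section \<open>Kernels of dilated symbols\<close>

text \<open>
  The \<open>L\<^sup>1\<close> norms of the kernel with symbol \<open>m\<close>, of \<open>\<bar>y\<bar>\<close> times this kernel,
  and of its gradient. They are the constants of Young's inequality, of the commutator estimate
  and of Bernstein's inequality.
\<close>

definition kernel_norm :: "(real^'n \<Rightarrow> complex) \<Rightarrow> ennreal"
  where "kernel_norm m = (\<integral>\<^sup>+y. ennreal (norm (inv_fourier m y)) \<partial>lborel)"

definition kernel_moment :: "(real^'n \<Rightarrow> complex) \<Rightarrow> ennreal"
  where "kernel_moment m = (\<integral>\<^sup>+y. ennreal (norm y * norm (inv_fourier m y)) \<partial>lborel)"

definition kernel_grad :: "(real^'n \<Rightarrow> complex) \<Rightarrow> ennreal"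
  where "kernel_grad m = (\<integral>\<^sup>+y. ennreal (vec_norm UNIV (\<lambda>j. pd j (inv_fourier m)) y) \<partial>lborel)"

lemma inv_fourier_measurable: "test_symbol m \<Longrightarrow> inv_fourier m \<in> borel_measurable borel"
  by (intro rapid_measurable test_symbol_rapid)

lemma pd_inv_fourier_rapid: "test_symbol m \<Longrightarrow> rapid (pd j (inv_fourier m))"
  by (intro schwartz_rapid schwartz_pd schwartz_inv_fourier)

lemma pd_inv_fourier_measurable: "test_symbol m \<Longrightarrow> pd j (inv_fourier m) \<in> borel_measurable borel"
  by (intro rapid_measurable pd_inv_fourier_rapid)

lemma nn_integral_norm_finite:
  fixes f :: "'a \<Rightarrow> 'b::{banach, second_countable_topology}"
  shows "integrable M f \<Longrightarrow> (\<integral>\<^sup>+y. ennreal (norm (f y)) \<partial>M) < top"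
  by (simp add: integrable_iff_bounded infinity_ennreal_def)

lemma kernel_norm_finite: "test_symbol m \<Longrightarrow> kernel_norm m < top"
  unfolding kernel_norm_def by (intro nn_integral_norm_finite rapid_integrable test_symbol_rapid)

lemma kernel_moment_finite:
  assumes m: "test_symbol m" shows "kernel_moment m < top"
proof -
  note [measurable] = inv_fourier_measurable[OF m]
  have "integrable lborel (\<lambda>y. (1 + norm y) ^ 1 * norm (inv_fourier m y))"
    by (intro rapid_weighted_integrable test_symbol_rapid m)
  then have "integrable lborel (\<lambda>y. norm y * norm (inv_fourier m y))"
    by (rule Bochner_Integration.integrable_bound) (auto intro!: AE_I2 mult_right_mono simp: abs_mult)
  from nn_integral_norm_finite[OF this] show ?thesis by (simp add: kernel_moment_def abs_mult)
qed

lemma kernel_grad_finite: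
  assumes m: "test_symbol m" shows "kernel_grad m < top"
proof -
  have "kernel_grad m \<le> (\<integral>\<^sup>+y. (\<Sum>j\<in>UNIV. ennreal (norm (pd j (inv_fourier m) y))) \<partial>lborel)"
    unfolding kernel_grad_def
  proof (rule nn_integral_mono)
    fix y
    have "vec_norm UNIV (\<lambda>j. pd j (inv_fourier m)) y \<le> (\<Sum>j\<in>UNIV. norm (pd j (inv_fourier m) y))"
      unfolding vec_norm_def by (rule L2_set_le_sum) simp
    then have "ennreal (vec_norm UNIV (\<lambda>j. pd j (inv_fourier m)) y) \<le> ennreal (\<Sum>j\<in>UNIV. norm (pd j (inv_fourier m) y))"
      by (rule ennreal_leI)
    also have "\<dots> = (\<Sum>j\<in>UNIV. ennreal (norm (pd j (inv_fourier m) y)))" by (rule sum_ennreal[symmetric]) simp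
    finally show "ennreal (vec_norm UNIV (\<lambda>j. pd j (inv_fourier m)) y) \<le> (\<Sum>j\<in>UNIV. ennreal (norm (pd j (inv_fourier m) y)))" .
  qed
  also have "\<dots> = (\<Sum>j\<in>UNIV. (\<integral>\<^sup>+y. ennreal (norm (pd j (inv_fourier m) y)) \<partial>lborel))"
  proof (rule nn_integral_sum)
    fix j :: 'a
    note [measurable] = pd_inv_fourier_measurable[OF m, of j]
    show "(\<lambda>y. ennreal (norm (pd j (inv_fourier m) y))) \<in> borel_measurable lborel" by measurable
  qed
  also have "\<dots> < top"
    using nn_integral_norm_finite[OF rapid_integrable[OF pd_inv_fourier_rapid[OF m]]]
    by (subst ennreal_sum_less_top) auto
  finally show ?thesis .
qed

lemma inv_fourier_diff:
  assumes "test_symbol m" "test_symbol n"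
  shows "inv_fourier (\<lambda>\<xi>. m \<xi> - n \<xi>) x = inv_fourier m x - inv_fourier n x"
proof -
  have i: "integrable lborel (\<lambda>\<xi>. ee (x \<bullet> \<xi>) * m \<xi>)" if "test_symbol m" for m :: "real^'a \<Rightarrow> complex"
    using test_symbol_measurable[OF that]
    by (intro Bochner_Integration.integrable_bound[OF test_symbol_integrable[OF that]]) auto
  show ?thesis
    unfolding inv_fourier_def right_diff_distrib
      Bochner_Integration.integral_diff[OF i[OF assms(1)] i[OF assms(2)]] diff_divide_distrib ..
qed

lemma
  assumes m: "test_symbol m" and n: "test_symbol n"
  shows kernel_norm_diff_le: "kernel_norm (\<lambda>\<xi>. m \<xi> - n \<xi>) \<le> kernel_norm m + kernel_norm n"
    and kernel_moment_diff_le: "kernel_moment (\<lambda>\<xi>. m \<xi> - n \<xi>) \<le> kernel_moment m + kernel_moment n"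
proof -
  note [measurable] = inv_fourier_measurable[OF m] inv_fourier_measurable[OF n]
  have le: "norm (inv_fourier (\<lambda>\<xi>. m \<xi> - n \<xi>) y) \<le> norm (inv_fourier m y) + norm (inv_fourier n y)" for y
    unfolding inv_fourier_diff[OF m n] by (rule norm_triangle_ineq4)
  have "kernel_norm (\<lambda>\<xi>. m \<xi> - n \<xi>) \<le> (\<integral>\<^sup>+y. ennreal (norm (inv_fourier m y)) + ennreal (norm (inv_fourier n y)) \<partial>lborel)"
    unfolding kernel_norm_def using le by (intro nn_integral_mono) (simp add: ennreal_plus[symmetric] ennreal_leI del: ennreal_plus)
  also have "\<dots> = kernel_norm m + kernel_norm n" unfolding kernel_norm_def by (rule nn_integral_add) measurable
  finally show "kernel_norm (\<lambda>\<xi>. m \<xi> - n \<xi>) \<le> kernel_norm m + kernel_norm n" .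
  have le': "norm y * norm (inv_fourier (\<lambda>\<xi>. m \<xi> - n \<xi>) y) \<le> norm y * norm (inv_fourier m y) + norm y * norm (inv_fourier n y)" for y
    using mult_left_mono[OF le norm_ge_zero] by (simp add: distrib_left)
  have "kernel_moment (\<lambda>\<xi>. m \<xi> - n \<xi>) \<le> (\<integral>\<^sup>+y. ennreal (norm y * norm (inv_fourier m y)) + ennreal (norm y * norm (inv_fourier n y)) \<partial>lborel)"
    unfolding kernel_moment_def using le' by (intro nn_integral_mono) (simp add: ennreal_plus[symmetric] ennreal_leI del: ennreal_plus)
  also have "\<dots> = kernel_moment m + kernel_moment n" unfolding kernel_moment_def by (rule nn_integral_add) measurable
  finally show "kernel_moment (\<lambda>\<xi>. m \<xi> - n \<xi>) \<le> kernel_moment m + kernel_moment n" .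
qed

lemma nn_integral_dilate:
  fixes g :: "real^'n \<Rightarrow> ennreal"
  assumes c: "c > 0" and g: "g \<in> borel_measurable borel"
  shows "(\<integral>\<^sup>+x. ennreal ((1 / c) ^ CARD('n)) * g ((1 / c) *\<^sub>R x) \<partial>lborel) = (\<integral>\<^sup>+x. g x \<partial>lborel)"
proof -
  note [measurable] = g
  have "(\<integral>\<^sup>+x. g x \<partial>lborel) = ennreal (\<bar>1 / c\<bar> ^ CARD('n)) * (\<integral>\<^sup>+x. g (0 + (1 / c) *\<^sub>R x) \<partial>lborel)"
    using nn_integral_lborel_affine[OF g, of "1 / c" 0] c by simp
  also have "\<dots> = (\<integral>\<^sup>+x. ennreal (\<bar>1 / c\<bar> ^ CARD('n)) * g (0 + (1 / c) *\<^sub>R x) \<partial>lborel)"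
    by (rule nn_integral_cmult[symmetric]) measurable
  finally show ?thesis using c by simp
qed

text \<open>
  The kernel of \<open>m (c \<xi>)\<close> is the \<open>L\<^sup>1\<close>-normalized dilation by \<open>c\<close> of the kernel of
  \<open>m\<close>; this is the origin of every power of \<open>2\<close> in the estimates.
\<close>

lemma
  fixes m :: "real^'n \<Rightarrow> complex"
  assumes m: "test_symbol m" and c: "c > 0"
  shows kernel_norm_dilate: "kernel_norm (\<lambda>\<xi>. m (c *\<^sub>R \<xi>)) = kernel_norm m"
    and kernel_moment_dilate: "kernel_moment (\<lambda>\<xi>. m (c *\<^sub>R \<xi>)) = ennreal c * kernel_moment m"
    and kernel_grad_dilate: "kernel_grad (\<lambda>\<xi>. m (c *\<^sub>R \<xi>)) = ennreal (1 / c) * kernel_grad m"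
proof -
  note [measurable] = inv_fourier_measurable[OF m]
  define D where "D = (1 / c) ^ CARD('n)"
  have D0: "D \<ge> 0" using c by (simp add: D_def)
  have n: "norm (inv_fourier (\<lambda>\<xi>. m (c *\<^sub>R \<xi>)) x) = D * norm (inv_fourier m ((1 / c) *\<^sub>R x))" for x
    unfolding inv_fourier_dilate[OF c] D_def[symmetric] norm_mult norm_of_real using D0 by simp
  show "kernel_norm (\<lambda>\<xi>. m (c *\<^sub>R \<xi>)) = kernel_norm m"
    unfolding kernel_norm_def n using nn_integral_dilate[OF c, of "\<lambda>y. ennreal (norm (inv_fourier m y))"] D0
    by (simp add: D_def[symmetric] ennreal_mult)
  have w: "ennreal (norm y * norm (inv_fourier (\<lambda>\<xi>. m (c *\<^sub>R \<xi>)) y)) =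
      ennreal c * (ennreal D * ennreal (norm ((1 / c) *\<^sub>R y) * norm (inv_fourier m ((1 / c) *\<^sub>R y))))" for y
  proof -
    have "norm y * norm (inv_fourier (\<lambda>\<xi>. m (c *\<^sub>R \<xi>)) y) = c * (D * (norm ((1 / c) *\<^sub>R y) * norm (inv_fourier m ((1 / c) *\<^sub>R y))))"
      unfolding n using c by simp
    moreover have "ennreal (c * (D * Z)) = ennreal c * (ennreal D * ennreal Z)" if "Z \<ge> 0" for Z
      using that c D0 by (simp add: ennreal_mult)
    ultimately show ?thesis by (simp only: mult_nonneg_nonneg norm_ge_zero)
  qed
  have "kernel_moment (\<lambda>\<xi>. m (c *\<^sub>R \<xi>)) = ennreal c * (\<integral>\<^sup>+y. ennreal D * ennreal (norm ((1 / c) *\<^sub>R y) * norm (inv_fourier m ((1 / c) *\<^sub>R y))) \<partial>lborel)"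
    unfolding kernel_moment_def w by (rule nn_integral_cmult) measurable
  also have "(\<integral>\<^sup>+y. ennreal D * ennreal (norm ((1 / c) *\<^sub>R y) * norm (inv_fourier m ((1 / c) *\<^sub>R y))) \<partial>lborel) = kernel_moment m"
    unfolding kernel_moment_def D_def by (rule nn_integral_dilate[OF c]) measurable
  finally show "kernel_moment (\<lambda>\<xi>. m (c *\<^sub>R \<xi>)) = ennreal c * kernel_moment m" .
  have md: "inv_fourier m differentiable (at x)" for x by (rule inv_fourier_differentiable[OF m])
  have p: "pd j (inv_fourier (\<lambda>\<xi>. m (c *\<^sub>R \<xi>))) x = of_real (D * (1 / c)) * pd j (inv_fourier m) ((1 / c) *\<^sub>R x)" for j x
  proof -
    have "inv_fourier (\<lambda>\<xi>. m (c *\<^sub>R \<xi>)) = (\<lambda>x. of_real D * inv_fourier m ((1 / c) *\<^sub>R x))"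
      unfolding D_def by (rule ext) (rule inv_fourier_dilate[OF c])
    moreover have "pd j (\<lambda>x. of_real D * inv_fourier m ((1 / c) *\<^sub>R x)) x = of_real D * pd j (\<lambda>x. inv_fourier m ((1 / c) *\<^sub>R x)) x"
      by (rule pd_cmult) (use differentiable_affine[OF md, of "1 / c" 0 x] in simp)
    moreover have "pd j (\<lambda>x. inv_fourier m ((1 / c) *\<^sub>R x)) x = (1 / c) *\<^sub>R pd j (inv_fourier m) ((1 / c) *\<^sub>R x)"
      using pd_affine[of "inv_fourier m" "1 / c" x 0 j] md by simp
    ultimately show ?thesis by (simp only: scaleR_conv_of_real of_real_mult mult.assoc)
  qed
  have v: "vec_norm UNIV (\<lambda>j. pd j (inv_fourier (\<lambda>\<xi>. m (c *\<^sub>R \<xi>)))) x = (1 / c) * (D * vec_norm UNIV (\<lambda>j. pd j (inv_fourier m)) ((1 / c) *\<^sub>R x))" for x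
  proof -
    have "vec_norm UNIV (\<lambda>j. pd j (inv_fourier (\<lambda>\<xi>. m (c *\<^sub>R \<xi>)))) x = D * (1 / c) * vec_norm UNIV (\<lambda>j. pd j (inv_fourier m)) ((1 / c) *\<^sub>R x)"
      unfolding vec_norm_def p norm_mult norm_of_real using D0 c by (subst L2_set_right_distrib) auto
    then show ?thesis by simp
  qed
  have [measurable]: "vec_norm UNIV (\<lambda>j. pd j (inv_fourier m)) \<in> borel_measurable borel"
    by (rule vec_norm_measurable) (rule pd_inv_fourier_measurable[OF m])
  have v': "ennreal (vec_norm UNIV (\<lambda>j. pd j (inv_fourier (\<lambda>\<xi>. m (c *\<^sub>R \<xi>)))) x) = ennreal (1 / c) * (ennreal D * ennreal (vec_norm UNIV (\<lambda>j. pd j (inv_fourier m)) ((1 / c) *\<^sub>R x)))" for x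
    unfolding v using c D0 by (simp add: ennreal_mult del: times_divide_eq_left mult_1_left)
  have "kernel_grad (\<lambda>\<xi>. m (c *\<^sub>R \<xi>)) = ennreal (1 / c) * (\<integral>\<^sup>+y. ennreal D * ennreal (vec_norm UNIV (\<lambda>j. pd j (inv_fourier m)) ((1 / c) *\<^sub>R y)) \<partial>lborel)"
    unfolding kernel_grad_def v' by (rule nn_integral_cmult) measurable
  also have "(\<integral>\<^sup>+y. ennreal D * ennreal (vec_norm UNIV (\<lambda>j. pd j (inv_fourier m)) ((1 / c) *\<^sub>R y)) \<partial>lborel) = kernel_grad m"
    unfolding kernel_grad_def D_def by (rule nn_integral_dilate[OF c]) measurable
  finally show "kernel_grad (\<lambda>\<xi>. m (c *\<^sub>R \<xi>)) = ennreal (1 / c) * kernel_grad m" .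
qed

section \<open>Littlewood--Paley pairs\<close>

locale lp_pair =
  fixes phi chi :: "real^'n \<Rightarrow> real"
  assumes lp: "littlewood_paley phi chi"
begin

lemma chi_support: "chi \<xi> \<noteq> 0 \<Longrightarrow> norm \<xi> \<le> 4/3"
proof -
  assume "chi \<xi> \<noteq> 0"
  then have "\<xi> \<in> closure {\<xi>. chi \<xi> \<noteq> 0}" using closure_subset by fastforce
  then show ?thesis using lp unfolding littlewood_paley_def by blast
qed

lemma phi_support: "phi \<xi> \<noteq> 0 \<Longrightarrow> 3/4 \<le> norm \<xi>"
proof -
  assume "phi \<xi> \<noteq> 0"
  then have "\<xi> \<in> closure {\<xi>. phi \<xi> \<noteq> 0}" using closure_subset by fastforce
  then show ?thesis using lp unfolding littlewood_paley_def by blast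
qed

lemma phi_sums: "(\<lambda>q::nat. phi ((1 / 2 ^ q) *\<^sub>R \<xi>)) sums (1 - chi \<xi>)"
  using lp unfolding littlewood_paley_def by blast

lemma chi_one: "norm \<xi> < 3/4 \<Longrightarrow> chi \<xi> = 1"
proof -
  assume x: "norm \<xi> < 3/4"
  have "phi ((1 / 2 ^ q) *\<^sub>R \<xi>) = 0" for q :: nat
  proof (rule ccontr)
    assume "phi ((1 / 2 ^ q) *\<^sub>R \<xi>) \<noteq> 0"
    then have "3/4 \<le> norm \<xi> / 2 ^ q" using phi_support by fastforce
    also have "\<dots> \<le> norm \<xi> / 1" by (intro divide_left_mono) auto
    finally show False using x by simp
  qed
  then have "(\<lambda>q::nat. 0) sums (1 - chi \<xi>)" using phi_sums[of \<xi>] by simp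
  then show ?thesis using sums_unique2[OF sums_zero] by fastforce
qed

text \<open>
  The partition of unity at \<open>\<eta> / 2\<close> differs from the one at \<open>\<eta>\<close> by a shift of the
  index: subtract.
\<close>

lemma phi_eq: "phi \<eta> = chi ((1/2) *\<^sub>R \<eta>) - chi \<eta>"
proof -
  have "(\<lambda>q::nat. phi ((1 / 2 ^ Suc q) *\<^sub>R \<eta>)) sums (1 - chi ((1/2) *\<^sub>R \<eta>))"
    using phi_sums[of "(1/2) *\<^sub>R \<eta>"] by (simp add: mult.commute)
  then have "(\<lambda>q::nat. phi ((1 / 2 ^ q) *\<^sub>R \<eta>)) sums (1 - chi ((1/2) *\<^sub>R \<eta>) + phi ((1 / 2 ^ 0) *\<^sub>R \<eta>))"
    by (simp only: sums_Suc_iff[of "\<lambda>q. phi ((1 / 2 ^ q) *\<^sub>R \<eta>)"])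
  from sums_unique2[OF this phi_sums] show ?thesis by simp
qed

text \<open>
  The symbol of the low-frequency cut-off. Blocks are differences of cut-offs, and \<open>bs (-1)\<close> is
  the cut-off \<open>cs 0\<close>, in accordance with the indexing from \<open>-1\<close>.
\<close>

definition cs :: "int \<Rightarrow> real^'n \<Rightarrow> complex"
  where "cs N \<xi> = complex_of_real (chi ((2 powr (- real_of_int N)) *\<^sub>R \<xi>))"

definition bs :: "int \<Rightarrow> real^'n \<Rightarrow> complex"
  where "bs q = (if q = -1 then cs 0 else (\<lambda>\<xi>. cs (q + 1) \<xi> - cs q \<xi>))"

definition SN :: "int \<Rightarrow> (real^'n \<Rightarrow> complex) \<Rightarrow> real^'n \<Rightarrow> complex"
  where "SN N F = conv (inv_fourier (cs N)) F"

definition DQ :: "int \<Rightarrow> (real^'n \<Rightarrow> complex) \<Rightarrow> real^'n \<Rightarrow> complex"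
  where "DQ q F = conv (inv_fourier (bs q)) F"

lemma test_cs: "test_symbol (cs N)"
proof -
  have "smooth chi" using lp by (simp add: littlewood_paley_def)
  then have "test_symbol (\<lambda>\<xi>. complex_of_real (chi \<xi>))"
    unfolding test_symbol_def using chi_support by (intro conjI smooth_of_real exI[of _ "4/3"]) (auto simp: not_le[symmetric])
  from test_symbol_scale[OF this, of "2 powr (- real_of_int N)"] show ?thesis
    by (simp add: cs_def[abs_def])
qed

lemma test_bs: "test_symbol (bs q)"
  unfolding bs_def by (auto intro: test_cs test_symbol_diff)

lemma cs_at_0: "cs N 0 = 1"
  by (simp add: cs_def chi_one)

lemma cs_dilate: "cs N = (\<lambda>\<xi>. cs 0 ((2 powr (- real_of_int N)) *\<^sub>R \<xi>))"
  by (simp add: cs_def[abs_def])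

lemma cs_support: "cs N \<xi> \<noteq> 0 \<Longrightarrow> norm \<xi> \<le> 4/3 * 2 powr N"
  using chi_support[of "(2 powr (- real_of_int N)) *\<^sub>R \<xi>"]
  by (simp add: cs_def powr_minus field_simps)

lemma cs_one: "norm \<xi> < 3/4 * 2 powr N \<Longrightarrow> cs N \<xi> = 1"
  using chi_one[of "(2 powr (- real_of_int N)) *\<^sub>R \<xi>"]
  by (simp add: cs_def powr_minus field_simps)

lemma cs_diff_support:
  assumes "N \<le> M" "cs M \<xi> - cs N \<xi> \<noteq> 0"
  shows "3/4 * 2 powr N \<le> norm \<xi>"
proof (rule ccontr)
  assume *: "\<not> 3/4 * 2 powr N \<le> norm \<xi>"
  have "2 powr real_of_int N \<le> 2 powr real_of_int M" using assms by (intro powr_mono) auto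
  then have "norm \<xi> < 3/4 * 2 powr N" and M: "norm \<xi> < 3/4 * 2 powr M" using * by linarith+
  then have "cs N \<xi> = 1" by (intro cs_one)
  moreover have "cs M \<xi> = 1" by (rule cs_one[OF M])
  ultimately show False using assms by simp
qed

lemma bs_support_upper: "q \<ge> -1 \<Longrightarrow> bs q \<xi> \<noteq> 0 \<Longrightarrow> norm \<xi> \<le> 4/3 * 2 powr (q + 1)"
proof -
  assume q: "q \<ge> -1" "bs q \<xi> \<noteq> 0"
  show ?thesis
  proof (cases "q = -1")
    case True
    then show ?thesis using q cs_support[of 0 \<xi>] by (simp add: bs_def)
  next
    case False
    then have "cs (q + 1) \<xi> \<noteq> 0 \<or> cs q \<xi> \<noteq> 0" using q by (auto simp: bs_def)
    moreover have "2 powr (real_of_int q + 1) = 2 * 2 powr real_of_int q" by (simp add: powr_add)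
    moreover have "2 powr real_of_int q \<ge> 0" by simp
    moreover note cs_support[of "q + 1" \<xi>] cs_support[of q \<xi>]
    ultimately show ?thesis unfolding of_int_add of_int_1 by (elim disjE) linarith+
  qed
qed

lemma bs_support_lower: "q \<ge> 0 \<Longrightarrow> bs q \<xi> \<noteq> 0 \<Longrightarrow> 3/4 * 2 powr q \<le> norm \<xi>"
  using cs_diff_support[of q "q + 1" \<xi>] by (auto simp: bs_def)

lemma cs_times_bs: "q \<ge> -1 \<Longrightarrow> cs (q + 2) \<xi> * bs q \<xi> = bs q \<xi>"
proof (cases "bs q \<xi> = 0")
  case False
  assume "q \<ge> -1"
  from bs_support_upper[OF this False] have "norm \<xi> \<le> 4/3 * 2 powr (real_of_int q + 1)" by simp
  also have "\<dots> < 3/4 * 2 powr (real_of_int (q + 2))" by (simp add: powr_add)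
  finally have "cs (q + 2) \<xi> = 1" by (rule cs_one)
  then show ?thesis by simp
qed simp

text \<open>
  A wider annulus reproduces the block. Its symbol vanishes at the origin, which makes the
  integral of its kernel zero.
\<close>

lemma fat_bs_times_bs: "q \<ge> 0 \<Longrightarrow> (cs (q + 2) \<xi> - cs (q - 1) \<xi>) * bs q \<xi> = bs q \<xi>"
proof (cases "bs q \<xi> = 0")
  case False
  assume q: "q \<ge> 0"
  have "cs (q - 1) \<xi> = 0"
  proof (rule ccontr)
    assume "cs (q - 1) \<xi> \<noteq> 0"
    then have "norm \<xi> \<le> 4/3 * 2 powr (real_of_int (q - 1))" by (rule cs_support)
    also have "\<dots> < 3/4 * 2 powr q" by (simp add: powr_diff)
    finally show False using bs_support_lower[OF q False] by simp
  qed
  then show ?thesis using cs_times_bs[of q \<xi>] q by simp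
qed simp

lemma lp_block_multiplier:
  assumes "q \<ge> -1"
  obtains m where "\<And>u. lp_block phi chi q u = fourier_multiplier m u" "(\<lambda>\<xi>. complex_of_real (m \<xi>)) = bs q"
proof (cases "q = -1")
  case True
  show ?thesis
    by (rule that[of chi]) (auto simp: lp_block_def True bs_def cs_def[abs_def])
next
  case False
  show ?thesis
  proof (rule that[of "\<lambda>\<xi>. phi ((2 powr (- of_int q)) *\<^sub>R \<xi>)"])
    show "lp_block phi chi q u = fourier_multiplier (\<lambda>\<xi>. phi ((2 powr (- of_int q)) *\<^sub>R \<xi>)) u" for u
      using False by (simp add: lp_block_def)
    show "(\<lambda>\<xi>. complex_of_real (phi ((2 powr (- of_int q)) *\<^sub>R \<xi>))) = bs q"
    proof
      fix \<xi>
      have "1/2 * 2 powr (- real_of_int q) = 2 powr (- real_of_int (q + 1))"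
        by (simp add: powr_diff powr_minus powr_add divide_simps)
      then show "complex_of_real (phi ((2 powr (- of_int q)) *\<^sub>R \<xi>)) = bs q \<xi>"
        using False unfolding phi_eq by (simp add: bs_def cs_def)
    qed
  qed
qed

lemma represents_block:
  assumes "q \<ge> -1" "represents H u"
  shows "represents (DQ q H) (lp_block phi chi q u)"
proof -
  obtain m where m: "\<And>u. lp_block phi chi q u = fourier_multiplier m u" "(\<lambda>\<xi>. complex_of_real (m \<xi>)) = bs q"
    using lp_block_multiplier[OF assms(1)] by metis
  have "test_symbol (\<lambda>\<xi>. complex_of_real (m \<xi>))" unfolding m(2) by (rule test_bs)
  from represents_fourier_multiplier[OF this assms(2)] show ?thesis unfolding m DQ_def .
qed

lemma represents_block_dpartial:
  assumes "q \<ge> -1" "tempered_fun F"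
  shows "represents (conv (pd j (inv_fourier (bs q))) F) (lp_block phi chi q (dpartial j (dist_of F)))"
proof -
  obtain m where m: "\<And>u. lp_block phi chi q u = fourier_multiplier m u" "(\<lambda>\<xi>. complex_of_real (m \<xi>)) = bs q"
    using lp_block_multiplier[OF assms(1)] by metis
  have "test_symbol (\<lambda>\<xi>. complex_of_real (m \<xi>))" unfolding m(2) by (rule test_bs)
  from represents_fourier_multiplier_dpartial[OF this assms(2), of j] show ?thesis unfolding m .
qed

lemma tempered_SN: "tempered_fun F \<Longrightarrow> tempered_fun (SN N F)"
  unfolding SN_def by (intro tempered_conv test_symbol_rapid test_cs)

lemma tempered_DQ: "tempered_fun F \<Longrightarrow> tempered_fun (DQ q F)"
  unfolding DQ_def by (intro tempered_conv test_symbol_rapid test_bs)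

lemma conv_symbol_diff:
  assumes m: "test_symbol m" and n: "test_symbol n" and F: "tempered_fun F"
  shows "conv (inv_fourier (\<lambda>\<xi>. m \<xi> - n \<xi>)) F x = conv (inv_fourier m) F x - conv (inv_fourier n) F x"
  unfolding conv_def inv_fourier_diff[OF m n] left_diff_distrib
  by (intro Bochner_Integration.integral_diff conv_integrable test_symbol_rapid m n F)

lemma DQ_eq: "q \<noteq> -1 \<Longrightarrow> tempered_fun F \<Longrightarrow> DQ q F x = SN (q + 1) F x - SN q F x"
  unfolding DQ_def SN_def bs_def by (simp add: conv_symbol_diff test_cs)

lemma DQ_minus_1: "DQ (-1) F = SN 0 F"
  by (simp add: DQ_def SN_def bs_def)

lemma sum_DQ:
  assumes "N \<ge> 0" "tempered_fun F"
  shows "(\<Sum>k<n. DQ (N + int k) F x) = SN (N + int n) F x - SN N F x"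
  using assms by (induction n) (auto simp: DQ_eq algebra_simps)

text \<open>
  The cut-offs are the approximate identity for the radii \<open>2\<^sup>-\<^sup>n\<close>.
\<close>

lemma SN_tendsto:
  assumes N: "N \<ge> 0" and F: "tempered_fun F" and psi: "rapid \<psi>" "continuous_on UNIV \<psi>"
  shows "(\<lambda>n. LINT x|lborel. SN (N + int n) F x * \<psi> x) \<longlonglongrightarrow> (LINT x|lborel. F x * \<psi> x)"
proof -
  define c where "c = (\<lambda>n::nat. 2 powr (- real_of_int (N + int n)))"
  have c: "c n > 0" "c n \<le> 1" for n
  proof -
    have "2 powr (- real_of_int (N + int n)) \<le> 2 powr 0" using N by (intro powr_mono) auto
    then show "c n \<le> 1" by (simp add: c_def)
  qed (simp add: c_def)
  have "c = (\<lambda>n. 2 powr (- real_of_int N) * (1/2) ^ n)"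
    by (simp add: c_def fun_eq_iff powr_diff powr_minus powr_realpow power_one_over divide_simps)
  moreover have "(\<lambda>n. 2 powr (- real_of_int N) * (1/2) ^ n) \<longlonglongrightarrow> 2 powr (- real_of_int N) * 0"
    by (intro tendsto_mult tendsto_const LIMSEQ_realpow_zero) auto
  ultimately have cl: "c \<longlonglongrightarrow> 0" by simp
  have "SN (N + int n) F = conv (inv_fourier (\<lambda>\<xi>. cs 0 (c n *\<^sub>R \<xi>))) F" for n
    unfolding SN_def c_def by (subst cs_dilate) (rule refl)
  then show ?thesis
    using conv_approximate_identity[OF test_cs cs_at_0 F psi cl c] by simp
qed

lemma kernel_norm_cs: "kernel_norm (cs N) = kernel_norm (cs 0)"
  by (subst cs_dilate) (rule kernel_norm_dilate[OF test_cs], simp)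

lemma kernel_moment_cs: "kernel_moment (cs N) = ennreal (2 powr (- real_of_int N)) * kernel_moment (cs 0)"
  by (subst cs_dilate) (rule kernel_moment_dilate[OF test_cs], simp)

lemma kernel_grad_cs: "kernel_grad (cs N) = ennreal (2 powr N) * kernel_grad (cs 0)"
proof -
  have "kernel_grad (cs N) = ennreal (1 / 2 powr (- real_of_int N)) * kernel_grad (cs 0)"
    by (subst cs_dilate) (rule kernel_grad_dilate[OF test_cs], simp)
  then show ?thesis by (simp add: powr_minus_divide)
qed

lemma kernel_norm_bs: "kernel_norm (bs q) \<le> 2 * kernel_norm (cs 0)"
proof (cases "q = -1")
  case True
  have "kernel_norm (cs 0) \<le> kernel_norm (cs 0) + kernel_norm (cs 0)" by (simp add: add_increasing2)
  then show ?thesis using True by (simp add: bs_def mult_2)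
next
  case False
  then show ?thesis using kernel_norm_diff_le[OF test_cs[of "q + 1"] test_cs[of q]] kernel_norm_cs[of "q+1"] kernel_norm_cs[of q]
    by (simp add: bs_def mult_2)
qed

lemma kernel_moment_fat_bs: "kernel_moment (\<lambda>\<xi>. cs (q + 2) \<xi> - cs (q - 1) \<xi>) \<le> ennreal (2 powr (- real_of_int q)) * (3 * kernel_moment (cs 0))"
proof -
  have "kernel_moment (\<lambda>\<xi>. cs (q + 2) \<xi> - cs (q - 1) \<xi>) \<le> ennreal (2 powr (- real_of_int (q + 2))) * kernel_moment (cs 0) + ennreal (2 powr (- real_of_int (q - 1))) * kernel_moment (cs 0)"
    using kernel_moment_diff_le[OF test_cs[of "q + 2"] test_cs[of "q - 1"]] unfolding kernel_moment_cs[of "q+2"] kernel_moment_cs[of "q - 1"] .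
  also have "\<dots> = ennreal (2 powr (- real_of_int (q + 2)) + 2 powr (- real_of_int (q - 1))) * kernel_moment (cs 0)"
    by (simp add: distrib_right)
  also have "\<dots> \<le> ennreal (2 powr (- real_of_int q) * 3) * kernel_moment (cs 0)"
    by (intro mult_right_mono ennreal_leI) (auto simp: powr_diff powr_minus powr_add field_simps)
  also have "\<dots> = ennreal (2 powr (- real_of_int q)) * (3 * kernel_moment (cs 0))"
    by (simp add: ennreal_mult mult.assoc)
  finally show ?thesis .
qed

lemma kernel_moment_bs: "kernel_moment (bs q) \<le> ennreal (2 powr (- real_of_int q)) * (2 * kernel_moment (cs 0))"
proof (cases "q = -1")
  case True
  have "1 * kernel_moment (cs 0) \<le> 4 * kernel_moment (cs 0)" by (intro mult_right_mono) auto
  moreover have "ennreal (2 powr 1) * (2 * kernel_moment (cs 0)) = 4 * kernel_moment (cs 0)"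
    by (simp add: mult.assoc[symmetric] ennreal_numeral[symmetric] ennreal_mult[symmetric] del: ennreal_numeral)
  ultimately show ?thesis using True by (simp add: bs_def)
next
  case False
  then have "kernel_moment (bs q) \<le> ennreal (2 powr (- real_of_int (q + 1))) * kernel_moment (cs 0) + ennreal (2 powr (- real_of_int q)) * kernel_moment (cs 0)"
    using kernel_moment_diff_le[OF test_cs[of "q + 1"] test_cs[of q]] unfolding kernel_moment_cs[of "q+1"] kernel_moment_cs[of q] by (simp add: bs_def)
  also have "\<dots> = ennreal (2 powr (- real_of_int (q + 1)) + 2 powr (- real_of_int q)) * kernel_moment (cs 0)"
    by (simp add: distrib_right)
  also have "\<dots> \<le> ennreal (2 powr (- real_of_int q) * 2) * kernel_moment (cs 0)"
    by (intro mult_right_mono ennreal_leI) (auto simp: powr_diff powr_minus powr_add field_simps)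
  also have "\<dots> = ennreal (2 powr (- real_of_int q)) * (2 * kernel_moment (cs 0))"
    by (simp add: ennreal_mult mult.assoc)
  finally show ?thesis .
qed

section \<open>Bernstein inequalities\<close>

lemma pd_DQ: "tempered_fun F \<Longrightarrow> pd j (DQ q F) x = conv (pd j (inv_fourier (bs q))) F x"
  unfolding DQ_def by (rule pd_conv[OF schwartz_inv_fourier[OF test_bs]])

lemma pd_SN: "tempered_fun F \<Longrightarrow> pd j (SN q F) x = conv (pd j (inv_fourier (cs q))) F x"
  unfolding SN_def by (rule pd_conv[OF schwartz_inv_fourier[OF test_cs]])

lemma DQ_differentiable: "tempered_fun F \<Longrightarrow> DQ q F differentiable (at x)"
  unfolding DQ_def by (rule conv_differentiable[OF schwartz_inv_fourier[OF test_bs]])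

lemma SN_differentiable: "tempered_fun F \<Longrightarrow> SN q F differentiable (at x)"
  unfolding SN_def by (rule conv_differentiable[OF schwartz_inv_fourier[OF test_cs]])

lemma continuous_conv:
  "schwartz k \<Longrightarrow> tempered_fun F \<Longrightarrow> continuous_on A (conv k F)"
  by (meson continuous_at_imp_continuous_on differentiable_imp_continuous_within conv_differentiable)

lemma continuous_pd_DQ: "tempered_fun F \<Longrightarrow> continuous_on UNIV (pd j (DQ q F))"
  unfolding DQ_def using continuous_conv[OF schwartz_pd[OF schwartz_inv_fourier[OF test_bs]], of F UNIV j q]
  by (subst ext[OF pd_conv[OF schwartz_inv_fourier[OF test_bs]]])

lemma continuous_pd_SN: "tempered_fun F \<Longrightarrow> continuous_on UNIV (pd j (SN q F))"
  unfolding SN_def using continuous_conv[OF schwartz_pd[OF schwartz_inv_fourier[OF test_cs]], of F UNIV j q]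
  by (subst ext[OF pd_conv[OF schwartz_inv_fourier[OF test_cs]]])

text \<open>
  The derivative falls on a wider cut-off, whose kernel has a gradient of size
  \<open>2\<^bsup>q+2\<^esup>\<close> in \<open>L\<^sup>1\<close>.
\<close>

lemma conv_pd_bs:
  assumes q: "q \<ge> -1" and F: "tempered_fun F"
  shows "conv (pd j (inv_fourier (bs q))) F x = conv (pd j (inv_fourier (cs (q + 2)))) (DQ q F) x"
proof -
  have t: "test_symbol (\<lambda>\<xi>. \<i> * (of_real (\<xi> $ j) * cs (q + 2) \<xi>))"
    by (intro test_symbol_cmult test_symbol_coord_times test_cs)
  have p: "pd j (inv_fourier m) = inv_fourier (\<lambda>\<xi>. \<i> * (of_real (\<xi> $ j) * m \<xi>))" if "test_symbol m" for m :: "real^'n \<Rightarrow> complex"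
    by (rule ext) (rule pd_inv_fourier[OF that])
  have "(\<lambda>\<xi>. \<i> * (of_real (\<xi> $ j) * bs q \<xi>)) = (\<lambda>\<xi>. \<i> * (of_real (\<xi> $ j) * cs (q + 2) \<xi>) * bs q \<xi>)"
    by (simp only: mult.assoc cs_times_bs[OF q])
  then show ?thesis
    unfolding p[OF test_bs] p[OF test_cs] DQ_def conv_conv[OF t test_bs F] by simp
qed

lemma DQ_fat:
  assumes q: "q \<ge> 0" and F: "tempered_fun F"
  shows "conv (inv_fourier (\<lambda>\<xi>. cs (q + 2) \<xi> - cs (q - 1) \<xi>)) (DQ q F) x = DQ q F x"
  unfolding DQ_def conv_conv[OF test_symbol_diff[OF test_cs test_cs] test_bs F] fat_bs_times_bs[OF q] ..

lemma Lpe_const_one: "Lpe lborel top (\<lambda>x::real^'n. 1) \<le> 1"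
  unfolding Lpe_infinity by (rule esssup_I) auto

lemma inverse_exponent_top: "1 / p = 1 / p + 1 / (top :: ennreal)"
  by simp

text \<open>
  The block is reproduced by a kernel of integral zero, so that it is, up to the sign, the
  commutator of that kernel with the block as multiplier, applied to the constant function \<open>1\<close>.
  The commutator estimate then gives the first moment of the kernel, which is of order
  \<open>2\<^sup>-\<^sup>q\<close>.
\<close>

lemma reverse_Bernstein:
  assumes p: "1 \<le> p" and q: "q \<ge> 0" and F: "tempered_fun F"
  shows "Lpe lborel p (\<lambda>x. ennreal (norm (DQ q F x))) \<le>
    ennreal (2 powr (- real_of_int q)) * (3 * kernel_moment (cs 0)) * Lpn p UNIV (\<lambda>j. pd j (DQ q F))"
proof -
  define m where "m = (\<lambda>\<xi>. cs (q + 2) \<xi> - cs (q - 1) \<xi>)"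
  have tm: "test_symbol m" unfolding m_def by (intro test_symbol_diff test_cs)
  have m0: "m 0 = 0" by (simp add: m_def cs_at_0)
  define k where "k = inv_fourier m"
  have rk: "rapid k" unfolding k_def by (rule test_symbol_rapid[OF tm])
  define a where "a = DQ q F"
  have ta: "tempered_fun a" unfolding a_def by (rule tempered_DQ[OF F])
  have rep: "(LINT y|lborel. k y * (a x - a (x - y)) * 1) = - a x" for x
  proof -
    have i1: "integrable lborel (\<lambda>y. k y * a x)" by (intro integrable_mult_left rapid_integrable rk)
    have "integrable lborel (\<lambda>y. k (x - (x - y)) * a (x - y))"
      using conv_integrable[OF rk ta, of x] integrable_lborel_reflect_iff[of "\<lambda>y. k (x - y) * a y" x] by simp
    then have i2: "integrable lborel (\<lambda>y. k y * a (x - y))" by simp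
    have "(LINT y|lborel. k y * (a x - a (x - y)) * 1) = (LINT y|lborel. k y * a x) - (LINT y|lborel. k y * a (x - y))"
      unfolding mult_1_right right_diff_distrib by (rule Bochner_Integration.integral_diff[OF i1 i2])
    also have "(LINT y|lborel. k y * a x) = 0"
      unfolding integral_mult_left_zero k_def integral_inv_fourier[OF tm] m0 by simp
    also have "(LINT y|lborel. k y * a (x - y)) = a x"
      unfolding conv_commute[symmetric] k_def m_def a_def by (rule DQ_fat[OF q F])
    finally show ?thesis by simp
  qed
  have "Lpn p {()} (\<lambda>i x. LINT y|lborel. k y * (a x - a (x - y)) * 1) \<le>
      (\<integral>\<^sup>+y. ennreal (norm y * norm (k y)) \<partial>lborel) * (Lpn p UNIV (\<lambda>j. pd j a) * Lpn top {()} (\<lambda>_ (_::real^'n). 1))"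
    by (rule Lpn_commutator[where a=a and k=k and I="{()}" and b="\<lambda>_ _. 1", OF p p _ inverse_exponent_top])
      (auto simp: a_def DQ_differentiable[OF F] continuous_pd_DQ[OF F] rapid_measurable[OF rk])
  also have "\<dots> \<le> (\<integral>\<^sup>+y. ennreal (norm y * norm (k y)) \<partial>lborel) * (Lpn p UNIV (\<lambda>j. pd j a) * 1)"
    by (intro mult_left_mono) (auto simp: Lpn_def vec_norm_def L2_set_def Lpe_const_one)
  also have "\<dots> \<le> ennreal (2 powr (- real_of_int q)) * (3 * kernel_moment (cs 0)) * (Lpn p UNIV (\<lambda>j. pd j a) * 1)"
    using kernel_moment_fat_bs[of q] unfolding kernel_moment_def[of "\<lambda>\<xi>. cs (q + 2) \<xi> - cs (q - 1) \<xi>"] k_def m_def by (rule mult_right_mono) simp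
  finally show ?thesis unfolding rep by (simp add: Lpn_def vec_norm_def L2_set_def a_def)
qed

lemma L2_set_times:
  assumes "finite I" "finite J"
  shows "L2_set (\<lambda>(i, j). a j * b i) (I \<times> J) = L2_set a J * L2_set b I"
proof -
  have "(\<Sum>z\<in>I \<times> J. (case z of (i, j) \<Rightarrow> a j * b i)\<^sup>2) = (\<Sum>i\<in>I. \<Sum>j\<in>J. (a j)\<^sup>2 * (b i)\<^sup>2)"
    unfolding sum.cartesian_product by (intro sum.cong) (auto simp: power_mult_distrib)
  also have "\<dots> = (\<Sum>j\<in>J. (a j)\<^sup>2) * (\<Sum>i\<in>I. (b i)\<^sup>2)"
    unfolding sum_product by (rule sum.swap)
  finally show ?thesis unfolding L2_set_def by (simp add: real_sqrt_mult)
qed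

text \<open>
  Young's inequality for the vector-valued kernel: the length of a tensor product is the
  product of the lengths.
\<close>

lemma Lpn_conv_grad:
  fixes F :: "'i \<Rightarrow> real^'n \<Rightarrow> complex"
  assumes p: "1 \<le> p" and I: "finite I" and m: "test_symbol m" and F: "\<And>i. i \<in> I \<Longrightarrow> tempered_fun (F i)"
  shows "Lpn p (I \<times> UNIV) (\<lambda>(i, j). conv (pd j (inv_fourier m)) (F i)) \<le> kernel_grad m * Lpn p I F"
proof -
  have km[measurable]: "pd j (inv_fourier m) \<in> borel_measurable borel" for j by (rule pd_inv_fourier_measurable[OF m])
  have Fm: "F i \<in> borel_measurable borel" if "i \<in> I" for i by (rule tempered_measurable[OF F[OF that]])
  have vm[measurable]: "vec_norm I F \<in> borel_measurable borel" by (rule vec_norm_measurable[OF Fm])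
  have dm[measurable]: "vec_norm UNIV (\<lambda>j. pd j (inv_fourier m)) \<in> borel_measurable borel" by (rule vec_norm_measurable[OF km])
  have "Lpn p (I \<times> UNIV) (\<lambda>(i, j). conv (pd j (inv_fourier m)) (F i)) \<le>
      Lpe lborel p (\<lambda>x. \<integral>\<^sup>+y. ennreal (vec_norm UNIV (\<lambda>j. pd j (inv_fourier m)) y) * ennreal (vec_norm I F (x - y)) \<partial>lborel)"
  proof (rule Lpn_mono_pointwise[OF p])
    fix z assume "z \<in> I \<times> (UNIV :: 'n set)"
    then show "(case z of (i, j) \<Rightarrow> conv (pd j (inv_fourier m)) (F i)) \<in> borel_measurable lborel"
      using conv_measurable[OF km Fm] by auto
  next
    fix x
    have meas: "(\<lambda>y. (case z of (i, j) \<Rightarrow> pd j (inv_fourier m) y * F i (x - y))) \<in> borel_measurable lborel" if "z \<in> I \<times> UNIV" for z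
    proof -
      obtain i j where z: "z = (i, j)" "i \<in> I" using \<open>z \<in> I \<times> UNIV\<close> by auto
      note [measurable] = Fm[OF z(2)]
      show ?thesis unfolding z(1) prod.case by measurable
    qed
    have "vec_norm (I \<times> UNIV) (\<lambda>(i, j). conv (pd j (inv_fourier m)) (F i)) x =
        L2_set (\<lambda>z. norm (LINT y|lborel. (case z of (i, j) \<Rightarrow> pd j (inv_fourier m) y * F i (x - y)))) (I \<times> UNIV)"
      unfolding vec_norm_def by (rule L2_set_cong) (auto simp: conv_commute)
    then have "ennreal (vec_norm (I \<times> UNIV) (\<lambda>(i, j). conv (pd j (inv_fourier m)) (F i)) x) \<le>
        (\<integral>\<^sup>+y. ennreal (L2_set (\<lambda>z. norm ((case z of (i, j) \<Rightarrow> pd j (inv_fourier m) y * F i (x - y)))) (I \<times> UNIV)) \<partial>lborel)"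
      using L2_set_integral_le[OF finite_cartesian_product[OF I finite_class.finite_UNIV] meas] by simp
    also have "\<dots> = (\<integral>\<^sup>+y. ennreal (vec_norm UNIV (\<lambda>j. pd j (inv_fourier m)) y) * ennreal (vec_norm I F (x - y)) \<partial>lborel)"
    proof (rule nn_integral_cong)
      fix y
      have "L2_set (\<lambda>z. norm ((case z of (i, j) \<Rightarrow> pd j (inv_fourier m) y * F i (x - y)))) (I \<times> UNIV) =
          L2_set (\<lambda>(i, j). norm (pd j (inv_fourier m) y) * norm (F i (x - y))) (I \<times> UNIV)"
        by (rule L2_set_cong) (auto simp: norm_mult)
      also have "\<dots> = vec_norm UNIV (\<lambda>j. pd j (inv_fourier m)) y * vec_norm I F (x - y)"
        unfolding vec_norm_def by (rule L2_set_times[OF I finite_class.finite_UNIV])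
      finally show "ennreal (L2_set (\<lambda>z. norm ((case z of (i, j) \<Rightarrow> pd j (inv_fourier m) y * F i (x - y)))) (I \<times> UNIV)) =
          ennreal (vec_norm UNIV (\<lambda>j. pd j (inv_fourier m)) y) * ennreal (vec_norm I F (x - y))"
        by (simp add: ennreal_mult)
    qed
    finally show "ennreal (vec_norm (I \<times> UNIV) (\<lambda>(i, j). conv (pd j (inv_fourier m)) (F i)) x) \<le>
        (\<integral>\<^sup>+y. ennreal (vec_norm UNIV (\<lambda>j. pd j (inv_fourier m)) y) * ennreal (vec_norm I F (x - y)) \<partial>lborel)" .
  qed
  also have "\<dots> \<le> kernel_grad m * Lpn p I F"
    unfolding Lpn_def kernel_grad_def by (rule Lpe_Young[OF p]) measurable
  finally show ?thesis .
qed

end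

lemma tempered_conv_times:
  assumes "rapid k" "tempered_fun f" "tempered_fun H"
  shows "tempered_fun (\<lambda>y. conv k f y * H y)"
proof -
  obtain C N where g: "\<And>x. norm (conv k f x) \<le> C * (1 + norm x) ^ N"
    using conv_growth[OF assms(1,2)] by blast
  note [measurable] = tempered_measurable[OF tempered_conv[OF assms(1,2)]] tempered_measurable[OF assms(3)]
  show ?thesis
  proof (rule tempered_bound[OF assms(3), where C=C and M=N])
    show "(\<lambda>y. conv k f y * H y) \<in> borel_measurable borel" by measurable
    show "norm (conv k f x * H x) \<le> C * (1 + norm x) ^ N * norm (H x)" for x
      unfolding norm_mult by (intro mult_right_mono g) auto
  qed
qed

lemma conv_sum_right:
  assumes k: "rapid k" and G: "\<And>i. i \<in> I \<Longrightarrow> tempered_fun (G i)"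
  shows "conv k (\<lambda>y. \<Sum>i\<in>I. G i y) x = (\<Sum>i\<in>I. conv k (G i) x)"
  unfolding conv_def sum_distrib_left
  by (rule Bochner_Integration.integral_sum) (intro conv_integrable k G)

lemma conv_add_right:
  assumes k: "rapid k" and G: "tempered_fun G" "tempered_fun G'"
  shows "conv k (\<lambda>y. G y + G' y) x = conv k G x + conv k G' x"
  unfolding conv_def distrib_left
  by (rule Bochner_Integration.integral_add) (intro conv_integrable k G)+

text \<open>
  Both convolutions have the same kernel; the values of the multiplier at \<open>x\<close> and at \<open>x - y\<close>
  are subtracted under the integral.
\<close>

lemma commutator_integral:
  assumes k: "rapid k" and G: "tempered_fun G" and aG: "tempered_fun (\<lambda>y. a y * G y)"
  shows "(LINT y|lborel. k y * (a x - a (x - y)) * G (x - y)) = a x * conv k G x - conv k (\<lambda>y. a y * G y) x"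
proof -
  have i: "integrable lborel (\<lambda>y. k y * g (x - y))" if "tempered_fun g" for g
  proof -
    have "integrable lborel (\<lambda>y. k (x - (x - y)) * g (x - y))"
      using conv_integrable[OF k that, of x] integrable_lborel_reflect_iff[of "\<lambda>y. k (x - y) * g y" x] by simp
    then show ?thesis by simp
  qed
  have eq: "k y * (a x - a (x - y)) * G (x - y) = a x * (k y * G (x - y)) - k y * (a (x - y) * G (x - y))" for y
    by (simp add: algebra_simps)
  have "(LINT y|lborel. k y * (a x - a (x - y)) * G (x - y)) = (LINT y|lborel. a x * (k y * G (x - y))) - (LINT y|lborel. k y * (a (x - y) * G (x - y)))"
    unfolding eq by (rule Bochner_Integration.integral_diff) (intro integrable_mult_right i G, rule i[OF aG])
  then show ?thesis unfolding conv_commute by (simp only: integral_mult_right_zero)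
qed

lemma vec_norm_triangle: "vec_norm I (\<lambda>i x. F i x + G i x) x \<le> vec_norm I F x + vec_norm I G x"
proof -
  have "vec_norm I (\<lambda>i x. F i x + G i x) x \<le> L2_set (\<lambda>i. norm (F i x) + norm (G i x)) I"
    unfolding vec_norm_def by (intro L2_set_mono norm_triangle_ineq) auto
  also have "\<dots> \<le> vec_norm I F x + vec_norm I G x" unfolding vec_norm_def by (rule L2_set_triangle_ineq)
  finally show ?thesis .
qed

lemma Lpn_add:
  assumes p: "1 \<le> p" and F: "\<And>i. i \<in> I \<Longrightarrow> F i \<in> borel_measurable borel" and G: "\<And>i. i \<in> I \<Longrightarrow> G i \<in> borel_measurable borel"
  shows "Lpn p I (\<lambda>i x. F i x + G i x) \<le> Lpn p I F + Lpn p I G"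
proof -
  have "Lpn p I (\<lambda>i x. F i x + G i x) \<le> Lpe lborel p (\<lambda>x. ennreal (vec_norm I F x) + ennreal (vec_norm I G x))"
  proof (rule Lpn_mono_pointwise[OF p])
    show "(\<lambda>x. F i x + G i x) \<in> borel_measurable lborel" if "i \<in> I" for i
      using F[OF that] G[OF that] by simp
    show "ennreal (vec_norm I (\<lambda>i x. F i x + G i x) x) \<le> ennreal (vec_norm I F x) + ennreal (vec_norm I G x)" for x
      using vec_norm_triangle[of I F G x] by (simp add: ennreal_plus[symmetric] ennreal_leI del: ennreal_plus)
  qed
  also have "\<dots> \<le> Lpn p I F + Lpn p I G"
    unfolding Lpn_def by (intro Lpe_add sigma_finite_lborel p ennreal_vec_norm_measurable) (use F G in simp_all)
  finally show ?thesis .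
qed

lemma Lpn_sum:
  fixes F :: "'k \<Rightarrow> 'i \<Rightarrow> real^'n \<Rightarrow> complex"
  assumes p: "1 \<le> p" and K: "finite K" and F: "\<And>k i. k \<in> K \<Longrightarrow> i \<in> I \<Longrightarrow> F k i \<in> borel_measurable borel"
  shows "Lpn p I (\<lambda>i x. \<Sum>k\<in>K. F k i x) \<le> (\<Sum>k\<in>K. Lpn p I (F k))"
  using K F
proof (induction K rule: finite_induct)
  case empty
  have "Lpe lborel p (\<lambda>x::real^'n. 0 * 0) \<le> 0 * Lpe lborel p (\<lambda>x::real^'n. 0)" by (rule Lpe_cmult_le[OF p]) simp
  then show ?case by (simp add: Lpn_def vec_norm_def L2_set_def)
next
  case (insert k K)
  have "Lpn p I (\<lambda>i x. \<Sum>k\<in>insert k K. F k i x) = Lpn p I (\<lambda>i x. F k i x + (\<Sum>k\<in>K. F k i x))"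
    using insert(1,2) by simp
  also have "\<dots> \<le> Lpn p I (F k) + Lpn p I (\<lambda>i x. \<Sum>k\<in>K. F k i x)"
    using insert(4) by (intro Lpn_add p borel_measurable_sum) auto
  also have "\<dots> \<le> Lpn p I (F k) + (\<Sum>k\<in>K. Lpn p I (F k))"
    using insert(3,4) by (intro add_left_mono) auto
  finally show ?case using insert(1,2) by simp
qed

lemma Lpn_cong: "(\<And>i x. i \<in> I \<Longrightarrow> F i x = G i x) \<Longrightarrow> Lpn p I F = Lpn p I G"
proof -
  assume "\<And>i x. i \<in> I \<Longrightarrow> F i x = G i x"
  then have "vec_norm I F = vec_norm I G" by (auto simp: vec_norm_def fun_eq_iff intro!: L2_set_cong)
  then show ?thesis by (simp add: Lpn_def)
qed

lemma Lpn_uminus: "Lpn p I (\<lambda>i x. - F i x) = Lpn p I F"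
  by (simp add: Lpn_def vec_norm_def)

lemma Lpn_times_scalar:
  fixes b :: "real^'n \<Rightarrow> complex"
  assumes p: "1 \<le> p" "1 \<le> p1" "1 \<le> p2" "1 / p = 1 / p1 + 1 / p2"
    and b: "b \<in> borel_measurable borel" and H: "\<And>i. i \<in> I \<Longrightarrow> H i \<in> borel_measurable borel"
  shows "Lpn p I (\<lambda>i x. b x * H i x) \<le> Lpe lborel p2 (\<lambda>x. ennreal (norm (b x))) * Lpn p1 I H"
proof -
  note [measurable] = b vec_norm_measurable[of I H borel, OF H]
  have "Lpn p I (\<lambda>i x. b x * H i x) = Lpe lborel p (\<lambda>x. ennreal (vec_norm I H x) * ennreal (norm (b x)))"
    unfolding Lpn_def vec_norm_def norm_mult by (simp add: L2_set_right_distrib[symmetric] ennreal_mult mult.commute)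
  also have "\<dots> \<le> Lpn p1 I H * Lpe lborel p2 (\<lambda>x. ennreal (norm (b x)))"
    unfolding Lpn_def by (rule Lpe_Holder[OF p]) measurable
  finally show ?thesis by (simp add: mult.commute)
qed

context lp_pair
begin

section \<open>Localization of the low-frequency commutator\<close>

lemma SN_eq_sum:
  assumes M: "M \<ge> L" and L: "L \<ge> 0" and H: "tempered_fun H"
  shows "SN M H x = SN L H x + (\<Sum>k\<in>{L..M - 1}. DQ k H x)"
  using M
proof (induction M rule: int_ge_induct)
  case (step M)
  have "{L..M + 1 - 1} = insert M {L..M - 1}" using step(1) by auto
  then show ?case using step DQ_eq[OF _ H, of M x] L by simp
qed simp

lemma SN_eq_sum_from_bottom:
  assumes M: "M \<ge> 0" and H: "tempered_fun H"
  shows "SN M H x = (\<Sum>k\<in>{-1..M - 1}. DQ k H x)"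
proof -
  have "{-1..M - 1} = insert (-1) {0..M - 1}" using M by auto
  then show ?thesis using SN_eq_sum[OF M order_refl H] by (simp add: DQ_minus_1)
qed

lemma SN_one: "SN N (\<lambda>_. 1) x = 1"
  unfolding SN_def conv_def using integral_lborel_reflect[of "inv_fourier (cs N)" x] integral_inv_fourier[OF test_cs, of N]
  by (simp add: cs_at_0)

text \<open>
  Frequencies of the first factor and of the block are at most \<open>8/3 \<cdot> 2\<^sup>q\<close>, so that
  those of the second factor would have to be at most \<open>16/3 \<cdot> 2\<^sup>q\<close>; but they are at
  least \<open>6 \<cdot> 2\<^sup>q\<close>.
\<close>

lemma low_high_localization:
  assumes q: "q \<ge> -1" and N: "N \<le> q + 1" and M: "q + 3 \<le> M" and f: "tempered_fun f" and H: "tempered_fun H"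
  shows "conv (inv_fourier (bs q)) (\<lambda>y. SN N f y * (SN M H y - SN (q + 3) H y)) x = 0"
proof -
  have "SN M H y - SN (q + 3) H y = conv (inv_fourier (\<lambda>\<xi>. cs M \<xi> - cs (q + 3) \<xi>)) H y" for y
    unfolding SN_def by (rule conv_symbol_diff[OF test_cs test_cs H, symmetric])
  then have "conv (inv_fourier (bs q)) (\<lambda>y. SN N f y * (SN M H y - SN (q + 3) H y)) x =
      conv (inv_fourier (bs q)) (\<lambda>y. conv (inv_fourier (cs N)) f y * conv (inv_fourier (\<lambda>\<xi>. cs M \<xi> - cs (q + 3) \<xi>)) H y) x"
    unfolding SN_def[of N] by simp
  also have "\<dots> = 0"
  proof (rule conv_spectral_localization[OF test_bs test_cs test_symbol_diff[OF test_cs test_cs] f H])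
    fix \<xi> \<eta> assume a: "cs N \<xi> \<noteq> 0" and b: "cs M \<eta> - cs (q + 3) \<eta> \<noteq> 0"
    show "bs q (\<xi> + \<eta>) = 0"
    proof (rule ccontr)
      assume c: "bs q (\<xi> + \<eta>) \<noteq> 0"
      have "2 powr real_of_int N \<le> 2 powr (real_of_int q + 1)" using N by (intro powr_mono) auto
      then have 1: "norm \<xi> \<le> 4/3 * (2 * 2 powr q)" using cs_support[OF a] by (simp add: powr_add)
      have 2: "norm (\<xi> + \<eta>) \<le> 4/3 * (2 * 2 powr q)" using bs_support_upper[OF q c] by (simp add: powr_add)
      have 3: "3/4 * (8 * 2 powr q) \<le> norm \<eta>" using cs_diff_support[OF M b] by (simp add: powr_add)
      have "norm \<eta> \<le> norm (\<xi> + \<eta>) + norm \<xi>" using norm_triangle_ineq4[of "\<xi> + \<eta>" \<xi>] by simp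
      moreover have "2 powr real_of_int q > 0" by simp
      ultimately show False using 1 2 3 by linarith
    qed
  qed
  finally show ?thesis .
qed

text \<open>
  Both factors have frequencies at most \<open>1/3 \<cdot> 2\<^sup>q\<close>, the block has frequencies at
  least \<open>3/4 \<cdot> 2\<^sup>q\<close>.
\<close>

lemma low_low_localization:
  assumes q: "q \<ge> 2" and f: "tempered_fun f" and H: "tempered_fun H"
  shows "conv (inv_fourier (bs q)) (\<lambda>y. SN (q - 2) f y * SN (q - 2) H y) x = 0"
  unfolding SN_def
proof (rule conv_spectral_localization[OF test_bs test_cs test_cs f H])
  fix \<xi> \<eta> assume a: "cs (q - 2) \<xi> \<noteq> 0" and b: "cs (q - 2) \<eta> \<noteq> 0"
  show "bs q (\<xi> + \<eta>) = 0"
  proof (rule ccontr)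
    assume c: "bs q (\<xi> + \<eta>) \<noteq> 0"
    have 1: "norm \<xi> \<le> 4/3 * (2 powr q / 4)" using cs_support[OF a] by (simp add: powr_diff)
    have 2: "norm \<eta> \<le> 4/3 * (2 powr q / 4)" using cs_support[OF b] by (simp add: powr_diff)
    have 3: "3/4 * 2 powr q \<le> norm (\<xi> + \<eta>)" using bs_support_lower[OF _ c] q by simp
    have "norm (\<xi> + \<eta>) \<le> norm \<xi> + norm \<eta>" by (rule norm_triangle_ineq)
    moreover have "2 powr real_of_int q > 0" by simp
    ultimately show False using 1 2 3 by linarith
  qed
qed

text \<open>
  The function \<open>H\<close> is the limit of its cut-offs only when tested against decaying functions,
  but the value at \<open>x\<close> of a block of a product with \<open>S\<^sub>N f\<close> is such a test. Along this
  limit the value does not change from the cut-off at \<open>q + 3\<close> on; frequencies below \<open>q - 2\<close> do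
  not contribute either, if there are any.
\<close>

lemma block_localization:
  assumes q: "q \<ge> -1" and N: "N = max (q - 2) 0" and f: "tempered_fun f" and H: "tempered_fun H"
  shows "conv (inv_fourier (bs q)) (\<lambda>y. SN N f y * H y) x =
    (\<Sum>k\<in>{max (-1) (q - 2)..q + 2}. conv (inv_fourier (bs q)) (\<lambda>y. SN N f y * DQ k H y) x)"
proof -
  define K where "K = inv_fourier (bs q)"
  have sK: "schwartz K" unfolding K_def by (rule schwartz_inv_fourier[OF test_bs])
  have rK: "rapid K" by (rule schwartz_rapid[OF sK])
  have rS: "rapid (inv_fourier (cs N))" by (rule test_symbol_rapid[OF test_cs])
  define C where "C = (\<lambda>G. conv K (\<lambda>y. SN N f y * G y) x)"
  have tG: "tempered_fun (\<lambda>y. SN N f y * G y)" if "tempered_fun G" for G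
    unfolding SN_def by (rule tempered_conv_times[OF rS f that])
  have Cadd: "C (\<lambda>y. G y + G' y) = C G + C G'" if "tempered_fun G" "tempered_fun G'" for G G'
    unfolding C_def distrib_left by (intro conv_add_right rK tG that)
  have Csum: "C (\<lambda>y. \<Sum>k\<in>S. DQ k H y) = (\<Sum>k\<in>S. C (DQ k H))" for S :: "int set"
    unfolding C_def sum_distrib_left by (intro conv_sum_right rK tG tempered_DQ H)
  \<comment> \<open>The decaying test function with which \<open>H\<close> is paired.\<close>
  define \<psi> where "\<psi> = (\<lambda>y. K (x - y) * SN N f y)"
  have CL: "C G = (LINT y|lborel. G y * \<psi> y)" for G
    unfolding C_def conv_def \<psi>_def by (simp only: mult_ac)
  have "rapid \<psi>"
  proof -
    obtain D M where g: "\<And>y. norm (SN N f y) \<le> D * (1 + norm y) ^ M" using conv_growth[OF rS f] unfolding SN_def by blast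
    show ?thesis unfolding \<psi>_def
      by (rule rapid_times_poly[OF rapid_reflect[OF rK] tempered_measurable[OF tempered_SN[OF f]] g])
  qed
  moreover have "continuous_on UNIV \<psi>"
    unfolding \<psi>_def SN_def
    by (intro continuous_on_mult smooth_continuous schwartz_smooth schwartz_reflect sK continuous_conv schwartz_inv_fourier test_cs f)
  ultimately have "(\<lambda>n. LINT y|lborel. SN (q + 3 + int n) H y * \<psi> y) \<longlonglongrightarrow> (LINT y|lborel. H y * \<psi> y)"
    using q by (intro SN_tendsto H) auto
  then have lim: "(\<lambda>n. C (SN (q + 3 + int n) H)) \<longlonglongrightarrow> C H" unfolding CL .
  have "C (SN (q + 3 + int n) H) = C (SN (q + 3) H)" for n
  proof -
    have "C (\<lambda>y. SN (q + 3) H y + (SN (q + 3 + int n) H y - SN (q + 3) H y)) = C (SN (q + 3) H) + C (\<lambda>y. SN (q + 3 + int n) H y - SN (q + 3) H y)"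
      by (intro Cadd tempered_SN tempered_diff H)
    moreover have "C (\<lambda>y. SN (q + 3 + int n) H y - SN (q + 3) H y) = 0"
      unfolding C_def K_def by (rule low_high_localization[OF q _ _ f H]) (use q N in auto)
    ultimately show ?thesis by simp
  qed
  then have "(\<lambda>n::nat. C (SN (q + 3) H)) \<longlonglongrightarrow> C H" using lim by (simp only:)
  then have CH: "C H = C (SN (q + 3) H)" by (simp only: LIMSEQ_const_iff)
  show ?thesis
  proof (cases "q \<ge> 2")
    case False
    then have m: "max (-1) (q - 2) = -1" by auto
    have e: "q + 3 - 1 = q + 2" by simp
    have "SN (q + 3) H = (\<lambda>y. \<Sum>k\<in>{-1..q + 2}. DQ k H y)"
    proof
      fix y
      show "SN (q + 3) H y = (\<Sum>k\<in>{-1..q + 2}. DQ k H y)"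
        using SN_eq_sum_from_bottom[OF _ H, of "q + 3" y] q unfolding e by simp
    qed
    then have "C H = (\<Sum>k\<in>{-1..q + 2}. C (DQ k H))" unfolding CH by (simp only: Csum)
    then show ?thesis unfolding m C_def K_def .
  next
    case True
    then have m: "max (-1) (q - 2) = q - 2" "N = q - 2" using N by auto
    have e: "q + 3 - 1 = q + 2" by simp
    have "SN (q + 3) H = (\<lambda>y. SN (q - 2) H y + (\<Sum>k\<in>{q - 2..q + 2}. DQ k H y))"
    proof
      fix y
      show "SN (q + 3) H y = SN (q - 2) H y + (\<Sum>k\<in>{q - 2..q + 2}. DQ k H y)"
        using SN_eq_sum[OF _ _ H, of "q - 2" "q + 3" y] True unfolding e by simp
    qed
    then have "C H = C (SN (q - 2) H) + C (\<lambda>y. \<Sum>k\<in>{q - 2..q + 2}. DQ k H y)"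
      unfolding CH by (simp only: Cadd[OF tempered_SN[OF H] tempered_sum[OF tempered_DQ[OF H]]])
    moreover have "C (SN (q - 2) H) = 0"
      unfolding C_def K_def m(2) by (rule low_low_localization[OF True f H])
    ultimately have "C H = (\<Sum>k\<in>{q - 2..q + 2}. C (DQ k H))" by (simp only: Csum add_0)
    then show ?thesis unfolding m(1) C_def K_def .
  qed
qed

text \<open>
  The localization applies to \<open>S\<^sub>N f\<close> and, with the constant function \<open>1\<close> in place of
  \<open>f\<close>, to \<open>\<Delta>\<^sub>q H\<close> itself; hence both terms of the commutator split into the same
  blocks of \<open>H\<close>.
\<close>

lemma low_commutator:
  assumes q: "q \<ge> -1" and N: "N = max (q - 2) 0" and f: "tempered_fun f" and H: "tempered_fun H"
  shows "SN N f x * DQ q H x - DQ q (\<lambda>y. SN N f y * H y) x =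
    (\<Sum>k\<in>{max (-1) (q - 2)..q + 2}. LINT y|lborel. inv_fourier (bs q) y * (SN N f x - SN N f (x - y)) * DQ k H (x - y))"
proof -
  have t1: "tempered_fun (\<lambda>_::real^'n. 1)" using tempered_poly_growth[of "\<lambda>_. 1" 1 0] by simp
  have rS: "rapid (inv_fourier (cs N))" by (rule test_symbol_rapid[OF test_cs])
  have tG: "tempered_fun (\<lambda>y. SN N f y * DQ k H y)" for k
    unfolding SN_def by (rule tempered_conv_times[OF rS f tempered_DQ[OF H]])
  have d: "DQ q H x = (\<Sum>k\<in>{max (-1) (q - 2)..q + 2}. conv (inv_fourier (bs q)) (DQ k H) x)"
    using block_localization[OF q N t1 H, of x] by (simp add: SN_one DQ_def)
  show ?thesis
    unfolding commutator_integral[OF test_symbol_rapid[OF test_bs] tempered_DQ[OF H] tG] sum_subtractf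
      sum_distrib_left[symmetric] d[symmetric] DQ_def[of q "\<lambda>y. SN N f y * H y"] block_localization[OF q N f H] ..
qed

section \<open>The high-frequency part\<close>

text \<open>
  The dyadic blocks converge to \<open>f - SN N f\<close> only when tested, whereas their \<open>L\<^sup>p\<close> series
  converges almost everywhere; the two limits agree because functions of tempered growth are
  determined by their tests.
\<close>

lemma high_frequency_bound:
  assumes p: "1 \<le> p" and N: "N \<ge> 0" and f: "tempered_fun f"
  shows "Lpe lborel p (\<lambda>x. ennreal (norm (f x - SN N f x))) \<le> (\<Sum>k. Lpe lborel p (\<lambda>x. ennreal (norm (DQ (N + int k) f x))))"
proof (cases "(\<Sum>k. Lpe lborel p (\<lambda>x. ennreal (norm (DQ (N + int k) f x)))) = top")
  case False
  have u: "Lpn p {()} (\<lambda>_. g) = Lpe lborel p (\<lambda>x. ennreal (norm (g x)))" for g :: "real^'n \<Rightarrow> complex"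
    by (simp add: Lpn_def vec_norm_def L2_set_def)
  define v where "v = (\<lambda>k (_::unit). DQ (N + int k) f)"
  have "(\<Sum>k. Lpn p {()} (v k)) < top" using False unfolding v_def u by (simp add: less_top)
  moreover have "v k i \<in> borel_measurable borel" for k i
    unfolding v_def by (rule tempered_measurable[OF tempered_DQ[OF f]])
  ultimately obtain F where F: "tempered_fun (F ())" "Lpn p {()} F \<le> (\<Sum>k. Lpn p {()} (v k))"
    and lim: "\<And>\<psi>. rapid \<psi> \<Longrightarrow> (\<lambda>n. LINT x|lborel. (\<Sum>k<n. v k () x) * \<psi> x) \<longlonglongrightarrow> (LINT x|lborel. F () x * \<psi> x)"
    using Lpn_series[OF p, of "{()}" v] by auto
  have tb: "tempered_fun (\<lambda>x. f x - SN N f x)" by (intro tempered_diff f tempered_SN)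
  note i = tempered_times_rapid_integrable
  have "AE x in lborel. F () x - (f x - SN N f x) = 0"
  proof (rule AE_zero_of_continuous_tests)
    show "tempered_fun (\<lambda>x. F () x - (f x - SN N f x))" by (intro tempered_diff[of "F ()"] F tb)
    fix \<psi> :: "real^'n \<Rightarrow> complex" assume psi: "rapid \<psi>" "continuous_on UNIV \<psi>"
    have e1: "(LINT x|lborel. (\<Sum>k<n. v k () x) * \<psi> x) = (LINT x|lborel. SN (N + int n) f x * \<psi> x) - (LINT x|lborel. SN N f x * \<psi> x)" for n
      unfolding v_def sum_DQ[OF N f] left_diff_distrib
      by (intro Bochner_Integration.integral_diff i tempered_SN f psi)
    have e2: "(LINT x|lborel. (f x - SN N f x) * \<psi> x) = (LINT x|lborel. f x * \<psi> x) - (LINT x|lborel. SN N f x * \<psi> x)"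
      unfolding left_diff_distrib by (intro Bochner_Integration.integral_diff i tempered_SN f psi)
    have "(\<lambda>n. LINT x|lborel. (\<Sum>k<n. v k () x) * \<psi> x) \<longlonglongrightarrow> (LINT x|lborel. (f x - SN N f x) * \<psi> x)"
      unfolding e1 e2 by (intro tendsto_diff tendsto_const SN_tendsto N f psi)
    then have "(LINT x|lborel. F () x * \<psi> x) = (LINT x|lborel. (f x - SN N f x) * \<psi> x)"
      using lim[OF psi(1)] LIMSEQ_unique by blast
    then show "(LINT x|lborel. (F () x - (f x - SN N f x)) * \<psi> x) = 0"
      unfolding left_diff_distrib[of "F () _"] by (subst Bochner_Integration.integral_diff) (intro i F tb psi, intro i F tb psi, simp)
  qed
  then have ae: "AE x in lborel. ennreal (norm (f x - SN N f x)) \<le> ennreal (vec_norm {()} F x)"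
    by eventually_elim (simp add: vec_norm_def L2_set_def)
  have "Lpe lborel p (\<lambda>x. ennreal (norm (f x - SN N f x))) \<le> Lpn p {()} F"
  proof -
    note [measurable] = tempered_measurable[OF f] tempered_measurable[OF tempered_SN[OF f, of N]]
    show ?thesis unfolding Lpn_def by (intro Lpe_mono_AE p ae) measurable
  qed
  also have "\<dots> \<le> (\<Sum>k. Lpn p {()} (v k))" by (rule F)
  finally show ?thesis unfolding v_def u .
qed simp

section \<open>The commutator with one block\<close>

text \<open>
  The splitting \<open>f = a + b\<close> with \<open>a = SN N f\<close>. The two terms with \<open>b\<close> are bounded by Hoelder's
  and Young's inequalities, the commutator with \<open>a\<close> by \<open>Lpn_commutator\<close> on each of the blocks
  of \<open>H\<close> that contribute. The gradient of \<open>a\<close> is the cut-off of \<open>F\<close>, hence bounded by \<open>F\<close>.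
\<close>

lemma block_commutator_bound:
  fixes H :: "'i \<Rightarrow> real^'n \<Rightarrow> complex"
  assumes p: "1 \<le> p" "1 \<le> p1" "1 \<le> p2" "1 / p = 1 / p1 + 1 / p2" and I: "finite I"
    and q: "q \<ge> -1" and N: "N = max (q - 2) 0" and f: "tempered_fun f"
    and F: "\<And>j. represents (F j) (dpartial j (dist_of f))"
    and H: "\<And>i. i \<in> I \<Longrightarrow> tempered_fun (H i)" and fH: "\<And>i. i \<in> I \<Longrightarrow> tempered_fun (\<lambda>x. f x * H i x)"
  defines "\<beta> \<equiv> Lpe lborel p2 (\<lambda>x. ennreal (norm (f x - SN N f x)))"
  shows "Lpn p I (\<lambda>i x. f x * DQ q (H i) x - DQ q (\<lambda>y. f y * H i y) x) \<le>
    4 * kernel_norm (cs 0) * (\<beta> * Lpn p1 I H) +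
    ennreal (2 powr (- real_of_int q)) * (2 * kernel_moment (cs 0) * kernel_norm (cs 0)) *
      (Lpn p1 UNIV F * (\<Sum>k\<in>{max (-1) (q - 2)..q + 2}. Lpn p2 I (\<lambda>i. DQ k (H i))))"
proof -
  define a where "a = SN N f"
  define b where "b = (\<lambda>x. f x - a x)"
  define K where "K = inv_fourier (bs q)"
  define Q where "Q = {max (-1) (q - 2)..q + 2}"
  have rK: "rapid K" unfolding K_def by (rule test_symbol_rapid[OF test_bs])
  have Km: "K \<in> borel_measurable borel" by (rule rapid_measurable[OF rK])
  have ta: "tempered_fun a" unfolding a_def by (rule tempered_SN[OF f])
  have tb: "tempered_fun b" unfolding b_def by (intro tempered_diff f ta)
  have am[measurable]: "a \<in> borel_measurable borel" by (rule tempered_measurable[OF ta])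
  have bm[measurable]: "b \<in> borel_measurable borel" by (rule tempered_measurable[OF tb])
  have Hm: "H i \<in> borel_measurable borel" if "i \<in> I" for i by (rule tempered_measurable[OF H[OF that]])
  have tD: "tempered_fun (DQ k (H i))" if "i \<in> I" for i k by (rule tempered_DQ[OF H[OF that]])
  have Dm: "DQ k (H i) \<in> borel_measurable borel" if "i \<in> I" for i k by (rule tempered_measurable[OF tD[OF that]])
  have taH: "tempered_fun (\<lambda>y. a y * H i y)" if "i \<in> I" for i
    unfolding a_def SN_def by (rule tempered_conv_times[OF test_symbol_rapid[OF test_cs] f H[OF that]])
  have tbH: "tempered_fun (\<lambda>y. b y * H i y)" if "i \<in> I" for i
    using tempered_diff[OF fH[OF that] taH[OF that]] unfolding b_def left_diff_distrib .
  define T1 where "T1 = (\<lambda>i x. b x * DQ q (H i) x)"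
  define T2 where "T2 = (\<lambda>i. conv K (\<lambda>y. b y * H i y))"
  define T3 where "T3 = (\<lambda>k i x. LINT y|lborel. K y * (a x - a (x - y)) * DQ k (H i) (x - y))"
  have T1m: "T1 i \<in> borel_measurable borel" if "i \<in> I" for i
    unfolding T1_def using Dm[OF that] by measurable
  have T2m: "T2 i \<in> borel_measurable borel" if "i \<in> I" for i
    unfolding T2_def by (rule conv_measurable[OF Km tempered_measurable[OF tbH[OF that]]])
  have T3m: "T3 k i \<in> borel_measurable borel" if "i \<in> I" for k i
  proof -
    note [measurable] = Dm[OF that] Km
    show ?thesis unfolding T3_def by measurable
  qed
  have split: "f x * DQ q (H i) x - DQ q (\<lambda>y. f y * H i y) x = (T1 i x + - T2 i x) + (\<Sum>k\<in>Q. T3 k i x)" if i: "i \<in> I" for i x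
  proof -
    have "DQ q (\<lambda>y. f y * H i y) x = conv K (\<lambda>y. a y * H i y + b y * H i y) x"
      unfolding DQ_def K_def b_def by (simp add: algebra_simps)
    also have "\<dots> = DQ q (\<lambda>y. a y * H i y) x + T2 i x"
      unfolding T2_def DQ_def K_def by (rule conv_add_right[OF test_symbol_rapid[OF test_bs] taH[OF i] tbH[OF i]])
    finally have "DQ q (\<lambda>y. f y * H i y) x = DQ q (\<lambda>y. a y * H i y) x + T2 i x" .
    moreover have "a x * DQ q (H i) x - DQ q (\<lambda>y. a y * H i y) x = (\<Sum>k\<in>Q. T3 k i x)"
      unfolding a_def T3_def K_def Q_def by (rule low_commutator[OF q N f H[OF i]])
    moreover have "f x * DQ q (H i) x = T1 i x + a x * DQ q (H i) x" by (simp add: T1_def b_def algebra_simps)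
    ultimately show ?thesis by (simp add: algebra_simps)
  qed
  have B: "\<beta> = Lpe lborel p2 (\<lambda>x. ennreal (norm (b x)))" by (simp add: \<beta>_def b_def a_def)
  have nkq: "(\<integral>\<^sup>+y. ennreal (norm (K y)) \<partial>lborel) \<le> 2 * kernel_norm (cs 0)"
    using kernel_norm_bs[of q] unfolding kernel_norm_def[of "bs q"] K_def .
  have E1: "Lpn p I T1 \<le> 2 * kernel_norm (cs 0) * (\<beta> * Lpn p1 I H)"
  proof -
    have "Lpn p I T1 \<le> \<beta> * Lpn p1 I (\<lambda>i. DQ q (H i))"
      unfolding T1_def B by (rule Lpn_times_scalar[OF p bm Dm])
    also have "\<dots> \<le> \<beta> * ((2 * kernel_norm (cs 0)) * Lpn p1 I H)"
    proof (rule mult_left_mono)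
      have "Lpn p1 I (\<lambda>i. conv K (H i)) \<le> (\<integral>\<^sup>+y. ennreal (norm (K y)) \<partial>lborel) * Lpn p1 I H"
        by (rule Lpn_conv[OF p(2) I rK H])
      also have "\<dots> \<le> (2 * kernel_norm (cs 0)) * Lpn p1 I H" by (rule mult_right_mono[OF nkq]) simp
      finally show "Lpn p1 I (\<lambda>i. DQ q (H i)) \<le> (2 * kernel_norm (cs 0)) * Lpn p1 I H"
        unfolding DQ_def K_def .
    qed simp
    finally show ?thesis by (simp add: mult_ac)
  qed
  have E2: "Lpn p I T2 \<le> 2 * kernel_norm (cs 0) * (\<beta> * Lpn p1 I H)"
  proof -
    have "Lpn p I T2 \<le> (\<integral>\<^sup>+y. ennreal (norm (K y)) \<partial>lborel) * Lpn p I (\<lambda>i y. b y * H i y)"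
      unfolding T2_def by (rule Lpn_conv[OF p(1) I rK tbH])
    also have "\<dots> \<le> 2 * kernel_norm (cs 0) * (\<beta> * Lpn p1 I H)"
      unfolding B by (rule mult_mono[OF nkq Lpn_times_scalar[OF p bm Hm]]) auto
    finally show ?thesis .
  qed
  define A where "A = ennreal (2 powr (- real_of_int q)) * (2 * kernel_moment (cs 0) * kernel_norm (cs 0))"
  have E3: "Lpn p I (T3 k) \<le> A * (Lpn p1 UNIV F * Lpn p2 I (\<lambda>i. DQ k (H i)))" for k
  proof -
    have "Lpn p I (T3 k) \<le> (\<integral>\<^sup>+y. ennreal (norm y * norm (K y)) \<partial>lborel) * (Lpn p1 UNIV (\<lambda>j. pd j a) * Lpn p2 I (\<lambda>i. DQ k (H i)))"
      unfolding T3_def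
    proof (rule Lpn_commutator[OF p I])
      show "a differentiable (at x)" for x unfolding a_def by (rule SN_differentiable[OF f])
      show "continuous_on UNIV (pd j a)" for j unfolding a_def by (rule continuous_pd_SN[OF f])
      show "K \<in> borel_measurable borel" by (rule Km)
      show "DQ k (H i) \<in> borel_measurable borel" if "i \<in> I" for i by (rule Dm[OF that])
    qed
    also have "\<dots> \<le> (ennreal (2 powr (- real_of_int q)) * (2 * kernel_moment (cs 0))) * ((kernel_norm (cs 0) * Lpn p1 UNIV F) * Lpn p2 I (\<lambda>i. DQ k (H i)))"
    proof (intro mult_mono)
      show "(\<integral>\<^sup>+y. ennreal (norm y * norm (K y)) \<partial>lborel) \<le> ennreal (2 powr (- real_of_int q)) * (2 * kernel_moment (cs 0))"
        using kernel_moment_bs[of q] unfolding kernel_moment_def[of "bs q"] K_def .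
      have "pd j a = conv (inv_fourier (cs N)) (F j)" for j
        unfolding a_def using pd_SN[OF f, of j N] conv_represents_dpartial[OF schwartz_inv_fourier[OF test_cs] F]
        by (intro ext) simp
      moreover have "tempered_fun (F j)" for j using F[of j] by (simp add: represents_def)
      ultimately have "Lpn p1 UNIV (\<lambda>j. pd j a) \<le> kernel_norm (cs N) * Lpn p1 UNIV F"
        unfolding kernel_norm_def using Lpn_conv[OF p(2) finite_class.finite_UNIV test_symbol_rapid[OF test_cs], of F N] by simp
      then show "Lpn p1 UNIV (\<lambda>j. pd j a) \<le> kernel_norm (cs 0) * Lpn p1 UNIV F" by (simp add: kernel_norm_cs[of N])
    qed auto
    finally show ?thesis by (simp add: A_def mult_ac)
  qed
  have "Lpn p I (\<lambda>i x. f x * DQ q (H i) x - DQ q (\<lambda>y. f y * H i y) x) = Lpn p I (\<lambda>i x. (T1 i x + - T2 i x) + (\<Sum>k\<in>Q. T3 k i x))"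
    by (rule Lpn_cong) (rule split)
  also have "\<dots> \<le> Lpn p I (\<lambda>i x. T1 i x + - T2 i x) + Lpn p I (\<lambda>i x. \<Sum>k\<in>Q. T3 k i x)"
    using T1m T2m T3m by (intro Lpn_add p borel_measurable_add borel_measurable_uminus borel_measurable_sum) auto
  also have "\<dots> \<le> (Lpn p I T1 + Lpn p I (\<lambda>i x. - T2 i x)) + (\<Sum>k\<in>Q. Lpn p I (T3 k))"
    using T1m T2m T3m by (intro add_mono Lpn_add Lpn_sum p borel_measurable_uminus) (auto simp: Q_def)
  also have "\<dots> \<le> (2 * kernel_norm (cs 0) * (\<beta> * Lpn p1 I H) + 2 * kernel_norm (cs 0) * (\<beta> * Lpn p1 I H)) + (\<Sum>k\<in>Q. A * (Lpn p1 UNIV F * Lpn p2 I (\<lambda>i. DQ k (H i))))"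
    unfolding Lpn_uminus by (intro add_mono sum_mono E1 E2 E3)
  also have "2 * kernel_norm (cs 0) * (\<beta> * Lpn p1 I H) + 2 * kernel_norm (cs 0) * (\<beta> * Lpn p1 I H) = 4 * kernel_norm (cs 0) * (\<beta> * Lpn p1 I H)"
  proof -
    have "2 * z + 2 * z = 4 * z" for z :: ennreal by (simp add: distrib_right[symmetric])
    then show ?thesis by (simp only: mult.assoc)
  qed
  finally show ?thesis unfolding A_def Q_def by (simp add: sum_distrib_left)
qed

end

section \<open>Summation over frequencies\<close>

definition pow2 :: "real \<Rightarrow> ennreal" where "pow2 x = ennreal (2 powr x)"

lemma pow2_add: "pow2 (x + y) = pow2 x * pow2 y"
  by (simp add: pow2_def powr_add ennreal_mult)

lemma pow2_finite [simp]: "pow2 x < top" and pow2_nonzero [simp]: "pow2 x \<noteq> 0"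
  by (simp_all add: pow2_def ennreal_eq_0_iff not_le)

lemma mult_swap4:
  fixes a b c d :: ennreal
  assumes "a * b = c * d" shows "a * (b * x * y) = x * (c * (d * y))"
proof -
  have "a * (b * x * y) = (a * b) * (x * y)" by (simp only: mult_ac)
  also have "\<dots> = x * (c * (d * y))" unfolding assms by (simp only: mult_ac)
  finally show ?thesis .
qed

text \<open>The Besov norm, once the blocks are represented by the functions \<open>V q\<close>.\<close>

abbreviation dyadic_norm :: "ennreal \<Rightarrow> real \<Rightarrow> ennreal \<Rightarrow> 'i set \<Rightarrow> (int \<Rightarrow> 'i \<Rightarrow> real^'n \<Rightarrow> complex) \<Rightarrow> ennreal"
  where "dyadic_norm r s p I V \<equiv> lr_norm r (\<lambda>q. pow2 (real_of_int q * s) * Lpn p I (V q))"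

lemma nn_integral_count_range_le:
  fixes g :: "'k \<Rightarrow> int" and h :: "int \<Rightarrow> ennreal"
  assumes "inj_on g K"
  shows "(\<integral>\<^sup>+k. h (g k) \<partial>count_space K) \<le> (\<integral>\<^sup>+l. h l \<partial>count_space UNIV)"
proof -
  have "(\<integral>\<^sup>+k. h (g k) \<partial>count_space K) = (\<integral>\<^sup>+l. h l \<partial>count_space (g ` K))"
    by (rule nn_integral_bij_count_space) (use assms in \<open>simp add: bij_betw_def\<close>)
  also have "\<dots> = (\<integral>\<^sup>+l. h l * indicator (g ` K) l \<partial>count_space UNIV)"
    by (simp add: nn_integral_restrict_space[symmetric] restrict_count_space)
  also have "\<dots> \<le> (\<integral>\<^sup>+l. h l \<partial>count_space UNIV)"
    by (intro nn_integral_mono) (auto simp: indicator_def)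
  finally show ?thesis .
qed

text \<open>
  The weights of the two discrete convolutions, indexed by the distance \<open>l = q - k\<close> of the
  frequency \<open>q\<close> of the commutator from the frequency \<open>k\<close> of a block: blocks of \<open>f\<close> occur for
  \<open>l \<le> 2\<close>, blocks of the other factor for \<open>\<bar>l\<bar> \<le> 2\<close>.
\<close>

definition high_weight :: "real \<Rightarrow> int \<Rightarrow> ennreal" where "high_weight s l = (if l \<le> 2 then pow2 (real_of_int l * s) else 0)"
definition low_weight :: "real \<Rightarrow> int \<Rightarrow> ennreal" where "low_weight s l = (if l \<in> {-2..2} then pow2 (real_of_int l * (s - 1)) else 0)"

lemma suminf_pow2_finite:
  assumes "s > 0" shows "(\<Sum>k::nat. pow2 (a - real k * s)) < top"
proof -
  have eq: "pow2 (a - real k * s) = ennreal (2 powr a * (2 powr (- s)) ^ k)" for k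
  proof -
    have "2 powr (a - real k * s) = 2 powr a * 2 powr (- s * real k)" by (simp add: powr_add[symmetric] mult.commute)
    also have "2 powr (- s * real k) = (2 powr (- s)) ^ k" by (subst powr_realpow[symmetric]) (simp_all add: powr_powr)
    finally show ?thesis by (simp add: pow2_def)
  qed
  have "2 powr (- s) < 1" using assms by (simp add: powr_less_one)
  then have "summable (\<lambda>k. 2 powr a * (2 powr (- s)) ^ k)" by (intro summable_mult summable_geometric) simp
  then have "(\<Sum>k. ennreal (2 powr a * (2 powr (- s)) ^ k)) = ennreal (\<Sum>k. 2 powr a * (2 powr (- s)) ^ k)"
    by (intro suminf_ennreal2) auto
  then show ?thesis unfolding eq by simp
qed

text \<open>
  A geometric series with ratio \<open>2\<^sup>-\<^sup>s\<close>; this is where \<open>s > 0\<close> enters.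
\<close>

lemma high_weight_finite: "s > 0 \<Longrightarrow> (\<integral>\<^sup>+l. high_weight s l \<partial>count_space UNIV) < top"
proof -
  assume s: "s > 0"
  have b: "bij_betw (\<lambda>k::nat. 2 - int k) UNIV {..2}"
    by (rule bij_betw_byWitness[where f'="\<lambda>l. nat (2 - l)"]) auto
  have "(\<integral>\<^sup>+l. high_weight s l \<partial>count_space UNIV) = (\<integral>\<^sup>+l. high_weight s l \<partial>count_space {..2})"
    by (rule nn_integral_count_space_eq) (auto simp: high_weight_def)
  also have "\<dots> = (\<integral>\<^sup>+k. high_weight s (2 - int k) \<partial>count_space UNIV)"
    by (rule nn_integral_bij_count_space[OF b, symmetric])
  also have "\<dots> = (\<Sum>k. pow2 (2 * s - real k * s))"
    unfolding nn_integral_count_space_nat high_weight_def by (simp add: algebra_simps)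
  also have "\<dots> < top" by (rule suminf_pow2_finite[OF s])
  finally show ?thesis .
qed

lemma low_weight_finite: "(\<integral>\<^sup>+l. low_weight s l \<partial>count_space UNIV) < top"
proof -
  have "(\<integral>\<^sup>+l. low_weight s l \<partial>count_space UNIV) = (\<integral>\<^sup>+l. low_weight s l \<partial>count_space {-2..2})"
    by (rule nn_integral_count_space_eq) (auto simp: low_weight_def)
  also have "\<dots> = (\<Sum>l\<in>{-2..2}. low_weight s l)" by (rule nn_integral_count_space_finite) simp
  also have "\<dots> < top" by (subst ennreal_sum_less_top) (auto simp: low_weight_def)
  finally show ?thesis .
qed

context lp_pair
begin

definition commutator_const :: "real \<Rightarrow> ennreal"
  where "commutator_const s = 12 * kernel_norm (cs 0) * kernel_moment (cs 0) * (\<integral>\<^sup>+l. high_weight s l \<partial>count_space UNIV) +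
    2 * kernel_moment (cs 0) * kernel_norm (cs 0) * (\<integral>\<^sup>+l. low_weight s l \<partial>count_space UNIV)"

lemma commutator_const_finite: "s > 0 \<Longrightarrow> commutator_const s < top"
  unfolding commutator_const_def using kernel_norm_finite[OF test_cs, of 0] kernel_moment_finite[OF test_cs, of 0] high_weight_finite[of s] low_weight_finite[of s]
  by (simp add: ennreal_mult_less_top)

text \<open>
  The factor \<open>2\<^sup>q\<^sup>s 2\<^sup>-\<^sup>k\<close> is
  \<open>2\<^bsup>(q-k)s\<^esup> 2\<^bsup>k(s-1)\<^esup>\<close>. All blocks that occur have \<open>k \<ge> 0\<close>,
  where the reverse Bernstein inequality is available.
\<close>

lemma high_frequency_sequence:
  fixes s :: real
  assumes p2: "1 \<le> p2" and q: "q \<ge> -1" and N: "N = max (q - 2) 0" and f: "tempered_fun f"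
  shows "pow2 (real_of_int q * s) * Lpe lborel p2 (\<lambda>x. ennreal (norm (f x - SN N f x))) \<le>
    3 * kernel_moment (cs 0) * (\<integral>\<^sup>+l. high_weight s l * (if q - l \<ge> -1 then pow2 (real_of_int (q - l) * (s - 1)) * Lpn p2 UNIV (\<lambda>j. pd j (DQ (q - l) f)) else 0) \<partial>count_space UNIV)"
proof -
  define \<delta> where "\<delta> = (\<lambda>q. Lpn p2 UNIV (\<lambda>j. pd j (DQ q f)))"
  define h where "h = (\<lambda>l. high_weight s l * (if q - l \<ge> -1 then pow2 (real_of_int (q - l) * (s - 1)) * \<delta> (q - l) else 0))"
  have "Lpe lborel p2 (\<lambda>x. ennreal (norm (f x - SN N f x))) \<le> (\<Sum>k. Lpe lborel p2 (\<lambda>x. ennreal (norm (DQ (N + int k) f x))))"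
    by (rule high_frequency_bound[OF p2 _ f]) (use N in simp)
  also have "\<dots> \<le> (\<Sum>k. pow2 (- real_of_int (N + int k)) * (3 * kernel_moment (cs 0)) * \<delta> (N + int k))"
  proof (rule suminf_le)
    fix k
    show "Lpe lborel p2 (\<lambda>x. ennreal (norm (DQ (N + int k) f x))) \<le> pow2 (- real_of_int (N + int k)) * (3 * kernel_moment (cs 0)) * \<delta> (N + int k)"
      unfolding \<delta>_def pow2_def by (rule reverse_Bernstein[OF p2 _ f]) (use N in simp)
  qed auto
  finally have "pow2 (real_of_int q * s) * Lpe lborel p2 (\<lambda>x. ennreal (norm (f x - SN N f x))) \<le>
      pow2 (real_of_int q * s) * (\<Sum>k. pow2 (- real_of_int (N + int k)) * (3 * kernel_moment (cs 0)) * \<delta> (N + int k))"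
    by (rule mult_left_mono) simp
  also have "\<dots> = (\<Sum>k. pow2 (real_of_int q * s) * (pow2 (- real_of_int (N + int k)) * (3 * kernel_moment (cs 0)) * \<delta> (N + int k)))"
    by (rule ennreal_suminf_cmult[symmetric])
  also have "\<dots> = (\<Sum>k. 3 * kernel_moment (cs 0) * h (q - N - int k))"
  proof (rule arg_cong[where f=suminf], rule ext)
    fix k
    define j where "j = N + int k"
    have j: "q - N - int k = q - j" "j \<ge> 0" "q - j \<le> 2" using N by (auto simp: j_def)
    have "real_of_int q * s + - real_of_int j = real_of_int (q - j) * s + real_of_int j * (s - 1)"
      by (simp add: algebra_simps)
    then have "pow2 (real_of_int q * s) * pow2 (- real_of_int j) = pow2 (real_of_int (q - j) * s) * pow2 (real_of_int j * (s - 1))"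
      by (simp only: pow2_add[symmetric])
    then have "pow2 (real_of_int q * s) * (pow2 (- real_of_int j) * (3 * kernel_moment (cs 0)) * \<delta> j) =
        3 * kernel_moment (cs 0) * (pow2 (real_of_int (q - j) * s) * (pow2 (real_of_int j * (s - 1)) * \<delta> j))"
      by (rule mult_swap4)
    also have "\<dots> = 3 * kernel_moment (cs 0) * h (q - j)" unfolding h_def high_weight_def using j by simp
    finally show "pow2 (real_of_int q * s) * (pow2 (- real_of_int (N + int k)) * (3 * kernel_moment (cs 0)) * \<delta> (N + int k)) = 3 * kernel_moment (cs 0) * h (q - N - int k)"
      unfolding j(1) unfolding j_def .
  qed
  also have "\<dots> = 3 * kernel_moment (cs 0) * (\<Sum>k. h (q - N - int k))" by (rule ennreal_suminf_cmult)
  also have "\<dots> \<le> 3 * kernel_moment (cs 0) * (\<integral>\<^sup>+l. h l \<partial>count_space UNIV)"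
    unfolding nn_integral_count_space_nat[symmetric]
    by (intro mult_left_mono nn_integral_count_range_le) (auto simp: inj_on_def)
  finally show ?thesis unfolding h_def \<delta>_def .
qed

text \<open>
  The factor \<open>2\<^sup>-\<^sup>q\<close> gained by the commutator turns \<open>2\<^sup>q\<^sup>s\<close> into
  \<open>2\<^bsup>q(s-1)\<^esup>\<close>.
\<close>

lemma low_frequency_sequence:
  fixes s :: real and \<gamma> :: "int \<Rightarrow> ennreal"
  assumes q: "q \<ge> -1"
  shows "pow2 (real_of_int q * s) * (pow2 (- real_of_int q) * (\<Sum>k\<in>{max (-1) (q - 2)..q + 2}. \<gamma> k)) \<le>
    (\<integral>\<^sup>+l. low_weight s l * (if q - l \<ge> -1 then pow2 (real_of_int (q - l) * (s - 1)) * \<gamma> (q - l) else 0) \<partial>count_space UNIV)"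
proof -
  define h where "h = (\<lambda>l. low_weight s l * (if q - l \<ge> -1 then pow2 (real_of_int (q - l) * (s - 1)) * \<gamma> (q - l) else 0))"
  define Q where "Q = {max (-1) (q - 2)..q + 2}"
  have "pow2 (real_of_int q * s) * (pow2 (- real_of_int q) * (\<Sum>k\<in>Q. \<gamma> k)) = (\<Sum>k\<in>Q. h (q - k))"
    unfolding sum_distrib_left
  proof (rule sum.cong[OF refl])
    fix k assume "k \<in> Q"
    then have k: "k \<ge> -1" "q - k \<in> {-2..2}" by (auto simp: Q_def)
    have "real_of_int q * s + - real_of_int q = real_of_int (q - k) * (s - 1) + real_of_int k * (s - 1)"
      by (simp add: algebra_simps)
    then have "pow2 (real_of_int q * s) * pow2 (- real_of_int q) = pow2 (real_of_int (q - k) * (s - 1)) * pow2 (real_of_int k * (s - 1))"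
      by (simp only: pow2_add[symmetric])
    then show "pow2 (real_of_int q * s) * (pow2 (- real_of_int q) * \<gamma> k) = h (q - k)"
      unfolding h_def low_weight_def using k by (simp add: mult.assoc[symmetric])
  qed
  also have "\<dots> = (\<integral>\<^sup>+k. h (q - k) \<partial>count_space Q)"
    by (rule nn_integral_count_space_finite[symmetric]) (simp add: Q_def)
  also have "\<dots> \<le> (\<integral>\<^sup>+l. h l \<partial>count_space UNIV)"
    by (rule nn_integral_count_range_le) (auto simp: inj_on_def)
  finally show ?thesis unfolding h_def Q_def .
qed

text \<open>
  That the product of \<open>f\<close> and \<open>H\<close> is defined rests on the same splitting, with cut-off at \<open>0\<close>:
  the high-frequency part of \<open>f\<close> is in \<open>L\<^sup>p\<^sup>2\<close> and multiplies \<open>L\<^sup>p\<^sup>1\<close>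
  into \<open>L\<^sup>p\<close>, and the low-frequency part has polynomial growth. The sequence bound sums
  \<open>block_commutator_bound\<close> over \<open>q\<close> by Young's inequality for sequences.
\<close>

theorem
  fixes H :: "'i \<Rightarrow> real^'n \<Rightarrow> complex" and s :: real
  assumes p: "1 \<le> p" "1 \<le> p1" "1 \<le> p2" "1 / p = 1 / p1 + 1 / p2" and r: "1 \<le> r" and s: "s > 0" and I: "finite I"
    and f: "tempered_fun f" and F: "\<And>j. represents (F j) (dpartial j (dist_of f))"
    and H: "\<And>i. i \<in> I \<Longrightarrow> tempered_fun (H i)"
    and Bf: "dyadic_norm r (s - 1) p2 UNIV (\<lambda>q j. pd j (DQ q f)) < top" (is "?Bf < top")
    and HF: "Lpn p1 I H < top"
  shows tempered_product: "i \<in> I \<Longrightarrow> tempered_fun (\<lambda>x. f x * H i x)"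
    and tempered_product_block: "i \<in> I \<Longrightarrow> tempered_fun (\<lambda>x. f x * DQ q (H i) x)"
    and commutator_sequence_bound:
      "lr_norm r (\<lambda>q. pow2 (real_of_int q * s) * Lpn p I (\<lambda>i x. f x * DQ q (H i) x - DQ q (\<lambda>y. f y * H i y) x)) \<le>
        commutator_const s * ((Lpn p1 UNIV F + ?Bf) * (Lpn p1 I H + dyadic_norm r (s - 1) p2 I (\<lambda>q i. DQ q (H i))))"
proof -
  define S1 where "S1 = (\<lambda>q. \<integral>\<^sup>+l. high_weight s l * (if q - l \<ge> -1 then pow2 (real_of_int (q - l) * (s - 1)) * Lpn p2 UNIV (\<lambda>j. pd j (DQ (q - l) f)) else 0) \<partial>count_space UNIV)"
  define S2 where "S2 = (\<lambda>q. \<integral>\<^sup>+l. low_weight s l * (if q - l \<ge> -1 then pow2 (real_of_int (q - l) * (s - 1)) * Lpn p2 I (\<lambda>i. DQ (q - l) (H i)) else 0) \<partial>count_space UNIV)"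
  define Bh where "Bh = dyadic_norm r (s - 1) p2 I (\<lambda>q i. DQ q (H i))"
  define i1 i2 where "i1 = (\<integral>\<^sup>+l. high_weight s l \<partial>count_space UNIV)" and "i2 = (\<integral>\<^sup>+l. low_weight s l \<partial>count_space UNIV)"
  have S1: "lr_norm r S1 \<le> i1 * ?Bf"
    unfolding S1_def i1_def by (rule lr_norm_convolution[OF r])
  have S2: "lr_norm r S2 \<le> i2 * Bh"
    unfolding S2_def i2_def Bh_def by (rule lr_norm_convolution[OF r])
  define b where "b = (\<lambda>x. f x - SN 0 f x)"
  have bm: "b \<in> borel_measurable borel"
    unfolding b_def by (intro tempered_measurable tempered_diff f tempered_SN)
  have bfin: "Lpe lborel p2 (\<lambda>x. ennreal (norm (b x))) < top"
  proof -
    have "S1 0 \<le> lr_norm r S1" by (rule lr_norm_component[OF r]) simp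
    also have "\<dots> < top" using S1 high_weight_finite[OF s] Bf unfolding i1_def
      by (meson ennreal_mult_less_top order_le_less_trans)
    finally have "3 * kernel_moment (cs 0) * S1 0 < top" using kernel_moment_finite[OF test_cs, of 0] by (simp add: ennreal_mult_less_top)
    moreover have "pow2 (real_of_int 0 * s) * Lpe lborel p2 (\<lambda>x. ennreal (norm (f x - SN 0 f x))) \<le> 3 * kernel_moment (cs 0) * S1 0"
      unfolding S1_def by (rule high_frequency_sequence[OF p(3) _ _ f]) auto
    ultimately show ?thesis by (simp add: b_def pow2_def)
  qed
  have prod: "tempered_fun (\<lambda>x. f x * G i x)"
    if G: "\<And>i. i \<in> I \<Longrightarrow> tempered_fun (G i)" and Gfin: "Lpn p1 I G < top" and i: "i \<in> I" for G :: "'i \<Rightarrow> real^'n \<Rightarrow> complex" and i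
  proof -
    have Gm: "G i \<in> borel_measurable borel" if "i \<in> I" for i by (rule tempered_measurable[OF G[OF that]])
    have "Lpn p I (\<lambda>i x. b x * G i x) \<le> Lpe lborel p2 (\<lambda>x. ennreal (norm (b x))) * Lpn p1 I G"
      by (rule Lpn_times_scalar[OF p bm Gm])
    also have "\<dots> < top" using bfin Gfin by (simp add: ennreal_mult_less_top)
    finally have "Lpn p I (\<lambda>i x. b x * G i x) < top" .
    then have "tempered_fun (\<lambda>x. b x * G i x)"
      using bm Gm by (intro tempered_of_Lpn[OF p(1) I _ _ i]) auto
    moreover have "tempered_fun (\<lambda>x. SN 0 f x * G i x)"
      unfolding SN_def by (rule tempered_conv_times[OF test_symbol_rapid[OF test_cs] f G[OF i]])
    ultimately have "tempered_fun (\<lambda>x. b x * G i x + SN 0 f x * G i x)" by (rule tempered_add)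
    then show ?thesis by (simp add: b_def algebra_simps)
  qed
  show fH: "tempered_fun (\<lambda>x. f x * H i x)" if "i \<in> I" for i by (rule prod[OF H HF that])
  show "tempered_fun (\<lambda>x. f x * DQ q (H i) x)" if "i \<in> I" for i q
  proof (rule prod[OF tempered_DQ[OF H] _ that])
    have "Lpn p1 I (\<lambda>i. DQ q (H i)) \<le> kernel_norm (bs q) * Lpn p1 I H"
      unfolding DQ_def kernel_norm_def by (rule Lpn_conv[OF p(2) I test_symbol_rapid[OF test_bs] H])
    also have "\<dots> < top" using kernel_norm_finite[OF test_bs, of q] HF by (simp add: ennreal_mult_less_top)
    finally show "Lpn p1 I (\<lambda>i. DQ q (H i)) < top" .
  qed
  define c1 where "c1 = 4 * kernel_norm (cs 0) * (3 * kernel_moment (cs 0)) * Lpn p1 I H"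
  define c2 where "c2 = 2 * kernel_moment (cs 0) * kernel_norm (cs 0) * Lpn p1 UNIV F"
  have X: "pow2 (real_of_int q * s) * Lpn p I (\<lambda>i x. f x * DQ q (H i) x - DQ q (\<lambda>y. f y * H i y) x) \<le> c1 * S1 q + c2 * S2 q"
    if q: "q \<ge> -1" for q
  proof -
    define N where "N = max (q - 2) 0"
    define \<beta> where "\<beta> = Lpe lborel p2 (\<lambda>x. ennreal (norm (f x - SN N f x)))"
    define \<Gamma> where "\<Gamma> = (\<Sum>k\<in>{max (-1) (q - 2)..q + 2}. Lpn p2 I (\<lambda>i. DQ k (H i)))"
    have "Lpn p I (\<lambda>i x. f x * DQ q (H i) x - DQ q (\<lambda>y. f y * H i y) x) \<le>
        4 * kernel_norm (cs 0) * (\<beta> * Lpn p1 I H) + pow2 (- real_of_int q) * (2 * kernel_moment (cs 0) * kernel_norm (cs 0)) * (Lpn p1 UNIV F * \<Gamma>)"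
      unfolding \<beta>_def \<Gamma>_def pow2_def by (rule block_commutator_bound[OF p I q N_def f F H fH])
    then have "pow2 (real_of_int q * s) * Lpn p I (\<lambda>i x. f x * DQ q (H i) x - DQ q (\<lambda>y. f y * H i y) x) \<le>
        pow2 (real_of_int q * s) * (4 * kernel_norm (cs 0) * (\<beta> * Lpn p1 I H) + pow2 (- real_of_int q) * (2 * kernel_moment (cs 0) * kernel_norm (cs 0)) * (Lpn p1 UNIV F * \<Gamma>))"
      by (rule mult_left_mono) simp
    also have "\<dots> = 4 * kernel_norm (cs 0) * Lpn p1 I H * (pow2 (real_of_int q * s) * \<beta>) + c2 * (pow2 (real_of_int q * s) * (pow2 (- real_of_int q) * \<Gamma>))"
      unfolding c2_def distrib_left by (simp only: mult_ac)
    also have "\<dots> \<le> 4 * kernel_norm (cs 0) * Lpn p1 I H * (3 * kernel_moment (cs 0) * S1 q) + c2 * S2 q"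
    proof (intro add_mono mult_left_mono)
      show "pow2 (real_of_int q * s) * \<beta> \<le> 3 * kernel_moment (cs 0) * S1 q"
        unfolding \<beta>_def S1_def by (rule high_frequency_sequence[OF p(3) q N_def f])
      show "pow2 (real_of_int q * s) * (pow2 (- real_of_int q) * \<Gamma>) \<le> S2 q"
        unfolding \<Gamma>_def S2_def by (rule low_frequency_sequence[OF q])
    qed auto
    also have "\<dots> = c1 * S1 q + c2 * S2 q" unfolding c1_def by (simp only: mult_ac)
    finally show ?thesis .
  qed
  have "lr_norm r (\<lambda>q. pow2 (real_of_int q * s) * Lpn p I (\<lambda>i x. f x * DQ q (H i) x - DQ q (\<lambda>y. f y * H i y) x)) \<le> lr_norm r (\<lambda>q. c1 * S1 q + c2 * S2 q)"
    by (rule lr_norm_mono[OF r X])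
  also have "\<dots> \<le> lr_norm r (\<lambda>q. c1 * S1 q) + lr_norm r (\<lambda>q. c2 * S2 q)" by (rule lr_norm_add[OF r])
  also have "\<dots> \<le> c1 * (i1 * ?Bf) + c2 * (i2 * Bh)"
    by (intro add_mono order_trans[OF lr_norm_cmult_le[OF r]] mult_left_mono S1 S2) auto
  also have "\<dots> = 12 * kernel_norm (cs 0) * kernel_moment (cs 0) * i1 * (?Bf * Lpn p1 I H) + 2 * kernel_moment (cs 0) * kernel_norm (cs 0) * i2 * (Lpn p1 UNIV F * Bh)"
  proof -
    have "4 * x * (3 * y) * z = 12 * x * y * z" for x y z :: ennreal
    proof -
      have "4 * x * (3 * y) * z = (4 * 3) * (x * y * z)" by (simp only: mult_ac)
      also have "(4::ennreal) * 3 = 12" by simp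
      finally show ?thesis by (simp only: mult_ac)
    qed
    then have "c1 = 12 * kernel_norm (cs 0) * kernel_moment (cs 0) * Lpn p1 I H" unfolding c1_def .
    then show ?thesis unfolding c2_def by (simp only: mult_ac)
  qed
  also have "\<dots> \<le> 12 * kernel_norm (cs 0) * kernel_moment (cs 0) * i1 * ((Lpn p1 UNIV F + ?Bf) * (Lpn p1 I H + Bh)) +
      2 * kernel_moment (cs 0) * kernel_norm (cs 0) * i2 * ((Lpn p1 UNIV F + ?Bf) * (Lpn p1 I H + Bh))"
    by (intro add_mono mult_left_mono mult_mono) (auto simp: add_increasing add_increasing2)
  also have "\<dots> = commutator_const s * ((Lpn p1 UNIV F + ?Bf) * (Lpn p1 I H + Bh))"
    unfolding commutator_const_def i1_def i2_def by (rule distrib_right[symmetric])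
  finally show "lr_norm r (\<lambda>q. pow2 (real_of_int q * s) * Lpn p I (\<lambda>i x. f x * DQ q (H i) x - DQ q (\<lambda>y. f y * H i y) x)) \<le>
        commutator_const s * ((Lpn p1 UNIV F + ?Bf) * (Lpn p1 I H + dyadic_norm r (s - 1) p2 I (\<lambda>q i. DQ q (H i))))"
    unfolding Bh_def .
qed

end

section \<open>Bernstein inequality between Lebesgue spaces\<close>

lemma Lpe_top_le: "u \<in> borel_measurable M \<Longrightarrow> (\<And>x. u x \<le> c) \<Longrightarrow> Lpe M top u \<le> c"
  unfolding Lpe_infinity by (rule esssup_I) auto

text \<open>
  Interpolation between two bounds. By Hoelder's inequality with the measure \<open>k(y) dy\<close>, of mass
  at most \<open>L\<close>, and by \<open>k \<le> L D\<close>, the convolution is pointwise at most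
  \<open>L D\<^bsup>1/p2\<^esup>\<close> times the norm of \<open>u\<close>; by Young's inequality its
  \<open>L\<^sup>p\<^sup>2\<close> norm is at most \<open>L\<close> times the norm of \<open>u\<close>.
\<close>

theorem Lpe_Bernstein:
  fixes u k :: "real^'n \<Rightarrow> ennreal"
  assumes p: "1 \<le> p1" "1 \<le> p2" "p2 \<le> p1"
    and um[measurable]: "u \<in> borel_measurable borel" and km[measurable]: "k \<in> borel_measurable borel"
    and L: "L > 0" and D: "D > 0"
    and k1: "(\<integral>\<^sup>+y. k y \<partial>lborel) \<le> ennreal L" and kD: "\<And>y. k y \<le> ennreal (L * D)"
  shows "Lpe lborel p1 (\<lambda>x. \<integral>\<^sup>+y. k y * u (x - y) \<partial>lborel) \<le>
    ennreal (L * D powr (enn2real (1 / p2) - enn2real (1 / p1))) * Lpe lborel p2 u"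
proof -
  define v where "v = (\<lambda>x. \<integral>\<^sup>+y. k y * u (x - y) \<partial>lborel)"
  have vm[measurable]: "v \<in> borel_measurable borel" unfolding v_def by measurable
  define U where "U = Lpe lborel p2 u"
  have Y: "Lpe lborel p2 v \<le> ennreal L * U"
    unfolding v_def U_def by (rule order_trans[OF Lpe_Young[OF p(2) um km] mult_right_mono[OF k1]]) simp
  show ?thesis using p(2)
  proof (cases rule: exponent_cases)
    case 1
    then have "p1 = top" using p(3) by (simp add: top_unique)
    then show ?thesis using Y D 1 unfolding v_def U_def by simp
  next
    case P2: (2 P2)
    have e2: "enn2real (1 / p2) = 1 / P2" using P2 divide_ennreal[of 1 P2] by simp
    have U: "U = epowr (\<integral>\<^sup>+x. epowr (u x) P2 \<partial>lborel) (1 / P2)"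
      unfolding U_def using P2 by (simp add: Lpe_ennreal)
    have sup: "v x \<le> ennreal (L * D powr (1 / P2)) * U" for x
    proof (cases "P2 = 1")
      case True
      have "v x \<le> (\<integral>\<^sup>+y. ennreal (L * D) * u (x - y) \<partial>lborel)"
        unfolding v_def by (intro nn_integral_mono mult_right_mono kD) auto
      also have "\<dots> = ennreal (L * D) * (\<integral>\<^sup>+y. u (x - y) \<partial>lborel)" by (rule nn_integral_cmult) measurable
      also have "(\<integral>\<^sup>+y. u (x - y) \<partial>lborel) = U" unfolding U using True nn_integral_lborel_reflect[OF um, of x] by simp
      finally show ?thesis using True D by simp
    next
      case False
      then have P: "P2 > 1" using P2 by simp
      have eq: "k y * u (x - y) = epowr (k y * epowr (u (x - y)) P2) (1 / P2) * epowr (k y) (1 - 1 / P2)" for y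
        using P epowr_add[of "k y" "1 / P2" "1 - 1 / P2"] by (simp add: epowr_mult epowr_epowr mult_ac)
      have "v x \<le> epowr (\<integral>\<^sup>+y. k y * epowr (u (x - y)) P2 \<partial>lborel) (1 / P2) * epowr (\<integral>\<^sup>+y. k y \<partial>lborel) (1 - 1 / P2)"
        unfolding v_def eq using P by (intro nn_integral_Holder) (auto simp: field_simps)
      also have "\<dots> \<le> epowr (ennreal (L * D) * (\<integral>\<^sup>+y. epowr (u y) P2 \<partial>lborel)) (1 / P2) * epowr (ennreal L) (1 - 1 / P2)"
      proof (intro mult_mono epowr_mono k1)
        have "(\<integral>\<^sup>+y. k y * epowr (u (x - y)) P2 \<partial>lborel) \<le> (\<integral>\<^sup>+y. ennreal (L * D) * epowr (u (x - y)) P2 \<partial>lborel)"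
          by (intro nn_integral_mono mult_right_mono kD) auto
        also have "\<dots> = ennreal (L * D) * (\<integral>\<^sup>+y. epowr (u (x - y)) P2 \<partial>lborel)" by (rule nn_integral_cmult) measurable
        also have "(\<integral>\<^sup>+y. epowr (u (x - y)) P2 \<partial>lborel) = (\<integral>\<^sup>+y. epowr (u y) P2 \<partial>lborel)"
          by (rule nn_integral_lborel_reflect) measurable
        finally show "(\<integral>\<^sup>+y. k y * epowr (u (x - y)) P2 \<partial>lborel) \<le> ennreal (L * D) * (\<integral>\<^sup>+y. epowr (u y) P2 \<partial>lborel)" .
      qed (use P in auto)
      also have "\<dots> = ennreal ((L * D) powr (1 / P2) * L powr (1 - 1 / P2)) * U"
        proof -
        have 1: "epowr (ennreal (L * D)) (1 / P2) = ennreal ((L * D) powr (1 / P2))" using L D by (intro epowr_ennreal) simp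
        have 2: "epowr (ennreal L) (1 - 1 / P2) = ennreal (L powr (1 - 1 / P2))" using L by (intro epowr_ennreal) simp
        have 3: "epowr (ennreal (L * D) * J) (1 / P2) = epowr (ennreal (L * D)) (1 / P2) * epowr J (1 / P2)" for J
          using P by (intro epowr_mult) simp
        have 4: "ennreal ((L * D) powr (1 / P2) * L powr (1 - 1 / P2)) = ennreal ((L * D) powr (1 / P2)) * ennreal (L powr (1 - 1 / P2))"
          by (rule ennreal_mult) auto
        show ?thesis unfolding U 3 1 2 4 by (simp only: mult_ac)
      qed
      also have "(L * D) powr (1 / P2) * L powr (1 - 1 / P2) = L * D powr (1 / P2)"
      proof -
        have "L powr (1 / P2) * L powr (1 - 1 / P2) = L" using L by (simp add: powr_add[symmetric])
        then show ?thesis using L D by (simp add: powr_mult mult_ac)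
      qed
      finally show ?thesis .
    qed
    show ?thesis using p(1)
    proof (cases rule: exponent_cases)
      case 1
      have "Lpe lborel top v \<le> ennreal (L * D powr (1 / P2)) * U" by (rule Lpe_top_le) (auto intro: sup)
      then show ?thesis unfolding e2 unfolding 1 v_def U_def by simp
    next
      case P1: (2 P1)
      have e1: "enn2real (1 / p1) = 1 / P1" using P1 divide_ennreal[of 1 P1] by simp
      have le: "P2 \<le> P1" using p(3) P1 P2 by (simp add: ennreal_le_iff)
      show ?thesis
      proof (cases "P1 = P2")
        case True
        then have "Lpe lborel p1 v \<le> ennreal L * U" using Y P1 P2 by simp
        then show ?thesis unfolding e1 e2 using True D unfolding v_def U_def by simp
      next
        case False
        then have lt: "P2 < P1" using le by simp
        define V where "V = ennreal (L * D powr (1 / P2)) * U"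
        have pow2: "epowr (v x) P1 \<le> epowr V (P1 - P2) * epowr (v x) P2" for x
        proof -
          have "epowr (v x) P1 = epowr (v x) (P1 - P2) * epowr (v x) P2" using epowr_add[of "v x" "P1 - P2" P2] by simp
          also have "\<dots> \<le> epowr V (P1 - P2) * epowr (v x) P2"
            using lt sup[of x] unfolding V_def by (intro mult_right_mono epowr_mono) auto
          finally show ?thesis .
        qed
        have Y': "(\<integral>\<^sup>+x. epowr (v x) P2 \<partial>lborel) \<le> epowr (ennreal L * U) P2"
        proof -
          have "epowr (epowr (\<integral>\<^sup>+x. epowr (v x) P2 \<partial>lborel) (1 / P2)) P2 \<le> epowr (ennreal L * U) P2"
            using Y P2 by (intro epowr_mono) (auto simp: Lpe_ennreal)
          then show ?thesis using P2 by (simp add: epowr_epowr)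
        qed
        have "(\<integral>\<^sup>+x. epowr (v x) P1 \<partial>lborel) \<le> (\<integral>\<^sup>+x. epowr V (P1 - P2) * epowr (v x) P2 \<partial>lborel)"
          by (intro nn_integral_mono pow2)
        also have "\<dots> = epowr V (P1 - P2) * (\<integral>\<^sup>+x. epowr (v x) P2 \<partial>lborel)" by (rule nn_integral_cmult) measurable
        also have "\<dots> \<le> epowr V (P1 - P2) * epowr (ennreal L * U) P2" by (rule mult_left_mono[OF Y']) simp
        finally have "Lpe lborel p1 v \<le> epowr (epowr V (P1 - P2) * epowr (ennreal L * U) P2) (1 / P1)"
          using P1 by (simp add: Lpe_ennreal epowr_mono)
        also have "\<dots> = epowr V (1 - P2 / P1) * epowr (ennreal L * U) (P2 / P1)"
          using P1 by (simp add: epowr_mult epowr_epowr diff_divide_distrib)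
        also have "\<dots> = ennreal ((L * D powr (1 / P2)) powr (1 - P2 / P1) * L powr (P2 / P1)) * (epowr U (1 - P2 / P1) * epowr U (P2 / P1))"
        proof -
          define c where "c = L * D powr (1 / P2)"
          have c: "c \<ge> 0" unfolding c_def using L D by simp
          have pos: "1 - P2 / P1 > 0" "P2 / P1 > 0" using P1 P2 lt by auto
          have "epowr (ennreal c * U) (1 - P2 / P1) = ennreal (c powr (1 - P2 / P1)) * epowr U (1 - P2 / P1)"
            by (simp only: epowr_mult[OF pos(1)] epowr_ennreal[OF c])
          moreover have "epowr (ennreal L * U) (P2 / P1) = ennreal (L powr (P2 / P1)) * epowr U (P2 / P1)"
            using L by (simp only: epowr_mult[OF pos(2)]) (simp add: epowr_ennreal)
          moreover have "ennreal (c powr (1 - P2 / P1) * L powr (P2 / P1)) = ennreal (c powr (1 - P2 / P1)) * ennreal (L powr (P2 / P1))"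
            by (rule ennreal_mult) auto
          ultimately show ?thesis unfolding V_def c_def[symmetric] by (simp only: mult_ac)
        qed
        also have "epowr U (1 - P2 / P1) * epowr U (P2 / P1) = U"
          using epowr_add[of U "1 - P2 / P1" "P2 / P1"] by simp
        also have "(L * D powr (1 / P2)) powr (1 - P2 / P1) * L powr (P2 / P1) = L * D powr (1 / P2 - 1 / P1)"
        proof -
          have 1: "1 / P2 * (1 - P2 / P1) = 1 / P2 - 1 / P1" using P1 P2 by (simp add: field_simps)
          have 2: "(L * D powr (1 / P2)) powr (1 - P2 / P1) = L powr (1 - P2 / P1) * D powr (1 / P2 - 1 / P1)"
            unfolding 1[symmetric] using L D by (simp add: powr_mult powr_powr)
          have 3: "L powr (1 - P2 / P1) * L powr (P2 / P1) = L" using L by (simp add: powr_add[symmetric])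
          have "L powr (1 - P2 / P1) * X * L powr (P2 / P1) = (L powr (1 - P2 / P1) * L powr (P2 / P1)) * X" for X
            by (simp only: mult_ac)
          then show ?thesis unfolding 2 3 by simp
        qed
        finally show ?thesis unfolding e1 e2 unfolding v_def U_def .
      qed
    qed
  qed
qed

section \<open>Embedding of derivatives into Lebesgue spaces\<close>

lemma lr_norm_1: "lr_norm 1 a = (\<Sum>k. a (int k - 1))"
proof -
  have b: "bij_betw (\<lambda>k::nat. int k - 1) UNIV {-1..}"
    by (rule bij_betw_byWitness[where f'="\<lambda>l. nat (l + 1)"]) auto
  have "lr_norm 1 a = (\<integral>\<^sup>+q. a q \<partial>count_space {-1..})" by (simp add: lr_norm_def)
  also have "\<dots> = (\<integral>\<^sup>+k. a (int k - 1) \<partial>count_space UNIV)"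
    by (rule nn_integral_bij_count_space[OF b, symmetric])
  finally show ?thesis unfolding nn_integral_count_space_nat .
qed

definition weight_sum :: "real \<Rightarrow> real \<Rightarrow> ennreal"
  where "weight_sum s \<sigma> = (if s > \<sigma> then (\<Sum>k::nat. pow2 ((s - \<sigma>) - real k * (s - \<sigma>))) else 1)"

lemma weight_sum_finite: "weight_sum s \<sigma> < top"
  unfolding weight_sum_def using suminf_pow2_finite[of "s - \<sigma>" "s - \<sigma>"] by simp

text \<open>
  For \<open>s > \<sigma>\<close> each entry of a sequence is bounded by its norm and the remaining
  geometric series converges; for \<open>s = \<sigma>\<close> and \<open>r = 1\<close> the sum is the norm.
\<close>

lemma weighted_sum_le:
  assumes r: "1 \<le> r" and h: "s > \<sigma> \<or> s = \<sigma> \<and> r = 1"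
  shows "(\<Sum>k. pow2 (real_of_int (int k - 1) * (\<sigma> - 1)) * a (int k - 1)) \<le>
    weight_sum s \<sigma> * lr_norm r (\<lambda>q. pow2 (real_of_int q * (s - 1)) * a q)"
proof (cases "s > \<sigma>")
  case True
  define B where "B = lr_norm r (\<lambda>q. pow2 (real_of_int q * (s - 1)) * a q)"
  have "(\<Sum>k. pow2 (real_of_int (int k - 1) * (\<sigma> - 1)) * a (int k - 1)) \<le>
      (\<Sum>k. pow2 ((s - \<sigma>) - real k * (s - \<sigma>)) * B)"
  proof (rule suminf_le)
    fix k
    have e: "real_of_int (int k - 1) * (\<sigma> - 1) = ((s - \<sigma>) - real k * (s - \<sigma>)) + real_of_int (int k - 1) * (s - 1)"
      by (simp add: algebra_simps)
    have "pow2 (real_of_int (int k - 1) * (s - 1)) * a (int k - 1) \<le> B"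
      unfolding B_def by (rule lr_norm_component[OF r, where a="\<lambda>q. pow2 (real_of_int q * (s - 1)) * a q"]) simp
    then show "pow2 (real_of_int (int k - 1) * (\<sigma> - 1)) * a (int k - 1) \<le> pow2 ((s - \<sigma>) - real k * (s - \<sigma>)) * B"
      unfolding e pow2_add mult.assoc by (rule mult_left_mono) simp
  qed auto
  also have "\<dots> = weight_sum s \<sigma> * B" unfolding weight_sum_def using True by simp
  finally show ?thesis unfolding B_def .
next
  case False
  then have "s = \<sigma>" "r = 1" using h by auto
  then show ?thesis by (simp add: weight_sum_def lr_norm_1)
qed

context lp_pair
begin

text \<open>
  A common bound for the \<open>L\<^sup>1\<close> norm and for the supremum of the kernel at frequency \<open>1\<close>.
  The number \<open>1\<close> makes it positive.
\<close>

definition kernel_bound :: real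
  where "kernel_bound = max (max 1 (enn2real (kernel_norm (cs 0)))) (SOME B. \<forall>x. norm (inv_fourier (cs 0) x) \<le> B)"

lemma kernel_bound_pos: "kernel_bound > 0"
  by (simp add: kernel_bound_def less_max_iff_disj)

lemma kernel_norm_le_bound: "kernel_norm (cs N) \<le> ennreal kernel_bound"
proof -
  have "kernel_norm (cs N) = ennreal (enn2real (kernel_norm (cs 0)))"
    unfolding kernel_norm_cs[of N] using kernel_norm_finite[OF test_cs, of 0] by simp
  also have "\<dots> \<le> ennreal kernel_bound" by (rule ennreal_leI) (simp add: kernel_bound_def)
  finally show ?thesis .
qed

lemma kernel_le_bound: "norm (inv_fourier (cs N) x) \<le> kernel_bound * 2 powr (real_of_int N * real CARD('n))"
proof -
  have B: "norm (inv_fourier (cs 0) x) \<le> kernel_bound" for x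
    using someI_ex[OF inv_fourier_bounded[OF test_cs, of 0]] by (simp add: kernel_bound_def le_max_iff_disj)
  have c: "2 powr (- real_of_int N) > (0::real)" by simp
  have e: "(1 / 2 powr (- real_of_int N)) ^ CARD('n) = 2 powr (real_of_int N * real CARD('n))"
    by (simp add: powr_minus divide_simps powr_powr[symmetric] powr_realpow)
  have "inv_fourier (cs N) x = of_real ((1 / 2 powr (- real_of_int N)) ^ CARD('n)) *
      inv_fourier (cs 0) ((1 / 2 powr (- real_of_int N)) *\<^sub>R x)"
    by (subst cs_dilate) (rule inv_fourier_dilate[OF c])
  then have "norm (inv_fourier (cs N) x) = 2 powr (real_of_int N * real CARD('n)) * norm (inv_fourier (cs 0) ((1 / 2 powr (- real_of_int N)) *\<^sub>R x))"
    unfolding e by (simp add: norm_mult)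
  also have "\<dots> \<le> 2 powr (real_of_int N * real CARD('n)) * kernel_bound"
    by (rule mult_left_mono[OF B]) simp
  finally show ?thesis by (simp only: mult.commute)
qed

text \<open>
  The kernel of the cut-off at \<open>N\<close> has height \<open>2\<^sup>N\<^sup>d\<close>.
\<close>

lemma Lpn_Bernstein:
  fixes F :: "'i \<Rightarrow> real^'n \<Rightarrow> complex"
  assumes p: "1 \<le> p1" "1 \<le> p2" "p2 \<le> p1" and I: "finite I" and F: "\<And>i. i \<in> I \<Longrightarrow> tempered_fun (F i)"
  shows "Lpn p1 I (\<lambda>i. SN N (F i)) \<le>
    ennreal kernel_bound * pow2 (real_of_int N * (real CARD('n) * (enn2real (1 / p2) - enn2real (1 / p1)))) * Lpn p2 I F"
proof -
  define D where "D = 2 powr (real_of_int N * real CARD('n))"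
  have D: "D > 0" by (simp add: D_def)
  define e where "e = enn2real (1 / p2) - enn2real (1 / p1)"
  have km: "(\<lambda>y. ennreal (norm (inv_fourier (cs N) y))) \<in> borel_measurable borel"
    using inv_fourier_measurable[OF test_cs, of N] by measurable
  have um: "(\<lambda>y. ennreal (vec_norm I F y)) \<in> borel_measurable borel"
    by (rule ennreal_vec_norm_measurable) (rule tempered_measurable[OF F])
  have "Lpn p1 I (\<lambda>i. SN N (F i)) \<le>
      Lpe lborel p1 (\<lambda>x. \<integral>\<^sup>+y. ennreal (norm (inv_fourier (cs N) y)) * ennreal (vec_norm I F (x - y)) \<partial>lborel)"
    unfolding SN_def by (rule Lpn_conv_pointwise[OF p(1) I test_symbol_rapid[OF test_cs] F])
  also have "\<dots> \<le> ennreal (kernel_bound * D powr e) * Lpe lborel p2 (\<lambda>y. ennreal (vec_norm I F y))"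
    unfolding e_def
  proof (rule Lpe_Bernstein[OF p um km kernel_bound_pos D])
    show "(\<integral>\<^sup>+y. ennreal (norm (inv_fourier (cs N) y)) \<partial>lborel) \<le> ennreal kernel_bound"
      using kernel_norm_le_bound[of N] by (simp add: kernel_norm_def)
    show "ennreal (norm (inv_fourier (cs N) y)) \<le> ennreal (kernel_bound * D)" for y
      unfolding D_def by (rule ennreal_leI) (rule kernel_le_bound)
  qed
  also have "ennreal (kernel_bound * D powr e) = ennreal kernel_bound * pow2 (real_of_int N * (real CARD('n) * e))"
    unfolding pow2_def D_def powr_powr mult.assoc using kernel_bound_pos by (intro ennreal_mult) auto
  finally show ?thesis unfolding e_def Lpn_def .
qed

text \<open>
  A derivative of a block has frequencies at most \<open>8/3 \<cdot> 2\<^sup>q\<close>, where the cut-off at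
  \<open>q + 2\<close> is \<open>1\<close>. This makes Bernstein's inequality applicable to it.
\<close>

lemma conv_pd_bs_reproduce:
  assumes q: "q \<ge> -1" and F: "tempered_fun F"
  shows "SN (q + 2) (conv (pd j (inv_fourier (bs q))) F) = conv (pd j (inv_fourier (bs q))) F"
proof
  fix x
  have t: "test_symbol (\<lambda>\<xi>. \<i> * (of_real (\<xi> $ j) * bs q \<xi>))"
    by (intro test_symbol_cmult test_symbol_coord_times test_bs)
  have p: "pd j (inv_fourier (bs q)) = inv_fourier (\<lambda>\<xi>. \<i> * (of_real (\<xi> $ j) * bs q \<xi>))"
    by (rule ext) (rule pd_inv_fourier[OF test_bs])
  have "cs (q + 2) \<xi> * (\<i> * (of_real (\<xi> $ j) * bs q \<xi>)) = \<i> * (of_real (\<xi> $ j) * (cs (q + 2) \<xi> * bs q \<xi>))" for \<xi>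
    by (simp only: mult_ac)
  then have "(\<lambda>\<xi>. cs (q + 2) \<xi> * (\<i> * (of_real (\<xi> $ j) * bs q \<xi>))) = (\<lambda>\<xi>. \<i> * (of_real (\<xi> $ j) * bs q \<xi>))"
    by (simp only: cs_times_bs[OF q])
  then show "SN (q + 2) (conv (pd j (inv_fourier (bs q))) F) x = conv (pd j (inv_fourier (bs q))) F x"
    unfolding SN_def p conv_conv[OF test_cs t F] by simp
qed

lemma sum_pd_DQ:
  assumes F: "tempered_fun F"
  shows "(\<Sum>k<Suc n. pd j (DQ (int k - 1) F) x) = pd j (SN (int n) F) x"
proof (induction n)
  case 0 show ?case by (simp add: DQ_minus_1)
next
  case (Suc n)
  have "SN (int (Suc n)) F = (\<lambda>x. SN (int n) F x + DQ (int n) F x)"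
    using DQ_eq[OF _ F, of "int n"] by (simp add: fun_eq_iff add.commute)
  then have "pd j (SN (int (Suc n)) F) x = pd j (SN (int n) F) x + pd j (DQ (int n) F) x"
    using pd_add[OF SN_differentiable[OF F] DQ_differentiable[OF F]] by simp
  then show ?case using Suc by simp
qed

text \<open>
  Integration by parts against a Schwartz function, through the distributional definition of
  the derivative and its commutation with multipliers.
\<close>

lemma integral_pd_SN:
  assumes F: "tempered_fun F" and psi: "schwartz \<psi>"
  shows "(LINT x|lborel. pd j (SN N F) x * \<psi> x) = - (LINT x|lborel. SN N F x * pd j \<psi> x)"
proof -
  define m where "m = (\<lambda>\<xi>. chi ((2 powr (- real_of_int N)) *\<^sub>R \<xi>))"
  have m: "(\<lambda>\<xi>. complex_of_real (m \<xi>)) = cs N" by (simp add: m_def cs_def[abs_def])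
  have tm: "test_symbol (\<lambda>\<xi>. complex_of_real (m \<xi>))" unfolding m by (rule test_cs)
  define \<Theta> where "\<Theta> = (\<lambda>z. inv_fourier (cs N) (- z))"
  have rt: "rapid \<Theta>" unfolding \<Theta>_def by (intro rapid_uminus test_symbol_rapid test_cs)
  have eq: "fourier_multiplier m u \<phi> = u (conv \<Theta> \<phi>)" if "rapid \<phi>" for u \<phi>
    unfolding \<Theta>_def m[symmetric] by (rule fourier_multiplier_eq[OF tm that])
  have "pd j (SN N F) = conv (pd j (inv_fourier (cs N))) F" by (rule ext) (rule pd_SN[OF F])
  then have "(LINT x|lborel. pd j (SN N F) x * \<psi> x) = fourier_multiplier m (dpartial j (dist_of F)) \<psi>"
    using represents_fourier_multiplier_dpartial[OF tm F, of j] psi by (simp add: represents_def m dist_of_def)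
  also have "\<dots> = - dist_of F (conv \<Theta> (pd j \<psi>))"
    unfolding eq[OF schwartz_rapid[OF psi]] dpartial_def ext[OF pd_conv_schwartz[OF rt psi]] ..
  also have "\<dots> = - fourier_multiplier m (dist_of F) (pd j \<psi>)"
    unfolding eq[OF schwartz_rapid[OF schwartz_pd[OF psi]]] ..
  also have "\<dots> = - (LINT x|lborel. SN N F x * pd j \<psi> x)"
    using represents_fourier_multiplier[OF tm represents_dist_of[OF F]] schwartz_pd[OF psi]
    by (simp add: represents_def m dist_of_def SN_def)
  finally show ?thesis .
qed

definition embedding_const :: "real \<Rightarrow> real \<Rightarrow> ennreal"
  where "embedding_const s \<sigma> = ennreal kernel_bound * pow2 (2 * (\<sigma> - 1)) * weight_sum s \<sigma>"

lemma embedding_const_finite: "embedding_const s \<sigma> < top"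
  unfolding embedding_const_def using weight_sum_finite[of s \<sigma>] by (simp add: ennreal_mult_less_top)

lemma pd_blocks_sum_bound:
  fixes g :: "'z \<Rightarrow> real^'n \<Rightarrow> complex" and J :: "'z \<Rightarrow> 'n"
  assumes p: "1 \<le> p1" "1 \<le> p2" "p2 \<le> p1" and I: "finite I" and g: "\<And>z. z \<in> I \<Longrightarrow> tempered_fun (g z)"
    and r: "1 \<le> r" and \<sigma>: "\<sigma> = 1 + real CARD('n) * (enn2real (1 / p2) - enn2real (1 / p1))"
    and h: "s > \<sigma> \<or> s = \<sigma> \<and> r = 1"
  shows "(\<Sum>k. Lpn p1 I (\<lambda>z. conv (pd (J z) (inv_fourier (bs (int k - 1)))) (g z))) \<le>
    embedding_const s \<sigma> * dyadic_norm r (s - 1) p2 I (\<lambda>q z. conv (pd (J z) (inv_fourier (bs q))) (g z))"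
proof -
  define v where "v = (\<lambda>q z. conv (pd (J z) (inv_fourier (bs q))) (g z))"
  have tv: "tempered_fun (v q z)" if "z \<in> I" for q z
    unfolding v_def by (rule tempered_conv[OF pd_inv_fourier_rapid[OF test_bs] g[OF that]])
  have le: "Lpn p1 I (v q) \<le> (ennreal kernel_bound * pow2 (2 * (\<sigma> - 1))) * (pow2 (real_of_int q * (\<sigma> - 1)) * Lpn p2 I (v q))" if q: "q \<ge> -1" for q
  proof -
    have "Lpn p1 I (v q) = Lpn p1 I (\<lambda>z. SN (q + 2) (v q z))"
      by (rule Lpn_cong) (simp add: v_def conv_pd_bs_reproduce[OF q g])
    also have "\<dots> \<le> ennreal kernel_bound * pow2 (real_of_int (q + 2) * (\<sigma> - 1)) * Lpn p2 I (v q)"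
      using Lpn_Bernstein[OF p I tv, where N="q + 2"] unfolding \<sigma> by simp
    also have "real_of_int (q + 2) * (\<sigma> - 1) = 2 * (\<sigma> - 1) + real_of_int q * (\<sigma> - 1)" by (simp add: algebra_simps)
    finally show ?thesis unfolding pow2_add by (simp only: mult.assoc)
  qed
  have "(\<Sum>k. Lpn p1 I (v (int k - 1))) \<le> (\<Sum>k. (ennreal kernel_bound * pow2 (2 * (\<sigma> - 1))) * (pow2 (real_of_int (int k - 1) * (\<sigma> - 1)) * Lpn p2 I (v (int k - 1))))"
  proof (rule suminf_le)
    fix k :: nat
    show "Lpn p1 I (v (int k - 1)) \<le> (ennreal kernel_bound * pow2 (2 * (\<sigma> - 1))) * (pow2 (real_of_int (int k - 1) * (\<sigma> - 1)) * Lpn p2 I (v (int k - 1)))"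
      by (rule le) simp
  qed auto
  also have "\<dots> = (ennreal kernel_bound * pow2 (2 * (\<sigma> - 1))) * (\<Sum>k. pow2 (real_of_int (int k - 1) * (\<sigma> - 1)) * Lpn p2 I (v (int k - 1)))"
    by (rule ennreal_suminf_cmult)
  also have "\<dots> \<le> (ennreal kernel_bound * pow2 (2 * (\<sigma> - 1))) * (weight_sum s \<sigma> * dyadic_norm r (s - 1) p2 I v)"
    by (rule mult_left_mono[OF weighted_sum_le[OF r h]]) simp
  finally show ?thesis unfolding embedding_const_def v_def by (simp only: mult.assoc)
qed

text \<open>
  The derivatives of the blocks form an absolutely convergent series in \<open>L\<^sup>p\<^sup>1\<close>.
  Its partial sums are derivatives of cut-offs, so that its limit represents the distributional
  derivative. The index \<open>z\<close> and the direction \<open>J z\<close> cover gradients of functions and of fields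
  at the same time.
\<close>

theorem derivative_embedding:
  fixes g :: "'z \<Rightarrow> real^'n \<Rightarrow> complex" and J :: "'z \<Rightarrow> 'n"
  assumes p: "1 \<le> p1" "1 \<le> p2" "p2 \<le> p1" and I: "finite I" and g: "\<And>z. z \<in> I \<Longrightarrow> tempered_fun (g z)"
    and r: "1 \<le> r" and \<sigma>: "\<sigma> = 1 + real CARD('n) * (enn2real (1 / p2) - enn2real (1 / p1))"
    and h: "s > \<sigma> \<or> s = \<sigma> \<and> r = 1"
    and fin: "dyadic_norm r (s - 1) p2 I (\<lambda>q z. conv (pd (J z) (inv_fourier (bs q))) (g z)) < top"
  shows "\<exists>F. (\<forall>z\<in>I. represents (F z) (dpartial (J z) (dist_of (g z)))) \<and>
    Lpn p1 I F \<le> embedding_const s \<sigma> * dyadic_norm r (s - 1) p2 I (\<lambda>q z. conv (pd (J z) (inv_fourier (bs q))) (g z))"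
proof -
  define B where "B = dyadic_norm r (s - 1) p2 I (\<lambda>q z. conv (pd (J z) (inv_fourier (bs q))) (g z))"
  define v where "v = (\<lambda>(k::nat) z. conv (pd (J z) (inv_fourier (bs (int k - 1)))) (g z))"
  have S: "(\<Sum>k. Lpn p1 I (v k)) \<le> embedding_const s \<sigma> * B"
    unfolding v_def B_def by (rule pd_blocks_sum_bound[OF p I g r \<sigma> h])
  have vm: "v k z \<in> borel_measurable borel" if "z \<in> I" for k z
    unfolding v_def by (intro conv_measurable pd_inv_fourier_measurable test_bs tempered_measurable g that)
  have "(\<Sum>k. Lpn p1 I (v k)) < top"
    using S fin embedding_const_finite[of s \<sigma>] unfolding B_def[symmetric] by (meson ennreal_mult_less_top order_le_less_trans)
  from Lpn_series[OF p(1) I vm this] obtain F where tF: "\<And>z. z \<in> I \<Longrightarrow> tempered_fun (F z)"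
    and LF: "Lpn p1 I F \<le> (\<Sum>k. Lpn p1 I (v k))"
    and lim: "\<And>z \<psi>. z \<in> I \<Longrightarrow> rapid \<psi> \<Longrightarrow> (\<lambda>n. LINT x|lborel. (\<Sum>k<n. v k z x) * \<psi> x) \<longlonglongrightarrow> (LINT x|lborel. F z x * \<psi> x)"
    by blast
  have "represents (F z) (dpartial (J z) (dist_of (g z)))" if z: "z \<in> I" for z
    unfolding represents_def
  proof (intro conjI allI impI)
    show "tempered_fun (F z)" by (rule tF[OF z])
    fix \<psi> :: "real^'n \<Rightarrow> complex" assume psi: "schwartz \<psi>"
    have "(\<Sum>k<Suc n. v k z x) = pd (J z) (SN (int n) (g z)) x" for n x
      unfolding v_def using sum_pd_DQ[OF g[OF z], of "J z" x n] by (simp only: pd_DQ[OF g[OF z]])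
    then have "(LINT x|lborel. (\<Sum>k<Suc n. v k z x) * \<psi> x) = - (LINT x|lborel. SN (int n) (g z) x * pd (J z) \<psi> x)" for n
      by (simp only: integral_pd_SN[OF g[OF z] psi])
    then have "(\<lambda>n. - (LINT x|lborel. SN (int n) (g z) x * pd (J z) \<psi> x)) \<longlonglongrightarrow> (LINT x|lborel. F z x * \<psi> x)"
      using LIMSEQ_Suc[OF lim[OF z schwartz_rapid[OF psi]]] by (simp only:)
    moreover have "(\<lambda>n. - (LINT x|lborel. SN (int n) (g z) x * pd (J z) \<psi> x)) \<longlonglongrightarrow> - (LINT x|lborel. g z x * pd (J z) \<psi> x)"
      using SN_tendsto[OF order_refl g[OF z] schwartz_rapid[OF schwartz_pd[OF psi]] smooth_continuous[OF schwartz_smooth[OF schwartz_pd[OF psi]]], of "J z"]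
      by (intro tendsto_minus) simp
    ultimately have "(LINT x|lborel. F z x * \<psi> x) = - (LINT x|lborel. g z x * pd (J z) \<psi> x)"
      by (rule LIMSEQ_unique)
    then show "dpartial (J z) (dist_of (g z)) \<psi> = dist_of (F z) \<psi>"
      by (simp add: dpartial_def dist_of_def)
  qed
  then show ?thesis using order_trans[OF LF S] unfolding B_def by blast
qed

end

section \<open>Distributions given by functions\<close>

lemma represents_diff:
  assumes "represents A u" "represents B w"
  shows "represents (\<lambda>x. A x - B x) (\<lambda>\<psi>. u \<psi> - w \<psi>)"
  unfolding represents_def
proof (intro conjI allI impI)
  have t: "tempered_fun A" "tempered_fun B" using assms by (auto simp: represents_def)
  show "tempered_fun (\<lambda>x. A x - B x)" by (rule tempered_diff[OF t])
  fix \<psi> :: "real^'a \<Rightarrow> complex" assume "schwartz \<psi>"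
  then show "u \<psi> - w \<psi> = dist_of (\<lambda>x. A x - B x) \<psi>"
    using assms Bochner_Integration.integral_diff[OF tempered_times_rapid_integrable[OF t(1)] tempered_times_rapid_integrable[OF t(2)], of \<psi> \<psi>]
    by (simp add: represents_def dist_of_def left_diff_distrib schwartz_rapid)
qed

lemma represents_sum:
  assumes "\<And>i. i \<in> I \<Longrightarrow> represents (A i) (u i)"
  shows "represents (\<lambda>x. \<Sum>i\<in>I. A i x) (\<lambda>\<psi>. \<Sum>i\<in>I. u i \<psi>)"
  unfolding represents_def
proof (intro conjI allI impI)
  have t: "tempered_fun (A i)" if "i \<in> I" for i using assms[OF that] by (simp add: represents_def)
  show "tempered_fun (\<lambda>x. \<Sum>i\<in>I. A i x)" by (rule tempered_sum[OF t])
  fix \<psi> :: "real^'b \<Rightarrow> complex" assume psi: "schwartz \<psi>"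
  have "dist_of (\<lambda>x. \<Sum>i\<in>I. A i x) \<psi> = (LINT x|lborel. (\<Sum>i\<in>I. A i x * \<psi> x))"
    by (simp add: dist_of_def sum_distrib_right)
  also have "\<dots> = (\<Sum>i\<in>I. (LINT x|lborel. A i x * \<psi> x))"
    by (rule Bochner_Integration.integral_sum) (intro tempered_times_rapid_integrable t schwartz_rapid psi)
  also have "\<dots> = (\<Sum>i\<in>I. u i \<psi>)"
    using assms psi by (intro sum.cong) (auto simp: represents_def dist_of_def)
  finally show "(\<Sum>i\<in>I. u i \<psi>) = dist_of (\<lambda>x. \<Sum>i\<in>I. A i x) \<psi>" ..
qed

text \<open>
  The representing function chosen in \<open>dist_prod\<close> agrees with \<open>H\<close> almost everywhere.
\<close>

lemma represents_dist_prod: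
  fixes m f H :: "real^'n \<Rightarrow> complex"
  assumes m: "test_symbol m" "m 0 = 1" and f: "tempered_fun f"
    and H: "represents H u" and fH: "tempered_fun (\<lambda>x. f x * H x)"
  shows "represents (\<lambda>x. f x * H x) (dist_prod f u)"
  unfolding represents_def
proof (intro conjI allI impI fH)
  fix \<psi> :: "real^'n \<Rightarrow> complex" assume psi: "schwartz \<psi>"
  define H' where "H' = (SOME H. represents H u)"
  have H': "represents H' u" unfolding H'_def by (rule someI[of "\<lambda>H. represents H u", OF H])
  have [measurable]: "f \<in> borel_measurable borel" "H \<in> borel_measurable borel" "H' \<in> borel_measurable borel" "\<psi> \<in> borel_measurable borel"
    using f H H' psi by (auto simp: represents_def dest: tempered_measurable rapid_measurable schwartz_rapid)
  have "AE x in lborel. H' x = H x" by (rule represents_unique[OF m H' H])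
  then have "AE x in lborel. f x * H' x * \<psi> x = f x * H x * \<psi> x" by eventually_elim simp
  then have "(LINT x|lborel. f x * H' x * \<psi> x) = (LINT x|lborel. f x * H x * \<psi> x)"
    by (intro integral_cong_AE) measurable
  then show "dist_prod f u \<psi> = dist_of (\<lambda>x. f x * H x) \<psi>"
    by (simp add: dist_prod_def dist_of_def H'_def)
qed

lemma Lp_norm_finite_represents:
  assumes "Lp_norm p I u < top"
  obtains F where "\<And>i. i \<in> I \<Longrightarrow> represents (F i) (u i)"
proof -
  have "{F. \<forall>i\<in>I. represents (F i) (u i)} \<noteq> {}"
  proof
    assume e: "{F. \<forall>i\<in>I. represents (F i) (u i)} = {}"
    have "Lp_norm p I u = top" unfolding Lp_norm_def e by simp
    then show False using assms by simp
  qed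
  then show ?thesis using that by blast
qed

text \<open>
  Controls a divergence by the full gradient. The family over the one-element type \<open>unit\<close> is a
  single function.
\<close>

lemma Lpn_trace:
  fixes H :: "'i::finite \<times> 'i \<Rightarrow> real^'n \<Rightarrow> complex"
  assumes p: "1 \<le> p" and H: "\<And>z. H z \<in> borel_measurable borel"
  shows "Lpn p (UNIV :: unit set) (\<lambda>_ x. \<Sum>i\<in>UNIV. H (i, i) x) \<le> of_nat CARD('i) * Lpn p (UNIV \<times> UNIV) H"
proof -
  have "Lpn p (UNIV :: unit set) (\<lambda>_ x. \<Sum>i\<in>UNIV. H (i, i) x) \<le>
      Lpe lborel p (\<lambda>x. of_nat CARD('i) * ennreal (vec_norm (UNIV \<times> UNIV) H x))"
  proof (rule Lpn_mono_pointwise[OF p])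
    show "(\<lambda>x. \<Sum>i\<in>UNIV. H (i, i) x) \<in> borel_measurable lborel" using H by simp
    fix x
    have "norm (\<Sum>i\<in>UNIV. H (i, i) x) \<le> (\<Sum>i\<in>(UNIV::'i set). vec_norm (UNIV \<times> UNIV) H x)"
      by (rule sum_norm_le) (auto intro: norm_le_vec_norm)
    then have "vec_norm (UNIV :: unit set) (\<lambda>_ x. \<Sum>i\<in>UNIV. H (i, i) x) x \<le> real CARD('i) * vec_norm (UNIV \<times> UNIV) H x"
      by (simp add: vec_norm_def UNIV_unit)
    then have "ennreal (vec_norm (UNIV :: unit set) (\<lambda>_ x. \<Sum>i\<in>UNIV. H (i, i) x) x) \<le> ennreal (real CARD('i) * vec_norm (UNIV \<times> UNIV) H x)"
      by (rule ennreal_leI)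
    also have "\<dots> = of_nat CARD('i) * ennreal (vec_norm (UNIV \<times> UNIV) H x)"
      by (simp add: ennreal_mult ennreal_of_nat_eq_real_of_nat)
    finally show "ennreal (vec_norm (UNIV :: unit set) (\<lambda>_ x. \<Sum>i\<in>UNIV. H (i, i) x) x) \<le> of_nat CARD('i) * ennreal (vec_norm (UNIV \<times> UNIV) H x)" .
  qed
  also have "\<dots> \<le> of_nat CARD('i) * Lpn p (UNIV \<times> UNIV) H"
    unfolding Lpn_def by (rule Lpe_cmult_le[OF p]) (use ennreal_vec_norm_measurable[of "UNIV \<times> UNIV" H borel] H in simp)
  finally show ?thesis .
qed

context lp_pair
begin

lemma besov_norm_eq:
  fixes V :: "int \<Rightarrow> 'i \<Rightarrow> real^'n \<Rightarrow> complex"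
  assumes p: "1 \<le> p" and r: "1 \<le> r" and I: "finite I"
    and V: "\<And>q i. q \<ge> -1 \<Longrightarrow> i \<in> I \<Longrightarrow> represents (V q i) (lp_block phi chi q (u i))"
  shows "besov_norm phi chi s p r I u = dyadic_norm r s p I V"
proof -
  have "ennreal (2 powr (real_of_int q * s)) * Lp_norm p I (\<lambda>i. lp_block phi chi q (u i)) = pow2 (real_of_int q * s) * Lpn p I (V q)"
    if "q \<ge> -1" for q
    unfolding pow2_def using Lp_norm_eq_Lpn[OF test_cs[of 0] cs_at_0 p I V[OF that]] by simp
  then show ?thesis unfolding besov_norm_def
    by (intro antisym lr_norm_mono[OF r]) auto
qed

lemma besov_norm_dist_of:
  assumes "1 \<le> p" "1 \<le> r" "finite I" "\<And>i. i \<in> I \<Longrightarrow> tempered_fun (g i)"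
  shows "besov_norm phi chi s p r I (\<lambda>i. dist_of (g i)) = dyadic_norm r s p I (\<lambda>q i. DQ q (g i))"
  by (rule besov_norm_eq[OF assms(1-3)]) (intro represents_block represents_dist_of assms(4))

lemma besov_norm_dpartial:
  fixes g :: "'z \<Rightarrow> real^'n \<Rightarrow> complex"
  assumes "1 \<le> p" "1 \<le> r" "finite I" "\<And>z. z \<in> I \<Longrightarrow> tempered_fun (g z)"
  shows "besov_norm phi chi s p r I (\<lambda>z. dpartial (J z) (dist_of (g z))) =
    dyadic_norm r s p I (\<lambda>q z. conv (pd (J z) (inv_fourier (bs q))) (g z))"
  by (rule besov_norm_eq[OF assms(1-3)]) (intro represents_block_dpartial assms(4))

lemma represents_commutator:
  assumes f: "tempered_fun f" and H: "represents H h" and q: "q \<ge> -1"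
    and fH: "tempered_fun (\<lambda>x. f x * H x)" and fD: "tempered_fun (\<lambda>x. f x * DQ q H x)"
  shows "represents (\<lambda>x. f x * DQ q H x - DQ q (\<lambda>y. f y * H y) x) (commutator phi chi f q h)"
  unfolding commutator_def
  by (intro represents_diff represents_dist_prod[OF test_cs[of 0] cs_at_0] represents_block q f H fH fD)

text \<open>
  The sequence \<open>c\<close> is the weighted norm of the commutator divided by \<open>M\<close>. If \<open>M = 0\<close>, then all
  these norms vanish and \<open>c = 0\<close> will do, in accordance with division by zero.
\<close>

lemma commutator_estimateI:
  fixes h :: "'i \<Rightarrow> 'n tdist" and H :: "'i \<Rightarrow> real^'n \<Rightarrow> complex"
  assumes p: "1 \<le> p" and r: "1 \<le> r" and I: "finite I" and f: "tempered_fun f"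
    and H: "\<And>i. i \<in> I \<Longrightarrow> represents (H i) (h i)"
    and fH: "\<And>i. i \<in> I \<Longrightarrow> tempered_fun (\<lambda>x. f x * H i x)"
    and fD: "\<And>i q. i \<in> I \<Longrightarrow> tempered_fun (\<lambda>x. f x * DQ q (H i) x)"
    and X: "lr_norm r (\<lambda>q. pow2 (real_of_int q * s) * Lpn p I (\<lambda>i x. f x * DQ q (H i) x - DQ q (\<lambda>y. f y * H i y) x)) \<le> M"
    and M: "M < top"
  shows "commutator_estimate phi chi s r p f I h M"
proof -
  define a where "a = (\<lambda>q. pow2 (real_of_int q * s) * Lpn p I (\<lambda>i x. f x * DQ q (H i) x - DQ q (\<lambda>y. f y * H i y) x))"
  have aM: "a q \<le> M" if "q \<ge> -1" for q
    using lr_norm_component[OF r that, of a] X unfolding a_def by (rule order_trans)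
  have norm: "ennreal (2 powr (of_int q * s)) * Lp_norm p I (\<lambda>i. commutator phi chi f q (h i)) = a q" if q: "q \<ge> -1" for q
    unfolding a_def pow2_def
    using Lp_norm_eq_Lpn[OF test_cs[of 0] cs_at_0 p I represents_commutator[OF f H q fH fD]] by simp
  have prod: "prod_defined f (h i) \<and> prod_defined f (lp_block phi chi q (h i))" if "q \<ge> -1" "i \<in> I" for q i
    unfolding prod_defined_def using H[OF that(2)] fH[OF that(2)] fD[OF that(2), of q] represents_block[OF that(1) H[OF that(2)]] by blast
  define c where "c = (\<lambda>q. enn2real (a q / M))"
  have c: "ennreal (c q) = a q / M" "a q = ennreal (c q) * M" if q: "q \<ge> -1" and M0: "M \<noteq> 0" for q
  proof -
    have "a q / M \<le> M / M" by (rule divide_right_mono_ennreal[OF aM[OF q]])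
    also have "\<dots> = 1" using M M0 by (simp add: ennreal_divide_self)
    finally have "a q / M < top" by (simp add: order_le_less_trans[OF _ ennreal_one_less_top])
    then show 1: "ennreal (c q) = a q / M" by (simp add: c_def)
    show "a q = ennreal (c q) * M" unfolding 1 ennreal_divide_times using M M0 by (simp add: ennreal_divide_self)
  qed
  have le: "a q \<le> ennreal (c q) * M" if q: "q \<ge> -1" for q
  proof (cases "M = 0")
    case True then show ?thesis using aM[OF q] by simp
  next
    case False then show ?thesis using c(2)[OF q] by simp
  qed
  have "lr_norm r (\<lambda>q. ennreal (c q)) \<le> 1"
  proof (cases "M = 0")
    case True
    have "lr_norm r (\<lambda>q. ennreal (c q)) \<le> lr_norm r (\<lambda>q. 0 * a q)"
    proof (rule lr_norm_mono[OF r])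
      fix q :: int assume "q \<ge> -1"
      then show "ennreal (c q) \<le> 0 * a q" using aM True by (simp add: c_def)
    qed
    also have "\<dots> \<le> 0 * lr_norm r a" by (rule lr_norm_cmult_le[OF r])
    finally show ?thesis by simp
  next
    case False
    have "lr_norm r (\<lambda>q. ennreal (c q)) \<le> lr_norm r (\<lambda>q. inverse M * a q)"
      by (rule lr_norm_mono[OF r]) (simp add: c(1) False divide_ennreal_def mult.commute)
    also have "\<dots> \<le> inverse M * lr_norm r a" by (rule lr_norm_cmult_le[OF r])
    also have "\<dots> \<le> inverse M * M" using X unfolding a_def by (intro mult_left_mono) auto
    also have "\<dots> = 1" using M False by (simp add: ennreal_divide_self divide_ennreal_def[symmetric] mult.commute)
    finally show ?thesis .
  qed
  then show ?thesis unfolding commutator_estimate_def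
    using le prod norm by (intro exI[of _ c]) (auto simp: c_def)
qed

text \<open>
  One derivative of the block \<open>q\<close> costs \<open>2\<^bsup>q+2\<^esup>\<close>, which is absorbed by the
  regularity \<open>s - 1\<close>.
\<close>

lemma derivative_block_bound:
  fixes g :: "'i \<Rightarrow> real^'n \<Rightarrow> complex"
  assumes p: "1 \<le> p" and r: "1 \<le> r" and I: "finite I" and g: "\<And>i. i \<in> I \<Longrightarrow> tempered_fun (g i)"
  shows "dyadic_norm r (s - 1) p (I \<times> UNIV) (\<lambda>q z. conv (pd (snd z) (inv_fourier (bs q))) (g (fst z))) \<le>
    pow2 2 * kernel_grad (cs 0) * dyadic_norm r s p I (\<lambda>q i. DQ q (g i))"
proof -
  have "dyadic_norm r (s - 1) p (I \<times> UNIV) (\<lambda>q z. conv (pd (snd z) (inv_fourier (bs q))) (g (fst z))) \<le>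
      lr_norm r (\<lambda>q. (pow2 2 * kernel_grad (cs 0)) * (pow2 (real_of_int q * s) * Lpn p I (\<lambda>i. DQ q (g i))))"
  proof (rule lr_norm_mono[OF r])
    fix q :: int assume q: "q \<ge> -1"
    have "Lpn p (I \<times> UNIV) (\<lambda>z. conv (pd (snd z) (inv_fourier (bs q))) (g (fst z))) =
        Lpn p (I \<times> UNIV) (\<lambda>(i, j). conv (pd j (inv_fourier (cs (q + 2)))) (DQ q (g i)))"
      by (rule Lpn_cong) (auto simp: conv_pd_bs[OF q g])
    also have "\<dots> \<le> kernel_grad (cs (q + 2)) * Lpn p I (\<lambda>i. DQ q (g i))"
      by (rule Lpn_conv_grad[OF p I test_cs]) (intro tempered_DQ g)
    also have "kernel_grad (cs (q + 2)) = pow2 (real_of_int (q + 2)) * kernel_grad (cs 0)" unfolding pow2_def by (rule kernel_grad_cs)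
    finally have "pow2 (real_of_int q * (s - 1)) * Lpn p (I \<times> UNIV) (\<lambda>z. conv (pd (snd z) (inv_fourier (bs q))) (g (fst z))) \<le>
        pow2 (real_of_int q * (s - 1)) * (pow2 (real_of_int (q + 2)) * kernel_grad (cs 0) * Lpn p I (\<lambda>i. DQ q (g i)))"
      by (rule mult_left_mono) simp
    also have "\<dots> = (pow2 (real_of_int q * (s - 1)) * pow2 (real_of_int (q + 2))) * (kernel_grad (cs 0) * Lpn p I (\<lambda>i. DQ q (g i)))"
      by (simp only: mult_ac)
    also have "pow2 (real_of_int q * (s - 1)) * pow2 (real_of_int (q + 2)) = pow2 2 * pow2 (real_of_int q * s)"
      unfolding pow2_add[symmetric] by (rule arg_cong[where f=pow2]) (simp add: algebra_simps)
    finally show "pow2 (real_of_int q * (s - 1)) * Lpn p (I \<times> UNIV) (\<lambda>z. conv (pd (snd z) (inv_fourier (bs q))) (g (fst z))) \<le>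
        (pow2 2 * kernel_grad (cs 0)) * (pow2 (real_of_int q * s) * Lpn p I (\<lambda>i. DQ q (g i)))"
      by (simp only: mult_ac)
  qed
  also have "\<dots> \<le> pow2 2 * kernel_grad (cs 0) * dyadic_norm r s p I (\<lambda>q i. DQ q (g i))"
    by (rule lr_norm_cmult_le[OF r])
  finally show ?thesis .
qed


section \<open>The commutator with divergence and gradient\<close>

text \<open>
  The norm of \<open>\<nabla>f\<close> in \<open>L\<^sup>p\<^sup>1 \<inter> B\<^bsup>s-1\<^esup>\<close> (over
  \<open>L\<^sup>p\<^sup>2\<close>).
\<close>

definition gradient_norm :: "real \<Rightarrow> ennreal \<Rightarrow> ennreal \<Rightarrow> ennreal \<Rightarrow> (real^'n \<Rightarrow> complex) \<Rightarrow> ennreal"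
  where "gradient_norm s r p1 p2 f =
    Lp_norm p1 UNIV (grad (dist_of f)) + besov_norm phi chi (s - 1) p2 r UNIV (grad (dist_of f))"

definition field_norm :: "real \<Rightarrow> ennreal \<Rightarrow> ennreal \<Rightarrow> ennreal \<Rightarrow> 'i set \<Rightarrow> ('i \<Rightarrow> real^'n \<Rightarrow> complex) \<Rightarrow> ennreal"
  where "field_norm s r p1 p2 I g =
    besov_norm phi chi s p2 r I (\<lambda>i. dist_of (g i)) + Lp_norm p1 (I \<times> UNIV) (grad_vec (\<lambda>i. dist_of (g i)))"

text \<open>
  Finite norms mean that the gradient of \<open>f\<close> is represented by functions, so that the estimate
  for functions applies.
\<close>

lemma commutator_estimate_of_represented:
  fixes H :: "'i \<Rightarrow> real^'n \<Rightarrow> complex" and s :: real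
  assumes p: "1 \<le> p" "1 \<le> p1" "1 \<le> p2" "1 / p = 1 / p1 + 1 / p2" and r: "1 \<le> r" and s: "s > 0" and I: "finite I"
    and f: "tempered_fun f" and A: "gradient_norm s r p1 p2 f < top"
    and H: "\<And>i. i \<in> I \<Longrightarrow> represents (H i) (h i)"
    and HF: "Lpn p1 I H < top"
    and M: "commutator_const s * (gradient_norm s r p1 p2 f *
        (Lpn p1 I H + dyadic_norm r (s - 1) p2 I (\<lambda>q i. DQ q (H i)))) \<le> M" "M < top"
  shows "commutator_estimate phi chi s r p f I h M"
proof -
  have "Lp_norm p1 UNIV (grad (dist_of f)) < top"
    using A by (simp add: gradient_norm_def)
  then obtain F where F0: "\<And>j. j \<in> UNIV \<Longrightarrow> represents (F j) (grad (dist_of f) j)"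
    by (rule Lp_norm_finite_represents) blast
  then have F: "represents (F j) (dpartial j (dist_of f))" for j by (simp add: grad_def)
  have LF: "Lp_norm p1 UNIV (grad (dist_of f)) = Lpn p1 UNIV F"
    by (rule Lp_norm_eq_Lpn[OF test_cs[of 0] cs_at_0 p(2) finite_class.finite_UNIV F0])
  have BF: "besov_norm phi chi (s - 1) p2 r UNIV (grad (dist_of f)) =
      dyadic_norm r (s - 1) p2 UNIV (\<lambda>q j. pd j (DQ q f))"
  proof -
    have "pd j (DQ q f) = conv (pd j (inv_fourier (bs q))) f" for j q by (rule ext) (rule pd_DQ[OF f])
    then show ?thesis unfolding grad_def using besov_norm_dpartial[OF p(3) r finite_class.finite_UNIV f, where J="\<lambda>j. j"] by simp
  qed
  note A_eq = gradient_norm_def[of s r p1 p2 f, unfolded LF BF]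
  have Bf: "dyadic_norm r (s - 1) p2 UNIV (\<lambda>q j. pd j (DQ q f)) < top"
    using A unfolding A_eq by simp
  have tH: "tempered_fun (H i)" if "i \<in> I" for i using H[OF that] by (simp add: represents_def)
  note c = tempered_product[OF p r s I f F tH Bf HF] tempered_product_block[OF p r s I f F tH Bf HF]
    commutator_sequence_bound[OF p r s I f F tH Bf HF]
  show ?thesis
    by (rule commutator_estimateI[OF p(1) r I f H c(1) c(2) order_trans[OF c(3) M(1)[unfolded A_eq]] M(2)])
qed

text \<open>
  The factor \<open>d\<close> bounds a trace, the factor \<open>1 + 4 kernel_grad (cs 0)\<close> the sum of the norms of
  \<open>\<nabla>g\<close> and of its blocks.
\<close>

definition estimate_const :: "real \<Rightarrow> ennreal"
  where "estimate_const s = commutator_const s * (of_nat CARD('n) * (1 + pow2 2 * kernel_grad (cs 0)))"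

lemma estimate_const_finite: "s > 0 \<Longrightarrow> estimate_const s < top"
  unfolding estimate_const_def using commutator_const_finite[of s] kernel_grad_finite[OF test_cs, of 0]
  by (simp add: ennreal_mult_less_top of_nat_less_top)

lemma grad_vec_represented:
  fixes g :: "'i \<Rightarrow> real^'n \<Rightarrow> complex"
  assumes p: "1 \<le> p1" "1 \<le> p2" and r: "1 \<le> r" and I: "finite I"
    and g: "\<And>i. i \<in> I \<Longrightarrow> tempered_fun (g i)" and fin: "field_norm s r p1 p2 I g < top"
  shows "\<exists>H. (\<forall>z\<in>I \<times> UNIV. represents (H z) (grad_vec (\<lambda>i. dist_of (g i)) z)) \<and> Lpn p1 (I \<times> UNIV) H < top \<and>
    Lpn p1 (I \<times> UNIV) H + dyadic_norm r (s - 1) p2 (I \<times> UNIV) (\<lambda>q z. DQ q (H z))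
      \<le> (1 + pow2 2 * kernel_grad (cs 0)) * field_norm s r p1 p2 I g"
proof -
  have "Lp_norm p1 (I \<times> UNIV) (grad_vec (\<lambda>i. dist_of (g i))) < top"
    using fin by (simp add: field_norm_def)
  then obtain H where H: "\<And>z. z \<in> I \<times> UNIV \<Longrightarrow> represents (H z) (grad_vec (\<lambda>i. dist_of (g i)) z)"
    by (rule Lp_norm_finite_represents) blast
  have IJ: "finite (I \<times> (UNIV :: 'n set))" using I by simp
  have LH: "Lp_norm p1 (I \<times> UNIV) (grad_vec (\<lambda>i. dist_of (g i))) = Lpn p1 (I \<times> UNIV) H"
    by (rule Lp_norm_eq_Lpn[OF test_cs[of 0] cs_at_0 p(1) IJ H])
  define b where "b = dyadic_norm r s p2 I (\<lambda>q i. DQ q (g i))"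
  have N: "field_norm s r p1 p2 I g = b + Lpn p1 (I \<times> UNIV) H"
    unfolding field_norm_def LH b_def by (simp only: besov_norm_dist_of[OF p(2) r I g, where s=s])
  have "Lpn p2 (I \<times> UNIV) (\<lambda>z. DQ q (H z)) = Lpn p2 (I \<times> UNIV) (\<lambda>z. conv (pd (snd z) (inv_fourier (bs q))) (g (fst z)))" for q
  proof (rule Lpn_cong)
    fix z x assume z: "z \<in> I \<times> (UNIV :: 'n set)"
    have "represents (H z) (dpartial (snd z) (dist_of (g (fst z))))"
      using H[OF z] by (simp add: grad_vec_def case_prod_beta)
    then show "DQ q (H z) x = conv (pd (snd z) (inv_fourier (bs q))) (g (fst z)) x"
      unfolding DQ_def by (rule conv_represents_dpartial[OF schwartz_inv_fourier[OF test_bs]])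
  qed
  then have "dyadic_norm r (s - 1) p2 (I \<times> UNIV) (\<lambda>q z. DQ q (H z)) \<le> pow2 2 * kernel_grad (cs 0) * b"
    unfolding b_def using derivative_block_bound[OF p(2) r I g, where s=s] by (simp only:)
  then have "Lpn p1 (I \<times> UNIV) H + dyadic_norm r (s - 1) p2 (I \<times> UNIV) (\<lambda>q z. DQ q (H z))
      \<le> Lpn p1 (I \<times> UNIV) H + pow2 2 * kernel_grad (cs 0) * b"
    by (rule add_left_mono)
  also have "\<dots> \<le> 1 * field_norm s r p1 p2 I g + pow2 2 * kernel_grad (cs 0) * field_norm s r p1 p2 I g"
    unfolding N by (intro add_mono mult_left_mono) auto
  finally have "Lpn p1 (I \<times> UNIV) H + dyadic_norm r (s - 1) p2 (I \<times> UNIV) (\<lambda>q z. DQ q (H z))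
      \<le> (1 + pow2 2 * kernel_grad (cs 0)) * field_norm s r p1 p2 I g"
    by (simp only: distrib_right)
  moreover have "Lpn p1 (I \<times> UNIV) H < top" using fin unfolding N by simp
  ultimately show ?thesis using H by blast
qed

lemma one_le_card: "1 \<le> (of_nat CARD('n) :: ennreal)"
proof -
  have "1 \<le> CARD('n)" by (simp add: Suc_le_eq)
  then have "(of_nat 1 :: ennreal) \<le> of_nat CARD('n)" by (rule of_nat_mono)
  then show ?thesis by simp
qed

theorem gradient_commutator_estimate:
  fixes g :: "'i \<Rightarrow> real^'n \<Rightarrow> complex" and s :: real
  assumes p: "1 \<le> p" "1 \<le> p1" "1 \<le> p2" "1 / p = 1 / p1 + 1 / p2" and r: "1 \<le> r" and s: "s > 0" and I: "finite I"
    and f: "tempered_fun f" and A: "gradient_norm s r p1 p2 f < top"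
    and g: "\<And>i. i \<in> I \<Longrightarrow> tempered_fun (g i)" and N: "field_norm s r p1 p2 I g < top"
    and M: "estimate_const s * (gradient_norm s r p1 p2 f * field_norm s r p1 p2 I g) \<le> M" "M < top"
  shows "commutator_estimate phi chi s r p f (I \<times> UNIV) (grad_vec (\<lambda>i. dist_of (g i))) M"
proof -
  obtain H where H: "\<And>z. z \<in> I \<times> UNIV \<Longrightarrow> represents (H z) (grad_vec (\<lambda>i. dist_of (g i)) z)"
    and HF: "Lpn p1 (I \<times> UNIV) H < top"
    and B: "Lpn p1 (I \<times> UNIV) H + dyadic_norm r (s - 1) p2 (I \<times> UNIV) (\<lambda>q z. DQ q (H z))
      \<le> (1 + pow2 2 * kernel_grad (cs 0)) * field_norm s r p1 p2 I g"
    using grad_vec_represented[OF p(2,3) r I g N] by blast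
  have IJ: "finite (I \<times> (UNIV :: 'n set))" using I by simp
  show ?thesis
  proof (rule commutator_estimate_of_represented[OF p r s IJ f A H HF _ M(2)])
    have "commutator_const s * (gradient_norm s r p1 p2 f * (Lpn p1 (I \<times> UNIV) H + dyadic_norm r (s - 1) p2 (I \<times> UNIV) (\<lambda>q z. DQ q (H z))))
        \<le> commutator_const s * (gradient_norm s r p1 p2 f * ((1 + pow2 2 * kernel_grad (cs 0)) * field_norm s r p1 p2 I g))"
      by (intro mult_left_mono B) auto
    also have "\<dots> = 1 * (commutator_const s * (gradient_norm s r p1 p2 f * ((1 + pow2 2 * kernel_grad (cs 0)) * field_norm s r p1 p2 I g)))" by (rule mult_1_left[symmetric])
    also have "\<dots> \<le> of_nat CARD('n) * (commutator_const s * (gradient_norm s r p1 p2 f * ((1 + pow2 2 * kernel_grad (cs 0)) * field_norm s r p1 p2 I g)))"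
      by (rule mult_right_mono[OF one_le_card]) simp
    also have "\<dots> = estimate_const s * (gradient_norm s r p1 p2 f * field_norm s r p1 p2 I g)"
      unfolding estimate_const_def by (simp only: mult_ac)
    also have "\<dots> \<le> M" by (rule M(1))
    finally show "commutator_const s * (gradient_norm s r p1 p2 f * (Lpn p1 (I \<times> UNIV) H + dyadic_norm r (s - 1) p2 (I \<times> UNIV) (\<lambda>q z. DQ q (H z)))) \<le> M" .
  qed
qed

text \<open>
  The divergence is the trace of the gradient, and so are its blocks. It is estimated through
  the gradient, whose representing functions exist by the finiteness of the norm.
\<close>

theorem divergence_commutator_estimate:
  fixes g :: "'n \<Rightarrow> real^'n \<Rightarrow> complex" and s :: real
  assumes p: "1 \<le> p" "1 \<le> p1" "1 \<le> p2" "1 / p = 1 / p1 + 1 / p2" and r: "1 \<le> r" and s: "s > 0"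
    and f: "tempered_fun f" and A: "gradient_norm s r p1 p2 f < top"
    and g: "\<And>i. tempered_fun (g i)" and N: "field_norm s r p1 p2 UNIV g < top"
    and M: "estimate_const s * (gradient_norm s r p1 p2 f * field_norm s r p1 p2 UNIV g) \<le> M" "M < top"
  shows "commutator_estimate phi chi s r p f (UNIV :: unit set) (\<lambda>_. divergence (\<lambda>i. dist_of (g i))) M"
proof -
  obtain H where H: "\<And>z. z \<in> UNIV \<times> UNIV \<Longrightarrow> represents (H z) (grad_vec (\<lambda>i. dist_of (g i)) z)"
    and HF: "Lpn p1 (UNIV \<times> UNIV) H < top"
    and B: "Lpn p1 (UNIV \<times> UNIV) H + dyadic_norm r (s - 1) p2 (UNIV \<times> UNIV) (\<lambda>q z. DQ q (H z))
      \<le> (1 + pow2 2 * kernel_grad (cs 0)) * field_norm s r p1 p2 UNIV g"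
    using grad_vec_represented[OF p(2,3) r finite_class.finite_UNIV g N] by blast
  define T where "T = (\<lambda>x. \<Sum>i\<in>UNIV. H (i, i) x)"
  have tH: "tempered_fun (H z)" for z using H[of z] by (cases z) (simp add: represents_def)
  have rT: "represents T (divergence (\<lambda>i. dist_of (g i)))"
    unfolding T_def divergence_def
    by (rule represents_sum) (use H in \<open>auto simp: grad_vec_def\<close>)
  have L1: "Lpn p1 (UNIV :: unit set) (\<lambda>_. T) \<le> of_nat CARD('n) * Lpn p1 (UNIV \<times> UNIV) H"
    unfolding T_def by (rule Lpn_trace[OF p(2) tempered_measurable[OF tH]])
  have L2: "Lpn p2 (UNIV :: unit set) (\<lambda>_. DQ q T) \<le> of_nat CARD('n) * Lpn p2 (UNIV \<times> UNIV) (\<lambda>z. DQ q (H z))" for q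
  proof -
    have "DQ q T = (\<lambda>x. \<Sum>i\<in>UNIV. DQ q (H (i, i)) x)"
      unfolding DQ_def T_def by (rule ext) (rule conv_sum_right[OF test_symbol_rapid[OF test_bs] tH])
    then show ?thesis
      using Lpn_trace[where H="\<lambda>z. DQ q (H z)", OF p(3) tempered_measurable[OF tempered_DQ[OF tH]]] by simp
  qed
  define L where "L = dyadic_norm r (s - 1) p2 (UNIV :: unit set) (\<lambda>q _. DQ q T)"
  have L: "L \<le> of_nat CARD('n) * dyadic_norm r (s - 1) p2 (UNIV \<times> UNIV) (\<lambda>q z. DQ q (H z))"
  proof -
    have "L \<le> lr_norm r (\<lambda>q. of_nat CARD('n) * (pow2 (real_of_int q * (s - 1)) * Lpn p2 (UNIV \<times> UNIV) (\<lambda>z. DQ q (H z))))"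
      unfolding L_def
    proof (rule lr_norm_mono[OF r])
      fix q :: int
      show "pow2 (real_of_int q * (s - 1)) * Lpn p2 (UNIV :: unit set) (\<lambda>_. DQ q T) \<le>
          of_nat CARD('n) * (pow2 (real_of_int q * (s - 1)) * Lpn p2 (UNIV \<times> UNIV) (\<lambda>z. DQ q (H z)))"
        using mult_left_mono[OF L2[of q], of "pow2 (real_of_int q * (s - 1))"] by (simp only: mult_ac zero_le)
    qed
    also have "\<dots> \<le> of_nat CARD('n) * dyadic_norm r (s - 1) p2 (UNIV \<times> UNIV) (\<lambda>q z. DQ q (H z))"
      by (rule lr_norm_cmult_le[OF r])
    finally show ?thesis .
  qed
  show ?thesis
  proof (rule commutator_estimate_of_represented[OF p r s finite_class.finite_UNIV f A _ _ _ M(2), where H="\<lambda>_. T"])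
    show "represents T (divergence (\<lambda>i. dist_of (g i)))" by (rule rT)
    show "Lpn p1 (UNIV :: unit set) (\<lambda>_. T) < top"
      by (rule order_le_less_trans[OF L1]) (use HF in \<open>simp add: ennreal_mult_less_top of_nat_less_top\<close>)
    have "Lpn p1 (UNIV :: unit set) (\<lambda>_. T) + L \<le> of_nat CARD('n) * (Lpn p1 (UNIV \<times> UNIV) H +
        dyadic_norm r (s - 1) p2 (UNIV \<times> UNIV) (\<lambda>q z. DQ q (H z)))"
      unfolding distrib_left by (rule add_mono[OF L1 L])
    also have "\<dots> \<le> of_nat CARD('n) * ((1 + pow2 2 * kernel_grad (cs 0)) * field_norm s r p1 p2 UNIV g)"
      by (rule mult_left_mono[OF B]) simp
    finally have "commutator_const s * (gradient_norm s r p1 p2 f * (Lpn p1 (UNIV :: unit set) (\<lambda>_. T) + L)) \<le>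
        commutator_const s * (gradient_norm s r p1 p2 f * (of_nat CARD('n) * ((1 + pow2 2 * kernel_grad (cs 0)) * field_norm s r p1 p2 UNIV g)))"
      by (intro mult_left_mono) auto
    also have "\<dots> = estimate_const s * (gradient_norm s r p1 p2 f * field_norm s r p1 p2 UNIV g)"
      unfolding estimate_const_def by (simp only: mult_ac)
    also have "\<dots> \<le> M" by (rule M(1))
    finally show "commutator_const s * (gradient_norm s r p1 p2 f * (Lpn p1 (UNIV :: unit set) (\<lambda>_. T) +
        dyadic_norm r (s - 1) p2 (UNIV :: unit set) (\<lambda>q _. DQ q T))) \<le> M"
      unfolding L_def .
  qed
qed

lemma gradient_norm_embedding:
  assumes p: "1 \<le> p1" "1 \<le> p2" "p2 \<le> p1" and r: "1 \<le> r"
    and \<sigma>: "\<sigma> = 1 + real CARD('n) * (enn2real (1 / p2) - enn2real (1 / p1))"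
    and h: "s > \<sigma> \<or> s = \<sigma> \<and> r = 1"
    and f: "tempered_fun f" and fin: "besov_norm phi chi (s - 1) p2 r UNIV (grad (dist_of f)) < top"
  shows "gradient_norm s r p1 p2 f \<le> (1 + embedding_const s \<sigma>) * besov_norm phi chi (s - 1) p2 r UNIV (grad (dist_of f))"
proof -
  define B where "B = besov_norm phi chi (s - 1) p2 r UNIV (grad (dist_of f))"
  have B: "B = dyadic_norm r (s - 1) p2 UNIV (\<lambda>q j. conv (pd j (inv_fourier (bs q))) f)"
    unfolding B_def grad_def by (rule besov_norm_dpartial[OF p(2) r finite_class.finite_UNIV f])
  obtain F where F: "\<And>j. represents (F j) (dpartial j (dist_of f))" "Lpn p1 UNIV F \<le> embedding_const s \<sigma> * B"
    using derivative_embedding[OF p finite_class.finite_UNIV f r \<sigma> h, where J="\<lambda>j. j"] fin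
    unfolding B_def[symmetric] B[symmetric] by blast
  have "Lp_norm p1 UNIV (grad (dist_of f)) = Lpn p1 UNIV F"
    unfolding grad_def by (rule Lp_norm_eq_Lpn[OF test_cs[of 0] cs_at_0 p(1) finite_class.finite_UNIV F(1)])
  then show ?thesis unfolding gradient_norm_def B_def[symmetric]
    using F(2) by (simp add: distrib_right add.commute add_right_mono)
qed

lemma field_norm_embedding:
  fixes g :: "'i \<Rightarrow> real^'n \<Rightarrow> complex"
  assumes p: "1 \<le> p1" "1 \<le> p2" "p2 \<le> p1" and r: "1 \<le> r" and I: "finite I"
    and \<sigma>: "\<sigma> = 1 + real CARD('n) * (enn2real (1 / p2) - enn2real (1 / p1))"
    and h: "s > \<sigma> \<or> s = \<sigma> \<and> r = 1"
    and g: "\<And>i. i \<in> I \<Longrightarrow> tempered_fun (g i)" and fin: "besov_norm phi chi s p2 r I (\<lambda>i. dist_of (g i)) < top"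
  shows "field_norm s r p1 p2 I g \<le> (1 + embedding_const s \<sigma> * (pow2 2 * kernel_grad (cs 0))) * besov_norm phi chi s p2 r I (\<lambda>i. dist_of (g i))"
proof -
  define B where "B = besov_norm phi chi s p2 r I (\<lambda>i. dist_of (g i))"
  define B' where "B' = dyadic_norm r (s - 1) p2 (I \<times> UNIV) (\<lambda>q z. conv (pd (snd z) (inv_fourier (bs q))) (g (fst z)))"
  have B: "B = dyadic_norm r s p2 I (\<lambda>q i. DQ q (g i))"
    unfolding B_def by (rule besov_norm_dist_of[OF p(2) r I g])
  have B': "B' \<le> pow2 2 * kernel_grad (cs 0) * B"
    unfolding B B'_def by (rule derivative_block_bound[OF p(2) r I g])
  also have "\<dots> < top" using fin kernel_grad_finite[OF test_cs, of 0] unfolding B_def by (simp add: ennreal_mult_less_top)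
  finally have B'fin: "B' < top" .
  have IJ: "finite (I \<times> (UNIV :: 'n set))" using I by simp
  have g': "tempered_fun (g (fst z))" if "z \<in> I \<times> (UNIV :: 'n set)" for z using that by (intro g) auto
  have "\<exists>F. (\<forall>z\<in>I \<times> UNIV. represents (F z) (dpartial (snd z) (dist_of (g (fst z))))) \<and> Lpn p1 (I \<times> UNIV) F \<le> embedding_const s \<sigma> * B'"
    unfolding B'_def by (rule derivative_embedding[OF p IJ g' r \<sigma> h B'fin[unfolded B'_def]])
  then obtain F where F: "\<And>z. z \<in> I \<times> UNIV \<Longrightarrow> represents (F z) (dpartial (snd z) (dist_of (g (fst z))))" "Lpn p1 (I \<times> UNIV) F \<le> embedding_const s \<sigma> * B'"
    by blast
  have "Lp_norm p1 (I \<times> UNIV) (grad_vec (\<lambda>i. dist_of (g i))) = Lpn p1 (I \<times> UNIV) F"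
    unfolding grad_vec_def case_prod_beta by (rule Lp_norm_eq_Lpn[OF test_cs[of 0] cs_at_0 p(1) IJ F(1)])
  also have "\<dots> \<le> embedding_const s \<sigma> * (pow2 2 * kernel_grad (cs 0) * B)"
    by (rule order_trans[OF F(2) mult_left_mono[OF B']]) simp
  finally show ?thesis unfolding field_norm_def B_def[symmetric]
    by (simp add: distrib_right mult.assoc add_left_mono)
qed

lemma le_ennreal_Suc_enn2real: "k < top \<Longrightarrow> k \<le> ennreal (enn2real k + 1)"
proof -
  assume "k < top"
  then have "k = ennreal (enn2real k)" by simp
  also have "\<dots> \<le> ennreal (enn2real k + 1)" by (rule ennreal_leI) simp
  finally show ?thesis .
qed

end

theorem proposition6p1:
  fixes phi chi :: "real^'n \<Rightarrow> real"
    and s :: real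
    and r p p1 p2 :: ennreal
  assumes "CARD('n) \<ge> 2"
    and "littlewood_paley phi chi"
    and "s > 0"
    and "1 \<le> r"
    and "1 \<le> p" and "1 \<le> p1" and "1 \<le> p2"
    and "1 / p = 1 / p1 + 1 / p2"
  shows
    "(\<exists>C::real. C > 0 \<and> (\<forall>f::real^'n \<Rightarrow> complex.
        let Df = grad (dist_of f);
            Nf = Lp_norm p1 UNIV Df + besov_norm phi chi (s - 1) p2 r UNIV Df
                   + besov_norm phi chi 0 p1 r UNIV Df
        in tempered_fun f \<and> Nf < \<infinity> \<longrightarrow>
          (\<forall>g::'n \<Rightarrow> real^'n \<Rightarrow> complex.
            let G = (\<lambda>i. dist_of (g i));
                Ng = besov_norm phi chi s p2 r UNIV G + Lp_norm p1 UNIV (grad_vec G)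
            in (\<forall>i. tempered_fun (g i)) \<and> Ng < \<infinity> \<longrightarrow>
              commutator_estimate phi chi s r p f (UNIV::unit set) (\<lambda>_. divergence G)
                (ennreal C * Nf * Ng)) \<and>
          (\<forall>(m::nat) (g::nat \<Rightarrow> real^'n \<Rightarrow> complex).
            let G = (\<lambda>i. dist_of (g i));
                Ng = besov_norm phi chi s p2 r {..<m} G
                       + Lp_norm p1 ({..<m} \<times> UNIV) (grad_vec G)
            in (\<forall>i<m. tempered_fun (g i)) \<and> Ng < \<infinity> \<longrightarrow>
              commutator_estimate phi chi s r p f ({..<m} \<times> UNIV) (grad_vec G)
                (ennreal C * Nf * Ng)))) \<and>
     (let \<sigma> = 1 + real CARD('n) * (enn2real (1 / p2) - enn2real (1 / p1))
      in p \<le> p2 \<and> p2 \<le> p1 \<and> (s > \<sigma> \<or> s = \<sigma> \<and> r = 1) \<longrightarrow>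
        (\<exists>C::real. C > 0 \<and> (\<forall>f::real^'n \<Rightarrow> complex.
          let Nf = besov_norm phi chi (s - 1) p2 r UNIV (grad (dist_of f))
          in tempered_fun f \<and> Nf < \<infinity> \<longrightarrow>
            (\<forall>g::'n \<Rightarrow> real^'n \<Rightarrow> complex.
              let G = (\<lambda>i. dist_of (g i));
                  Ng = besov_norm phi chi s p2 r UNIV G
              in (\<forall>i. tempered_fun (g i)) \<and> Ng < \<infinity> \<longrightarrow>
                commutator_estimate phi chi s r p f (UNIV::unit set) (\<lambda>_. divergence G)
                  (ennreal C * Nf * Ng)) \<and>
            (\<forall>(m::nat) (g::nat \<Rightarrow> real^'n \<Rightarrow> complex).
              let G = (\<lambda>i. dist_of (g i));
                  Ng = besov_norm phi chi s p2 r {..<m} G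
              in (\<forall>i<m. tempered_fun (g i)) \<and> Ng < \<infinity> \<longrightarrow>
                commutator_estimate phi chi s r p f ({..<m} \<times> UNIV) (grad_vec G)
                  (ennreal C * Nf * Ng)))))"
proof -
  interpret lp_pair phi chi by unfold_locales (rule assms(2))
  note s = assms(3) and r = assms(4) and p = assms(5-8)
  define C1 where "C1 = enn2real (estimate_const s) + 1"
  have C1: "C1 > 0" "estimate_const s \<le> ennreal C1"
    unfolding C1_def using le_ennreal_Suc_enn2real[OF estimate_const_finite[OF s]] by (simp_all add: add_nonneg_pos)
  show ?thesis unfolding Let_def infinity_ennreal_def
  proof (intro conjI impI, goal_cases)
    case 1
    show ?case
      unfolding gradient_norm_def[symmetric] field_norm_def[symmetric] UNIV_Times_UNIV[symmetric]
    proof (intro exI[of _ C1] conjI C1(1) allI impI; elim conjE)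
      fix f :: "real^'n \<Rightarrow> complex"
      assume f: "tempered_fun f" and A: "gradient_norm s r p1 p2 f + besov_norm phi chi 0 p1 r UNIV (grad (dist_of f)) < top"
      have fin: "gradient_norm s r p1 p2 f < top" using A by simp
      have M: "estimate_const s * (gradient_norm s r p1 p2 f * n) \<le> ennreal C1 * (gradient_norm s r p1 p2 f + besov_norm phi chi 0 p1 r UNIV (grad (dist_of f))) * n"
        "n < top \<Longrightarrow> ennreal C1 * (gradient_norm s r p1 p2 f + besov_norm phi chi 0 p1 r UNIV (grad (dist_of f))) * n < top" for n
        using C1(2) A by (auto simp: mult.assoc ennreal_mult_less_top intro!: mult_mono)
      show "commutator_estimate phi chi s r p f (UNIV::unit set) (\<lambda>_. divergence (\<lambda>i. dist_of (g i)))
          (ennreal C1 * (gradient_norm s r p1 p2 f + besov_norm phi chi 0 p1 r UNIV (grad (dist_of f))) * field_norm s r p1 p2 UNIV g)"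
        if "\<forall>i. tempered_fun (g i)" "field_norm s r p1 p2 UNIV g < top" for g :: "'n \<Rightarrow> real^'n \<Rightarrow> complex"
        using that by (intro divergence_commutator_estimate[OF p r s f fin _ _ M(1) M(2)]) auto
      show "commutator_estimate phi chi s r p f ({..<m} \<times> UNIV) (grad_vec (\<lambda>i. dist_of (g i)))
          (ennreal C1 * (gradient_norm s r p1 p2 f + besov_norm phi chi 0 p1 r UNIV (grad (dist_of f))) * field_norm s r p1 p2 {..<m} g)"
        if "\<forall>i<m. tempered_fun (g i)" "field_norm s r p1 p2 {..<m} g < top" for m :: nat and g :: "nat \<Rightarrow> real^'n \<Rightarrow> complex"
        using that by (intro gradient_commutator_estimate[OF p r s _ f fin _ _ M(1) M(2)]) auto
    qed
  next
    define \<sigma> where "\<sigma> = 1 + real CARD('n) * (enn2real (1 / p2) - enn2real (1 / p1))"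
    case 2
    then have p21: "p2 \<le> p1" and h: "s > \<sigma> \<or> s = \<sigma> \<and> r = 1" by (auto simp: \<sigma>_def)
    \<comment> \<open>Both factors of the first estimate are replaced by Besov norms, each at the cost of one
      embedding.\<close>
    define K where "K = estimate_const s * ((1 + embedding_const s \<sigma>) * (1 + embedding_const s \<sigma> * (pow2 2 * kernel_grad (cs 0))))"
    have "K < top" unfolding K_def using estimate_const_finite[OF s] embedding_const_finite[of s \<sigma>] kernel_grad_finite[OF test_cs, of 0]
      by (simp add: ennreal_mult_less_top)
    define C2 where "C2 = enn2real K + 1"
    have C2: "C2 > 0" "K \<le> ennreal C2"
      unfolding C2_def using le_ennreal_Suc_enn2real[OF \<open>K < top\<close>] by (simp_all add: add_nonneg_pos)
    show ?case
    proof (intro exI[of _ C2] conjI C2(1) allI impI; elim conjE)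
      fix f :: "real^'n \<Rightarrow> complex"
      define a where "a = besov_norm phi chi (s - 1) p2 r UNIV (grad (dist_of f))"
      assume f: "tempered_fun f" and A: "besov_norm phi chi (s - 1) p2 r UNIV (grad (dist_of f)) < top"
      have a: "gradient_norm s r p1 p2 f \<le> (1 + embedding_const s \<sigma>) * a"
        unfolding a_def by (rule gradient_norm_embedding[OF p(2,3) p21 r \<sigma>_def h f A])
      have afin: "a < top" using A by (simp add: a_def)
      have fin: "gradient_norm s r p1 p2 f < top"
        using a embedding_const_finite[of s \<sigma>] afin by (auto intro: order_le_less_trans simp: ennreal_mult_less_top)
      have M: "estimate_const s * (gradient_norm s r p1 p2 f * n) \<le> ennreal C2 * a * b" "n < top" "ennreal C2 * a * b < top"
        if n: "n \<le> (1 + embedding_const s \<sigma> * (pow2 2 * kernel_grad (cs 0))) * b" and b: "b < top" for n b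
      proof -
        have "estimate_const s * (gradient_norm s r p1 p2 f * n) \<le> estimate_const s * (((1 + embedding_const s \<sigma>) * a) * ((1 + embedding_const s \<sigma> * (pow2 2 * kernel_grad (cs 0))) * b))"
          by (intro mult_left_mono mult_mono a n) auto
        also have "\<dots> = K * (a * b)" unfolding K_def by (simp only: mult_ac)
        also have "\<dots> \<le> ennreal C2 * (a * b)" by (rule mult_right_mono[OF C2(2)]) simp
        finally show "estimate_const s * (gradient_norm s r p1 p2 f * n) \<le> ennreal C2 * a * b" by (simp only: mult.assoc)
        show "n < top" using n b embedding_const_finite[of s \<sigma>] kernel_grad_finite[OF test_cs, of 0]
          by (auto intro: order_le_less_trans simp: ennreal_mult_less_top)
        show "ennreal C2 * a * b < top" using afin b by (simp add: ennreal_mult_less_top)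
      qed
      show "commutator_estimate phi chi s r p f (UNIV::unit set) (\<lambda>_. divergence (\<lambda>i. dist_of (g i)))
          (ennreal C2 * besov_norm phi chi (s - 1) p2 r UNIV (grad (dist_of f)) * besov_norm phi chi s p2 r UNIV (\<lambda>i. dist_of (g i)))"
        if g: "\<forall>i. tempered_fun (g i)" and B: "besov_norm phi chi s p2 r UNIV (\<lambda>i. dist_of (g i)) < top" for g :: "'n \<Rightarrow> real^'n \<Rightarrow> complex"
      proof -
        have e: "field_norm s r p1 p2 UNIV g \<le> (1 + embedding_const s \<sigma> * (pow2 2 * kernel_grad (cs 0))) * besov_norm phi chi s p2 r UNIV (\<lambda>i. dist_of (g i))"
          using g by (intro field_norm_embedding[OF p(2,3) p21 r finite_class.finite_UNIV \<sigma>_def h _ B]) auto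
        show ?thesis unfolding a_def[symmetric] using g
          by (intro divergence_commutator_estimate[OF p r s f fin _ M(2)[OF e B] M(1)[OF e B] M(3)[OF e B]]) auto
      qed
      show "commutator_estimate phi chi s r p f ({..<m} \<times> UNIV) (grad_vec (\<lambda>i. dist_of (g i)))
          (ennreal C2 * besov_norm phi chi (s - 1) p2 r UNIV (grad (dist_of f)) * besov_norm phi chi s p2 r {..<m} (\<lambda>i. dist_of (g i)))"
        if g: "\<forall>i<m. tempered_fun (g i)" and B: "besov_norm phi chi s p2 r {..<m} (\<lambda>i. dist_of (g i)) < top" for m :: nat and g :: "nat \<Rightarrow> real^'n \<Rightarrow> complex"
      proof -
        have e: "field_norm s r p1 p2 {..<m} g \<le> (1 + embedding_const s \<sigma> * (pow2 2 * kernel_grad (cs 0))) * besov_norm phi chi s p2 r {..<m} (\<lambda>i. dist_of (g i))"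
          using g by (intro field_norm_embedding[OF p(2,3) p21 r _ \<sigma>_def h _ B]) auto
        show ?thesis unfolding a_def[symmetric] using g
          by (intro gradient_commutator_estimate[OF p r s _ f fin _ M(2)[OF e B] M(1)[OF e B] M(3)[OF e B]]) auto
      qed
    qed
  qed
qed

end
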